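(* Let $T>0$, $\varepsilon>0$, $\alpha\in L^\infty(\Omega M)$ with $\alpha(x,\xi)\ge\alpha_0>0$ for all $(x,\xi)\in\Omega M$, $n\in C^1(M)$, and let $f\in L^2(0,T;L^2(S^m\tau_M'))$ be a time-dependent $m$-tensor field. Let $\phi$ be given boundary data on $(0,T)\times\partial_+\Omega M$ and $\hat\phi\in L^2(0,T;H^1(\Omega M))$ an extension of it, i.e. $\gamma_+\hat\phi(t)=\phi(t)$ for a.e. $t$. Put $V=H_0^1(\Omega M)$ and $V^*=H^{-1}(\Omega M)$. If $$\sup_{x\in M}\frac{\|\nabla n(x)\|}{n(x)}<\alpha_0,$$ then there exists a unique $u_\varepsilon\in W^{1,1,2}(V,V^* )$ such that $u_\varepsilon(0)=0$ and $$\langle\mathrm d_tu_\varepsilon(t),v\rangle_{V^*,V}+a_\varepsilon(u_\varepsilon(t),v)=\langle b_\phi^\varepsilon(t),v\rangle_{V^*,V}\qquad\text{for all }v\in V\text{ and a.e. }t\in(0,T),$$ where $$a_\varepsilon(u,v)=\int_{\Omega M}\Big(\varepsilon\langle\nabla_xu,\nabla_xv\rangle+\varepsilon\langle\nabla_\xi u,\nabla_\xi v\rangle+\langle\nabla_xu,\xi\rangle v-\Gamma_{ij}^k(x)\xi^i\xi^j\frac{\partial u}{\partial\xi_k}v+\alpha uv\Big)\mathrm d\Sigma,$$ $$\langle b_\phi^\varepsilon(t),v\rangle_{V^*,V}=\int_{\Omega M}f_{i_1\dots i_m}(t,x)\,\xi^{i_1}\cdots\xi^{i_m}\,v\,\mathrm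 d\Sigma-a_\varepsilon(\hat\phi(t),v).$$
   Context: Setting: $M=\{x\in\mathbb R^3:\|x\|_{eucl}\le1\}$; the refractive index $n:M\to\mathbb R$ satisfies $n(x)\ge c_n>0$ for a constant $c_n$; $M$ carries the Riemannian metric $g_{ij}(x)=n^2(x)\delta_{ij}$. Repeated indices are summed over. $\langle u,v\rangle=g_{ij}u_iv_j=n^2(x)\sum_iu_iv_i$ and $\|u\|=n(x)\|u\|_{eucl}$ for tangent vectors; the gradient is $\nabla h=n^{-2}(x)\nabla_{eucl}h$, so $\|\nabla n\|=n^{-1}\|\nabla_{eucl}n\|$. The Christoffel symbols are $$\Gamma_{ij}^k(x)=n^{-1}(x)\Big(\frac{\partial n}{\partial x_j}\delta_{ik}+\frac{\partial n}{\partial x_i}\delta_{jk}-\frac{\partial n}{\partial x_k}\delta_{ij}\Big).$$ $\Omega M=\{(x,\xi)\in TM:\|\xi\|=1\}$ is the unit sphere bundle, and $\partial_+\Omega M=\{(x,\xi)\in\Omega M:x\in\partial M,\ \langle\xi,\nu(x)\rangle\ge0\}$ with $\nu$ the outer unit normal. Points of $\Omega M$ are written $(x,\xi)$ with $\xi=n^{-1}(x)(\cos\varphi\sin\theta,\sin\varphi\sin\theta,\cos\theta)$, $\varphi\in[0,2\pi]$, $\theta\in[0,\pi]$. Derivatives with respect to $\xi$ are $$\tfrac{\partial}{\partial\xi_1}=n(x)\Big(\cos\varphi\cos\theta\tfrac{\partial}{\partial\theta}-\tfrac{\sin\varphi}{\sin\theta}\tfrac{\partial}{\partial\varphi}\Big),\quad\tfrac{\partial}{\partial\xi_2}=n(x)\Big(\sin\varphi\cos\theta\tfrac{\partial}{\partial\theta}+\tfrac{\cos\varphi}{\sin\theta}\tfrac{\partial}{\partial\varphi}\Big),\quad\tfrac{\partial}{\partial\xi_3}=-n(x)\sin\theta\tfrac{\partial}{\partial\theta},$$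 and derivatives $\partial/\partial x_i$ are taken with the angles $(\varphi,\theta)$ fixed (equivalently, functions on $\Omega M$ are extended to be homogeneous of degree $0$ in $\xi$). $\nabla_xu$ and $\nabla_\xi u$ are the vectors with components $n^{-2}\partial u/\partial x_i$, respectively $n^{-2}\partial u/\partial\xi_i$; thus $\langle\nabla_xu,\xi\rangle=\xi_i\,\partial u/\partial x_i$, $\langle\nabla_xu,\nabla_xv\rangle=n^{-2}\sum_i\frac{\partial u}{\partial x_i}\frac{\partial v}{\partial x_i}$, $\langle\nabla_\xi u,\nabla_\xi v\rangle=n^{-2}\sum_i\frac{\partial u}{\partial\xi_i}\frac{\partial v}{\partial\xi_i}$. The measure on $\Omega M$ is $\mathrm d\Sigma=n^3(x)\sin\theta\,\mathrm d\theta\,\mathrm d\varphi\,\mathrm dx$. $H^1(\Omega M)$ is the Sobolev space with norm $\|u\|_{H^1(\Omega M)}^2=\int_{\Omega M}(u^2+\|\nabla_xu\|^2+\|\nabla_\xi u\|^2)\,\mathrm d\Sigma$; $H_0^1(\Omega M)$ is its subspace of functions with zero trace on $\partial\Omega M=\{(x,\xi)\in\Omega M:x\in\partial M\}$, and $H^{-1}(\Omega M)$ is the dual of $H_0^1(\Omega M)$ (with pivot space $L^2(\Omega M)$). $\gamma_+:H^1(\Omega M)\to L^2(\partial_+\Omega M)$ is the trace operator. $L^2(S^m\tau_M')$ is the space of square-integrable symmetric covariant $m$-tensor fields $f=(f_{i_1\cdots i_m})$ on $M$, $m\ge0$ an integer. For a Banach space $V$, $L^2(0,T;V)$ is the Bochner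 space with norm $(\int_0^T\|u(t)\|_V^2\,\mathrm dt)^{1/2}$, and $W^{1,1,2}(V,V^* )=\{u\in L^2(0,T;V):\mathrm d_tu\in L^2(0,T;V^* )\}$, with $\mathrm d_tu$ the distributional time derivative; elements of $W^{1,1,2}(V,V^* )$ have representatives in $C([0,T];L^2(\Omega M))$, so $u_\varepsilon(0)$ is well-defined. The variational problem is the weak form of the viscosity equation $\frac{\partial u}{\partial t}-\varepsilon\Delta u+\langle\nabla_xu,\xi\rangle-\Gamma_{ij}^k\xi_i\xi_j\frac{\partial u}{\partial\xi_k}+\alpha u=f_{i_1\dots i_m}(t,x)\xi^{i_1}\cdots\xi^{i_m}$, and the viscosity solution is $u_\varepsilon+\hat\phi$. *)

theory Defs
  imports "HOL-Analysis.Analysis" "HOL-Library.Multiset"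
begin

subsection \<open>Classical differentiability and test functions\<close>

(* For a set S with nonempty interior that is locally convex (the closed ball, or its product with a
   punctured space) the derivative within S is unique, and Ck_on says that all derivatives up to
   order k exist and are continuous up to the boundary. *)
primrec Ck_on :: "nat \<Rightarrow> 'a::real_normed_vector set \<Rightarrow> ('a \<Rightarrow> real) \<Rightarrow> bool" where
  "Ck_on 0 S f \<longleftrightarrow> continuous_on S f"
| "Ck_on (Suc k) S f \<longleftrightarrow>
     f differentiable_on S \<and> (\<forall>h. Ck_on k S (\<lambda>x. frechet_derivative f (at x within S) h))"

definition test_functions :: "'a::real_normed_vector set \<Rightarrow> ('a \<Rightarrow> real) set" where
  "test_functions U = {\<psi>. (\<forall>k. Ck_on k UNIV \<psi>) \<and>
      (\<exists>K. compact K \<and> K \<subseteq> U \<and> (\<forall>z. z \<notin> K \<longrightarrow> \<psi> z = 0))}"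

definition weak_derivative ::
  "'a::euclidean_space set \<Rightarrow> 'a \<Rightarrow> ('a \<Rightarrow> real) \<Rightarrow> ('a \<Rightarrow> real) \<Rightarrow> bool" where
  "weak_derivative U b F G \<longleftrightarrow>
     (\<forall>K. compact K \<and> K \<subseteq> U \<longrightarrow> set_integrable lborel K F \<and> set_integrable lborel K G) \<and>
     (\<forall>\<psi>\<in>test_functions U.
        (LINT z:U|lborel. F z * frechet_derivative \<psi> (at z) b) = - (LINT z:U|lborel. G z * \<psi> z))"

subsection \<open>Spaces of square-integrable functions\<close>

(* Elements of all function spaces are represented by functions; the norms below are seminorms on
   representatives, and equality in the spaces is equality almost everywhere. *)
definition L2 :: "'a measure \<Rightarrow> ('a \<Rightarrow> real) set" where
  "L2 N = {u. u \<in> borel_measurable N \<and> integrable N (\<lambda>z. (u z)\<^sup>2)}"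

definition L2_norm :: "'a measure \<Rightarrow> ('a \<Rightarrow> real) \<Rightarrow> real" where
  "L2_norm N u = sqrt (\<integral>z. (u z)\<^sup>2 \<partial>N)"

(* The Bochner space L^2(0,T;X), X a space of real-valued functions with (semi)norm nrm: strongly
   measurable functions (a.e. limits, in the norm of X, of X-valued simple functions) with
   square-integrable norm. *)
definition L2_Bochner ::
  "real \<Rightarrow> ('c \<Rightarrow> real) set \<Rightarrow> (('c \<Rightarrow> real) \<Rightarrow> real) \<Rightarrow> (real \<Rightarrow> 'c \<Rightarrow> real) set" where
  "L2_Bochner T X nrm = {u.
     (AE t in lebesgue_on {0<..<T}. u t \<in> X) \<and>
     (\<exists>s :: nat \<Rightarrow> real \<Rightarrow> 'c \<Rightarrow> real.
        (\<forall>k. simple_function (lebesgue_on {0<..<T}) (s k) \<and> (\<forall>t\<in>{0<..<T}. s k t \<in> X)) \<and>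
        (AE t in lebesgue_on {0<..<T}. (\<lambda>k. nrm (\<lambda>z. s k t z - u t z)) \<longlonglongrightarrow> 0)) \<and>
     integrable (lebesgue_on {0<..<T}) (\<lambda>t. (nrm (u t))\<^sup>2)}"

subsection \<open>The Riemannian ball and its unit sphere bundle\<close>

abbreviation M :: "(real^3) set" where
  "M \<equiv> cball 0 1"

definition metric :: "(real^3 \<Rightarrow> real) \<Rightarrow> real^3 \<Rightarrow> real^3 \<Rightarrow> real^3 \<Rightarrow> real" where
  "metric n x u v = (n x)\<^sup>2 * (u \<bullet> v)"

definition metric_norm :: "(real^3 \<Rightarrow> real) \<Rightarrow> real^3 \<Rightarrow> real^3 \<Rightarrow> real" where
  "metric_norm n x u = sqrt (metric n x u u)"

definition pdn :: "(real^3 \<Rightarrow> real) \<Rightarrow> 3 \<Rightarrow> real^3 \<Rightarrow> real" where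
  "pdn n i x = frechet_derivative n (at x within M) (axis i 1)"

definition grad_n :: "(real^3 \<Rightarrow> real) \<Rightarrow> real^3 \<Rightarrow> real^3" where
  "grad_n n x = (\<chi> i. pdn n i x / (n x)\<^sup>2)"

(* christoffel n i j k is the symbol with lower indices i, j and upper index k. *)
definition christoffel :: "(real^3 \<Rightarrow> real) \<Rightarrow> 3 \<Rightarrow> 3 \<Rightarrow> 3 \<Rightarrow> real^3 \<Rightarrow> real" where
  "christoffel n i j k x =
     (pdn n j x * of_bool (i = k) + pdn n i x * of_bool (j = k) - pdn n k x * of_bool (i = j)) / n x"

type_synonym phase = "(real^3) \<times> (real^3)"

definition OmegaM :: "(real^3 \<Rightarrow> real) \<Rightarrow> phase set" where
  "OmegaM n = {(x, \<xi>). x \<in> M \<and> metric_norm n x \<xi> = 1}"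

definition bdry_OmegaM :: "(real^3 \<Rightarrow> real) \<Rightarrow> phase set" where
  "bdry_OmegaM n = {(x, \<xi>). (x, \<xi>) \<in> OmegaM n \<and> x \<in> sphere 0 1}"

(* The outer unit normal of M with respect to the metric. *)
definition normal :: "(real^3 \<Rightarrow> real) \<Rightarrow> real^3 \<Rightarrow> real^3" where
  "normal n x = x /\<^sub>R n x"

definition bdry_plus :: "(real^3 \<Rightarrow> real) \<Rightarrow> phase set" where
  "bdry_plus n = {(x, \<xi>). (x, \<xi>) \<in> bdry_OmegaM n \<and> metric n x \<xi> (normal n x) \<ge> 0}"

definition direction :: "real \<Rightarrow> real \<Rightarrow> real^3" where
  "direction \<phi> \<theta> = vector [cos \<phi> * sin \<theta>, sin \<phi> * sin \<theta>, cos \<theta>]"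

definition sphere_measure :: "(real^3) measure" where
  "sphere_measure =
     distr (density (restrict_space lborel ({0..2*pi} \<times> {0..pi})) (\<lambda>(\<phi>, \<theta>). ennreal (sin \<theta>)))
       (restrict_space borel (sphere 0 1)) (\<lambda>(\<phi>, \<theta>). direction \<phi> \<theta>)"

(* The measure n^3 sin(theta) dtheta dphi dx, transported to OmegaM by the parametrisation
   xi = omega / n(x), omega on the Euclidean unit sphere. *)
definition Sigma_measure :: "(real^3 \<Rightarrow> real) \<Rightarrow> phase measure" where
  "Sigma_measure n =
     distr (density (restrict_space lborel M \<Otimes>\<^sub>M sphere_measure) (\<lambda>(x, \<omega>). ennreal (n x ^ 3)))
       (restrict_space borel (OmegaM n)) (\<lambda>(x, \<omega>). (x, \<omega> /\<^sub>R n x))"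

(* On the boundary the Riemannian area element n^2 dS(x) replaces the volume element n^3 dx. *)
definition bdry_measure :: "(real^3 \<Rightarrow> real) \<Rightarrow> phase measure" where
  "bdry_measure n =
     distr (density (sphere_measure \<Otimes>\<^sub>M sphere_measure) (\<lambda>(x, \<omega>). ennreal ((n x)\<^sup>2)))
       (restrict_space borel (bdry_OmegaM n)) (\<lambda>(x, \<omega>). (x, \<omega> /\<^sub>R n x))"

subsection \<open>Sobolev spaces on the sphere bundle\<close>

(* Extension to nonzero tangent vectors y, homogeneous of degree 0 in the fibre variable. *)
definition hext :: "(real^3 \<Rightarrow> real) \<Rightarrow> (phase \<Rightarrow> real) \<Rightarrow> phase \<Rightarrow> real" where
  "hext n u = (\<lambda>(x, y). u (x, y /\<^sub>R (n x * norm y)))"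

definition punctured_TM :: "phase set" where
  "punctured_TM = interior M \<times> (- {0})"

(* Weak derivatives on OmegaM are Euclidean weak derivatives of the extension. The x-derivatives
   are then taken with the angles fixed. The fibre derivatives of the extension are homogeneous of
   degree -1, so that their values on OmegaM determine them by division by the metric norm n(x)|y| of y;
   on smooth functions they are the fibre derivatives given by the usual formulas in the angles,
   e.g. d/dxi_3 = - n(x) sin(theta) d/dtheta. *)
definition weak_dx :: "(real^3 \<Rightarrow> real) \<Rightarrow> 3 \<Rightarrow> (phase \<Rightarrow> real) \<Rightarrow> (phase \<Rightarrow> real) \<Rightarrow> bool" where
  "weak_dx n i u p \<longleftrightarrow> p \<in> L2 (Sigma_measure n) \<and>
     weak_derivative punctured_TM (axis i 1, 0) (hext n u) (hext n p)"

definition weak_dxi :: "(real^3 \<Rightarrow> real) \<Rightarrow> 3 \<Rightarrow> (phase \<Rightarrow> real) \<Rightarrow> (phase \<Rightarrow> real) \<Rightarrow> bool" where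
  "weak_dxi n i u q \<longleftrightarrow> q \<in> L2 (Sigma_measure n) \<and>
     weak_derivative punctured_TM (0, axis i 1) (hext n u) (\<lambda>(x, y). hext n q (x, y) / (n x * norm y))"

definition dx :: "(real^3 \<Rightarrow> real) \<Rightarrow> 3 \<Rightarrow> (phase \<Rightarrow> real) \<Rightarrow> phase \<Rightarrow> real" where
  "dx n i u = (SOME p. weak_dx n i u p)"

definition dxi :: "(real^3 \<Rightarrow> real) \<Rightarrow> 3 \<Rightarrow> (phase \<Rightarrow> real) \<Rightarrow> phase \<Rightarrow> real" where
  "dxi n i u = (SOME q. weak_dxi n i u q)"

definition nabla_x :: "(real^3 \<Rightarrow> real) \<Rightarrow> (phase \<Rightarrow> real) \<Rightarrow> phase \<Rightarrow> real^3" where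
  "nabla_x n u z = (\<chi> i. dx n i u z / (n (fst z))\<^sup>2)"

definition nabla_xi :: "(real^3 \<Rightarrow> real) \<Rightarrow> (phase \<Rightarrow> real) \<Rightarrow> phase \<Rightarrow> real^3" where
  "nabla_xi n u z = (\<chi> i. dxi n i u z / (n (fst z))\<^sup>2)"

definition H1 :: "(real^3 \<Rightarrow> real) \<Rightarrow> (phase \<Rightarrow> real) set" where
  "H1 n = {u. u \<in> L2 (Sigma_measure n) \<and> (\<forall>i. \<exists>p. weak_dx n i u p) \<and> (\<forall>i. \<exists>q. weak_dxi n i u q)}"

definition H1_norm :: "(real^3 \<Rightarrow> real) \<Rightarrow> (phase \<Rightarrow> real) \<Rightarrow> real" where
  "H1_norm n u = sqrt (\<integral>z. ((u z)\<^sup>2 + (metric_norm n (fst z) (nabla_x n u z))\<^sup>2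
      + (metric_norm n (fst z) (nabla_xi n u z))\<^sup>2) \<partial>Sigma_measure n)"

(* u has trace g in L^2(N), where N is bdry_measure n or its restriction to a part of the boundary:
   graph of the continuous extension to H^1 of the restriction map on functions that are C^1 up to
   the boundary. *)
definition has_trace ::
  "(real^3 \<Rightarrow> real) \<Rightarrow> phase measure \<Rightarrow> (phase \<Rightarrow> real) \<Rightarrow> (phase \<Rightarrow> real) \<Rightarrow> bool" where
  "has_trace n N u g \<longleftrightarrow> u \<in> H1 n \<and> g \<in> L2 N \<and>
     (\<exists>w :: nat \<Rightarrow> phase \<Rightarrow> real.
        (\<forall>k. Ck_on 1 (M \<times> (- {0})) (hext n (w k))) \<and>
        (\<lambda>k. H1_norm n (\<lambda>z. w k z - u z)) \<longlonglongrightarrow> 0 \<and>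
        (\<lambda>k. L2_norm N (\<lambda>z. w k z - g z)) \<longlonglongrightarrow> 0)"

definition has_trace_plus :: "(real^3 \<Rightarrow> real) \<Rightarrow> (phase \<Rightarrow> real) \<Rightarrow> (phase \<Rightarrow> real) \<Rightarrow> bool" where
  "has_trace_plus n u g \<longleftrightarrow> has_trace n (restrict_space (bdry_measure n) (bdry_plus n)) u g"

definition H10 :: "(real^3 \<Rightarrow> real) \<Rightarrow> (phase \<Rightarrow> real) set" where
  "H10 n = {u \<in> H1 n. has_trace n (bdry_measure n) u (\<lambda>z. 0)}"

(* Functionals are compared on H10 n only; their values elsewhere are irrelevant. *)
definition Hm1 :: "(real^3 \<Rightarrow> real) \<Rightarrow> ((phase \<Rightarrow> real) \<Rightarrow> real) set" where
  "Hm1 n = {l.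
     (\<forall>u\<in>H10 n. \<forall>v\<in>H10 n. \<forall>a b. l (\<lambda>z. a * u z + b * v z) = a * l u + b * l v) \<and>
     (\<exists>C. \<forall>v\<in>H10 n. \<bar>l v\<bar> \<le> C * H1_norm n v)}"

definition Hm1_norm :: "(real^3 \<Rightarrow> real) \<Rightarrow> ((phase \<Rightarrow> real) \<Rightarrow> real) \<Rightarrow> real" where
  "Hm1_norm n l = (SUP v\<in>{v \<in> H10 n. H1_norm n v \<le> 1}. \<bar>l v\<bar>)"

subsection \<open>The parabolic solution space\<close>

(* w is the distributional time derivative of u, where u(t) is regarded as an element of the dual
   space through the pivot space L^2(OmegaM). The identity of the two Bochner integrals in the dual
   space is tested on each v; evaluation at v commutes with the integral. *)
definition has_time_derivative ::
  "(real^3 \<Rightarrow> real) \<Rightarrow> real \<Rightarrow> (real \<Rightarrow> phase \<Rightarrow> real) \<Rightarrow> (real \<Rightarrow> (phase \<Rightarrow> real) \<Rightarrow> real) \<Rightarrow> bool" where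
  "has_time_derivative n T u w \<longleftrightarrow>
     (\<forall>\<eta>\<in>test_functions {0<..<T}. \<forall>v\<in>H10 n.
        (\<integral>t. deriv \<eta> t * (\<integral>z. u t z * v z \<partial>Sigma_measure n) \<partial>lebesgue_on {0<..<T})
        = - (\<integral>t. \<eta> t * w t v \<partial>lebesgue_on {0<..<T}))"

definition W112 :: "(real^3 \<Rightarrow> real) \<Rightarrow> real \<Rightarrow> (real \<Rightarrow> phase \<Rightarrow> real) set" where
  "W112 n T = {u \<in> L2_Bochner T (H10 n) (H1_norm n).
     \<exists>w\<in>L2_Bochner T (Hm1 n) (Hm1_norm n). has_time_derivative n T u w}"

(* u(0) = u0, in the sense of the representative of u in C([0,T]; L^2(OmegaM)). *)
definition initial_value ::
  "(real^3 \<Rightarrow> real) \<Rightarrow> real \<Rightarrow> (real \<Rightarrow> phase \<Rightarrow> real) \<Rightarrow> (phase \<Rightarrow> real) \<Rightarrow> bool" where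
  "initial_value n T u u0 \<longleftrightarrow>
     (\<exists>c :: real \<Rightarrow> phase \<Rightarrow> real.
        (\<forall>t\<in>{0..T}. c t \<in> L2 (Sigma_measure n) \<and>
           ((\<lambda>s. L2_norm (Sigma_measure n) (\<lambda>z. c s z - c t z)) \<longlongrightarrow> 0) (at t within {0..T})) \<and>
        (AE t in lebesgue_on {0<..<T}. AE z in Sigma_measure n. c t z = u t z) \<and>
        (AE z in Sigma_measure n. c 0 z = u0 z))"

subsection \<open>Tensor fields and the variational problem\<close>

definition multi_indices :: "nat \<Rightarrow> 3 list set" where
  "multi_indices m = {I. length I = m}"

(* F (x, [i1, ..., im]) is the component with covariant indices i1, ..., im at x. *)
definition L2_tensor :: "(real^3 \<Rightarrow> real) \<Rightarrow> nat \<Rightarrow> ((real^3) \<times> 3 list \<Rightarrow> real) set" where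
  "L2_tensor n m = {F.
     (\<forall>I\<in>multi_indices m.
        (\<lambda>x. F (x, I)) \<in> L2 (density (restrict_space lborel M) (\<lambda>x. ennreal (n x ^ 3)))) \<and>
     (\<forall>x\<in>M. \<forall>I\<in>multi_indices m. \<forall>J. mset J = mset I \<longrightarrow> F (x, J) = F (x, I))}"

(* The pointwise norm uses the inverse metric n^(-2) delta on each of the m covariant indices. *)
definition L2_tensor_norm :: "(real^3 \<Rightarrow> real) \<Rightarrow> nat \<Rightarrow> ((real^3) \<times> 3 list \<Rightarrow> real) \<Rightarrow> real" where
  "L2_tensor_norm n m F = sqrt (\<integral>x. (\<Sum>I\<in>multi_indices m. (F (x, I))\<^sup>2) / n x ^ (2 * m)
      \<partial>density (restrict_space lborel M) (\<lambda>x. ennreal (n x ^ 3)))"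

definition contract :: "nat \<Rightarrow> ((real^3) \<times> 3 list \<Rightarrow> real) \<Rightarrow> phase \<Rightarrow> real" where
  "contract m F = (\<lambda>(x, \<xi>). \<Sum>I\<in>multi_indices m. F (x, I) * prod_list (map (\<lambda>i. \<xi> $ i) I))"

definition a_form ::
  "(real^3 \<Rightarrow> real) \<Rightarrow> (phase \<Rightarrow> real) \<Rightarrow> real \<Rightarrow> (phase \<Rightarrow> real) \<Rightarrow> (phase \<Rightarrow> real) \<Rightarrow> real" where
  "a_form n \<alpha> \<epsilon> u v =
     (\<integral>z. (case z of (x, \<xi>) \<Rightarrow>
        \<epsilon> * metric n x (nabla_x n u z) (nabla_x n v z)
        + \<epsilon> * metric n x (nabla_xi n u z) (nabla_xi n v z)
        + metric n x (nabla_x n u z) \<xi> * v z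
        - (\<Sum>i\<in>UNIV. \<Sum>j\<in>UNIV. \<Sum>k\<in>UNIV.
             christoffel n i j k x * \<xi> $ i * \<xi> $ j * dxi n k u z) * v z
        + \<alpha> z * u z * v z) \<partial>Sigma_measure n)"

definition b_form ::
  "(real^3 \<Rightarrow> real) \<Rightarrow> nat \<Rightarrow> (phase \<Rightarrow> real) \<Rightarrow> real \<Rightarrow> (real \<Rightarrow> (real^3) \<times> 3 list \<Rightarrow> real) \<Rightarrow>
    (real \<Rightarrow> phase \<Rightarrow> real) \<Rightarrow> real \<Rightarrow> (phase \<Rightarrow> real) \<Rightarrow> real" where
  "b_form n m \<alpha> \<epsilon> f \<phi>h t v =
     (\<integral>z. contract m (f t) z * v z \<partial>Sigma_measure n) - a_form n \<alpha> \<epsilon> (\<phi>h t) v"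

definition variational_solution ::
  "(real^3 \<Rightarrow> real) \<Rightarrow> nat \<Rightarrow> real \<Rightarrow> (phase \<Rightarrow> real) \<Rightarrow> real \<Rightarrow>
    (real \<Rightarrow> (real^3) \<times> 3 list \<Rightarrow> real) \<Rightarrow> (real \<Rightarrow> phase \<Rightarrow> real) \<Rightarrow> (real \<Rightarrow> phase \<Rightarrow> real) \<Rightarrow> bool" where
  "variational_solution n m T \<alpha> \<epsilon> f \<phi>h u \<longleftrightarrow>
     u \<in> W112 n T \<and> initial_value n T u (\<lambda>z. 0) \<and>
     (\<exists>w\<in>L2_Bochner T (Hm1 n) (Hm1_norm n). has_time_derivative n T u w \<and>
        (AE t in lebesgue_on {0<..<T}. \<forall>v\<in>H10 n.
           w t v + a_form n \<alpha> \<epsilon> (u t) v = b_form n m \<alpha> \<epsilon> f \<phi>h t v))"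

end

theory Submission
 imports Defs "HOL-Library.Function_Algebras"
begin

text \<open>The first-order terms of the bilinear form have bounded coefficients, so Young's inequality absorbs them
into the viscosity and gives a Garding inequality on the Hilbert space of zero-trace functions. Hence the problem is an abstract parabolic
Cauchy problem for a Gelfand triple. Existence: the Rothe scheme together with the energy estimate shows that
the residuals of smooth-in-time functions are dense, and the energy estimate makes the solution operator
continuous. Uniqueness: the Riesz primitive of a difference of two solutions satisfies an energy identity,
which forces it to vanish.\<close>

text \<open>Elements of the spaces are representatives: a.e. equal functions are not identified and
  every norm is only a seminorm. Hence the functional analysis is carried out on carriers inside the
  vector space of all functions, limits are unique up to norm zero, and functionals are compared on
  the carrier only. Weak derivatives are chosen by \<open>SOME\<close> and are linear only almost
  everywhere.

  Two obstacles shape the abstract part. A dual-valued right-hand side has no regularity; it is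
  approximated by Lipschitz functions with values in V, acting through the pivot, because Rothe's
  method supplies its rate for such data. And testing a function with itself needs a chain rule for
  its squared pivot norm; this is proved only for piecewise affine functions (existence) and for
  primitives (uniqueness).

  The concrete part has its own obstacle: weak derivatives are defined in a six-dimensional open
  set, while the norms live on the sphere bundle. Polar coordinates in the fibres relate the two
  measures; uniqueness of weak derivatives, and with it completeness of the Sobolev space, rests on
  them.\<close>

instantiation "fun" :: (type, real_vector) real_vector
begin
definition scaleR_fun :: "real => ('a => 'b) => 'a => 'b" where
 "scaleR_fun c f = (%x. c *\<^sub>R f x)"
instance
 by standard (auto simp: scaleR_fun_def fun_eq_iff algebra_simps)
end

lemma scaleR_fun_apply [simp]: "(c *\<^sub>R f) x = c *\<^sub>R f x" for f :: "'a => 'b::real_vector"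
 by (simp add: scaleR_fun_def)

lemma sum_fun_apply: "(\<Sum>i\<in>I. f i) x = (\<Sum>i\<in>I. f i x)" for f :: "'i => 'a => 'b::real_vector"
 by (induction I rule: infinite_finite_induct) auto

subsection \<open>Seminormed and semi-Hilbert spaces on a carrier\<close>

text \<open>A carrier inside a type is used because \<open>H1 n\<close>, \<open>H10 n\<close> and
  \<open>Hm1 n\<close> are proper subsets of function types; \<open>nrm x = 0\<close> does not force
  \<open>x = 0\<close>, as a.e. equal functions stay distinct.\<close>

locale seminormed =
 fixes X :: "'v::real_vector set" and nrm :: "'v => real"
 assumes sub: "subspace X"
  and nonneg: "x \<in> X ==> 0 <= nrm x"
  and triangle: "x \<in> X ==> y \<in> X ==> nrm (x + y) <= nrm x + nrm y"
  and scale: "x \<in> X ==> nrm (c *\<^sub>R x) = \<bar>c\<bar> * nrm x"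
begin

lemma mem [simp, intro]: "0 \<in> X" "x \<in> X ==> y \<in> X ==> x + y \<in> X" "x \<in> X ==> c *\<^sub>R x \<in> X"
  "x \<in> X ==> y \<in> X ==> x - y \<in> X" "x \<in> X ==> - x \<in> X"
 by (auto intro: sub subspace_0 subspace_add subspace_scale subspace_diff subspace_neg)

lemma mem_sum [intro]: "(!!i. i \<in> I ==> f i \<in> X) ==> sum f I \<in> X"
 by (rule subspace_sum[OF sub])

lemma nrm_0 [simp]: "nrm 0 = 0"
 using scale[of 0 0] by simp

lemma nrm_minus: "x \<in> X ==> nrm (- x) = nrm x"
 using scale[of x "-1"] by simp

lemma nrm_commute: "x \<in> X ==> y \<in> X ==> nrm (x - y) = nrm (y - x)"
 using nrm_minus[of "x - y"] by simp

lemma triangle_diff: "x \<in> X ==> y \<in> X ==> nrm (x - y) <= nrm x + nrm y"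
 using triangle[of x "-y"] nrm_minus[of y] by simp

lemma triangle_via: "x \<in> X ==> y \<in> X ==> z \<in> X ==> nrm (x - z) <= nrm (x - y) + nrm (y - z)"
 using triangle[of "x - y" "y - z"] by simp

lemma reverse_triangle: "x \<in> X ==> y \<in> X ==> \<bar>nrm x - nrm y\<bar> <= nrm (x - y)"
 using triangle[of "x - y" y] triangle[of "y - x" x] nrm_commute[of x y] by simp

lemma nrm_sum: "(!!i. i \<in> I ==> f i \<in> X) ==> nrm (sum f I) <= (\<Sum>i\<in>I. nrm (f i))"
proof (induction I rule: infinite_finite_induct)
 case (insert i I)
 hence "sum f I \<in> X" by (intro mem_sum) auto
 thus ?case using insert triangle[of "f i" "sum f I"] by force
qed auto

lemma tendsto_nrm:
 assumes "!!k. s k \<in> X" "x \<in> X" "(%k. nrm (s k - x)) \<longlonglongrightarrow> 0"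
 shows "(%k. nrm (s k)) \<longlonglongrightarrow> nrm x"
proof -
 have "(%k. nrm (s k) - nrm x) \<longlonglongrightarrow> 0"
  by (rule Lim_null_comparison[OF _ assms(3)]) (use assms reverse_triangle in auto)
 thus ?thesis by (simp add: LIM_zero_iff)
qed

text \<open>Linearity and boundedness are demanded on \<open>X\<close> only, in the shape of
  \<open>Hm1\<close>, so that the concrete dual space is literally an instance. Values outside
  \<open>X\<close> are arbitrary, so \<open>dnorm\<close> is again only a seminorm.\<close>

definition dual :: "('v => real) set" where
 "dual = {l. (ALL u:X. ALL v:X. ALL a b. l (a *\<^sub>R u + b *\<^sub>R v) = a * l u + b * l v) \<and>
   (EX C. ALL v:X. \<bar>l v\<bar> <= C * nrm v)}"

definition dnorm :: "('v => real) => real" where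
 "dnorm l = (SUP v\<in>{v \<in> X. nrm v <= 1}. \<bar>l v\<bar>)"

lemma dualD:
 assumes "l \<in> dual"
 shows "u \<in> X ==> v \<in> X ==> l (u + v) = l u + l v" "u \<in> X ==> l (a *\<^sub>R u) = a * l u"
  "u \<in> X ==> v \<in> X ==> l (u - v) = l u - l v" "l 0 = 0" "u \<in> X ==> l (- u) = - l u"
proof -
 have *: "l (a *\<^sub>R u + b *\<^sub>R v) = a * l u + b * l v" if "u \<in> X" "v \<in> X" for a b u v
  using assms that unfolding dual_def by blast
 show "l (u + v) = l u + l v" if "u \<in> X" "v \<in> X" using *[of u v 1 1] that by simp
 show "l (a *\<^sub>R u) = a * l u" if "u \<in> X" using *[of u u a 0] that by simp
 show "l (u - v) = l u - l v" if "u \<in> X" "v \<in> X" using *[of u v 1 "-1"] that by simp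
 show "l 0 = 0" using *[of 0 0 0 0] by simp
 show "l (- u) = - l u" if "u \<in> X" using *[of u u "-1" 0] that by simp
qed

lemma dualI:
 assumes "!!u v. u \<in> X ==> v \<in> X ==> l (u + v) = l u + l v" "!!c u. u \<in> X ==> l (c *\<^sub>R u) = c * l u"
   "!!v. v \<in> X ==> \<bar>l v\<bar> <= C * nrm v"
 shows "l \<in> dual"
 unfolding dual_def using assms by (auto intro!: exI[of _ C])

lemma dnorm_bdd: "l \<in> dual ==> bdd_above ((%v. \<bar>l v\<bar>) ` {v \<in> X. nrm v <= 1})"
proof -
 assume "l \<in> dual"
 then obtain C where C: "ALL v:X. \<bar>l v\<bar> <= C * nrm v" unfolding dual_def by blast
 have "\<bar>l v\<bar> <= \<bar>C\<bar>" if "v \<in> X" "nrm v <= 1" for v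
 proof -
  have "\<bar>l v\<bar> <= C * nrm v" using C that by auto
  also have "... <= \<bar>C\<bar> * 1" using nonneg[of v] that by (intro mult_mono) auto
  finally show ?thesis by simp
 qed
 thus ?thesis by (intro bdd_aboveI[of _ "\<bar>C\<bar>"]) auto
qed

lemma dnorm_nonneg: "l \<in> dual ==> 0 <= dnorm l"
 unfolding dnorm_def by (rule cSUP_upper2[OF dnorm_bdd, of _ 0]) auto

lemma dnorm_bound:
 assumes l: "l \<in> dual" and v: "v \<in> X"
 shows "\<bar>l v\<bar> <= dnorm l * nrm v"
proof (cases "nrm v = 0")
 \<comment> \<open>A nonzero \<open>v\<close> may have norm zero and cannot be normalised; the bound
   from membership in \<open>dual\<close> gives \<open>l v = 0\<close>.\<close>
 case True
 obtain C where C: "ALL v:X. \<bar>l v\<bar> <= C * nrm v" using l unfolding dual_def by blast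
 hence "\<bar>l v\<bar> <= 0" using True v by force
 thus ?thesis using True by simp
next
 case False
 hence pos: "nrm v > 0" using nonneg[OF v] by simp
 have "\<bar>l ((1 / nrm v) *\<^sub>R v)\<bar> <= dnorm l"
  unfolding dnorm_def
  by (rule cSUP_upper[OF _ dnorm_bdd[OF l]]) (use v pos scale in auto)
 thus ?thesis using dualD(2)[OF l v] pos by (simp add: field_simps abs_mult)
qed

lemma dnorm_least:
 assumes "C >= 0" "!!v. v \<in> X ==> \<bar>l v\<bar> <= C * nrm v"
 shows "dnorm l <= C"
 unfolding dnorm_def
proof (rule cSUP_least)
 show "{v \<in> X. nrm v <= 1} \<noteq> {}" by (auto intro!: exI[of _ 0])
 fix v assume "v \<in> {v \<in> X. nrm v <= 1}"
 thus "\<bar>l v\<bar> <= C" using assms mult_left_mono[of "nrm v" 1 C] by force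
qed

lemma subspace_dual: "subspace dual"
proof (rule subspaceI)
 show "0 \<in> dual" by (rule dualI[of _ 0]) auto
 fix l k assume l: "l \<in> dual" and k: "k \<in> dual"
 show "l + k \<in> dual"
 proof (rule dualI[of _ "dnorm l + dnorm k"])
  fix v assume "v \<in> X"
  thus "\<bar>(l + k) v\<bar> <= (dnorm l + dnorm k) * nrm v"
   using dnorm_bound[OF l, of v] dnorm_bound[OF k, of v] by (simp add: algebra_simps)
 qed (use dualD[OF l] dualD[OF k] in \<open>auto simp: algebra_simps\<close>)
next
 fix l c assume l: "l \<in> dual"
 show "c *\<^sub>R l \<in> dual"
 proof (rule dualI[of _ "\<bar>c\<bar> * dnorm l"])
  fix v assume "v \<in> X"
  thus "\<bar>(c *\<^sub>R l) v\<bar> <= (\<bar>c\<bar> * dnorm l) * nrm v"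
   using mult_left_mono[OF dnorm_bound[OF l, of v], of "\<bar>c\<bar>"] by (simp add: abs_mult mult.assoc)
 qed (use dualD[OF l] in \<open>auto simp: algebra_simps\<close>)
qed

lemma dual_seminormed: "seminormed dual dnorm"
proof
 show "subspace dual" by (rule subspace_dual)
 fix l assume l: "l \<in> dual"
 show "0 <= dnorm l" by (rule dnorm_nonneg[OF l])
 show "dnorm (l + k) <= dnorm l + dnorm k" if k: "k \<in> dual" for k
 proof (rule dnorm_least)
  fix v assume "v \<in> X"
  thus "\<bar>(l + k) v\<bar> <= (dnorm l + dnorm k) * nrm v"
   using dnorm_bound[OF l, of v] dnorm_bound[OF k, of v] by (simp add: algebra_simps)
 qed (use dnorm_nonneg l k in auto)
 have le: "dnorm (c *\<^sub>R l) <= \<bar>c\<bar> * dnorm l" if l: "l \<in> dual" for c l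
 proof (rule dnorm_least)
  fix v assume "v \<in> X"
  thus "\<bar>(c *\<^sub>R l) v\<bar> <= (\<bar>c\<bar> * dnorm l) * nrm v"
   using mult_left_mono[OF dnorm_bound[OF l, of v], of "\<bar>c\<bar>"] by (simp add: abs_mult mult.assoc)
 qed (use dnorm_nonneg l in auto)
 fix c
 show "dnorm (c *\<^sub>R l) = \<bar>c\<bar> * dnorm l"
 proof (cases "c = 0")
  case True
  have "0 \<in> dual" using subspace_dual subspace_0 by blast
  hence "dnorm (0 :: 'v => real) = 0"
   using dnorm_nonneg[of 0] dnorm_least[of 0 0] by auto
  thus ?thesis using True by simp
 next
  case False
  have "dnorm ((1/c) *\<^sub>R (c *\<^sub>R l)) <= \<bar>1/c\<bar> * dnorm (c *\<^sub>R l)"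
   by (rule le) (use subspace_dual l subspace_scale in blast)
  hence "\<bar>c\<bar> * dnorm l <= dnorm (c *\<^sub>R l)" using False by (simp add: field_simps)
  thus ?thesis using le[OF l, of c] by simp
 qed
qed

end

section \<open>Semi-inner products, the Riesz representation and the Lax-Milgram lemma\<close>

locale semi_inner =
 fixes X :: "'v::real_vector set" and ip :: "'v => 'v => real"
 assumes sub: "subspace X"
  and add_left: "x \<in> X ==> y \<in> X ==> z \<in> X ==> ip (x + y) z = ip x z + ip y z"
  and scale_left: "x \<in> X ==> z \<in> X ==> ip (c *\<^sub>R x) z = c * ip x z"
  and sym: "x \<in> X ==> z \<in> X ==> ip x z = ip z x"
  and pos: "x \<in> X ==> 0 <= ip x x"
begin

definition nrm :: "'v => real" where "nrm x = sqrt (ip x x)"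

lemma mem': "0 \<in> X" "x \<in> X ==> y \<in> X ==> x + y \<in> X" "x \<in> X ==> c *\<^sub>R x \<in> X"
  "x \<in> X ==> y \<in> X ==> x - y \<in> X" "x \<in> X ==> - x \<in> X"
 by (auto intro: sub subspace_0 subspace_add subspace_scale subspace_diff subspace_neg)

lemma add_right: "x \<in> X ==> y \<in> X ==> z \<in> X ==> ip z (x + y) = ip z x + ip z y"
 using add_left[of x y z] sym mem' by metis

lemma scale_right: "x \<in> X ==> z \<in> X ==> ip z (c *\<^sub>R x) = c * ip z x"
 using scale_left[of x z c] sym mem' by metis

lemma diff_left: "x \<in> X ==> y \<in> X ==> z \<in> X ==> ip (x - y) z = ip x z - ip y z"
 using add_left[of x "(-1) *\<^sub>R y" z] scale_left[of y z "-1"] mem'(3)[of y "-1"] by simp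

lemma diff_right: "x \<in> X ==> y \<in> X ==> z \<in> X ==> ip z (x - y) = ip z x - ip z y"
 using add_right[of x "(-1) *\<^sub>R y" z] scale_right[of y z "-1"] mem'(3)[of y "-1"] by simp

lemma minus_left: "x \<in> X ==> z \<in> X ==> ip (- x) z = - ip x z"
 using scale_left[of x z "-1"] by simp

lemma minus_right: "x \<in> X ==> z \<in> X ==> ip z (- x) = - ip z x"
 using scale_right[of x z "-1"] by simp

lemma zero_left [simp]: "x \<in> X ==> ip 0 x = 0"
 using scale_left[of 0 x 0] mem'(1) by simp

lemma zero_right [simp]: "x \<in> X ==> ip x 0 = 0"
 using scale_right[of 0 x 0] mem'(1) by simp

lemmas ip_simps = add_left add_right scale_left scale_right diff_left diff_right minus_left minus_right

lemma nrm_sq: "x \<in> X ==> (nrm x)^2 = ip x x"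
 by (simp add: nrm_def pos)

lemma nrm_ge0: "x \<in> X ==> 0 <= nrm x"
 by (simp add: nrm_def pos)

lemma Cauchy_Schwarz:
 assumes x: "x \<in> X" and y: "y \<in> X"
 shows "\<bar>ip x y\<bar> <= nrm x * nrm y"
proof -
 have q: "0 <= ip x x - 2 * t * ip x y + t^2 * ip y y" for t
 proof -
  have "0 <= ip (x - t *\<^sub>R y) (x - t *\<^sub>R y)" using x y by (intro pos mem')
  also have "... = ip x x - 2 * t * ip x y + t^2 * ip y y"
   using x y sym[of y x] by (simp add: ip_simps mem' power2_eq_square algebra_simps)
  finally show ?thesis .
 qed
 have "(ip x y)^2 <= ip x x * ip y y"
 proof (cases "ip y y = 0")
  case True
  have "ip x y = 0"
  proof (rule ccontr)
   assume ne: "ip x y \<noteq> 0"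
   \<comment> \<open>With \<open>ip y y = 0\<close> the quadratic is affine in its parameter; this
     parameter brings it down to -1.\<close>
   have "0 <= ip x x - 2 * ((ip x x + 1) / (2 * ip x y)) * ip x y"
    using q[of "(ip x x + 1) / (2 * ip x y)"] True by simp
   also have "... = -1" using ne by (simp add: field_simps)
   finally show False by simp
  qed
  thus ?thesis using True by simp
 next
  case False
  hence "ip y y > 0" using pos[OF y] by simp
  thus ?thesis using q[of "ip x y / ip y y"] by (simp add: field_simps power2_eq_square)
 qed
 hence "(ip x y)^2 <= (nrm x * nrm y)^2" using nrm_sq x y by (simp add: power_mult_distrib)
 thus ?thesis using nrm_ge0 x y by (metis abs_le_square_iff abs_of_nonneg mult_nonneg_nonneg)
qed

sublocale seminormed X nrm
proof
 show "subspace X" by (rule sub)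
 fix x assume x: "x \<in> X"
 show "0 <= nrm x" by (rule nrm_ge0[OF x])
 show "nrm (c *\<^sub>R x) = \<bar>c\<bar> * nrm x" for c
  using x by (simp add: nrm_def ip_simps mem' real_sqrt_mult flip: mult.assoc)
 fix y assume y: "y \<in> X"
 have "(nrm (x + y))^2 = ip x x + 2 * ip x y + ip y y"
  using x y sym[of y x] by (simp add: nrm_sq ip_simps mem')
 also have "... <= (nrm x + nrm y)^2"
  using Cauchy_Schwarz[OF x y] nrm_sq[OF x] nrm_sq[OF y] by (simp add: power2_sum)
 finally show "nrm (x + y) <= nrm x + nrm y"
  by (rule power2_le_imp_le) (use nrm_ge0[OF x] nrm_ge0[OF y] in simp)
qed

lemma ip_dual: "h \<in> X ==> ip h \<in> dual"
 by (rule dualI[of _ "nrm h"]) (auto simp: ip_simps Cauchy_Schwarz)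

lemma nrm_le_of_sq_le:
 assumes "w \<in> X" "(nrm w)^2 <= C * nrm w"  "0 <= C"
 shows "nrm w <= C"
proof (cases "nrm w = 0")
 case False
 hence "nrm w > 0" using nrm_ge0[OF assms(1)] by simp
 thus ?thesis using assms(2) by (simp add: power2_eq_square)
qed (use assms in auto)

end

locale semi_hilbert = semi_inner +
 assumes complete: "!!s. (!!k. s k \<in> X) ==> (!!e. e > 0 ==> EX N. ALL m>=N. ALL k>=N. nrm (s m - s k) < e)
   ==> EX x:X. (%k. nrm (s k - x)) \<longlonglongrightarrow> 0"
begin

text \<open>The representative minimises \<open>J v = ip v v - 2 * l v\<close>. By the parallelogram
  law minimising sequences are Cauchy, and the first variation at the limit gives the
  representation.\<close>

lemma riesz:
 assumes l: "l \<in> dual"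
 obtains r where "r \<in> X" "!!v. v \<in> X ==> l v = ip r v"
proof -
 define J where "J v = ip v v - 2 * l v" for v
 define m where "m = (INF v\<in>X. J v)"
 have lb: "- ((dnorm l)^2) <= J v" if "v \<in> X" for v
 proof -
  have "2 * l v <= 2 * (dnorm l * nrm v)" using dnorm_bound[OF l that] by linarith
  also have "... <= (dnorm l)^2 + (nrm v)^2" using sum_squares_bound[of "dnorm l" "nrm v"] by simp
  finally show ?thesis using nrm_sq[OF that] by (simp add: J_def)
 qed
 hence bdd: "bdd_below (J ` X)" by (intro bdd_belowI[of _ "- ((dnorm l)^2)"]) auto
 have ge: "m <= J v" if "v \<in> X" for v
  unfolding m_def by (rule cINF_lower[OF bdd that])
 have "EX v:X. J v < m + 1 / real (Suc k)" for k
 proof (rule ccontr)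
  assume "\<not> ?thesis"
  hence "m + 1 / real (Suc k) <= J v" if "v \<in> X" for v using that by force
  moreover have "X \<noteq> {}" using mem(1) by blast
  ultimately have "m + 1 / real (Suc k) <= (INF v\<in>X. J v)" by (intro cINF_greatest)
  hence "1 / real (Suc k) <= 0" unfolding m_def by linarith
  thus False by simp
 qed
 then obtain s where s: "!!k. s k \<in> X" "!!k. J (s k) < m + 1 / real (Suc k)" by metis
 have cau: "(nrm (s i - s j))^2 <= 2 * (1 / real (Suc i) + 1 / real (Suc j))" for i j
 proof -
  \<comment> \<open>\<open>m\<close> bounds \<open>J\<close> from below at the midpoint; the
    parallelogram law turns this into a bound on the distance of the two points.\<close>
  have "4 * m <= 4 * J ((1/2) *\<^sub>R (s i + s j))" using ge s by auto
  also have "... = 2 * J (s i) + 2 * J (s j) - (nrm (s i - s j))^2"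
   using s sym[of "s i" "s j"] by (simp add: J_def nrm_sq ip_simps dualD[OF l] field_simps)
  finally show ?thesis using s(2)[of i] s(2)[of j] by (simp add: algebra_simps)
 qed
 have "EX N. ALL i>=N. ALL j>=N. nrm (s i - s j) < e" if e: "e > 0" for e
 proof -
  obtain N where N: "4 / e^2 < real N" using reals_Archimedean2 by blast
  have "nrm (s i - s j) < e" if "i >= N" "j >= N" for i j
  proof (rule power2_less_imp_less)
   have "1 / real (Suc i) <= 1 / real (Suc N)" "1 / real (Suc j) <= 1 / real (Suc N)"
    using that by (auto intro!: divide_left_mono)
   hence "2 * (1 / real (Suc i) + 1 / real (Suc j)) <= 2 * (1 / real (Suc N) + 1 / real (Suc N))"
    by (intro mult_left_mono add_mono) auto
   hence "(nrm (s i - s j))^2 <= 4 * (1 / real (Suc N))" using cau[of i j] by simp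
   also have "... < e^2"
   proof -
    have "4 < real N * e^2" using N e by (simp add: divide_less_eq)
    also have "... <= real (Suc N) * e^2" by (intro mult_right_mono) auto
    finally show ?thesis by (simp add: divide_less_eq mult.commute)
   qed
   finally show "(nrm (s i - s j))^2 < e^2" .
  qed (use e in auto)
  thus ?thesis by blast
 qed
 then obtain r where r: "r \<in> X" "(%k. nrm (s k - r)) \<longlonglongrightarrow> 0" using complete[of s] s by blast
 have "l v = ip r v" if v: "v \<in> X" for v
 proof -
  have conv: "(%k. ip (s k) v) \<longlonglongrightarrow> ip r v"
  proof -
   have "(%k. ip (s k) v - ip r v) \<longlonglongrightarrow> 0"
   proof (rule Lim_null_comparison)
    show "\<forall>\<^sub>F k in sequentially. norm (ip (s k) v - ip r v) <= nrm (s k - r) * nrm v"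
     using Cauchy_Schwarz[of "s _ - r" v] s r v by (simp add: ip_simps)
    show "(%k. nrm (s k - r) * nrm v) \<longlonglongrightarrow> 0" using tendsto_mult_left_zero[OF r(2)] by simp
   qed
   thus ?thesis by (simp add: LIM_zero_iff)
  qed
  have key: "0 <= t^2 * ip v v + 2 * t * (ip r v - l v)" for t
  proof -
   have le: "- (1 / real (Suc k)) <= t^2 * ip v v + 2 * t * (ip (s k) v - l v)" for k
   proof -
    have "J (s k + t *\<^sub>R v) = J (s k) + t^2 * ip v v + 2 * t * (ip (s k) v - l v)"
     using s v sym[of "s k" v]
     by (simp add: J_def ip_simps dualD[OF l] power2_eq_square algebra_simps)
    moreover have "m <= J (s k + t *\<^sub>R v)" using ge s v by auto
    ultimately have "- x <= t^2 * ip v v + 2 * t * (ip (s k) v - l v)" if "J (s k) < m + x" for x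
     using that by linarith
    thus ?thesis using s(2) by blast
   qed
   have "(%k. 1 / real (Suc k)) \<longlonglongrightarrow> 0" by (intro LIMSEQ_Suc lim_1_over_n)
   from tendsto_minus[OF this] have l1: "(%k. - (1 / real (Suc k))) \<longlonglongrightarrow> 0" by simp
   have l2: "(%k. t^2 * ip v v + 2 * t * (ip (s k) v - l v)) \<longlonglongrightarrow> t^2 * ip v v + 2 * t * (ip r v - l v)"
    by (intro tendsto_intros conv)
   show ?thesis by (rule LIMSEQ_le[OF l1 l2]) (use le in auto)
  qed
  define d where "d = ip r v - l v"
  \<comment> \<open>The added 1 keeps \<open>q\<close> positive for \<open>v\<close> of norm zero;
    the parameter \<open>- d / q\<close> in \<open>key\<close> then yields
    \<open>- (d^2 / q) >= 0\<close>, hence \<open>d = 0\<close>.\<close>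
  define q where "q = ip v v + 1"
  have q: "q > 0" "ip v v < q" using pos[OF v] by (auto simp: q_def)
  have "0 <= (- d / q)^2 * ip v v + 2 * (- d / q) * d" using key[of "- d / q"] by (simp add: d_def)
  also have "... <= (- d / q)^2 * q + 2 * (- d / q) * d" using q by (intro add_right_mono mult_left_mono) auto
  also have "... = - (d^2 / q)" using q by (simp add: field_simps power2_eq_square)
  finally have "d^2 / q <= 0" by simp
  hence "d = 0" using q by (simp add: divide_le_0_iff)
  thus ?thesis by (simp add: d_def)
 qed
 thus ?thesis using r(1) that by blast
qed

lemma tendsto_ip:
 assumes "!!k. s k \<in> X" "r \<in> X" "(%k. nrm (s k - r)) \<longlonglongrightarrow> 0" "v \<in> X"
 shows "(%k. ip (s k) v) \<longlonglongrightarrow> ip r v"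
proof -
 have "(%k. ip (s k) v - ip r v) \<longlonglongrightarrow> 0"
 proof (rule Lim_null_comparison)
  show "\<forall>\<^sub>F k in sequentially. norm (ip (s k) v - ip r v) <= nrm (s k - r) * nrm v"
   using Cauchy_Schwarz[of "s _ - r" v] assms by (simp add: ip_simps)
  show "(%k. nrm (s k - r) * nrm v) \<longlonglongrightarrow> 0" using tendsto_mult_left_zero[OF assms(3)] by simp
 qed
 thus ?thesis by (simp add: LIM_zero_iff)
qed

lemma complete_geometric:
 assumes s: "!!k. s k \<in> X" and q: "0 <= q" "q < 1"
  and step: "!!k. nrm (s (Suc k) - s k) <= C * q ^ k"
 obtains x where "x \<in> X" "(%k. nrm (s k - x)) \<longlonglongrightarrow> 0"
proof -
 have C: "C >= 0" using step[of 0] nonneg[of "s (Suc 0) - s 0"] s by (auto intro: order_trans)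
 have far: "nrm (s (k + j) - s k) <= C * q ^ k / (1 - q)" for k j
 proof -
  have "nrm (s (k + j) - s k) <= (\<Sum>i<j. C * q ^ (k + i))"
  proof (induction j)
   case (Suc j)
   have "nrm (s (k + Suc j) - s k) <= nrm (s (Suc (k + j)) - s (k + j)) + nrm (s (k + j) - s k)"
    using triangle_via[of "s (Suc (k+j))" "s (k+j)" "s k"] s by simp
   thus ?case using Suc step[of "k + j"] by (simp add: algebra_simps)
  qed (use s in simp)
  also have "... = C * q ^ k * (\<Sum>i<j. q ^ i)" by (simp add: sum_distrib_left power_add algebra_simps)
  also have "... <= C * q ^ k * (1 / (1 - q))"
   using C q sum_gp_strict[of q j] by (intro mult_left_mono) (auto simp: divide_right_mono)
  finally show ?thesis by simp
 qed
 have "EX N. ALL m>=N. ALL k>=N. nrm (s m - s k) < e" if e: "e > 0" for e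
 proof -
  have "(%k. C * q ^ k / (1 - q)) \<longlonglongrightarrow> C * 0 / (1 - q)"
   using q by (intro tendsto_intros LIMSEQ_power_zero) auto
  hence "\<forall>\<^sub>F k in sequentially. C * q ^ k / (1 - q) < e / 2"
   using e by (intro order_tendstoD(2)) auto
  then obtain N where N: "C * q ^ N / (1 - q) < e / 2" by (auto simp: eventually_sequentially)
  have "nrm (s m - s k) < e" if "m >= N" "k >= N" for m k
  proof -
   have "nrm (s m - s N) <= C * q ^ N / (1 - q)" "nrm (s N - s k) <= C * q ^ N / (1 - q)"
    using far[of N "m - N"] far[of N "k - N"] nrm_commute[of "s k" "s N"] s that by simp_all
   thus ?thesis using triangle_via[OF s s s, of m k N] N by linarith
  qed
  thus ?thesis by blast
 qed
 thus ?thesis using complete[of s] s that by blast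
qed

text \<open>Richardson iteration: \<open>u\<close> is moved by \<rho> times the Riesz representative
  of its residual \<open>l - B u\<close>. Boundedness and coercivity, without symmetry, make the
  residuals contract, so the iterates converge geometrically.\<close>

lemma lax_milgram:
 assumes B: "!!u. u \<in> X ==> B u \<in> dual"
  and Badd: "!!u w v. u \<in> X ==> w \<in> X ==> v \<in> X ==> B (u + w) v = B u v + B w v"
  and Bscale: "!!c u v. u \<in> X ==> v \<in> X ==> B (c *\<^sub>R u) v = c * B u v"
  and bd: "!!u v. u \<in> X ==> v \<in> X ==> \<bar>B u v\<bar> <= C * nrm u * nrm v"
  and coer: "c > 0" "!!u. u \<in> X ==> B u u >= c * (nrm u)^2"
  and l: "l \<in> dual"
 obtains u where "u \<in> X" "!!v. v \<in> X ==> B u v = l v"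
proof -
 \<comment> \<open>Enlarging the bound beyond \<open>c\<close> gives \<open>c / K < 1\<close>, so
   that the contraction factor \<open>q\<close> below is a real number in [0,1).\<close>
 define K where "K = \<bar>C\<bar> + c + 1"
 have K: "K > c" "K > 0" "\<bar>C\<bar> <= K" using coer by (auto simp: K_def)
 have bdK: "\<bar>B u v\<bar> <= K * nrm u * nrm v" if "u \<in> X" "v \<in> X" for u v
  using bd[OF that] K nonneg that by (smt (verit, best) mult_right_mono)
 define rep where "rep l = (SOME r. r \<in> X \<and> (ALL v:X. l v = ip r v))" for l
 have rep: "rep l \<in> X \<and> (ALL v:X. l v = ip (rep l) v)" if "l \<in> dual" for l
  unfolding rep_def by (rule someI_ex) (use riesz[OF that] in metis)
 \<comment> \<open>This step size minimises \<open>1 - 2 * \<rho> * c + \<rho>^2 * K^2\<close>, the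
   bound for the squared contraction factor; the minimum is \<open>1 - (c / K)^2\<close>.\<close>
 define \<rho> where "\<rho> = c / K^2"
 have \<rho>: "\<rho> > 0" using coer K by (simp add: \<rho>_def)
 define w where "w u = rep (l - B u)" for u
 have lB: "l - B u \<in> dual" if "u \<in> X" for u
  using subspace_diff[OF subspace_dual l B[OF that]] .
 have w: "w u \<in> X" "!!v. v \<in> X ==> l v - B u v = ip (w u) v" if "u \<in> X" for u
  using rep[OF lB[OF that]] by (auto simp: w_def)
 define s where "s = rec_nat 0 (%_ u. u + \<rho> *\<^sub>R w u)"
 have s_simps: "s 0 = 0" "s (Suc k) = s k + \<rho> *\<^sub>R w (s k)" for k by (auto simp: s_def)
 have s: "s k \<in> X" for k by (induction k) (auto simp: s_simps w)
 define q where "q = sqrt (1 - (c / K)^2)"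
 have cK: "0 < c / K" "c / K < 1" using coer K by auto
 hence cK2: "(c / K)^2 < 1" by (simp only: abs_square_less_1)
 have "(c / K)^2 > 0" using cK(1) by (rule zero_less_power)
 with cK2 have q: "0 <= q" "q < 1" "q^2 = 1 - (c / K)^2" by (auto simp: q_def)
 have contr: "nrm (w (s (Suc k))) <= q * nrm (w (s k))" for k
 proof (rule power2_le_imp_le)
  let ?w = "w (s k)" and ?w' = "w (s (Suc k))"
  have ww: "?w \<in> X" "?w' \<in> X" using w s by auto
  have e: "ip ?w' v = ip ?w v - \<rho> * B ?w v" if "v \<in> X" for v
  proof -
   have "ip ?w' v = l v - B (s k + \<rho> *\<^sub>R ?w) v" using w(2)[OF s that, of "Suc k"] s_simps by simp
   also have "... = l v - B (s k) v - \<rho> * B ?w v" using Badd Bscale s ww that by simp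
   finally show ?thesis using w(2)[OF s that, of k] by simp
  qed
  have n1: "nrm (?w - ?w') <= \<rho> * K * nrm ?w"
  proof (rule nrm_le_of_sq_le)
   have "(nrm (?w - ?w'))^2 = \<rho> * B ?w (?w - ?w')"
    using ww e[of "?w - ?w'"] by (simp add: nrm_sq ip_simps)
   also have "... <= \<rho> * (K * nrm ?w * nrm (?w - ?w'))"
    using bdK[of ?w "?w - ?w'"] ww \<rho> by (intro mult_left_mono) auto
   finally show "(nrm (?w - ?w'))^2 <= \<rho> * K * nrm ?w * nrm (?w - ?w')" by (simp add: algebra_simps)
  qed (use ww \<rho> K nonneg in auto)
  have "(nrm ?w')^2 = (nrm ?w)^2 - 2 * \<rho> * B ?w ?w + (nrm (?w - ?w'))^2"
   using ww e[of ?w] sym[of ?w ?w'] by (simp add: nrm_sq ip_simps)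
  also have "... <= (nrm ?w)^2 - 2 * \<rho> * (c * (nrm ?w)^2) + (\<rho> * K * nrm ?w)^2"
   using coer(2)[of ?w] ww \<rho> n1 nonneg[of "?w - ?w'"] nonneg[of ?w] by (intro add_mono diff_mono mult_left_mono power_mono) auto
  also have "... = (1 - (c / K)^2) * (nrm ?w)^2"
   using K by (simp add: \<rho>_def field_simps power2_eq_square)
  also have "... = (q * nrm ?w)^2"
   by (simp add: power_mult_distrib q)
  finally show "(nrm ?w')^2 <= (q * nrm ?w)^2" .
 qed (use q w s nonneg in auto)
 have wk: "nrm (w (s k)) <= q ^ k * nrm (w (s 0))" for k
 proof (induction k)
  case (Suc k)
  have "nrm (w (s (Suc k))) <= q * nrm (w (s k))" by (rule contr)
  also have "... <= q * (q ^ k * nrm (w (s 0)))" using Suc q by (intro mult_left_mono) auto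
  finally show ?case by (simp add: mult.assoc)
 qed simp
 obtain u where u: "u \<in> X" "(%k. nrm (s k - u)) \<longlonglongrightarrow> 0"
 proof (rule complete_geometric[of s q "\<rho> * nrm (w (s 0))"])
  show "nrm (s (Suc k) - s k) <= \<rho> * nrm (w (s 0)) * q ^ k" for k
   using wk[of k] \<rho> scale[of "w (s k)" \<rho>] w s by (simp add: s_simps mult.commute mult_left_mono)
 qed (use s q in auto)
 have "B u v = l v" if v: "v \<in> X" for v
 proof -
  have Bdiff: "B (x - y) v = B x v - B y v" if "x \<in> X" "y \<in> X" for x y
   using Badd[of "x - y" y v] v that by simp
  have "(%k. l v - B (s k) v) \<longlonglongrightarrow> l v - B u v"
  proof (intro tendsto_diff tendsto_const)
   have "(%k. B (s k) v - B u v) \<longlonglongrightarrow> 0"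
   proof (rule Lim_null_comparison)
    show "\<forall>\<^sub>F k in sequentially. norm (B (s k) v - B u v) <= nrm (s k - u) * (K * nrm v)"
     using bdK[of "s _ - u" v] s u v Bdiff by (simp add: algebra_simps)
    show "(%k. nrm (s k - u) * (K * nrm v)) \<longlonglongrightarrow> 0" using tendsto_mult_left_zero[OF u(2)] by simp
   qed
   thus "(%k. B (s k) v) \<longlonglongrightarrow> B u v" by (simp add: LIM_zero_iff)
  qed
  moreover have "(%k. l v - B (s k) v) \<longlonglongrightarrow> 0"
  proof (rule Lim_null_comparison)
   have "\<bar>ip (w (s k)) v\<bar> <= q ^ k * nrm (w (s 0)) * nrm v" for k
    using Cauchy_Schwarz[of "w (s k)" v] wk[of k] w s v nonneg[OF v]
    by (meson mult_right_mono order_trans)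
   thus "\<forall>\<^sub>F k in sequentially. norm (l v - B (s k) v) <= q ^ k * nrm (w (s 0)) * nrm v"
    using w(2)[OF s v] by simp
   have "(%k. q ^ k) \<longlonglongrightarrow> 0" using q by (intro LIMSEQ_power_zero) auto
   thus "(%k. q ^ k * nrm (w (s 0)) * nrm v) \<longlonglongrightarrow> 0"
    by (intro tendsto_mult_left_zero)
  qed
  ultimately show ?thesis using LIMSEQ_unique by fastforce
 qed
 thus ?thesis using u that by blast
qed

end

subsection \<open>Strong measurability\<close>

abbreviation time :: "real => real measure" where
 "time T \<equiv> lebesgue_on {0<..<T}"

definition strong_meas ::
  "real => 'v::ab_group_add set => ('v => real) => (real => 'v) => bool" where
 "strong_meas T X nrm u \<longleftrightarrow> (AE t in time T. u t \<in> X) \<and>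
   (EX s. (ALL k. simple_function (time T) (s k) \<and> (ALL t:{0<..<T}. s k t \<in> X)) \<and>
    (AE t in time T. (%k. nrm (s k t - u t)) \<longlonglongrightarrow> 0))"

lemma L2_Bochner_iff:
 "u \<in> L2_Bochner T X nrm \<longleftrightarrow>
   strong_meas T X nrm u \<and> integrable (time T) (%t. (nrm (u t))^2)"
 unfolding L2_Bochner_def strong_meas_def fun_diff_def by auto

lemma finite_measure_time: "finite_measure (time T)"
 by (rule finite_measure_lebesgue_on) auto

lemma space_time [simp]: "space (time T) = {0<..<T}"
 by simp

lemma AE_time_in: "AE t in time T. t \<in> {0<..<T}"
 by (rule AE_I2) simp

lemma integrable_time_const [simp]: "integrable (time T) (%t. c :: real)"
 using finite_measure.integrable_const[OF finite_measure_time] .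

text \<open>The simple functions converge only almost everywhere. Extended by 0 to the line,
  \<open>f\<close> agrees a.e. with the measurable limit of the extended simple functions, and
  completeness of Lebesgue measure makes it measurable itself.\<close>

lemma strong_meas_real:
 assumes "strong_meas T (UNIV :: real set) abs f"
 shows "f \<in> borel_measurable (time T)"
proof -
 obtain s :: "nat => real => real" where s: "!!k. simple_function (time T) (s k)"
   "AE t in time T. (%k. \<bar>s k t - f t\<bar>) \<longlonglongrightarrow> 0"
  using assms unfolding strong_meas_def by auto
 define F where "F k t = (if t \<in> {0<..<T} then s k t else 0)" for k t
 have F: "F k \<in> borel_measurable lebesgue" for k
  unfolding F_def by (rule borel_measurable_if_I[OF borel_measurable_simple_function[OF s(1)]]) simp
 hence "(%t. lim (%k. F k t)) \<in> borel_measurable lebesgue"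
  by (rule borel_measurable_lim_metric)
 moreover have "AE t in lebesgue. lim (%k. F k t) = (if t \<in> {0<..<T} then f t else 0)"
 proof -
  have "AE t in lebesgue. t \<in> {0<..<T} --> (%k. \<bar>s k t - f t\<bar>) \<longlonglongrightarrow> 0"
   using s(2) by (subst (asm) AE_restrict_space_iff) auto
  thus ?thesis
  proof eventually_elim
   case (elim t)
   show ?case
   proof (cases "t \<in> {0<..<T}")
    case True
    hence "(%k. s k t - f t) \<longlonglongrightarrow> 0" using elim tendsto_rabs_zero_iff by blast
    hence "(%k. F k t) \<longlonglongrightarrow> f t" using True by (simp add: F_def LIM_zero_iff)
    thus ?thesis using True limI by auto
   next
    case False
    thus ?thesis by (auto simp: F_def intro!: limI)
   qed
  qed
 qed
 ultimately have "(%t. if t \<in> {0<..<T} then f t else 0) \<in> borel_measurable lebesgue"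
  by (rule borel_measurable_AE)
 thus ?thesis by (rule borel_measurable_if_D)
qed

text \<open>Pairs of simple functions are simple, so the approximants may be inserted into
  \<open>G\<close>, and sequential continuity gives convergence. Sums, scalar multiples, norms and
  dual pairings are all obtained from this.\<close>

lemma strong_meas_binary:
 assumes u: "strong_meas T X nX u" and w: "strong_meas T Y nY w"
  and G: "!!x y. x \<in> X ==> y \<in> Y ==> G x y \<in> Z"
  and cont: "!!x y xs ys. x \<in> X ==> y \<in> Y ==> (!!k. xs k \<in> X) ==> (!!k. ys k \<in> Y) ==>
   (%k. nX (xs k - x)) \<longlonglongrightarrow> 0 ==> (%k. nY (ys k - y)) \<longlonglongrightarrow> 0 ==>
   (%k. nZ (G (xs k) (ys k) - G x y)) \<longlonglongrightarrow> 0"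
 shows "strong_meas T Z nZ (%t. G (u t) (w t))"
proof -
 obtain s where s: "!!k. simple_function (time T) (s k)" "!!k t. t \<in> {0<..<T} ==> s k t \<in> X"
   "AE t in time T. (%k. nX (s k t - u t)) \<longlonglongrightarrow> 0"
  using u unfolding strong_meas_def by blast
 obtain r where r: "!!k. simple_function (time T) (r k)" "!!k t. t \<in> {0<..<T} ==> r k t \<in> Y"
   "AE t in time T. (%k. nY (r k t - w t)) \<longlonglongrightarrow> 0"
  using w unfolding strong_meas_def by blast
 have uX: "AE t in time T. u t \<in> X" and wY: "AE t in time T. w t \<in> Y"
  using u w unfolding strong_meas_def by auto
 have "AE t in time T. G (u t) (w t) \<in> Z" using uX wY by eventually_elim (rule G)
 moreover have "simple_function (time T) (%t. G (s k t) (r k t))" for k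
  by (rule simple_function_compose2[OF s(1) r(1)])
 moreover have "AE t in time T. (%k. nZ (G (s k t) (r k t) - G (u t) (w t))) \<longlonglongrightarrow> 0"
  using s(3) r(3) uX wY AE_time_in by eventually_elim (rule cont, auto intro: s(2) r(2))
 ultimately show ?thesis
  unfolding strong_meas_def using G s(2) r(2)
  by (intro conjI exI[of _ "%k t. G (s k t) (r k t)"]) auto
qed

lemma strong_meas_unary:
 assumes u: "strong_meas T X nX u"
  and G: "!!x. x \<in> X ==> G x \<in> Z"
  and cont: "!!x xs. x \<in> X ==> (!!k. xs k \<in> X) ==>
   (%k. nX (xs k - x)) \<longlonglongrightarrow> 0 ==> (%k. nZ (G (xs k) - G x)) \<longlonglongrightarrow> 0"
 shows "strong_meas T Z nZ (%t. G (u t))"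
 by (rule strong_meas_binary[OF u u, of "%x _. G x"]) (auto intro: G cont)

lemma strong_meas_of_real:
 assumes "f \<in> borel_measurable (time T)"
 shows "strong_meas T (UNIV :: real set) abs f"
proof -
 obtain s where s: "!!i. simple_function (time T) (s i)"
   "!!x. x \<in> space (time T) ==> (%i. s i x) \<longlonglongrightarrow> f x"
  using borel_measurable_implies_sequence_metric[OF assms, of 0] by blast
 have "AE t in time T. (%k. \<bar>s k t - f t\<bar>) \<longlonglongrightarrow> 0"
 proof (rule AE_I2)
  fix t assume "t \<in> space (time T)"
  hence "(%k. s k t - f t) \<longlonglongrightarrow> 0" using s(2) LIM_zero by blast
  thus "(%k. \<bar>s k t - f t\<bar>) \<longlonglongrightarrow> 0" using tendsto_rabs_zero by blast
 qed
 thus ?thesis using s(1) unfolding strong_meas_def by auto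
qed

section \<open>Strongly measurable and square-integrable functions of time\<close>

context seminormed
begin

lemma sm_add:
 assumes "strong_meas T X nrm u" "strong_meas T X nrm w"
 shows "strong_meas T X nrm (%t. u t + w t)"
proof (rule strong_meas_binary[OF assms])
 fix x y xs ys assume *: "x \<in> X" "y \<in> X" "!!k. xs k \<in> X" "!!k. ys k \<in> X"
  "(%k. nrm (xs k - x)) \<longlonglongrightarrow> 0" "(%k. nrm (ys k - y)) \<longlonglongrightarrow> 0"
 show "(%k. nrm (xs k + ys k - (x + y))) \<longlonglongrightarrow> 0"
 proof (rule Lim_null_comparison)
  have "nrm (xs k + ys k - (x + y)) <= nrm (xs k - x) + nrm (ys k - y)" for k
   using triangle[of "xs k - x" "ys k - y"] * by (simp add: algebra_simps)
  thus "\<forall>\<^sub>F k in sequentially. norm (nrm (xs k + ys k - (x + y))) <= nrm (xs k - x) + nrm (ys k - y)"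
   using * nonneg by simp
  show "(%k. nrm (xs k - x) + nrm (ys k - y)) \<longlonglongrightarrow> 0" using tendsto_add[OF *(5,6)] by simp
 qed
qed auto

lemma sm_scaleR:
 assumes phi: "phi \<in> borel_measurable (time T)" and u: "strong_meas T X nrm u"
 shows "strong_meas T X nrm (%t. phi t *\<^sub>R u t)"
proof (rule strong_meas_binary[OF strong_meas_of_real[OF phi] u])
 fix c :: real and y cs ys assume *: "y \<in> X" "!!k. ys k \<in> X"
  "(%k. \<bar>cs k - c\<bar>) \<longlonglongrightarrow> 0" "(%k. nrm (ys k - y)) \<longlonglongrightarrow> 0"
 have cs: "cs \<longlonglongrightarrow> c" using *(3) tendsto_rabs_zero_iff LIM_zero_iff by blast
 show "(%k. nrm (cs k *\<^sub>R ys k - c *\<^sub>R y)) \<longlonglongrightarrow> 0"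
 proof (rule Lim_null_comparison)
  have "nrm (cs k *\<^sub>R ys k - c *\<^sub>R y) <= \<bar>cs k\<bar> * nrm (ys k - y) + \<bar>cs k - c\<bar> * nrm y" for k
   using triangle[of "cs k *\<^sub>R (ys k - y)" "(cs k - c) *\<^sub>R y"] * scale[of "ys k - y" "cs k"] scale[of y "cs k - c"]
   by (simp add: algebra_simps)
  thus "\<forall>\<^sub>F k in sequentially. norm (nrm (cs k *\<^sub>R ys k - c *\<^sub>R y)) <= \<bar>cs k\<bar> * nrm (ys k - y) + \<bar>cs k - c\<bar> * nrm y"
   using * nonneg by simp
  have "(%k. \<bar>cs k\<bar> * nrm (ys k - y) + \<bar>cs k - c\<bar> * nrm y) \<longlonglongrightarrow> \<bar>c\<bar> * 0 + 0 * nrm y"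
   by (intro tendsto_intros cs *)
  thus "(%k. \<bar>cs k\<bar> * nrm (ys k - y) + \<bar>cs k - c\<bar> * nrm y) \<longlonglongrightarrow> 0" by simp
 qed
qed auto

lemma sm_minus:
 assumes "strong_meas T X nrm u"
 shows "strong_meas T X nrm (%t. - u t)"
 using sm_scaleR[OF _ assms, of "%_. -1"] by simp

lemma sm_diff:
 assumes "strong_meas T X nrm u" "strong_meas T X nrm w"
 shows "strong_meas T X nrm (%t. u t - w t)"
 using sm_add[OF assms(1) sm_minus[OF assms(2)]] by simp

lemma sm_const: "x \<in> X ==> strong_meas T X nrm (%t. x)"
 unfolding strong_meas_def by (auto intro!: exI[of _ "%_ _. x"])

lemma sm_nrm:
 assumes "strong_meas T X nrm u"
 shows "(%t. nrm (u t)) \<in> borel_measurable (time T)"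
proof (rule strong_meas_real, rule strong_meas_unary[OF assms])
 fix x xs assume *: "x \<in> X" "!!k. xs k \<in> X" "(%k. nrm (xs k - x)) \<longlonglongrightarrow> 0"
 have "(%k. nrm (xs k)) \<longlonglongrightarrow> nrm x" by (rule tendsto_nrm[OF *(2,1,3)])
 thus "(%k. \<bar>nrm (xs k) - nrm x\<bar>) \<longlonglongrightarrow> 0" using LIM_zero tendsto_rabs_zero by blast
qed simp

lemma sm_linear:
 assumes u: "strong_meas T X nrm u" and Y: "seminormed Y nY"
  and G: "!!x. x \<in> X ==> G x \<in> Y"
  and Gd: "!!x y. x \<in> X ==> y \<in> X ==> nY (G x - G y) <= C * nrm (x - y)"
 shows "strong_meas T Y nY (%t. G (u t))"
proof (rule strong_meas_unary[OF u G])
 interpret Y: seminormed Y nY by (rule Y)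
 fix x xs assume *: "x \<in> X" "!!k. xs k \<in> X" "(%k. nrm (xs k - x)) \<longlonglongrightarrow> 0"
 show "(%k. nY (G (xs k) - G x)) \<longlonglongrightarrow> 0"
 proof (rule Lim_null_comparison)
  show "\<forall>\<^sub>F k in sequentially. norm (nY (G (xs k) - G x)) <= C * nrm (xs k - x)"
   using * Y.nonneg G Gd by simp
  show "(%k. C * nrm (xs k - x)) \<longlonglongrightarrow> 0" using tendsto_mult_right_zero[OF *(3)] .
 qed
qed

text \<open>Sampling at the grid point \<open>tau k t\<close> to the left of \<open>t\<close>, at
  distance at most \<open>1 / (k + 1)\<close>, gives functions with finitely many values that
  converge to \<open>u\<close> pointwise.\<close>

lemma sm_Lipschitz:
 assumes mem: "!!t. t \<in> {0..T} ==> u t \<in> X"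
  and lip: "!!t s. t \<in> {0..T} ==> s \<in> {0..T} ==> nrm (u t - u s) <= L * \<bar>t - s\<bar>"
 shows "strong_meas T X nrm u"
proof -
 define tau where "tau k t = real_of_int \<lfloor>real (Suc k) * t\<rfloor> / real (Suc k)" for k t
 have tau: "tau k t \<in> {0..T}" "\<bar>tau k t - t\<bar> <= 1 / real (Suc k)" if "t \<in> {0<..<T}" for k t
 proof -
  have "real_of_int \<lfloor>real (Suc k) * t\<rfloor> <= real (Suc k) * t" by (rule of_int_floor_le)
  moreover have "real (Suc k) * t < real_of_int \<lfloor>real (Suc k) * t\<rfloor> + 1" by linarith
  moreover have "0 <= real_of_int \<lfloor>real (Suc k) * t\<rfloor>" using that by simp
  ultimately have "tau k t <= t" "t < tau k t + 1 / real (Suc k)" "0 <= tau k t"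
   by (auto simp: tau_def divide_simps algebra_simps simp del: of_nat_Suc)
  thus "tau k t \<in> {0..T}" "\<bar>tau k t - t\<bar> <= 1 / real (Suc k)" using that by auto
 qed
 have sf: "simple_function (time T) (tau k)" for k
 proof (rule simple_function_borel_measurable)
  have "tau k \<in> borel_measurable borel" unfolding tau_def by measurable
  thus "tau k \<in> borel_measurable (time T)"
   by (intro measurable_restrict_space1 measurable_completion) simp
  have "tau k ` {0<..<T} \<subseteq> (%i. real_of_int i / real (Suc k)) ` {0..\<lfloor>real (Suc k) * T\<rfloor>}"
  proof
   fix y assume "y \<in> tau k ` {0<..<T}"
   then obtain t where t: "t \<in> {0<..<T}" "y = tau k t" by auto
   have "\<lfloor>real (Suc k) * t\<rfloor> \<in> {0..\<lfloor>real (Suc k) * T\<rfloor>}"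
    using t by (auto intro!: floor_mono mult_left_mono simp del: of_nat_Suc)
   thus "y \<in> (%i. real_of_int i / real (Suc k)) ` {0..\<lfloor>real (Suc k) * T\<rfloor>}"
    using t by (auto simp: tau_def)
  qed
  thus "finite (tau k ` space (time T))" by (simp add: finite_subset[OF _ finite_imageI])
 qed
 have "AE t in time T. (%k. nrm (u (tau k t) - u t)) \<longlonglongrightarrow> 0"
 proof (rule AE_I2)
  fix t assume t: "t \<in> space (time T)"
  show "(%k. nrm (u (tau k t) - u t)) \<longlonglongrightarrow> 0"
  proof (rule Lim_null_comparison)
   have "nrm (u (tau k t) - u t) <= \<bar>L\<bar> * (1 / real (Suc k))" for k
   proof -
    have "nrm (u (tau k t) - u t) <= L * \<bar>tau k t - t\<bar>" using lip tau t by auto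
    also have "... <= \<bar>L\<bar> * \<bar>tau k t - t\<bar>" by (intro mult_right_mono) auto
    also have "... <= \<bar>L\<bar> * (1 / real (Suc k))" using tau t by (intro mult_left_mono) auto
    finally show ?thesis .
   qed
   moreover have "0 <= nrm (u (tau k t) - u t)" for k
    using tau(1)[of t k] t mem by (intro nonneg mem) auto
   ultimately show "\<forall>\<^sub>F k in sequentially. norm (nrm (u (tau k t) - u t)) <= \<bar>L\<bar> * (1 / real (Suc k))"
    by simp
   show "(%k. \<bar>L\<bar> * (1 / real (Suc k))) \<longlonglongrightarrow> 0"
    by (intro tendsto_mult_right_zero LIMSEQ_Suc lim_1_over_n)
  qed
 qed
 moreover have "AE t in time T. u t \<in> X" by (rule AE_I2) (use mem in auto)
 ultimately show ?thesis unfolding strong_meas_def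
  using tau(1) mem simple_function_compose1[OF sf] by (intro conjI exI[of _ "%k t. u (tau k t)"]) auto
qed

lemma sm_pairing:
 assumes b: "strong_meas T dual dnorm b" and u: "strong_meas T X nrm u"
 shows "(%t. b t (u t)) \<in> borel_measurable (time T)"
proof (rule strong_meas_real, rule strong_meas_binary[OF b u])
 interpret D: seminormed dual dnorm by (rule dual_seminormed)
 fix l x ls xs assume *: "l \<in> dual" "x \<in> X" "!!k. ls k \<in> dual" "!!k. xs k \<in> X"
  "(%k. dnorm (ls k - l)) \<longlonglongrightarrow> 0" "(%k. nrm (xs k - x)) \<longlonglongrightarrow> 0"
 show "(%k. \<bar>ls k (xs k) - l x\<bar>) \<longlonglongrightarrow> 0"
 proof (rule Lim_null_comparison)
  have "\<bar>ls k (xs k) - l x\<bar> <= dnorm (ls k - l) * nrm (xs k) + dnorm l * nrm (xs k - x)" for k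
  proof -
   have "ls k (xs k) - l x = (ls k - l) (xs k) + l (xs k - x)"
    using * dualD(3)[of l] by simp
   moreover have "ls k - l \<in> dual" using * by auto
   ultimately show ?thesis
    using dnorm_bound[of "ls k - l" "xs k"] dnorm_bound[of l "xs k - x"] * by fastforce
  qed
  thus "\<forall>\<^sub>F k in sequentially. norm \<bar>ls k (xs k) - l x\<bar> <= dnorm (ls k - l) * nrm (xs k) + dnorm l * nrm (xs k - x)"
   by simp
  have "(%k. dnorm (ls k - l) * nrm (xs k) + dnorm l * nrm (xs k - x)) \<longlonglongrightarrow> 0 * nrm x + dnorm l * 0"
   by (intro tendsto_intros * tendsto_nrm)
  thus "(%k. dnorm (ls k - l) * nrm (xs k) + dnorm l * nrm (xs k - x)) \<longlonglongrightarrow> 0" by simp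
 qed
qed simp

lemma sq_add_le: "x \<in> X ==> y \<in> X ==> (nrm (x + y))^2 <= 2 * (nrm x)^2 + 2 * (nrm y)^2"
proof -
 assume *: "x \<in> X" "y \<in> X"
 hence "(nrm (x + y))^2 <= (nrm x + nrm y)^2" using triangle nonneg by (intro power_mono) auto
 also have "... <= 2 * (nrm x)^2 + 2 * (nrm y)^2"
  using sum_squares_bound[of "nrm x" "nrm y"] by (simp add: power2_sum)
 finally show ?thesis .
qed

definition sq_int :: "real => (real => 'v) => bool" where
 "sq_int T u \<longleftrightarrow> strong_meas T X nrm u \<and> integrable (time T) (%t. (nrm (u t))^2)"

lemma sq_int_mem: "sq_int T u ==> AE t in time T. u t \<in> X"
 unfolding sq_int_def strong_meas_def by auto

lemma sq_int_bound:
 assumes "strong_meas T X nrm u" "integrable (time T) f" "AE t in time T. (nrm (u t))^2 <= f t"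
 shows "sq_int T u"
 unfolding sq_int_def
proof
 show "integrable (time T) (%t. (nrm (u t))^2)"
  by (rule Bochner_Integration.integrable_bound[OF assms(2)])
    (use sm_nrm[OF assms(1)] assms(3) in auto)
qed (rule assms)

lemma sq_int_add:
 assumes "sq_int T u" "sq_int T w"
 shows "sq_int T (%t. u t + w t)"
proof (rule sq_int_bound)
 show "integrable (time T) (%t. 2 * (nrm (u t))^2 + 2 * (nrm (w t))^2)"
  using assms unfolding sq_int_def by auto
 show "AE t in time T. (nrm (u t + w t))^2 <= 2 * (nrm (u t))^2 + 2 * (nrm (w t))^2"
  using sq_int_mem[OF assms(1)] sq_int_mem[OF assms(2)] by eventually_elim (rule sq_add_le)
qed (use assms sm_add in \<open>auto simp: sq_int_def\<close>)

lemma sq_int_scale: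
 assumes "sq_int T u"
 shows "sq_int T (%t. c *\<^sub>R u t)"
proof (rule sq_int_bound)
 show "integrable (time T) (%t. c^2 * (nrm (u t))^2)"
  using assms unfolding sq_int_def by auto
 show "AE t in time T. (nrm (c *\<^sub>R u t))^2 <= c^2 * (nrm (u t))^2"
  using sq_int_mem[OF assms(1)] by eventually_elim (simp add: scale power_mult_distrib)
qed (use assms sm_scaleR[of "%_. c"] in \<open>auto simp: sq_int_def\<close>)

lemma sq_int_diff:
 assumes "sq_int T u" "sq_int T w"
 shows "sq_int T (%t. u t - w t)"
 using sq_int_add[OF assms(1) sq_int_scale[OF assms(2), of "-1"]] by simp

lemma sq_int_sum:
 assumes "!!i. i \<in> I ==> sq_int T (u i)"
 shows "sq_int T (%t. \<Sum>i\<in>I. u i t)"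
 using assms
proof (induction I rule: infinite_finite_induct)
 case (insert i I)
 thus ?case using sq_int_add[of T "u i" "%t. \<Sum>i\<in>I. u i t"] by simp
qed (auto simp: sm_const sq_int_def)

lemma sq_int_linear:
 assumes u: "sq_int T u" and Y: "seminormed Y nY"
  and G: "!!x. x \<in> X ==> G x \<in> Y"
  and Gd: "!!x y. x \<in> X ==> y \<in> X ==> nY (G x - G y) <= C * nrm (x - y)"
  and G0: "!!x. x \<in> X ==> nY (G x) <= C * nrm x"
 shows "seminormed.sq_int Y nY T (%t. G (u t))"
proof -
 interpret Y: seminormed Y nY by (rule Y)
 show ?thesis
 proof (rule Y.sq_int_bound)
  show "strong_meas T Y nY (%t. G (u t))"
   by (rule sm_linear[OF _ Y G Gd]) (use u in \<open>auto simp: sq_int_def\<close>)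
  show "integrable (time T) (%t. C^2 * (nrm (u t))^2)"
   using u unfolding sq_int_def by auto
  show "AE t in time T. (nY (G (u t)))^2 <= C^2 * (nrm (u t))^2"
   using sq_int_mem[OF u]
  proof eventually_elim
   case (elim t)
   hence "(nY (G (u t)))^2 <= (C * nrm (u t))^2" using G0 Y.nonneg G by (intro power_mono) auto
   thus ?case by (simp add: power_mult_distrib)
  qed
 qed
qed

lemma integrable_pairing:
 assumes b: "seminormed.sq_int dual dnorm T b" and u: "sq_int T u"
 shows "integrable (time T) (%t. b t (u t))"
proof -
 interpret D: seminormed dual dnorm by (rule dual_seminormed)
 show ?thesis
 proof (rule Bochner_Integration.integrable_bound)
  show "integrable (time T) (%t. (dnorm (b t))^2 + (nrm (u t))^2)"
   using b u unfolding sq_int_def D.sq_int_def by auto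
  show "(%t. b t (u t)) \<in> borel_measurable (time T)"
   using b u sm_pairing unfolding sq_int_def D.sq_int_def by auto
  show "AE t in time T. norm (b t (u t)) <= norm ((dnorm (b t))^2 + (nrm (u t))^2)"
   using sq_int_mem[OF u] D.sq_int_mem[OF b]
  proof eventually_elim
   case (elim t)
   have "\<bar>b t (u t)\<bar> <= dnorm (b t) * nrm (u t)" using dnorm_bound elim by blast
   also have "... <= (dnorm (b t))^2 + (nrm (u t))^2"
    using sum_squares_bound[of "dnorm (b t)" "nrm (u t)"] zero_le_power2[of "dnorm (b t)"] zero_le_power2[of "nrm (u t)"]
    by linarith
   finally show ?case by simp
  qed
 qed
qed

lemma sq_int_Lipschitz:
 assumes mem: "!!t. t \<in> {0..T} ==> u t \<in> X"
  and lip: "!!t s. t \<in> {0..T} ==> s \<in> {0..T} ==> nrm (u t - u s) <= L * \<bar>t - s\<bar>"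
 shows "sq_int T u"
proof (cases "T > 0")
 case T: True
 show ?thesis
 proof (rule sq_int_bound[OF sm_Lipschitz[OF mem lip]])
  show "AE t in time T. (nrm (u t))^2 <= (nrm (u 0) + \<bar>L\<bar> * T)^2"
  proof (rule AE_I2)
   fix t assume t: "t \<in> space (time T)"
   have "nrm (u t) <= nrm (u t - u 0) + nrm (u 0)" using triangle[of "u t - u 0" "u 0"] mem t T by simp
   moreover have "nrm (u t - u 0) <= L * \<bar>t - 0\<bar>" using lip[of t 0] t T by auto
   moreover have "L * \<bar>t - 0\<bar> <= \<bar>L\<bar> * T" using t by (intro mult_mono) auto
   ultimately show "(nrm (u t))^2 <= (nrm (u 0) + \<bar>L\<bar> * T)^2"
    using nonneg[of "u t"] mem t by (intro power_mono) auto
  qed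
 qed auto
next
 case False
 show ?thesis
  by (rule sq_int_bound[OF sm_Lipschitz[OF mem lip], where f = "%_. 0"]) (use False in \<open>auto intro!: AE_I2\<close>)
qed

text \<open>The simple functions from the definition converge pointwise but need not be dominated.
  Reset to 0 wherever their norm exceeds \<open>2 * nrm (u t)\<close> they still converge, and
  \<open>9 * (nrm (u t))^2\<close> dominates the squared error.\<close>

lemma simple_approx:
 assumes u: "sq_int T u" and e: "e > 0"
 obtains s where "simple_function (time T) s" "!!t. t \<in> {0<..<T} ==> s t \<in> X"
  "(LINT t|time T. (nrm (u t - s t))^2) < e"
proof -
 have um: "strong_meas T X nrm u" and ui: "integrable (time T) (%t. (nrm (u t))^2)"
  using u unfolding sq_int_def by auto
 obtain s where s: "!!k. simple_function (time T) (s k)" "!!k t. t \<in> {0<..<T} ==> s k t \<in> X"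
   "AE t in time T. (%k. nrm (s k t - u t)) \<longlonglongrightarrow> 0"
  using um unfolding strong_meas_def by blast
 note [measurable] = sm_nrm[OF um]
 have [measurable]: "(%t. nrm (s k t)) \<in> borel_measurable (time T)" for k
  by (rule borel_measurable_simple_function[OF simple_function_compose1[OF s(1)]])
 define r where "r k t = (if nrm (s k t) <= 2 * nrm (u t) then s k t else 0)" for k t
 have sr: "simple_function (time T) (r k)" for k
 proof -
  have "{t \<in> space (time T). nrm (s k t) <= 2 * nrm (u t)} \<in> sets (time T)" by measurable
  thus ?thesis unfolding r_def
   by (rule simple_function_If[OF s(1) simple_function_const])
 qed
 have rX: "r k t \<in> X" if "t \<in> {0<..<T}" for k t using s(2)[OF that] by (simp add: r_def)
 have smr: "strong_meas T X nrm (%t. u t - r k t)" for k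
 proof (rule sm_diff[OF um])
  show "strong_meas T X nrm (r k)"
   unfolding strong_meas_def using sr rX
   by (intro conjI exI[of _ "%_. r k"]) (auto intro!: AE_I2)
 qed
 have "(%k. \<integral>t. (nrm (u t - r k t))^2 \<partial>time T) \<longlonglongrightarrow> (LINT t|time T. 0)"
 proof (rule integral_dominated_convergence)
  show "integrable (time T) (%t. 9 * (nrm (u t))^2)" using ui by simp
  show "(%t. (nrm (u t - r k t))^2) \<in> borel_measurable (time T)" for k
   using sm_nrm[OF smr] by measurable
  show "AE t in time T. norm ((nrm (u t - r k t))^2) <= 9 * (nrm (u t))^2" for k
   using sq_int_mem[OF u] AE_time_in
  proof eventually_elim
   case (elim t)
   have "nrm (u t - r k t) <= nrm (u t) + nrm (r k t)" using triangle_diff elim rX by blast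
   also have "nrm (r k t) <= 2 * nrm (u t)" using nonneg elim by (auto simp: r_def)
   finally have "nrm (u t - r k t) <= 3 * nrm (u t)" by simp
   hence "(nrm (u t - r k t))^2 <= (3 * nrm (u t))^2" using nonneg elim rX by (intro power_mono) auto
   thus ?case by (simp add: power_mult_distrib)
  qed
  show "AE t in time T. (%k. (nrm (u t - r k t))^2) \<longlonglongrightarrow> 0"
   using sq_int_mem[OF u] AE_time_in s(3)
  proof eventually_elim
   case (elim t)
   have "(%k. nrm (u t - r k t)) \<longlonglongrightarrow> 0"
   \<comment> \<open>Where \<open>u t\<close> has norm zero the truncation already leaves error
     zero; elsewhere it is eventually inactive.\<close>
   proof (cases "nrm (u t) = 0")
    case True
    have "nrm (u t - r k t) = 0" for k
    proof -
     have "nrm (r k t) <= 0" using True by (auto simp: r_def)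
     hence "nrm (u t - r k t) <= 0" using triangle_diff[of "u t" "r k t"] True elim rX by auto
     thus ?thesis using nonneg[of "u t - r k t"] elim rX by fastforce
    qed
    thus ?thesis by simp
   next
    case False
    hence pos: "nrm (u t) > 0" using nonneg[of "u t"] elim by simp
    have "(%k. nrm (s k t)) \<longlonglongrightarrow> nrm (u t)"
     by (rule tendsto_nrm) (use elim s(2) in blast)+
    hence "\<forall>\<^sub>F k in sequentially. nrm (s k t) < 2 * nrm (u t)"
     using pos by (intro order_tendstoD) auto
    hence "\<forall>\<^sub>F k in sequentially. nrm (s k t - u t) = nrm (u t - r k t)"
    proof eventually_elim
     case *: (elim k)
     hence "r k t = s k t" by (simp add: r_def)
     thus ?case using nrm_commute[of "s k t" "u t"] elim s(2) by simp
    qed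
    from tendsto_cong[OF this] elim(3) show ?thesis by simp
   qed
   hence "(%k. (nrm (u t - r k t))^2) \<longlonglongrightarrow> 0^2" by (intro tendsto_power)
   thus ?case by simp
  qed
 qed auto
 hence "\<forall>\<^sub>F k in sequentially. (LINT t|time T. (nrm (u t - r k t))^2) < e"
  using e by (intro order_tendstoD(2)) auto
 then obtain k where "(LINT t|time T. (nrm (u t - r k t))^2) < e"
  by (meson eventually_sequentially order_refl)
 thus ?thesis using that[OF sr rX] by blast
qed

end

lemma L2_Bochner_sq_integrable:
 "seminormed X nrm ==> u \<in> L2_Bochner T X nrm \<longleftrightarrow> seminormed.sq_int X nrm T u"
 by (simp add: L2_Bochner_iff seminormed.sq_int_def)

text \<open>Inner regularity replaces \<open>A\<close> by a closed \<open>K\<close>, and the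
  cut-offs \<open>max 0 (1 - j * infdist t K)\<close> decrease to the indicator of \<open>K\<close>.
  Both errors are kept below \<open>e / 4\<close> because
  \<open>(x + y)^2 <= 2 * x^2 + 2 * y^2\<close> doubles each.\<close>

lemma Lipschitz_approx_indicator:
 assumes A: "A \<in> sets (time T)" and e: "e > 0"
 obtains zeta :: "real => real" and L where "!!t s. \<bar>zeta t - zeta s\<bar> <= L * \<bar>t - s\<bar>" "!!t. 0 <= zeta t \<and> zeta t <= 1"
  "(LINT t|time T. (indicator A t - zeta t)^2) < e"
proof -
 interpret finite_measure "time T" by (rule finite_measure_time)
 have A': "A \<in> sets lebesgue" "A \<subseteq> {0<..<T}" using A by (subst (asm) sets_restrict_space_iff; force)+
 obtain K where K: "closed K" "K \<subseteq> A" "A - K \<in> lmeasurable" "emeasure lebesgue (A - K) < ennreal (e/4)"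
  using sets_lebesgue_inner_closed[OF A'(1), of "e/4"] e by auto
 have Ks: "K \<in> sets lebesgue" using K(1) by simp
 have Kt: "K \<in> sets (time T)" using K A' Ks by (subst sets_restrict_space_iff) auto
 have mAK: "measure lebesgue (A - K) < e / 4"
  using K(3,4) emeasure_eq_measure2[OF K(3)] by (simp add: ennreal_less_iff)
 have AK: "(LINT t|time T. (indicator A t - indicator K t :: real)^2) < e / 4"
 proof -
  have "(LINT t|time T. (indicator A t - indicator K t :: real)^2) = (LINT t|time T. indicator (A - K) t)"
   using K(2) by (intro Bochner_Integration.integral_cong) (auto simp: indicator_def)
  also have "... = measure (time T) (A - K)" using A A' by (simp add: Int_absorb2 Diff_subset_conv le_supI2)
  also have "... = measure lebesgue (A - K)" using A' by (intro measure_restrict_space) auto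
  finally show ?thesis using mAK by simp
 qed
 obtain zeta :: "real => real" and L where zeta: "!!t s. \<bar>zeta t - zeta s\<bar> <= L * \<bar>t - s\<bar>" "!!t. 0 <= zeta t \<and> zeta t <= 1"
  "zeta \<in> borel_measurable (time T)" "(LINT t|time T. (indicator K t - zeta t)^2) < e / 4"
 \<comment> \<open>\<open>infdist\<close> to the empty set is 0 by convention, which would make
   every cut-off equal to 1.\<close>
 proof (cases "K = {}")
  case True
  thus ?thesis using that[of "%_. 0" 0] e by simp
 next
  case False
  define X where "X j t = max 0 (1 - real j * infdist t K)" for j t
  have lip: "\<bar>X j t - X j s\<bar> <= real j * \<bar>t - s\<bar>" for j t s
  proof -
   have "\<bar>X j t - X j s\<bar> <= \<bar>real j * infdist t K - real j * infdist s K\<bar>" by (auto simp: X_def)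
   also have "... = real j * \<bar>infdist t K - infdist s K\<bar>" by (simp add: abs_mult flip: right_diff_distrib)
   also have "... <= real j * \<bar>t - s\<bar>"
    using infdist_triangle_abs[of t K s] by (intro mult_left_mono) (auto simp: dist_real_def)
   finally show ?thesis .
  qed
  have bd: "0 <= X j t \<and> X j t <= 1" for j t by (auto simp: X_def infdist_nonneg)
  have meas: "X j \<in> borel_measurable (time T)" for j
  proof -
   have "X j \<in> borel_measurable borel" unfolding X_def
    by (intro borel_measurable_continuous_onI continuous_intros)
   thus ?thesis by (intro measurable_restrict_space1 measurable_completion) simp
  qed
  have "(%j. \<integral>t. (indicator K t - X j t)^2 \<partial>time T) \<longlonglongrightarrow> (LINT t|time T. 0)"
  proof (rule integral_dominated_convergence)
   show "integrable (time T) (%t. 1 :: real)" by simp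
   show "(%t. (indicator K t - X j t)^2) \<in> borel_measurable (time T)" for j
    using meas[of j] Kt by measurable
   show "AE t in time T. norm ((indicator K t - X j t)^2) <= 1" for j
   proof (rule AE_I2)
    fix t
    have "\<bar>indicator K t - X j t\<bar> <= 1" using bd[of j t] by (auto simp: indicator_def)
    thus "norm ((indicator K t - X j t)^2) <= 1" by (simp add: abs_square_le_1)
   qed
   show "AE t in time T. (%j. (indicator K t - X j t)^2) \<longlonglongrightarrow> 0"
   proof (rule AE_I2)
    fix t
    have "\<forall>\<^sub>F j in sequentially. (indicator K t - X j t)^2 = 0"
    proof (cases "t \<in> K")
     case True
     thus ?thesis by (simp add: X_def)
    next
     case out: False
     hence pos: "infdist t K > 0"
      using in_closed_iff_infdist_zero[OF K(1) False] infdist_nonneg[of t K] by force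
     obtain j0 :: nat where "1 / infdist t K < real j0" using reals_Archimedean2 by blast
     hence "X j t = 0" if "j >= j0" for j
     proof -
      have "1 <= real j0 * infdist t K" using \<open>1 / infdist t K < real j0\<close> pos by (simp add: divide_less_eq)
      also have "... <= real j * infdist t K" using that pos by (intro mult_right_mono) auto
      finally show ?thesis by (simp add: X_def)
     qed
     thus ?thesis using out by (auto simp: eventually_sequentially)
    qed
    thus "(%j. (indicator K t - X j t)^2) \<longlonglongrightarrow> 0" by (rule tendsto_eventually)
   qed
  qed auto
  hence "\<forall>\<^sub>F j in sequentially. (LINT t|time T. (indicator K t - X j t)^2) < e / 4"
   using e by (intro order_tendstoD(2)) auto
  then obtain j where "(LINT t|time T. (indicator K t - X j t)^2) < e / 4"
   by (meson eventually_sequentially order_refl)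
  thus ?thesis using that[of "X j"] lip bd meas by blast
 qed
 note [measurable] = zeta(3) A Kt
 have i1: "integrable (time T) (%t. (indicator A t - indicator K t :: real)^2)"
  by (rule integrable_const_bound[of _ 1]) (auto simp: indicator_def intro!: AE_I2)
 have le1: "(indicator B t - zeta t)^2 <= 1" for B t
 proof -
  have "\<bar>indicator B t - zeta t\<bar> <= 1" using zeta(2)[of t] by (auto simp: indicator_def)
  thus ?thesis by (simp add: abs_square_le_1)
 qed
 have i2: "integrable (time T) (%t. (indicator K t - zeta t)^2)"
  by (rule integrable_const_bound[of _ 1]) (auto intro!: AE_I2 le1)
 have i3: "integrable (time T) (%t. (indicator A t - zeta t)^2)"
  by (rule integrable_const_bound[of _ 1]) (auto intro!: AE_I2 le1)
 have "(LINT t|time T. (indicator A t - zeta t)^2) <= (LINT t|time T. 2 * (indicator A t - indicator K t)^2 + 2 * (indicator K t - zeta t)^2)"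
 proof (rule integral_mono)
  fix t
  show "(indicator A t - zeta t)^2 <= 2 * (indicator A t - indicator K t)^2 + 2 * (indicator K t - zeta t)^2"
   using sum_squares_bound[of "indicator A t - indicator K t" "indicator K t - zeta t"]
   by (simp add: power2_eq_square algebra_simps)
 qed (use i1 i2 i3 in auto)
 also have "... < e" using AK zeta(4) i1 i2 by simp
 finally show ?thesis using that zeta by blast
qed

subsection \<open>The evolution triple\<close>

text \<open>\<open>inj\<close> says that the embedding of \<open>V\<close> into \<open>H\<close> is
  injective up to norm zero. By duality it is what makes the functionals \<open>hp h\<close> with
  \<open>h\<close> in \<open>V\<close> dense in \<open>V.dual\<close>; see
  \<open>pivot_dense\<close>.\<close>

locale gelfand = V: semi_hilbert V ip + H: semi_hilbert H hp
 for V H :: "'v::real_vector set" and ip hp :: "'v => 'v => real" +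
 assumes VH: "V \<subseteq> H"
  and nrm_le: "v \<in> V ==> H.nrm v <= V.nrm v"
  and inj: "v \<in> V ==> H.nrm v = 0 ==> V.nrm v = 0"
begin

sublocale D: seminormed V.dual V.dnorm
 by (rule V.dual_seminormed)

lemma VH' [simp, intro]: "v \<in> V ==> v \<in> H"
 using VH by blast

lemma hp_bound: "h \<in> H ==> v \<in> V ==> \<bar>hp h v\<bar> <= H.nrm h * V.nrm v"
 using H.Cauchy_Schwarz[of h v] mult_left_mono[OF nrm_le H.nonneg, of v h] by force

lemma hp_dual [simp, intro]: "h \<in> H ==> hp h \<in> V.dual"
 by (rule V.dualI[of _ "H.nrm h"]) (auto simp: H.ip_simps hp_bound)

lemma dnorm_hp_diff:
 assumes "h \<in> H" "k \<in> H"
 shows "V.dnorm (hp h - hp k) <= H.nrm (h - k)"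
proof (rule V.dnorm_least)
 fix v assume "v \<in> V"
 thus "\<bar>(hp h - hp k) v\<bar> <= H.nrm (h - k) * V.nrm v"
  using hp_bound[of "h - k" v] assms by (simp add: H.ip_simps)
qed (use assms H.nonneg in auto)

text \<open>The minimisers \<open>y m\<close> of the functional with penalty \<open>m\<close> on the pivot norm tend to zero,
 and \<open>l - m (y m, \<cdot>)\<close> is represented by \<open>y m\<close>.\<close>

lemma pivot_dense:
 assumes l: "l \<in> V.dual" and e: "e > 0"
 obtains h where "h \<in> V" "V.dnorm (l - hp h) <= e"
proof -
 have "EX y. y \<in> V \<and> (ALL v:V. ip y v + real m * hp y v = l v)" for m
 proof -
  obtain y where "y \<in> V" "!!v. v \<in> V ==> ip y v + real m * hp y v = l v"
  proof (rule V.lax_milgram[of "%u v. ip u v + real m * hp u v" "1 + real m" 1 l])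
   have bd: "\<bar>ip u v + real m * hp u v\<bar> <= (1 + real m) * V.nrm u * V.nrm v" if "u \<in> V" "v \<in> V" for u v
   proof -
    have "\<bar>hp u v\<bar> <= V.nrm u * V.nrm v"
     using hp_bound[of u v] mult_right_mono[OF nrm_le, of u "V.nrm v"] that V.nonneg by force
    hence "real m * \<bar>hp u v\<bar> <= real m * (V.nrm u * V.nrm v)" by (rule mult_left_mono) simp
    thus ?thesis using V.Cauchy_Schwarz[OF that] abs_triangle_ineq[of "ip u v" "real m * hp u v"]
     by (simp add: abs_mult algebra_simps)
   qed
   thus "\<bar>ip u v + real m * hp u v\<bar> <= (1 + real m) * V.nrm u * V.nrm v" if "u \<in> V" "v \<in> V" for u v
    using that .
   show "(%v. ip u v + real m * hp u v) \<in> V.dual" if "u \<in> V" for u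
    using that bd[OF that] by (intro V.dualI[of _ "(1 + real m) * V.nrm u"])
     (auto simp: V.ip_simps H.ip_simps algebra_simps)
   show "1 * (V.nrm u)^2 <= ip u u + real m * hp u u" if "u \<in> V" for u
    using that H.pos[of u] by (simp add: V.nrm_sq)
  qed (use l in \<open>auto simp: V.ip_simps H.ip_simps algebra_simps\<close>)
  thus ?thesis by blast
 qed
 then obtain y where y: "!!m. y m \<in> V" "!!m v. v \<in> V ==> ip (y m) v + real m * hp (y m) v = l v"
  by metis
 define L where "L m = l (y m)" for m
 have L_eq: "L m = (V.nrm (y m))^2 + real m * (H.nrm (y m))^2" for m
  using y(2)[OF y(1), of m m] y(1) by (simp add: L_def V.nrm_sq H.nrm_sq)
 hence L0: "0 <= L m" for m by simp
 \<comment> \<open>Larger penalties lower \<open>L\<close>, and the loss controls the squared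
   distance of the minimisers. So \<open>L\<close> is decreasing and bounded below, and the
   \<open>y m\<close> form a Cauchy sequence.\<close>
 have key: "(V.nrm (y m - y k))^2 <= L k - L m" if "k <= m" for k m
 proof -
  define p a b where "p = hp (y k) (y m)" and "a = hp (y m) (y m)" and "b = hp (y k) (y k)"
  have e1: "ip (y m) (y m) = L m - real m * a" "ip (y k) (y k) = L k - real k * b"
   using y(2)[OF y(1), of m m] y(2)[OF y(1), of k k] by (auto simp: L_def a_def b_def)
  have e3: "ip (y k) (y m) = L m - real k * p" "ip (y k) (y m) = L k - real m * p"
   using y(2)[OF y(1), of k m] y(2)[OF y(1), of m k] V.sym[OF y(1) y(1), of m k] H.sym[of "y m" "y k"] y(1)
   by (auto simp: L_def p_def)
  have "0 <= hp (y m - y k) (y m - y k)" using y(1) by (intro H.pos) auto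
  hence "2 * p <= a + b"
   using H.sym[of "y m" "y k"] y(1) by (simp add: H.ip_simps p_def a_def b_def)
  hence "real k * (2 * p) <= real k * (a + b)" by (rule mult_left_mono) simp
  also have "... <= real m * a + real k * b"
   using that H.pos[of "y m"] y(1) by (simp add: a_def algebra_simps mult_right_mono)
  finally have fin: "2 * (real k * p) <= real m * a + real k * b" by simp
  have "(V.nrm (y m - y k))^2 = ip (y m) (y m) - 2 * ip (y k) (y m) + ip (y k) (y k)"
   using y(1) V.sym[OF y(1) y(1), of m k] by (simp add: V.nrm_sq V.ip_simps)
  thus ?thesis using e1 e3 fin by argo
 qed
 hence "decseq L" by (intro decseq_SucI) (smt (verit) le_SucI order_refl zero_le_power2)
 hence "Cauchy L"
  using decseq_convergent[of L 0] L0 LIMSEQ_imp_Cauchy by (metis)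
 have "EX N. ALL m>=N. ALL k>=N. V.nrm (y m - y k) < d" if d: "d > 0" for d
 proof -
  obtain N where N: "!!m k. m >= N ==> k >= N ==> \<bar>L m - L k\<bar> < d^2"
   using \<open>Cauchy L\<close> d unfolding Cauchy_def dist_real_def by (meson zero_less_power)
  have "V.nrm (y m - y k) < d" if "m >= N" "k >= N" for m k
  proof (rule power2_less_imp_less)
   have "(V.nrm (y m - y k))^2 <= \<bar>L m - L k\<bar>"
    using key[of k m] key[of m k] V.nrm_commute[OF y(1) y(1), of m k] by (cases "k <= m") auto
   thus "(V.nrm (y m - y k))^2 < d^2" using N[OF that] by linarith
  qed (use d in simp)
  thus ?thesis by blast
 qed
 then obtain z where z: "z \<in> V" "(%m. V.nrm (y m - z)) \<longlonglongrightarrow> 0"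
  using V.complete[of y] y(1) by blast
 have "H.nrm z = 0"
 proof -
  have Lle: "L m <= L 0" for m using key[of 0 m] zero_le_power2[of "V.nrm (y m - y 0)"] by linarith
  \<comment> \<open>\<open>L_eq\<close> bounds \<open>real m * (H.nrm (y m))^2\<close> by
    \<open>L 0\<close>, so the pivot norms decay like 1/sqrt(m). The limit \<open>z\<close> then has
    pivot norm zero, and \<open>inj\<close> applies.\<close>
  have hy: "(%m. H.nrm (y (Suc m))) \<longlonglongrightarrow> 0"
  proof (rule Lim_null_comparison)
   show "\<forall>\<^sub>F m in sequentially. norm (H.nrm (y (Suc m))) <= sqrt (L 0 / real (Suc m))"
   proof (rule eventuallyI)
    fix m
    have "real (Suc m) * (H.nrm (y (Suc m)))^2 <= L 0"
     using L_eq[of "Suc m"] Lle[of "Suc m"] zero_le_power2[of "V.nrm (y (Suc m))"] by linarith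
    hence "(H.nrm (y (Suc m)))^2 <= L 0 / real (Suc m)" by (simp add: field_simps)
    thus "norm (H.nrm (y (Suc m))) <= sqrt (L 0 / real (Suc m))"
     using real_le_rsqrt H.nonneg[of "y (Suc m)"] y(1) by auto
   qed
   have "(%m. sqrt (L 0 * (1 / real (Suc m)))) \<longlonglongrightarrow> sqrt (L 0 * 0)"
    by (intro tendsto_intros LIMSEQ_Suc lim_1_over_n)
   thus "(%m. sqrt (L 0 / real (Suc m))) \<longlonglongrightarrow> 0" by simp
  qed
  have "(%m. V.nrm (y (Suc m) - z) + H.nrm (y (Suc m))) \<longlonglongrightarrow> 0 + 0"
   by (intro tendsto_add LIMSEQ_Suc hy) (rule z(2))
  moreover have "H.nrm z <= V.nrm (y (Suc m) - z) + H.nrm (y (Suc m))" for m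
   using H.triangle_diff[of "y (Suc m)" "y (Suc m) - z"] nrm_le[of "y (Suc m) - z"] y(1) z(1) by simp
  ultimately have "H.nrm z <= 0" by (intro LIMSEQ_le_const) auto
  thus ?thesis using H.nonneg[of z] z(1) by simp
 qed
 hence "V.nrm z = 0" using inj z(1) by blast
 hence "(%m. V.nrm (y m)) \<longlonglongrightarrow> 0"
  using V.tendsto_nrm[OF y(1) z(1) z(2)] by simp
 hence "\<forall>\<^sub>F m in sequentially. V.nrm (y m) < e" using e by (intro order_tendstoD(2)) auto
 then obtain m where m: "V.nrm (y m) < e" by (auto simp: eventually_sequentially)
 have "V.dnorm (l - hp (real m *\<^sub>R y m)) <= e"
 proof (rule V.dnorm_least)
  fix v assume v: "v \<in> V"
  have "(l - hp (real m *\<^sub>R y m)) v = ip (y m) v" using y(2)[OF v, of m] y(1) v by (simp add: H.ip_simps)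
  hence "\<bar>(l - hp (real m *\<^sub>R y m)) v\<bar> <= V.nrm (y m) * V.nrm v"
   using V.Cauchy_Schwarz[OF y(1) v, of m] by simp
  also have "... <= e * V.nrm v" using m V.nonneg[OF v] by (intro mult_right_mono) auto
  finally show "\<bar>(l - hp (real m *\<^sub>R y m)) v\<bar> <= e * V.nrm v" .
 qed (use e in simp)
 thus ?thesis using that[of "real m *\<^sub>R y m"] y(1) by auto
qed

text \<open>Lipschitz functions with values in \<open>V\<close>, acting through the pivot, are the
  data for which the Rothe scheme has a rate; the definition singles out the right-hand sides that
  such data approximate in the L2 norm of dual-valued functions.\<close>

definition approx :: "real => (real => 'v => real) => bool" where
 "approx T b \<longleftrightarrow> (ALL e>0. EX g L. (ALL t:{0..T}. g t \<in> V) \<and>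
   (ALL t:{0..T}. ALL s:{0..T}. V.nrm (g t - g s) <= L * \<bar>t - s\<bar>) \<and>
   (LINT t|time T. (V.dnorm (b t - hp (g t)))^2) < e)"

lemma sq_int_hp:
 assumes "!!t. t \<in> {0..T} ==> g t \<in> V"
  "!!t s. t \<in> {0..T} ==> s \<in> {0..T} ==> V.nrm (g t - g s) <= L * \<bar>t - s\<bar>"
 shows "D.sq_int T (%t. hp (g t))"
proof (rule D.sq_int_Lipschitz)
 fix t s assume ts: "t \<in> {0..T}" "s \<in> {0..T}"
 have "V.dnorm (hp (g t) - hp (g s)) <= H.nrm (g t - g s)"
  using assms(1) ts by (intro dnorm_hp_diff) auto
 also have "... <= V.nrm (g t - g s)" using assms(1) ts by (intro nrm_le) auto
 also have "... <= L * \<bar>t - s\<bar>" using assms(2) ts by blast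
 finally show "V.dnorm (hp (g t) - hp (g s)) <= L * \<bar>t - s\<bar>" .
qed (use assms in auto)

text \<open>\<open>v\<close> enters through its dual norm only, since functionals such as
  \<open>hp (g t + k t)\<close> and \<open>hp (g t) + hp (k t)\<close> agree on \<open>V\<close> but
  need not agree on the whole type.\<close>

lemma sq_integral_add_le:
 assumes u: "D.sq_int T u" and w: "D.sq_int T w"
  and v: "AE t in time T. V.dnorm (v t) = V.dnorm (u t + w t)"
 shows "(LINT t|time T. (V.dnorm (v t))^2)
  <= 2 * (LINT t|time T. (V.dnorm (u t))^2) + 2 * (LINT t|time T. (V.dnorm (w t))^2)"
proof -
 have ui: "integrable (time T) (%t. (V.dnorm (u t))^2)" and wi: "integrable (time T) (%t. (V.dnorm (w t))^2)"
  using u w unfolding D.sq_int_def by auto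
 have "(LINT t|time T. (V.dnorm (v t))^2) <= (LINT t|time T. 2 * (V.dnorm (u t))^2 + 2 * (V.dnorm (w t))^2)"
 proof (rule integral_mono_AE')
  show "integrable (time T) (%t. 2 * (V.dnorm (u t))^2 + 2 * (V.dnorm (w t))^2)" using ui wi by simp
  show "AE t in time T. (V.dnorm (v t))^2 <= 2 * (V.dnorm (u t))^2 + 2 * (V.dnorm (w t))^2"
   using v D.sq_int_mem[OF u] D.sq_int_mem[OF w]
   by eventually_elim (simp add: D.sq_add_le)
 qed auto
 thus ?thesis using ui wi by simp
qed

lemma dnorm_cong: "(!!v. v \<in> V ==> l v = k v) ==> V.dnorm l = V.dnorm k"
 unfolding V.dnorm_def by (intro arg_cong[where f = Sup] image_cong) auto

lemma approx_add:
 assumes b: "D.sq_int T b" "approx T b" and b': "D.sq_int T b'" "approx T b'"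
 shows "approx T (%t. b t + b' t)"
 unfolding approx_def
proof (intro allI impI)
 fix e :: real assume e: "e > 0"
 hence e4: "e / 4 > 0" by simp
 obtain g L where g: "!!t. t \<in> {0..T} ==> g t \<in> V"
   "!!t s. t \<in> {0..T} ==> s \<in> {0..T} ==> V.nrm (g t - g s) <= L * \<bar>t - s\<bar>"
   "(LINT t|time T. (V.dnorm (b t - hp (g t)))^2) < e / 4"
  using b(2)[unfolded approx_def, rule_format, OF e4] by blast
 obtain g' L' where g': "!!t. t \<in> {0..T} ==> g' t \<in> V"
   "!!t s. t \<in> {0..T} ==> s \<in> {0..T} ==> V.nrm (g' t - g' s) <= L' * \<bar>t - s\<bar>"
   "(LINT t|time T. (V.dnorm (b' t - hp (g' t)))^2) < e / 4"
  using b'(2)[unfolded approx_def, rule_format, OF e4] by blast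
 have "(LINT t|time T. (V.dnorm (b t + b' t - hp (g t + g' t)))^2)
   <= 2 * (LINT t|time T. (V.dnorm (b t - hp (g t)))^2) + 2 * (LINT t|time T. (V.dnorm (b' t - hp (g' t)))^2)"
 proof (rule sq_integral_add_le)
  show "D.sq_int T (%t. b t - hp (g t))" "D.sq_int T (%t. b' t - hp (g' t))"
   by (rule D.sq_int_diff[OF b(1) sq_int_hp[OF g(1,2)]], assumption+,
     rule D.sq_int_diff[OF b'(1) sq_int_hp[OF g'(1,2)]])
  show "AE t in time T. V.dnorm (b t + b' t - hp (g t + g' t)) = V.dnorm (b t - hp (g t) + (b' t - hp (g' t)))"
   by (rule AE_I2, rule dnorm_cong) (use g(1) g'(1) in \<open>simp add: H.ip_simps\<close>)
 qed
 hence "(LINT t|time T. (V.dnorm (b t + b' t - hp (g t + g' t)))^2) < e" using g(3) g'(3) by linarith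
 moreover have "V.nrm (g t + g' t - (g s + g' s)) <= (L + L') * \<bar>t - s\<bar>" if "t \<in> {0..T}" "s \<in> {0..T}" for t s
 proof -
  have eq: "g t + g' t - (g s + g' s) = (g t - g s) + (g' t - g' s)" by simp
  have "V.nrm (g t + g' t - (g s + g' s)) <= V.nrm (g t - g s) + V.nrm (g' t - g' s)"
   unfolding eq by (rule V.triangle) (use g(1) g'(1) that in auto)
  thus ?thesis using g(2)[OF that] g'(2)[OF that] by (simp add: distrib_right)
 qed
 ultimately show "EX g L. (ALL t:{0..T}. g t \<in> V) \<and>
   (ALL t:{0..T}. ALL s:{0..T}. V.nrm (g t - g s) <= L * \<bar>t - s\<bar>) \<and>
   (LINT t|time T. (V.dnorm (b t + b' t - hp (g t)))^2) < e"
  using g(1) g'(1) by (intro exI[of _ "%t. g t + g' t"] exI[of _ "L + L'"]) auto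
qed

lemma sq_int_indicator:
 assumes "A \<in> sets (time T)" "l \<in> V.dual"
 shows "D.sq_int T (%t. indicator A t *\<^sub>R l)"
proof (rule D.sq_int_bound)
 show "strong_meas T V.dual V.dnorm (%t. indicator A t *\<^sub>R l)"
  using assms by (intro D.sm_scaleR D.sm_const) auto
 show "AE t in time T. (V.dnorm (indicator A t *\<^sub>R l))^2 <= (V.dnorm l)^2"
  using assms by (intro AE_I2) (auto simp: indicator_def)
qed auto

text \<open>With \<open>zeta\<close> near the indicator and \<open>h\<close> near \<open>l\<close>,
  the error splits as \<open>(indicator A t - zeta t) *\<^sub>R l + zeta t *\<^sub>R (l - hp
  h)\<close> on \<open>V\<close>.\<close>

lemma approx_indicator:
 assumes A: "A \<in> sets (time T)" and l: "l \<in> V.dual"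
 shows "approx T (%t. indicator A t *\<^sub>R l)"
 unfolding approx_def
proof (intro allI impI)
 fix e :: real assume e: "e > 0"
 interpret finite_measure "time T" by (rule finite_measure_time)
 \<comment> \<open>\<open>W\<close> and \<open>Q\<close> are enlarged by 1 so that one can divide by
   them. With \<open>r\<close> as below the two error integrals are at most \<open>e / 4\<close>,
   the first strictly, and each is doubled in \<open>split\<close>.\<close>
 define W where "W = measure (time T) {0<..<T} + 1"
 have W: "W > 0" by (simp add: W_def add_nonneg_pos)
 define Q where "Q = (V.dnorm l)^2 + 1"
 have Q: "Q > 0" by (simp add: Q_def add_nonneg_pos)
 define r where "r = sqrt (e / (4 * W))"
 have r: "r > 0" "r^2 = e / (4 * W)" using e W by (auto simp: r_def)
 obtain h where h: "h \<in> V" "V.dnorm (l - hp h) <= r" using pivot_dense[OF l r(1)] .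
 obtain zeta :: "real => real" and L where zeta: "!!t s. \<bar>zeta t - zeta s\<bar> <= L * \<bar>t - s\<bar>" "!!t. 0 <= zeta t \<and> zeta t <= 1"
  "(LINT t|time T. (indicator A t - zeta t)^2) < e / (4 * Q)"
  using Lipschitz_approx_indicator[OF A, of "e / (4 * Q)"] e Q by auto
 have zetam: "zeta \<in> borel_measurable (time T)"
 proof -
  interpret R: seminormed "UNIV :: real set" abs by standard (auto simp: subspace_UNIV abs_mult)
  show ?thesis by (rule strong_meas_real, rule R.sm_Lipschitz[where L = L]) (use zeta in auto)
 qed
 have lh: "l - hp h \<in> V.dual" using l h by auto
 have split: "(LINT t|time T. (V.dnorm (indicator A t *\<^sub>R l - hp (zeta t *\<^sub>R h)))^2)
   <= 2 * (LINT t|time T. (V.dnorm ((indicator A t - zeta t) *\<^sub>R l))^2) + 2 * (LINT t|time T. (V.dnorm (zeta t *\<^sub>R (l - hp h)))^2)"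
 proof (rule sq_integral_add_le)
  show "D.sq_int T (%t. (indicator A t - zeta t) *\<^sub>R l)"
  proof (rule D.sq_int_bound)
   show "strong_meas T V.dual V.dnorm (%t. (indicator A t - zeta t) *\<^sub>R l)"
    using A l zetam by (intro D.sm_scaleR D.sm_const) auto
   show "AE t in time T. (V.dnorm ((indicator A t - zeta t) *\<^sub>R l))^2 <= (V.dnorm l)^2"
   proof (rule AE_I2)
    fix t
    have "\<bar>indicator A t - zeta t\<bar> <= 1" using zeta(2)[of t] by (auto simp: indicator_def)
    hence "\<bar>indicator A t - zeta t\<bar> * V.dnorm l <= 1 * V.dnorm l"
     using V.dnorm_nonneg[OF l] by (intro mult_right_mono) auto
    thus "(V.dnorm ((indicator A t - zeta t) *\<^sub>R l))^2 <= (V.dnorm l)^2"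
     using l V.dnorm_nonneg[OF l] by (intro power_mono) (auto simp: D.scale)
   qed
  qed auto
  show "D.sq_int T (%t. zeta t *\<^sub>R (l - hp h))"
  proof (rule D.sq_int_bound)
   show "strong_meas T V.dual V.dnorm (%t. zeta t *\<^sub>R (l - hp h))"
    using lh zetam by (intro D.sm_scaleR D.sm_const) auto
   show "AE t in time T. (V.dnorm (zeta t *\<^sub>R (l - hp h)))^2 <= (V.dnorm (l - hp h))^2"
   proof (rule AE_I2)
    fix t
    have "\<bar>zeta t\<bar> * V.dnorm (l - hp h) <= 1 * V.dnorm (l - hp h)"
     using V.dnorm_nonneg[OF lh] zeta(2)[of t] by (intro mult_right_mono) auto
    thus "(V.dnorm (zeta t *\<^sub>R (l - hp h)))^2 <= (V.dnorm (l - hp h))^2"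
     using lh V.dnorm_nonneg[OF lh] by (intro power_mono) (auto simp: D.scale)
   qed
  qed auto
  show "AE t in time T. V.dnorm (indicator A t *\<^sub>R l - hp (zeta t *\<^sub>R h))
    = V.dnorm ((indicator A t - zeta t) *\<^sub>R l + zeta t *\<^sub>R (l - hp h))"
   by (rule AE_I2, rule dnorm_cong) (use h in \<open>simp add: H.ip_simps algebra_simps\<close>)
 qed
 have "(LINT t|time T. (V.dnorm ((indicator A t - zeta t) *\<^sub>R l))^2) = (LINT t|time T. (V.dnorm l)^2 * (indicator A t - zeta t)^2)"
  using l by (simp add: D.scale power_mult_distrib mult.commute)
 also have "... <= Q * (LINT t|time T. (indicator A t - zeta t)^2)"
  by (simp add: Q_def mult_right_mono)
 finally have i1: "(LINT t|time T. (V.dnorm ((indicator A t - zeta t) *\<^sub>R l))^2) <= Q * (LINT t|time T. (indicator A t - zeta t)^2)" .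
 have "(LINT t|time T. (V.dnorm (zeta t *\<^sub>R (l - hp h)))^2) <= (LINT t|time T. r^2)"
 proof (rule integral_mono')
  fix t
  have "\<bar>zeta t\<bar> * V.dnorm (l - hp h) <= 1 * r"
   using zeta(2)[of t] h(2) V.dnorm_nonneg[OF lh] by (intro mult_mono) auto
  thus "(V.dnorm (zeta t *\<^sub>R (l - hp h)))^2 <= r^2"
   using lh V.dnorm_nonneg[OF lh] by (intro power_mono) (auto simp: D.scale)
 qed auto
 also have "(LINT t|time T. r^2) <= r^2 * W" by (simp add: W_def measure_def algebra_simps)
 finally have i2: "(LINT t|time T. (V.dnorm (zeta t *\<^sub>R (l - hp h)))^2) <= r^2 * W" .
 moreover have "Q * (LINT t|time T. (indicator A t - zeta t)^2) < e / 4"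
  using zeta(3) Q by (simp add: field_simps)
 moreover have "r^2 * W = e / 4" using r W by simp
 ultimately have "(LINT t|time T. (V.dnorm (indicator A t *\<^sub>R l - hp (zeta t *\<^sub>R h)))^2) < e"
  using split i1 by linarith
 moreover have "V.nrm (zeta t *\<^sub>R h - zeta s *\<^sub>R h) <= (L * V.nrm h) * \<bar>t - s\<bar>" for t s
  using zeta(1)[of t s] V.scale[OF h(1), of "zeta t - zeta s"] V.nonneg[OF h(1)] mult_right_mono[of "\<bar>zeta t - zeta s\<bar>" _ "V.nrm h"]
  by (simp add: algebra_simps) (metis mult.commute mult.left_commute)
 ultimately show "EX g L. (ALL t:{0..T}. g t \<in> V) \<and>
   (ALL t:{0..T}. ALL s:{0..T}. V.nrm (g t - g s) <= L * \<bar>t - s\<bar>) \<and>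
   (LINT t|time T. (V.dnorm (indicator A t *\<^sub>R l - hp (g t)))^2) < e"
  using h(1) by (intro exI[of _ "%t. zeta t *\<^sub>R h"] exI[of _ "L * V.nrm h"]) auto
qed

lemma approx_sum:
 assumes "finite I" "!!i. i \<in> I ==> A i \<in> sets (time T)" "!!i. i \<in> I ==> l i \<in> V.dual"
 shows "approx T (%t. \<Sum>i\<in>I. indicator (A i) t *\<^sub>R l i)"
 using assms
proof (induction I rule: finite_induct)
 case empty
 have "approx T (%t. indicator {} t *\<^sub>R 0)" by (rule approx_indicator) auto
 thus ?case by (simp only: sum.empty scaleR_zero_right)
next
 case (insert i I)
 have "approx T (%t. indicator (A i) t *\<^sub>R l i + (\<Sum>i\<in>I. indicator (A i) t *\<^sub>R l i))"
  using insert by (intro approx_add D.sq_int_sum sq_int_indicator approx_indicator insert.IH) auto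
 moreover have "(%t. \<Sum>i\<in>insert i I. indicator (A i) t *\<^sub>R l i)
   = (%t. indicator (A i) t *\<^sub>R l i + (\<Sum>i\<in>I. indicator (A i) t *\<^sub>R l i))"
  by (rule ext, rule sum.insert[OF insert(1,2)])
 ultimately show ?case by metis
qed

text \<open>A simple function is a finite sum of indicators times its values. \<open>s'\<close> is
  this sum over the values taken inside the interval; it agrees with \<open>s\<close> there, which
  is all that integrals over the interval see.\<close>

theorem sq_int_approx:
 assumes b: "D.sq_int T b"
 shows "approx T b"
 unfolding approx_def
proof (intro allI impI)
 fix e :: real assume e: "e > 0"
 hence e4: "e / 4 > 0" by simp
 obtain s where s: "simple_function (time T) s" "!!t. t \<in> {0<..<T} ==> s t \<in> V.dual"
  "(LINT t|time T. (V.dnorm (b t - s t))^2) < e / 4"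
  using D.simple_approx[OF b, of "e / 4"] e by auto
 define R where "R = s ` {0<..<T}"
 have R: "finite R" using simple_functionD(1)[OF s(1)] by (simp add: R_def)
 define A where "A l = s -` {l} \<inter> {0<..<T}" for l
 have A: "A l \<in> sets (time T)" for l using simple_functionD(2)[OF s(1), of "{l}"] by (simp add: A_def)
 have RD: "l \<in> V.dual" if "l \<in> R" for l using that s(2) by (auto simp: R_def)
 define s' where "s' t = (\<Sum>l\<in>R. indicator (A l) t *\<^sub>R l)" for t
 have ss: "s' t = s t" if "t \<in> {0<..<T}" for t
 proof -
  have "s' t = (\<Sum>l\<in>R. if l = s t then l else 0)"
   unfolding s'_def by (rule sum.cong) (use that in \<open>auto simp: A_def indicator_def\<close>)
  also have "... = s t" using R that by (simp add: R_def)
  finally show ?thesis .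
 qed
 have s'i: "D.sq_int T s'" unfolding s'_def
  by (intro D.sq_int_sum sq_int_indicator A RD)
 have ap: "approx T s'" unfolding s'_def by (intro approx_sum R A RD)
 obtain g L where g: "!!t. t \<in> {0..T} ==> g t \<in> V"
   "!!t r. t \<in> {0..T} ==> r \<in> {0..T} ==> V.nrm (g t - g r) <= L * \<bar>t - r\<bar>"
   "(LINT t|time T. (V.dnorm (s' t - hp (g t)))^2) < e / 4"
  using ap[unfolded approx_def, rule_format, OF e4] by blast
 have "(LINT t|time T. (V.dnorm (b t - hp (g t)))^2)
   <= 2 * (LINT t|time T. (V.dnorm (b t - s' t))^2) + 2 * (LINT t|time T. (V.dnorm (s' t - hp (g t)))^2)"
  by (rule sq_integral_add_le[OF D.sq_int_diff[OF b s'i] D.sq_int_diff[OF s'i sq_int_hp[OF g(1,2)]]])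
   auto
 also have "(LINT t|time T. (V.dnorm (b t - s' t))^2) = (LINT t|time T. (V.dnorm (b t - s t))^2)"
  by (rule Bochner_Integration.integral_cong) (auto simp: ss)
 finally have "(LINT t|time T. (V.dnorm (b t - hp (g t)))^2) < e" using s(3) g(3) by linarith
 thus "EX g L. (ALL t:{0..T}. g t \<in> V) \<and>
   (ALL t:{0..T}. ALL s:{0..T}. V.nrm (g t - g s) <= L * \<bar>t - s\<bar>) \<and>
   (LINT t|time T. (V.dnorm (b t - hp (g t)))^2) < e"
  using g by (intro exI[of _ g] exI[of _ L]) auto
qed

end

subsection \<open>Integration over time intervals\<close>

lemma time_has_integral:
 fixes f :: "real => real"
 assumes "integrable (time T) f"
 shows "(f has_integral (LINT t|time T. f t)) {0..T}"
 using has_integral_integral_lebesgue_on[OF assms] by (simp add: has_integral_Icc_iff_Ioo)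

lemma time_restrict:
 fixes f :: "real => real"
 assumes "tau <= T"
 shows "integrable (time tau) f \<longleftrightarrow> integrable (time T) (%t. indicator {0<..<tau} t * f t)"
  "(LINT t|time tau. f t) = (LINT t|time T. indicator {0<..<tau} t * f t)"
proof -
 have "(%t. indicator {0<..<T} t *\<^sub>R (indicator {0<..<tau} t * f t)) = (%t. indicator {0<..<tau} t *\<^sub>R f t)"
  using assms by (auto simp: indicator_def fun_eq_iff)
 thus "integrable (time tau) f \<longleftrightarrow> integrable (time T) (%t. indicator {0<..<tau} t * f t)"
  "(LINT t|time tau. f t) = (LINT t|time T. indicator {0<..<tau} t * f t)"
  by (simp_all add: integrable_restrict_space integral_restrict_space)
qed

lemma time_integrable_subset:
 fixes f :: "real => real"
 assumes "integrable (time T) f" "tau <= T"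
 shows "integrable (time tau) f"
proof -
 have "integrable (time T) (%t. indicator ({0<..<tau} \<inter> space (time T)) t *\<^sub>R f t)"
  by (rule integrable_mult_indicator[OF _ assms(1)]) (use assms(2) in \<open>auto simp: sets_restrict_space_iff\<close>)
 moreover have "integrable (time T) (%t. indicator ({0<..<tau} \<inter> space (time T)) t *\<^sub>R f t)
   = integrable (time T) (%t. indicator {0<..<tau} t * f t)"
  by (rule Bochner_Integration.integrable_cong) (auto simp: indicator_def)
 ultimately show ?thesis using time_restrict(1)[OF assms(2)] by simp
qed

lemma time_integral_mono_set:
 fixes f :: "real => real"
 assumes "integrable (time T) f" "tau <= T" "!!t. t \<in> {0<..<T} ==> 0 <= f t"
 shows "(LINT t|time tau. f t) <= (LINT t|time T. f t)"
 unfolding time_restrict(2)[OF assms(2), of f]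
proof (rule integral_mono)
 show "integrable (time T) (%t. indicator {0<..<tau} t * f t)"
  using time_integrable_subset[OF assms(1,2)] time_restrict(1)[OF assms(2)] by simp
qed (use assms in \<open>auto simp: indicator_def\<close>)

text \<open>The gauge integral handles the derivative \<open>f'\<close> itself, so only the majorant
  is asked to be Lebesgue integrable. This lets differential inequalities be integrated directly,
  across finitely many kinks.\<close>

lemma time_FTC_le:
 fixes f f' g :: "real => real"
 assumes F: "finite F" and tau: "0 <= tau" and cont: "continuous_on {0..tau} f"
  and deriv: "!!x. x \<in> {0<..<tau} - F ==> (f has_real_derivative f' x) (at x)"
  and le: "!!x. x \<in> {0<..<tau} - F ==> f' x <= g x"
  and g: "integrable (time tau) g"
 shows "f tau - f 0 <= (LINT t|time tau. g t)"
proof -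
 have "(f' has_integral (f tau - f 0)) {0..tau}"
  by (rule fundamental_theorem_of_calculus_interior_strong[OF F tau _ cont])
    (use deriv in \<open>simp add: has_real_derivative_iff_has_vector_derivative\<close>)
 \<comment> \<open>The order \<open>f' x <= g x\<close> is known only off the exceptional points;
   overwriting \<open>f'\<close> by \<open>g\<close> on this finite set leaves the integral
   unchanged.\<close>
 hence "((%x. if x \<in> F \<union> {0, tau} then g x else f' x) has_integral (f tau - f 0)) {0..tau}"
  by (rule has_integral_spike_finite[of "F \<union> {0, tau}", rotated 2]) (use F in auto)
 thus ?thesis
  by (rule has_integral_le[OF _ time_has_integral[OF g]]) (use le in auto)
qed

lemma time_FTC:
 fixes f f' :: "real => real"
 assumes F: "finite F" and tau: "0 <= tau" and cont: "continuous_on {0..tau} f"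
  and deriv: "!!x. x \<in> {0<..<tau} - F ==> (f has_real_derivative f' x) (at x)"
  and int: "integrable (time tau) f'"
 shows "(LINT t|time tau. f' t) = f tau - f 0"
proof (rule antisym)
 show "f tau - f 0 <= (LINT t|time tau. f' t)"
  by (rule time_FTC_le[OF F tau cont deriv _ int]) auto
 have "- f tau - - f 0 <= (LINT t|time tau. - f' t)"
  by (rule time_FTC_le[OF F tau, of "%x. - f x" "%x. - f' x"])
    (use cont deriv int in \<open>auto intro!: continuous_intros derivative_eq_intros\<close>)
 thus "(LINT t|time tau. f' t) <= f tau - f 0" by simp
qed

subsection \<open>Piecewise linear functions of time\<close>

text \<open>This is the primitive of \<open>window h i\<close>, the indicator of the i-th time step,
  open on the left and closed on the right. So \<open>polygon\<close> is the continuous interpolant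
  that starts at 0 and has slope \<open>d i\<close> on the i-th step.\<close>

definition ramp :: "real => nat => real => real" where
 "ramp h i t = min h (max 0 (t - real i * h))"

definition window :: "real => nat => real => real" where
 "window h i t = (if real i * h < t \<and> t <= real (Suc i) * h then 1 else 0)"

definition polygon :: "real => nat => (nat => 'v::real_vector) => real => 'v" where
 "polygon h N d t = (\<Sum>i<N. ramp h i t *\<^sub>R d i)"

definition slope :: "real => nat => (nat => 'v::real_vector) => real => 'v" where
 "slope h N d t = (\<Sum>i<N. window h i t *\<^sub>R d i)"

lemma ramp_nonpos: "h > 0 ==> t <= 0 ==> ramp h i t = 0"
proof -
 assume h: "h > 0" "t <= 0"
 have "0 <= real i * h" using h by simp
 hence "t - real i * h <= 0" using h by linarith
 thus ?thesis using h by (simp add: ramp_def)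
qed

lemma ramp_Lipschitz: "\<bar>ramp h i t - ramp h i s\<bar> <= \<bar>t - s\<bar>"
 by (simp add: ramp_def min_def max_def)

lemma ramp_locally_linear:
 assumes h: "h > 0" and t: "t \<noteq> real i * h" "t \<noteq> real (Suc i) * h"
 shows "\<forall>\<^sub>F s in at t. ramp h i s = ramp h i t + (s - t) * window h i t"
proof -
 have e: "real (Suc i) * h = real i * h + h" by (simp add: algebra_simps)
 consider "t < real i * h" | "real i * h < t" "t < real i * h + h" | "t > real i * h + h"
  using t e by linarith
 thus ?thesis
 proof cases
  case 1
  hence "\<forall>\<^sub>F s in at t. s \<in> {..<real i * h}" by (intro eventually_at_in_open') auto
  thus ?thesis by eventually_elim (use 1 h in \<open>simp add: ramp_def window_def\<close>)
 next
  case 2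
  hence "\<forall>\<^sub>F s in at t. s \<in> {real i * h<..<real i * h + h}" by (intro eventually_at_in_open') auto
  thus ?thesis by eventually_elim (use 2 h e in \<open>simp add: ramp_def window_def\<close>)
 next
  case 3
  hence "\<forall>\<^sub>F s in at t. s \<in> {real i * h + h<..}" by (intro eventually_at_in_open') auto
  thus ?thesis by eventually_elim (use 3 h e in \<open>simp add: ramp_def window_def\<close>)
 qed
qed

lemma locate:
 assumes h: "h > 0" and t: "0 < t" "t <= real N * h"
 obtains i where "i < N" "real i * h < t" "t <= real (Suc i) * h"
 using t(2)
proof (induction N arbitrary: thesis)
 case 0
 thus ?case using t by simp
next
 case (Suc N)
 show ?case
 proof (cases "t <= real N * h")
  case True
  then obtain i where "i < N" "real i * h < t" "t <= real (Suc i) * h" using Suc.IH by blast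
  thus ?thesis using Suc.prems(1)[of i] by simp
 next
  case False
  thus ?thesis using Suc.prems by (intro Suc.prems(1)[of N]) auto
 qed
qed

lemma window_at:
 assumes h: "h > 0" and i: "real i * h < t" "t <= real (Suc i) * h"
 shows "window h j t = (if j = i then 1 else 0)"
proof (cases j i rule: linorder_cases)
 case less
 hence "real (Suc j) * h <= real i * h" using h by (intro mult_right_mono) auto
 thus ?thesis using i less by (simp add: window_def)
next
 case greater
 hence "real (Suc i) * h <= real j * h" using h by (intro mult_right_mono) auto
 thus ?thesis using i greater by (simp add: window_def)
qed (use i in \<open>simp add: window_def\<close>)

lemma slope_at:
 assumes "h > 0" "i < N" "real i * h < t" "t <= real (Suc i) * h"
 shows "slope h N d t = d i"
proof -
 have "slope h N d t = (\<Sum>j<N. if j = i then d i else 0)"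
  unfolding slope_def by (rule sum.cong) (use window_at[OF assms(1,3,4)] in auto)
 thus ?thesis using assms(2) by simp
qed

text \<open>The value is measured back from the right node, because the implicit scheme holds there
  and the distance to that node governs the interpolation error.\<close>

lemma polygon_at:
 assumes h: "h > 0" and i: "i < N" "real i * h < t" "t <= real (Suc i) * h"
 shows "polygon h N d t = (\<Sum>j<Suc i. h *\<^sub>R d j) - (real (Suc i) * h - t) *\<^sub>R d i"
proof -
 have e: "real (Suc i) * h = real i * h + h" by (simp add: algebra_simps)
 have 0: "ramp h j t = 0" if "j > i" for j
 proof -
  have "real (Suc i) * h <= real j * h" using h that by (intro mult_right_mono) auto
  hence "t - real j * h <= 0" using i by linarith
  thus ?thesis using h by (simp add: ramp_def)
 qed
 have 1: "ramp h j t = h" if "j < i" for j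
 proof -
  have "real (Suc j) * h <= real i * h" using h that by (intro mult_right_mono) auto
  hence "t - real j * h >= h" using i h by (simp add: algebra_simps)
  thus ?thesis using h by (simp add: ramp_def)
 qed
 have 2: "ramp h i t = t - real i * h" using i e by (simp add: ramp_def)
 have "polygon h N d t = (\<Sum>j<Suc i. ramp h j t *\<^sub>R d j)"
  unfolding polygon_def by (rule sum.mono_neutral_right) (use i 0 in auto)
 also have "... = (\<Sum>j<i. h *\<^sub>R d j) + (t - real i * h) *\<^sub>R d i"
  using 1 2 by simp
 also have "... = (\<Sum>j<Suc i. h *\<^sub>R d j) - (real (Suc i) * h - t) *\<^sub>R d i"
  unfolding e by (simp add: algebra_simps)
 finally show ?thesis .
qed

lemma window_measurable: "window h i \<in> borel_measurable borel"
 unfolding window_def by measurable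

lemma window_time_measurable [measurable]: "window h i \<in> borel_measurable (time T)"
 by (intro measurable_restrict_space1 measurable_completion) (use window_measurable in simp)

lemma integrable_window: "integrable (time T) (window h i)"
proof (rule finite_measure.integrable_const_bound[OF finite_measure_time _ window_time_measurable])
 show "AE t in time T. norm (window h i t) <= 1" by (rule AE_I2) (simp add: window_def)
qed

lemma integral_window_le:
 assumes h: "h > 0"
 shows "(LINT t|time T. window h i t) <= h"
proof -
 have i: "integrable (time T) (%t. indicator {real i * h..real i * h + h} t :: real)"
  by (rule finite_measure.integrable_const_bound[OF finite_measure_time, of _ 1])
   (auto simp: indicator_def intro!: AE_I2 measurable_restrict_space1 measurable_completion)
 have "(LINT t|time T. window h i t) <= (LINT t|time T. indicator {real i * h..real i * h + h} t)"
  by (rule integral_mono'[OF i]) (auto simp: window_def indicator_def algebra_simps)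
 also have "... = measure (time T) ({real i * h..real i * h + h} \<inter> {0<..<T})" by simp
 also have "... = measure lebesgue ({real i * h..real i * h + h} \<inter> {0<..<T})" by (rule measure_restrict_space) auto
 also have "... <= measure lebesgue {real i * h..real i * h + h}" by (rule measure_mono_fmeasurable) auto
 finally show ?thesis using h by simp
qed

context semi_inner
begin

text \<open>Affinity near every point off \<open>F\<close> is stated literally rather than through
  derivatives; then \<open>hp (U s) v\<close> and \<open>hp (U s) (U s)\<close> are polynomials in
  \<open>s\<close> there and are differentiated by hand. \<open>U\<close> and \<open>D\<close> are
  total so that two-sided neighbourhoods make sense.\<close>

definition piecewise :: "real => real set => (real => 'v) => (real => 'v) => bool" where
 "piecewise T F U D \<longleftrightarrow> finite F \<and> (ALL t. U t \<in> X) \<and> (ALL t. D t \<in> X) \<and> U 0 = 0 \<and>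
   (EX L. ALL t s. nrm (U t - U s) <= L * \<bar>t - s\<bar>) \<and>
   (ALL t. t \<notin> F --> (\<forall>\<^sub>F s in at t. U s = U t + (s - t) *\<^sub>R D t)) \<and> sq_int T D"

lemma piecewise_polygon:
 assumes h: "h > 0" and d: "!!i. d i \<in> X"
 shows "piecewise T ((%i. real i * h) ` {..N}) (polygon h N d) (slope h N d)"
 unfolding piecewise_def
proof (intro conjI allI impI)
 show "polygon h N d t \<in> X" "slope h N d t \<in> X" for t
  unfolding polygon_def slope_def using d by (auto intro!: mem_sum)
 show "polygon h N d 0 = 0" unfolding polygon_def using ramp_nonpos[OF h] by simp
 show "EX L. ALL t s. nrm (polygon h N d t - polygon h N d s) <= L * \<bar>t - s\<bar>"
 proof (intro exI allI)
  fix t s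
  have "polygon h N d t - polygon h N d s = (\<Sum>i<N. (ramp h i t - ramp h i s) *\<^sub>R d i)"
   by (simp add: polygon_def sum_subtractf scaleR_left_diff_distrib)
  also have "nrm ... <= (\<Sum>i<N. nrm ((ramp h i t - ramp h i s) *\<^sub>R d i))"
   using d by (intro nrm_sum) auto
  also have "... <= (\<Sum>i<N. \<bar>t - s\<bar> * nrm (d i))"
   using d nonneg ramp_Lipschitz by (intro sum_mono) (simp add: scale mult_right_mono)
  finally show "nrm (polygon h N d t - polygon h N d s) <= (\<Sum>i<N. nrm (d i)) * \<bar>t - s\<bar>"
   by (simp add: sum_distrib_left mult.commute)
 qed
 show "\<forall>\<^sub>F s in at t. polygon h N d s = polygon h N d t + (s - t) *\<^sub>R slope h N d t"
  if t: "t \<notin> (%i. real i * h) ` {..N}" for t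
 proof -
  have "\<forall>\<^sub>F s in at t. ALL i:{..<N}. ramp h i s = ramp h i t + (s - t) * window h i t"
  proof (rule eventually_ball_finite)
   show "ALL i:{..<N}. \<forall>\<^sub>F s in at t. ramp h i s = ramp h i t + (s - t) * window h i t"
   proof
    fix i assume "i \<in> {..<N}"
    hence "i \<in> {..N}" "Suc i \<in> {..N}" by auto
    hence "t \<noteq> real i * h" "t \<noteq> real (Suc i) * h" using t by blast+
    thus "\<forall>\<^sub>F s in at t. ramp h i s = ramp h i t + (s - t) * window h i t"
     by (rule ramp_locally_linear[OF h])
   qed
  qed simp
  thus ?thesis
  proof eventually_elim
   case (elim s)
   have "polygon h N d s = (\<Sum>i<N. ramp h i t *\<^sub>R d i + (s - t) *\<^sub>R (window h i t *\<^sub>R d i))"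
    unfolding polygon_def by (rule sum.cong) (use elim in \<open>auto simp: scaleR_left_distrib\<close>)
   thus ?case by (simp add: polygon_def slope_def sum.distrib scaleR_sum_right)
  qed
 qed
 show "sq_int T (slope h N d)"
  unfolding slope_def
 proof (rule sq_int_sum)
  fix i
  show "sq_int T (%t. window h i t *\<^sub>R d i)"
  proof (rule sq_int_bound)
   show "AE t in time T. (nrm (window h i t *\<^sub>R d i))^2 <= (nrm (d i))^2"
    by (rule AE_I2) (simp add: window_def)
  qed (auto intro!: sm_scaleR sm_const d)
 qed
qed auto

lemma piecewise_diff:
 assumes "piecewise T F U D" "piecewise T F' U' D'"
 shows "piecewise T (F \<union> F') (%t. U t - U' t) (%t. D t - D' t)"
 unfolding piecewise_def
proof (intro conjI allI impI)
 obtain L where L: "!!t s. nrm (U t - U s) <= L * \<bar>t - s\<bar>" using assms(1) unfolding piecewise_def by blast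
 obtain L' where L': "!!t s. nrm (U' t - U' s) <= L' * \<bar>t - s\<bar>" using assms(2) unfolding piecewise_def by blast
 have mem: "U t \<in> X" "U' t \<in> X" "D t \<in> X" "D' t \<in> X" for t using assms unfolding piecewise_def by auto
 show "EX L. ALL t s. nrm (U t - U' t - (U s - U' s)) <= L * \<bar>t - s\<bar>"
 proof (intro exI allI)
  fix t s
  have eq: "U t - U' t - (U s - U' s) = (U t - U s) - (U' t - U' s)" by simp
  have "nrm (U t - U' t - (U s - U' s)) <= nrm (U t - U s) + nrm (U' t - U' s)"
   unfolding eq by (rule triangle_diff) (use mem in auto)
  thus "nrm (U t - U' t - (U s - U' s)) <= (L + L') * \<bar>t - s\<bar>"
   using L[of t s] L'[of t s] by (simp add: distrib_right)
 qed
 fix t assume t: "t \<notin> F \<union> F'"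
 have "\<forall>\<^sub>F s in at t. U s = U t + (s - t) *\<^sub>R D t" "\<forall>\<^sub>F s in at t. U' s = U' t + (s - t) *\<^sub>R D' t"
  using assms t unfolding piecewise_def by auto
 thus "\<forall>\<^sub>F s in at t. U s - U' s = U t - U' t + (s - t) *\<^sub>R (D t - D' t)"
  by eventually_elim (simp add: algebra_simps)
qed (use assms in \<open>auto simp: piecewise_def intro: sq_int_diff\<close>)

lemma piecewise_sq_integrable:
 assumes "piecewise T F U D" shows "sq_int T U"
proof -
 obtain L where L: "!!t s. nrm (U t - U s) <= L * \<bar>t - s\<bar>" using assms unfolding piecewise_def by blast
 show ?thesis by (rule sq_int_Lipschitz[of _ _ L]) (use assms L in \<open>auto simp: piecewise_def\<close>)
qed

end

subsection \<open>The implicit Euler scheme\<close>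

locale garding = gelfand V H ip hp for V H :: "'v::real_vector set" and ip hp :: "'v => 'v => real" +
 fixes a :: "'v => 'v => real" and Ca c0 K :: real
 assumes a_add_left: "u \<in> V ==> w \<in> V ==> v \<in> V ==> a (u + w) v = a u v + a w v"
  and a_scale_left: "u \<in> V ==> v \<in> V ==> a (c *\<^sub>R u) v = c * a u v"
  and a_add_right: "u \<in> V ==> w \<in> V ==> v \<in> V ==> a v (u + w) = a v u + a v w"
  and a_scale_right: "u \<in> V ==> v \<in> V ==> a v (c *\<^sub>R u) = c * a v u"
  and a_bound: "u \<in> V ==> v \<in> V ==> \<bar>a u v\<bar> <= Ca * V.nrm u * V.nrm v"
  and Ca: "0 <= Ca" and c0: "0 < c0" and K: "0 <= K"
  and garding: "u \<in> V ==> c0 * (V.nrm u)^2 - K * (H.nrm u)^2 <= a u u"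
begin

lemma a_diff_left: "u \<in> V ==> w \<in> V ==> v \<in> V ==> a (u - w) v = a u v - a w v"
 using a_add_left[of "u - w" w v] by simp

lemma a_dual [simp, intro]: "u \<in> V ==> a u \<in> V.dual"
 by (rule V.dualI[of _ "Ca * V.nrm u"]) (auto simp: a_add_right a_scale_right a_bound)

lemma a_dnorm: "u \<in> V ==> V.dnorm (a u) <= Ca * V.nrm u"
 by (rule V.dnorm_least) (auto simp: a_bound Ca V.nonneg)

lemma a_dnorm_diff:
 assumes "u \<in> V" "w \<in> V"
 shows "V.dnorm (a u - a w) <= Ca * V.nrm (u - w)"
proof (rule V.dnorm_least)
 fix v assume "v \<in> V"
 thus "\<bar>(a u - a w) v\<bar> <= Ca * V.nrm (u - w) * V.nrm v"
  using a_bound[of "u - w" v] assms by (simp add: a_diff_left)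
qed (use assms V.nonneg Ca in auto)

text \<open>\<open>h * K <= 1\<close> lets \<open>hp u u\<close> absorb the negative Garding term,
  so the form \<open>hp u v + h * a u v\<close> is coercive with constant
  \<open>h * c0\<close>.\<close>

lemma resolvent:
 assumes h: "h > 0" "h * K <= 1" and p: "p \<in> H"
 obtains d where "d \<in> V" "!!v. v \<in> V ==> hp d v + h * a d v = hp p v"
proof (rule V.lax_milgram[of "%u v. hp u v + h * a u v" "1 + h * Ca" "h * c0" "hp p"])
 have bd: "\<bar>hp u v + h * a u v\<bar> <= (1 + h * Ca) * V.nrm u * V.nrm v" if "u \<in> V" "v \<in> V" for u v
 proof -
  have "\<bar>hp u v\<bar> <= V.nrm u * V.nrm v"
   using hp_bound[of u v] mult_right_mono[OF nrm_le, of u "V.nrm v"] that V.nonneg by force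
  moreover have "h * \<bar>a u v\<bar> <= h * (Ca * V.nrm u * V.nrm v)"
   using a_bound[OF that] h by (intro mult_left_mono) auto
  moreover have "\<bar>h * a u v\<bar> = h * \<bar>a u v\<bar>" using h by (simp add: abs_mult)
  moreover have "(1 + h * Ca) * V.nrm u * V.nrm v = V.nrm u * V.nrm v + h * (Ca * V.nrm u * V.nrm v)"
   by (simp add: algebra_simps)
  ultimately show ?thesis using abs_triangle_ineq[of "hp u v" "h * a u v"] by linarith
 qed
 thus "\<bar>hp u v + h * a u v\<bar> <= (1 + h * Ca) * V.nrm u * V.nrm v" if "u \<in> V" "v \<in> V" for u v
  using that .
 show "(%v. hp u v + h * a u v) \<in> V.dual" if "u \<in> V" for u
  using that bd[OF that] by (intro V.dualI[of _ "(1 + h * Ca) * V.nrm u"])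
   (auto simp: H.ip_simps a_add_right a_scale_right algebra_simps)
 show "h * c0 * (V.nrm u)^2 <= hp u u + h * a u u" if u: "u \<in> V" for u
 proof -
  have "h * (c0 * (V.nrm u)^2 - K * (H.nrm u)^2) <= h * a u u" using garding[OF u] h by (intro mult_left_mono) auto
  moreover have "(h * K) * (H.nrm u)^2 <= 1 * (H.nrm u)^2" using h by (intro mult_right_mono) auto
  moreover have "(H.nrm u)^2 = hp u u" using u by (simp add: H.nrm_sq)
  ultimately show ?thesis by (simp add: algebra_simps)
 qed
 show "0 < h * c0" using h c0 by simp
 show "hp p \<in> V.dual" using p by simp
qed (use that in \<open>auto simp: H.ip_simps a_add_left a_scale_left algebra_simps\<close>)

text \<open>The scheme is run on the difference quotients \<open>delta i = (u i - u (i - 1)) / h\<close>, which solve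
 the implicit Euler scheme for the differentiated equation. This bounds them in \<open>L^2(0,T;V)\<close>, so that
 interpolating the \<open>u i\<close> costs only \<open>O(h)\<close>.\<close>

lemma euler_step:
 assumes h: "h > 0" "h * K <= 1" and G: "!!i. G i \<in> V"
 obtains delta where "delta 0 = G 0" "!!i. delta i \<in> V"
  "!!i v. v \<in> V ==> hp (delta (Suc i)) v + h * a (delta (Suc i)) v = hp (delta i + (G (Suc i) - G i)) v"
proof -
 define res where "res p = (SOME d. d \<in> V \<and> (ALL v:V. hp d v + h * a d v = hp p v))" for p
 have res: "res p \<in> V \<and> (ALL v:V. hp (res p) v + h * a (res p) v = hp p v)" if p: "p \<in> H" for p
 proof -
  obtain d where "d \<in> V" "!!v. v \<in> V ==> hp d v + h * a d v = hp p v" by (rule resolvent[OF h p]) (rule that, assumption+)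
  hence "EX d. d \<in> V \<and> (ALL v:V. hp d v + h * a d v = hp p v)" by (intro exI[of _ d] conjI ballI)
  thus ?thesis unfolding res_def by (rule someI_ex)
 qed
 define delta where "delta = rec_nat (G 0) (%i d. res (d + (G (Suc i) - G i)))"
 have delta0: "delta 0 = G 0" and deltaS: "delta (Suc i) = res (delta i + (G (Suc i) - G i))" for i by (auto simp: delta_def)
 have deltaV: "delta i \<in> V" for i
  by (induction i) (use delta0 deltaS G res in auto)
 show thesis
 proof (rule that[of delta, OF delta0 deltaV])
  fix i v assume v: "v \<in> V"
  have "delta i + (G (Suc i) - G i) \<in> H" using deltaV G by auto
  from res[OF this] show "hp (delta (Suc i)) v + h * a (delta (Suc i)) v = hp (delta i + (G (Suc i) - G i)) v"
   unfolding deltaS using v by blast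
 qed
qed

lemma rothe:
 assumes T: "T > 0" and g: "!!t. t \<in> {0..T} ==> g t \<in> V"
  and lip: "!!t s. t \<in> {0..T} ==> s \<in> {0..T} ==> V.nrm (g t - g s) <= L * \<bar>t - s\<bar>"
 obtains C1 N0 where "N0 > 0"
  "!!N. N >= N0 ==> EX d. (ALL i. d i \<in> V) \<and> (T / real N) * (\<Sum>i<N. (V.nrm (d i))^2) <= C1 \<and>
    (ALL t:{0<..T}. ALL v:V. \<bar>hp (slope (T / real N) N d t) v + a (polygon (T / real N) N d t) v - hp (g t) v\<bar>
      <= (T / real N) * (L + Ca * V.nrm (slope (T / real N) N d t)) * V.nrm v)"
proof -
 have gT: "g T \<in> V" "g 0 \<in> V" using g[of T] g[of 0] T by auto
 have "0 <= V.nrm (g T - g 0)" using gT by (intro V.nonneg) auto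
 also have "... <= L * T" using lip[of T 0] T by simp
 finally have L0: "L >= 0" using T by (simp add: zero_le_mult_iff)
 \<comment> \<open>\<open>M\<close> is the discrete Gronwall bound for the pivot norms of the
   quotients, and \<open>C1\<close> is what the telescoped energy inequality then leaves for their
   squared \<open>V\<close> norms.\<close>
 define M where "M = exp (2 * K * T) * (H.nrm (g 0) + 2 * L * T)"
 have g0: "0 <= H.nrm (g 0)" using g T by (intro H.nonneg) auto
 hence M0: "M >= 0" using L0 T by (simp add: M_def)
 define C1 where "C1 = ((H.nrm (g 0))^2 / 2 + T * (K * M^2 + L * M)) / c0"
 \<comment> \<open>For \<open>N >= N0\<close> the step satisfies \<open>h * K <= 1 / 2\<close>: the
   resolvent exists, and \<open>1 / (1 - h * K) <= 1 + 2 * (h * K)\<close>, as used in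
   \<open>grow\<close>.\<close>
 obtain N0 :: nat where N0: "2 * K * T + 1 < real N0" using reals_Archimedean2 by blast
 have "0 <= 2 * K * T" using K T by simp
 hence "0 < real N0" using N0 by linarith
 hence "N0 > 0" by simp
 moreover have "EX d. (ALL i. d i \<in> V) \<and> (T / real N) * (\<Sum>i<N. (V.nrm (d i))^2) <= C1 \<and>
    (ALL t:{0<..T}. ALL v:V. \<bar>hp (slope (T / real N) N d t) v + a (polygon (T / real N) N d t) v - hp (g t) v\<bar>
      <= (T / real N) * (L + Ca * V.nrm (slope (T / real N) N d t)) * V.nrm v)" if N: "N >= N0" for N
 proof -
  define h where "h = T / real N"
  have Npos: "real N > 0" using N \<open>N0 > 0\<close> by simp
  have h: "h > 0" "real N * h = T" using T Npos by (auto simp: h_def)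
  have hK: "h * K <= 1 / 2"
  proof -
   have "real N0 <= real N" using N by simp
   hence "2 * K * T <= real N" using N0 by linarith
   thus ?thesis using Npos by (simp add: h_def field_simps)
  qed
  \<comment> \<open>The recursion runs over all \<open>i\<close>, so the nodes are clamped to
    \<open>T\<close> to keep \<open>g\<close> inside its domain; up to step \<open>N\<close> the
    clamp has no effect.\<close>
  define G where "G i = g (min T (real i * h))" for i
  have Gt: "min T (real i * h) \<in> {0..T}" for i using T h by simp
  have GV: "G i \<in> V" for i unfolding G_def by (rule g[OF Gt])
  have Gd: "H.nrm (G (Suc i) - G i) <= L * h" for i
  proof -
   have "H.nrm (G (Suc i) - G i) <= V.nrm (G (Suc i) - G i)" using GV by (intro nrm_le) auto
   also have "... <= L * \<bar>min T (real (Suc i) * h) - min T (real i * h)\<bar>"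
    unfolding G_def by (rule lip[OF Gt Gt])
   also have "... <= L * h" using L0 h by (intro mult_left_mono) (auto simp: algebra_simps min_def)
   finally show ?thesis .
  qed
  have hK1: "h * K <= 1" using hK by simp
  obtain delta where delta0: "delta 0 = G 0" and deltaV: "!!i. delta i \<in> V" and deltaeq:
   "!!i v. v \<in> V ==> hp (delta (Suc i)) v + h * a (delta (Suc i)) v = hp (delta i + (G (Suc i) - G i)) v"
   by (rule euler_step[OF h(1) hK1, of G]) (rule GV, rule that, assumption+)
  define x where "x i = H.nrm (delta i)" for i
  have x0: "x i >= 0" for i unfolding x_def by (intro H.nonneg) (use deltaV in auto)
  have test: "(x (Suc i))^2 + h * a (delta (Suc i)) (delta (Suc i)) <= (x i + L * h) * x (Suc i)" for i
  proof -
   have "(x (Suc i))^2 + h * a (delta (Suc i)) (delta (Suc i)) = hp (delta i) (delta (Suc i)) + hp (G (Suc i) - G i) (delta (Suc i))"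
    using deltaeq[OF deltaV, of i "Suc i"] deltaV GV by (simp add: x_def H.nrm_sq H.add_left)
   moreover have "hp (delta i) (delta (Suc i)) <= x i * x (Suc i)"
    using H.Cauchy_Schwarz[of "delta i" "delta (Suc i)"] deltaV by (simp add: x_def)
   moreover have "hp (G (Suc i) - G i) (delta (Suc i)) <= (L * h) * x (Suc i)"
    using H.Cauchy_Schwarz[of "G (Suc i) - G i" "delta (Suc i)"] deltaV GV mult_right_mono[OF Gd x0, of i "Suc i"]
    by (simp add: x_def)
   ultimately show ?thesis by (simp add: distrib_right)
  qed
  have gar: "h * (c0 * (V.nrm (delta i))^2) - h * K * (x i)^2 <= h * a (delta i) (delta i)" for i
   using mult_left_mono[OF garding[OF deltaV], of h i] h by (simp add: x_def algebra_simps)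
  have step: "(1 - h * K) * x (Suc i) <= x i + L * h" for i
  proof -
   have "0 <= h * (c0 * (V.nrm (delta (Suc i)))^2)" using h c0 by simp
   hence "(1 - h * K) * (x (Suc i))^2 <= (x i + L * h) * x (Suc i)"
    using test[of i] gar[of "Suc i"] by (simp add: algebra_simps)
   hence le: "((1 - h * K) * x (Suc i)) * x (Suc i) <= (x i + L * h) * x (Suc i)"
    by (simp add: power2_eq_square mult.assoc)
   show ?thesis
   proof (cases "x (Suc i) = 0")
    case True
    thus ?thesis using x0[of i] L0 h by simp
   next
    case False
    hence "x (Suc i) > 0" using x0[of "Suc i"] by simp
    thus ?thesis using le by simp
   qed
  qed
  have grow: "x (Suc i) <= (1 + 2 * (h * K)) * (x i + L * h)" for i
  proof -
   have y: "0 <= x i + L * h" using x0[of i] L0 h by simp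
   have "1 <= (1 + 2 * (h * K)) * (1 - h * K)"
   proof -
    have "(1 + 2 * (h * K)) * (1 - h * K) = 1 + (h * K) * (1 - 2 * (h * K))" by (simp add: algebra_simps)
    moreover have "0 <= (h * K) * (1 - 2 * (h * K))" using h K hK by (intro mult_nonneg_nonneg) auto
    ultimately show ?thesis by simp
   qed
   hence "x (Suc i) <= (1 + 2 * (h * K)) * (1 - h * K) * x (Suc i)"
    using x0[of "Suc i"] mult_right_mono[of 1 _ "x (Suc i)"] by simp
   also have "... <= (1 + 2 * (h * K)) * (x i + L * h)"
    using mult_left_mono[OF step[of i], of "1 + 2 * (h * K)"] h K by (simp add: mult.assoc)
   finally show ?thesis .
  qed
  have hK0: "0 <= h * K" using h K by simp
  have iter: "x i <= (1 + 2 * (h * K)) ^ i * (x 0 + 2 * L * (real i * h))" for i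
  proof (induction i)
   case (Suc i)
   have p1: "1 <= (1 + 2 * (h * K)) ^ i" using hK0 by (intro one_le_power) simp
   have "x (Suc i) <= (1 + 2 * (h * K)) * (x i + L * h)" by (rule grow)
   also have "x i + L * h <= (1 + 2 * (h * K)) ^ i * (x 0 + 2 * L * (real i * h)) + (1 + 2 * (h * K)) ^ i * (2 * L * h)"
    using Suc mult_mono[OF p1, of "L * h" "2 * L * h"] L0 h p1 by (intro add_mono) auto
   hence "(1 + 2 * (h * K)) * (x i + L * h) <= (1 + 2 * (h * K)) * ((1 + 2 * (h * K)) ^ i * (x 0 + 2 * L * (real i * h)) + (1 + 2 * (h * K)) ^ i * (2 * L * h))"
    using hK0 by (intro mult_left_mono) auto
   also have "... = (1 + 2 * (h * K)) ^ Suc i * (x 0 + 2 * L * (real (Suc i) * h))"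
    by (simp add: algebra_simps)
   finally show ?case .
  qed simp
  have xM: "x i <= M" if "i <= N" for i
  proof -
   have ih: "real i * h <= T" using mult_right_mono[of "real i" "real N" h] that h by simp
   have "(1 + 2 * (h * K)) ^ i <= exp (2 * (h * K)) ^ i"
    using hK0 by (intro power_mono) (auto simp: exp_ge_add_one_self)
   also have "... = exp (2 * K * (real i * h))" by (simp add: exp_of_nat_mult[symmetric] algebra_simps)
   also have "... <= exp (2 * K * T)" using ih K by (simp add: mult_left_mono)
   finally have "(1 + 2 * (h * K)) ^ i <= exp (2 * K * T)" .
   moreover have "x 0 + 2 * L * (real i * h) <= H.nrm (g 0) + 2 * L * T"
    using delta0 ih L0 T by (simp add: x_def G_def mult_left_mono)
   moreover have "0 <= x 0 + 2 * L * (real i * h)" using x0[of 0] L0 h by simp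
   ultimately have "(1 + 2 * (h * K)) ^ i * (x 0 + 2 * L * (real i * h)) <= M"
    unfolding M_def by (intro mult_mono) auto
   thus ?thesis using iter[of i] by linarith
  qed
  \<comment> \<open>Young's inequality turns the mixed term into a difference of consecutive
    squares, which telescopes in the sum over \<open>i\<close>.\<close>
  have en: "h * (c0 * (V.nrm (delta (Suc i)))^2) <= ((x i)^2 / 2 - (x (Suc i))^2 / 2) + h * (K * M^2 + L * M)" if "i < N" for i
  proof -
   have "x i * x (Suc i) <= (x i)^2 / 2 + (x (Suc i))^2 / 2" using sum_squares_bound[of "x i" "x (Suc i)"] by simp
   moreover have "L * h * x (Suc i) <= L * h * M" using xM[of "Suc i"] that L0 h by (intro mult_left_mono) auto
   moreover have "h * K * (x (Suc i))^2 <= h * K * M^2"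
    using xM[of "Suc i"] that hK0 x0 by (intro mult_left_mono power_mono) auto
   ultimately show ?thesis using test[of i] gar[of "Suc i"] by (simp add: algebra_simps)
  qed
  \<comment> \<open>The shift drops \<open>delta 0 = G 0\<close>, the slope prescribed at time 0;
    \<open>d i\<close> is the slope on the i-th step and solves the scheme at its right end.\<close>
  define d where "d i = delta (Suc i)" for i
  have dV: "d i \<in> V" for i using deltaV by (simp add: d_def)
  have "h * (\<Sum>i<N. (V.nrm (d i))^2) * c0 = (\<Sum>i<N. h * (c0 * (V.nrm (delta (Suc i)))^2))"
   by (simp add: d_def sum_distrib_left sum_distrib_right algebra_simps)
  also have "... <= (\<Sum>i<N. ((x i)^2 / 2 - (x (Suc i))^2 / 2) + h * (K * M^2 + L * M))"
   by (rule sum_mono) (use en in auto)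
  also have "... = (x 0)^2 / 2 - (x N)^2 / 2 + (real N * h) * (K * M^2 + L * M)"
   using sum_lessThan_telescope'[of "%i. (x i)^2 / 2" N] by (simp add: sum.distrib)
  also have "... <= C1 * c0" using c0 delta0 T h by (simp add: C1_def x_def G_def)
  finally have sum: "h * (\<Sum>i<N. (V.nrm (d i))^2) <= C1" using c0 by simp
  \<comment> \<open>Summing the differentiated scheme recovers the implicit Euler scheme for the
    partial sums of \<open>h *\<^sub>R d j\<close>; the choice \<open>delta 0 = G 0\<close> starts
    the induction.\<close>
  have scheme: "hp (delta i) v + a (\<Sum>j<i. h *\<^sub>R d j) v = hp (G i) v" if v: "v \<in> V" for i v
  proof (induction i)
   case 0
   have "a 0 v = 0" using a_scale_left[of 0 v 0] v by simp
   thus ?case using delta0 by simp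
  next
   case (Suc i)
   have S: "(\<Sum>j<i. h *\<^sub>R d j) \<in> V" using dV by (intro V.mem_sum) auto
   have "hp (delta (Suc i)) v + a (\<Sum>j<Suc i. h *\<^sub>R d j) v = (hp (delta (Suc i)) v + h * a (delta (Suc i)) v) + a (\<Sum>j<i. h *\<^sub>R d j) v"
    using S dV v by (simp add: a_add_left a_scale_left d_def)
   also have "... = hp (delta i) v + hp (G (Suc i)) v - hp (G i) v + a (\<Sum>j<i. h *\<^sub>R d j) v"
    using deltaeq[OF v, of i] deltaV GV v by (simp add: H.ip_simps)
   finally show ?case using Suc by simp
  qed
  have err: "\<bar>hp (slope h N d t) v + a (polygon h N d t) v - hp (g t) v\<bar>
      <= h * (L + Ca * V.nrm (slope h N d t)) * V.nrm v" if t: "t \<in> {0<..T}" and v: "v \<in> V" for t v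
  proof -
   obtain i where i: "i < N" "real i * h < t" "t <= real (Suc i) * h"
    using locate[OF h(1), of t N] t h by auto
   have "real (Suc i) * h <= real N * h" using i h by (intro mult_right_mono) auto
   hence Gi: "G (Suc i) = g (real (Suc i) * h)" and ti: "real (Suc i) * h \<in> {0..T}"
    using h by (auto simp: G_def min_def)
   define r where "r = real (Suc i) * h - t"
   have r: "0 <= r" "r <= h" using i by (auto simp: r_def algebra_simps)
   have S: "(\<Sum>j<Suc i. h *\<^sub>R d j) \<in> V" using dV by (intro V.mem_sum) auto
   have gV: "g t \<in> V" using g t by auto
   have poly: "polygon h N d t = (\<Sum>j<Suc i. h *\<^sub>R d j) - r *\<^sub>R d i"
    unfolding r_def by (rule polygon_at[OF h(1) i])
   have eq: "hp (slope h N d t) v + a (polygon h N d t) v - hp (g t) v = hp (G (Suc i) - g t) v - r * a (d i) v"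
    using scheme[OF v, of "Suc i"] S dV v GV gV
    by (simp del: sum.lessThan_Suc add: slope_at[OF h(1) i] poly a_diff_left a_scale_left H.ip_simps d_def)
   have 1: "\<bar>hp (G (Suc i) - g t) v\<bar> <= h * L * V.nrm v"
   proof -
    have "\<bar>hp (G (Suc i) - g t) v\<bar> <= H.nrm (G (Suc i) - g t) * V.nrm v"
     using GV gV v by (intro hp_bound) auto
    also have "H.nrm (G (Suc i) - g t) <= V.nrm (G (Suc i) - g t)" using GV gV by (intro nrm_le) auto
    also have "V.nrm (G (Suc i) - g t) <= L * \<bar>real (Suc i) * h - t\<bar>"
     unfolding Gi by (rule lip[OF ti]) (use t in auto)
    also have "L * \<bar>real (Suc i) * h - t\<bar> <= h * L" using r L0 unfolding r_def by (simp add: mult.commute mult_left_mono)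
    finally show ?thesis using V.nonneg[OF v] by (simp add: mult_right_mono)
   qed
   have 2: "\<bar>r * a (d i) v\<bar> <= h * (Ca * V.nrm (d i)) * V.nrm v"
   proof -
    have "r * \<bar>a (d i) v\<bar> <= h * (Ca * V.nrm (d i) * V.nrm v)"
     using r a_bound[OF dV v] by (intro mult_mono) auto
    thus ?thesis using r by (simp add: abs_mult mult.assoc)
   qed
   show ?thesis unfolding eq unfolding slope_at[OF h(1) i] using 1 2 by (simp add: algebra_simps)
  qed
  show ?thesis
   using dV sum err unfolding h_def by (intro exI[of _ d]) auto
 qed
 ultimately show thesis using that by blast
qed

subsection \<open>The energy estimate\<close>

lemma piecewise_continuous_ip:
 assumes "V.piecewise T F U D" and v: "v \<in> V"
 shows "continuous_on S (%t. hp (U t) v)" "continuous_on S (%t. hp (U t) (U t))"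
proof -
 obtain L where L: "!!t s. V.nrm (U t - U s) <= L * \<bar>t - s\<bar>" using assms(1) unfolding V.piecewise_def by blast
 have UV: "U t \<in> V" for t using assms(1) unfolding V.piecewise_def by blast
 have lim: "((%s. V.nrm (U s - U t)) \<longlongrightarrow> 0) (at t within S)" for t
 proof (rule Lim_null_comparison)
  show "\<forall>\<^sub>F s in at t within S. norm (V.nrm (U s - U t)) <= L * \<bar>s - t\<bar>"
   using L UV by (auto intro!: always_eventually simp: V.nonneg)
  have "((%s. L * \<bar>s - t\<bar>) \<longlongrightarrow> L * \<bar>t - t\<bar>) (at t within S)" by (intro tendsto_intros)
  thus "((%s. L * \<bar>s - t\<bar>) \<longlongrightarrow> 0) (at t within S)" by simp
 qed
 have conv: "((%s. hp (U s) w) \<longlongrightarrow> hp (U t) w) (at t within S)" if w: "w \<in> V" for w t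
 proof -
  have "((%s. hp (U s) w - hp (U t) w) \<longlongrightarrow> 0) (at t within S)"
  proof (rule Lim_null_comparison)
   have "\<bar>hp (U s) w - hp (U t) w\<bar> <= V.nrm (U s - U t) * V.nrm w" for s
    using hp_bound[of "U s - U t" w] mult_right_mono[OF nrm_le[of "U s - U t"] V.nonneg[OF w]] UV w
    by (simp add: H.ip_simps)
   thus "\<forall>\<^sub>F s in at t within S. norm (hp (U s) w - hp (U t) w) <= V.nrm (U s - U t) * V.nrm w"
    by simp
   show "((%s. V.nrm (U s - U t) * V.nrm w) \<longlongrightarrow> 0) (at t within S)"
    using tendsto_mult_left_zero[OF lim] by simp
  qed
  thus ?thesis by (simp add: LIM_zero_iff)
 qed
 show "continuous_on S (%t. hp (U t) v)" unfolding continuous_on_def using conv[OF v] by blast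
 have "((%s. hp (U s) (U s)) \<longlongrightarrow> hp (U t) (U t)) (at t within S)" for t
 proof -
  have e: "hp (U s) (U s) = hp (U s - U t) (U s - U t) + 2 * hp (U s) (U t) - hp (U t) (U t)" for s
   using UV H.sym[of "U s" "U t"] by (simp add: H.ip_simps)
  have "((%s. hp (U s - U t) (U s - U t)) \<longlongrightarrow> 0) (at t within S)"
  proof (rule Lim_null_comparison)
   have "\<bar>hp (U s - U t) (U s - U t)\<bar> <= (V.nrm (U s - U t))^2" for s
    using power_mono[OF nrm_le[of "U s - U t"] H.nonneg[of "U s - U t"], of 2] UV H.pos[of "U s - U t"]
    by (simp add: H.nrm_sq)
   thus "\<forall>\<^sub>F s in at t within S. norm (hp (U s - U t) (U s - U t)) <= (V.nrm (U s - U t))^2" by simp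
   show "((%s. (V.nrm (U s - U t))^2) \<longlongrightarrow> 0) (at t within S)" using tendsto_power[OF lim, of _ 2] by simp
  qed
  from tendsto_diff[OF tendsto_add[OF this tendsto_mult[OF tendsto_const conv[OF UV]]] tendsto_const]
  have "((%s. hp (U s - U t) (U s - U t) + 2 * hp (U s) (U t) - hp (U t) (U t)) \<longlongrightarrow> 0 + 2 * hp (U t) (U t) - hp (U t) (U t)) (at t within S)" .
  thus ?thesis by (subst e) simp
 qed
 thus "continuous_on S (%t. hp (U t) (U t))" unfolding continuous_on_def by blast
qed

lemma piecewise_derivative:
 assumes p: "V.piecewise T F U D" and t: "t \<notin> F"
 shows "v \<in> V ==> ((%s. hp (U s) v) has_real_derivative hp (D t) v) (at t)"
  "((%s. hp (U s) (U s)) has_real_derivative 2 * hp (D t) (U t)) (at t)"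
proof -
 have mem: "U s \<in> V" "D s \<in> V" for s using p unfolding V.piecewise_def by auto
 have ev: "\<forall>\<^sub>F s in at t. U s = U t + (s - t) *\<^sub>R D t" using p t unfolding V.piecewise_def by auto
 hence ev': "\<forall>\<^sub>F s in nhds t. U s = U t + (s - t) *\<^sub>R D t"
  by (simp add: eventually_nhds_conv_at)
 show "((%s. hp (U s) v) has_real_derivative hp (D t) v) (at t)" if v: "v \<in> V"
 proof -
  have "\<forall>\<^sub>F s in nhds t. hp (U s) v = hp (U t) v + (s - t) * hp (D t) v"
   using ev' by eventually_elim (use mem v in \<open>simp add: H.ip_simps\<close>)
  moreover have "((%s. hp (U t) v + (s - t) * hp (D t) v) has_real_derivative hp (D t) v) (at t)"
   by (auto intro!: derivative_eq_intros)
  ultimately show ?thesis by (subst DERIV_cong_ev[OF refl _ refl])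
 qed
 have "\<forall>\<^sub>F s in nhds t. hp (U s) (U s) = hp (U t) (U t) + 2 * (s - t) * hp (D t) (U t) + (s - t)^2 * hp (D t) (D t)"
  using ev'
 proof eventually_elim
  case (elim s)
  show ?case unfolding elim using mem H.sym[of "U t" "D t"]
   by (simp add: H.ip_simps power2_eq_square algebra_simps)
 qed
 moreover have "((%s. hp (U t) (U t) + 2 * (s - t) * hp (D t) (U t) + (s - t)^2 * hp (D t) (D t)) has_real_derivative 2 * hp (D t) (U t)) (at t)"
  by (auto intro!: derivative_eq_intros)
 ultimately show "((%s. hp (U s) (U s)) has_real_derivative 2 * hp (D t) (U t)) (at t)"
  by (subst DERIV_cong_ev[OF refl _ refl])
qed

text \<open>\<open>hp (U t) (U t)\<close> is multiplied by \<open>exp (- 2 * K * t)\<close>, the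
  integrating factor for the Garding term. The majorant \<open>f\<close> is required at every time,
  not at almost every one, because the fundamental theorem used is pointwise off a finite
  set.\<close>

lemma energy:
 assumes p: "V.piecewise T F U D" and tau: "0 <= tau" "tau <= T"
  and f: "integrable (time T) f"
  and fB: "!!t. t \<in> {0<..<T} ==> (V.dnorm (hp (D t) + a (U t)))^2 <= f t"
 shows "exp (- 2 * K * T) * ((H.nrm (U tau))^2 + c0 * (LINT t|time tau. (V.nrm (U t))^2)) <= (LINT t|time T. f t) / c0"
proof -
 have mem: "U s \<in> V" "D s \<in> V" for s using p unfolding V.piecewise_def by auto
 have F: "finite F" using p unfolding V.piecewise_def by blast
 define E where "E = exp (- 2 * K * T)"
 have Ui: "integrable (time T) (%t. (V.nrm (U t))^2)"
  using V.piecewise_sq_integrable[OF p] unfolding V.sq_int_def by blast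
 have f0: "0 <= f t" if "t \<in> {0<..<T}" for t using fB[OF that] order_trans[OF zero_le_power2] by blast
 have "exp (- 2 * K * tau) * hp (U tau) (U tau) - exp (- 2 * K * 0) * hp (U 0) (U 0)
   <= (LINT t|time tau. f t / c0 - E * c0 * (V.nrm (U t))^2)"
 proof (rule time_FTC_le[OF F tau(1), of "%t. exp (- 2 * K * t) * hp (U t) (U t)"
   "%t. exp (- 2 * K * t) * (2 * hp (D t) (U t) - 2 * K * hp (U t) (U t))"])
  show "continuous_on {0..tau} (%t. exp (- 2 * K * t) * hp (U t) (U t))"
   by (intro continuous_intros piecewise_continuous_ip(2)[OF p mem(1)])
  show "((%t. exp (- 2 * K * t) * hp (U t) (U t)) has_real_derivative
    exp (- 2 * K * x) * (2 * hp (D x) (U x) - 2 * K * hp (U x) (U x))) (at x)" if "x \<in> {0<..<tau} - F" for x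
   by (rule derivative_eq_intros piecewise_derivative(2)[OF p] refl | use that in \<open>simp add: algebra_simps\<close>)+
  show "integrable (time tau) (%t. f t / c0 - E * c0 * (V.nrm (U t))^2)"
   using time_integrable_subset[OF f tau(2)] time_integrable_subset[OF Ui tau(2)] by auto
  fix t assume t: "t \<in> {0<..<tau} - F"
  define B where "B = V.dnorm (hp (D t) + a (U t))"
  define x where "x = V.nrm (U t)"
  have Bd: "hp (D t) + a (U t) \<in> V.dual" using mem by auto
  have x0: "x >= 0" using mem V.nonneg by (simp add: x_def)
  have "hp (D t) (U t) + a (U t) (U t) <= B * x"
   using V.dnorm_bound[OF Bd mem(1)[of t]] by (simp add: B_def x_def)
  hence 1: "hp (D t) (U t) - K * hp (U t) (U t) <= B * x - c0 * x^2"
   using garding[OF mem(1)[of t]] mem by (simp add: x_def H.nrm_sq)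
  \<comment> \<open>Young's inequality in the form \<open>2 * B * x <= B^2 / c0 + c0 * x^2\<close>;
    half of the coercive term survives.\<close>
  have "0 <= (B / c0 - x)^2" by simp
  hence "0 <= c0 * (B / c0 - x)^2" using c0 by simp
  also have "... = B^2 / c0 - 2 * (B * x) + c0 * x^2" using c0 by (simp add: power2_eq_square field_simps)
  finally have 2: "2 * (B * x) - 2 * (c0 * x^2) <= B^2 / c0 - c0 * x^2" by simp
  have 3: "B^2 / c0 <= f t / c0" using fB[of t] t tau c0 by (simp add: B_def divide_right_mono)
  have e: "E <= exp (- 2 * K * t)" "exp (- 2 * K * t) <= 1" using t tau K by (auto simp: E_def mult_left_mono)
  have "exp (- 2 * K * t) * (2 * hp (D t) (U t) - 2 * K * hp (U t) (U t)) <= exp (- 2 * K * t) * (f t / c0 - c0 * x^2)"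
   using 1 2 3 by (intro mult_left_mono) auto
  also have "... <= f t / c0 - E * c0 * x^2"
  proof -
   have "exp (- 2 * K * t) * (f t / c0) <= 1 * (f t / c0)" using e(2) f0[of t] t tau c0 by (intro mult_right_mono) auto
   moreover have "E * (c0 * x^2) <= exp (- 2 * K * t) * (c0 * x^2)" using e(1) c0 by (intro mult_right_mono) auto
   ultimately show ?thesis by (simp add: algebra_simps)
  qed
  finally show "exp (- 2 * K * t) * (2 * hp (D t) (U t) - 2 * K * hp (U t) (U t)) <= f t / c0 - E * c0 * (V.nrm (U t))^2"
   by (simp add: x_def)
 qed
 moreover have "exp (- 2 * K * 0) * hp (U 0) (U 0) = 0" using p unfolding V.piecewise_def by simp
 moreover have "(LINT t|time tau. f t / c0 - E * c0 * (V.nrm (U t))^2)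
   = (LINT t|time tau. f t) / c0 - E * c0 * (LINT t|time tau. (V.nrm (U t))^2)"
  using time_integrable_subset[OF f tau(2)] time_integrable_subset[OF Ui tau(2)] by simp
 moreover have "(LINT t|time tau. f t) / c0 <= (LINT t|time T. f t) / c0"
  using time_integral_mono_set[OF f tau(2) f0] c0 by (simp add: divide_right_mono)
 moreover have "E * (H.nrm (U tau))^2 <= exp (- 2 * K * tau) * hp (U tau) (U tau)"
  using tau K mem H.pos[of "U tau"] by (simp add: H.nrm_sq E_def mult_right_mono mult_left_mono)
 moreover have "E * ((H.nrm (U tau))^2 + c0 * (LINT t|time tau. (V.nrm (U t))^2))
   = E * (H.nrm (U tau))^2 + E * c0 * (LINT t|time tau. (V.nrm (U t))^2)" by (simp add: algebra_simps)
 ultimately show ?thesis unfolding E_def[symmetric] by linarith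
qed

end

subsection \<open>Existence for the abstract parabolic problem\<close>

lemma time_measurable_AE:
 fixes f g :: "real => real"
 assumes g: "g \<in> borel_measurable (time T)" and ae: "AE t in time T. g t = f t"
 shows "f \<in> borel_measurable (time T)"
proof (rule strong_meas_real)
 from strong_meas_of_real[OF g] obtain s :: "nat => real => real" where
  s: "!!k. simple_function (time T) (s k)" "AE t in time T. (%k. \<bar>s k t - g t\<bar>) \<longlonglongrightarrow> 0"
  unfolding strong_meas_def by auto
 have "AE t in time T. (%k. \<bar>s k t - f t\<bar>) \<longlonglongrightarrow> 0"
  using s(2) ae by eventually_elim simp
 thus "strong_meas T UNIV abs f" unfolding strong_meas_def using s(1) by auto
qed

text \<open>\<open>\<bar>x\<bar> <= (1/2)^k + 2^k * x^2\<close> trades the L1 norm for the L2 norm,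
  and the rate \<open>(1/4)^k\<close> beats the weight \<open>2^k\<close>.\<close>

lemma time_integral_small:
 fixes x :: "nat => real => real"
 assumes m: "!!k. x k \<in> borel_measurable (time T)" and i: "!!k. integrable (time T) (%t. (x k t)^2)"
  and b: "!!k. (LINT t|time T. (x k t)^2) <= C * (1/4) ^ k"
 shows "integrable (time T) (%t. \<bar>x k t\<bar>)" "(%k. \<integral>t. \<bar>x k t\<bar> \<partial>time T) \<longlonglongrightarrow> 0"
proof -
 have le: "\<bar>x k t\<bar> <= (1/2) ^ k + 2 ^ k * (x k t)^2" for k t
 proof -
  have "0 <= ((1/2) ^ k) * (1 - 2 ^ k * \<bar>x k t\<bar>)^2" by simp
  also have "... = (1/2) ^ k - 2 * \<bar>x k t\<bar> + 2 ^ k * (x k t)^2"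
   by (simp add: power2_eq_square algebra_simps power_one_over flip: abs_mult)
  finally show ?thesis by (smt (verit) abs_ge_zero zero_le_power2)
 qed
 show int: "integrable (time T) (%t. \<bar>x k t\<bar>)" for k
  by (rule Bochner_Integration.integrable_bound[of _ "%t. (1/2) ^ k + 2 ^ k * (x k t)^2"])
    (use le m i in \<open>auto intro!: AE_I2 order_trans[OF le]\<close>)
 define W where "W = measure (time T) (space (time T))"
 show "(%k. \<integral>t. \<bar>x k t\<bar> \<partial>time T) \<longlonglongrightarrow> 0"
 proof (rule Lim_null_comparison)
  have "(LINT t|time T. \<bar>x k t\<bar>) <= (W + C) * (1/2) ^ k" for k
  proof -
   have "(LINT t|time T. \<bar>x k t\<bar>) <= (LINT t|time T. (1/2) ^ k + 2 ^ k * (x k t)^2)"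
    by (rule integral_mono) (use int i le in auto)
   also have "... = (1/2) ^ k * W + 2 ^ k * (LINT t|time T. (x k t)^2)"
    using i by (simp add: W_def)
   also have "... <= (1/2) ^ k * W + 2 ^ k * (C * (1/4) ^ k)"
    using b[of k] by (intro add_left_mono mult_left_mono) auto
   also have "2 ^ k * (C * (1/4) ^ k) = C * (1/2) ^ k"
   proof -
    have "(2::real) ^ k * (1/4) ^ k = (1/2) ^ k" by (simp flip: power_mult_distrib)
    thus ?thesis by (simp add: mult.left_commute)
   qed
   finally show ?thesis by (simp add: algebra_simps)
  qed
  thus "\<forall>\<^sub>F k in sequentially. norm (LINT t|time T. \<bar>x k t\<bar>) <= (W + C) * (1/2) ^ k" by simp
  have "(%k. (W + C) * (1/2) ^ k) \<longlonglongrightarrow> (W + C) * 0"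
   by (intro tendsto_intros LIMSEQ_power_zero) auto
  thus "(%k. (W + C) * (1/2) ^ k) \<longlonglongrightarrow> 0" by simp
 qed
qed

text \<open>The series of \<open>2^k * (x k t)^2\<close> has a finite integral, so it is finite for
  almost every \<open>t\<close> and bounds each of its terms. This turns L2 rates into pointwise
  rates.\<close>

lemma AE_geometric:
 fixes x :: "nat => 'a => real"
 assumes m: "!!k. x k \<in> borel_measurable (N)" and i: "!!k. integrable (N) (%t. (x k t)^2)"
  and b: "!!k. (LINT t|N. (x k t)^2) <= C * (1/4) ^ k"
 shows "AE t in N. EX S. ALL k. \<bar>x k t\<bar> <= S * sqrt (1/2) ^ k"
proof -
 note [measurable] = m
 have "0 <= (LINT t|N. (x 0 t)^2)" by (rule integral_nonneg_AE) simp
 also have "... <= C * (1/4) ^ 0" by (rule b)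
 finally have C: "C >= 0" by simp
 have "(\<integral>\<^sup>+t. (\<Sum>k. ennreal (2 ^ k * (x k t)^2)) \<partial>N) = (\<Sum>k. \<integral>\<^sup>+t. ennreal (2 ^ k * (x k t)^2) \<partial>N)"
  by (rule nn_integral_suminf) measurable
 also have "... <= (\<Sum>k. ennreal (C * (1/2) ^ k))"
 proof (rule suminf_le)
  fix k
  have "(\<integral>\<^sup>+t. ennreal (2 ^ k * (x k t)^2) \<partial>N) = ennreal (LINT t|N. 2 ^ k * (x k t)^2)"
   by (rule nn_integral_eq_integral) (use i in auto)
  also have "(LINT t|N. 2 ^ k * (x k t)^2) <= 2 ^ k * (C * (1/4) ^ k)"
   using b[of k] by simp
  also have "2 ^ k * (C * (1/4) ^ k) = C * (1/2) ^ k"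
  proof -
   have "(2::real) ^ k * (1/4) ^ k = (1/2) ^ k" by (simp flip: power_mult_distrib)
   thus ?thesis by (simp add: mult.left_commute)
  qed
  finally show "(\<integral>\<^sup>+t. ennreal (2 ^ k * (x k t)^2) \<partial>N) <= ennreal (C * (1/2) ^ k)"
   by (simp add: ennreal_leI)
 qed auto
 also have "... = ennreal (\<Sum>k. C * (1/2) ^ k)"
  by (rule suminf_ennreal2) (use C in \<open>auto intro!: summable_mult summable_geometric\<close>)
 finally have "(\<integral>\<^sup>+t. (\<Sum>k. ennreal (2 ^ k * (x k t)^2)) \<partial>N) \<noteq> \<infinity>"
  using ennreal_less_top le_less_trans less_irrefl by (metis infinity_ennreal_def)
 hence "AE t in N. (\<Sum>k. ennreal (2 ^ k * (x k t)^2)) \<noteq> \<infinity>"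
  by (intro nn_integral_PInf_AE) measurable
 thus ?thesis
 proof eventually_elim
  case (elim t)
  define R where "R = (\<Sum>k. ennreal (2 ^ k * (x k t)^2))"
  have "\<bar>x k t\<bar> <= sqrt (enn2real R) * sqrt (1/2) ^ k" for k
  proof -
   have "(\<Sum>j\<in>{k}. ennreal (2 ^ j * (x j t)^2)) <= R"
    unfolding R_def by (rule sum_le_suminf) auto
   hence "ennreal (2 ^ k * (x k t)^2) <= R" by simp
   hence "2 ^ k * (x k t)^2 <= enn2real R"
    using elim unfolding R_def by (metis enn2real_ennreal enn2real_mono infinity_ennreal_def top.not_eq_extremum
     zero_le_mult_iff zero_le_numeral zero_le_power zero_le_power2)
   hence "(x k t)^2 <= enn2real R * (1/2) ^ k" by (simp add: field_simps power_one_over)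
   hence "sqrt ((x k t)^2) <= sqrt (enn2real R * (1/2) ^ k)" by (rule real_sqrt_le_mono)
   moreover have "sqrt (enn2real R * (1/2) ^ k) = sqrt (enn2real R) * sqrt (1/2) ^ k"
    by (simp only: real_sqrt_mult real_sqrt_power)
   ultimately show ?thesis by (simp only: real_sqrt_abs)
  qed
  thus ?case by blast
 qed
qed

text \<open>Completeness gives the limit pointwise, Fatou's lemma transfers the rate. The limit is
  picked by \<open>SOME\<close> and its measurability is not known at this point, hence the
  conclusion in terms of nonnegative integrals.\<close>

lemma (in semi_hilbert) L2_geometric_limit:
 fixes U :: "nat => 'b => 'a"
 assumes mem: "!!k t. U k t \<in> X" and i: "!!k l. integrable N (%t. (nrm (U k t - U l t))^2)"
  and m: "!!k l. (%t. nrm (U k t - U l t)) \<in> borel_measurable N"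
  and b: "!!k l. k <= l ==> (LINT t|N. (nrm (U k t - U l t))^2) <= C * (1/4) ^ k"
 obtains u where "AE t in N. u t \<in> X \<and> (%k. nrm (U k t - u t)) \<longlonglongrightarrow> 0"
  "!!k. (\<integral>\<^sup>+t. ennreal ((nrm (U k t - u t))^2) \<partial>N) <= ennreal (C * (1/4) ^ k)"
proof -
 have half: "sqrt (1/2) < 1" "0 <= sqrt (1/2 :: real)" by (simp_all add: real_sqrt_divide)
 have "AE t in N. EX S. ALL k. \<bar>nrm (U k t - U (Suc k) t)\<bar> <= S * sqrt (1/2) ^ k"
  by (rule AE_geometric[OF m i b]) simp
 hence AEconv: "AE t in N. EX x. x \<in> X \<and> (%k. nrm (U k t - x)) \<longlonglongrightarrow> 0"
 proof eventually_elim
  case (elim t)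
  then obtain S where S: "!!k. \<bar>nrm (U k t - U (Suc k) t)\<bar> <= S * sqrt (1/2) ^ k" by blast
  obtain x where "x \<in> X" "(%k. nrm (U k t - x)) \<longlonglongrightarrow> 0"
  proof (rule complete_geometric[of "%k. U k t" "sqrt (1/2)" S])
   show "nrm (U (Suc k) t - U k t) <= S * sqrt (1/2) ^ k" for k
    using S[of k] nrm_commute[OF mem mem, of k t "Suc k" t] by simp
  qed (use mem half in auto)
  thus ?case by blast
 qed
 define u where "u t = (SOME x. x \<in> X \<and> (%k. nrm (U k t - x)) \<longlonglongrightarrow> 0)" for t
 have uAE: "AE t in N. u t \<in> X \<and> (%k. nrm (U k t - u t)) \<longlonglongrightarrow> 0"
  using AEconv unfolding u_def by eventually_elim (rule someI_ex)
 have "(\<integral>\<^sup>+t. ennreal ((nrm (U k t - u t))^2) \<partial>N) <= ennreal (C * (1/4) ^ k)" for k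
 proof -
  have "(\<integral>\<^sup>+t. ennreal ((nrm (U k t - u t))^2) \<partial>N) = (\<integral>\<^sup>+t. liminf (%l. ennreal ((nrm (U k t - U l t))^2)) \<partial>N)"
  proof (rule nn_integral_cong_AE)
   show "AE t in N. ennreal ((nrm (U k t - u t))^2) = liminf (%l. ennreal ((nrm (U k t - U l t))^2))"
    using uAE
   proof eventually_elim
    case (elim t)
    have "nrm ((U k t - U l t) - (U k t - u t)) = nrm (U l t - u t)" for l
     using nrm_commute[of "U l t" "u t"] elim mem by simp
    hence "(%l. nrm (U k t - U l t)) \<longlonglongrightarrow> nrm (U k t - u t)"
     by (intro tendsto_nrm) (use elim mem in auto)
    hence "(%l. ennreal ((nrm (U k t - U l t))^2)) \<longlonglongrightarrow> ennreal ((nrm (U k t - u t))^2)"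
     by (intro tendsto_intros) auto
    thus ?case by (metis lim_imp_Liminf trivial_limit_sequentially)
   qed
  qed
  also have "... <= liminf (%l. \<integral>\<^sup>+t. ennreal ((nrm (U k t - U l t))^2) \<partial>N)"
   by (rule nn_integral_liminf) (use m in measurable)
  also have "... <= limsup (%l. \<integral>\<^sup>+t. ennreal ((nrm (U k t - U l t))^2) \<partial>N)"
   by (rule Liminf_le_Limsup) simp
  also have "... <= ennreal (C * (1/4) ^ k)"
  proof (rule Limsup_bounded)
   show "\<forall>\<^sub>F l in sequentially. (\<integral>\<^sup>+t. ennreal ((nrm (U k t - U l t))^2) \<partial>N) <= ennreal (C * (1/4) ^ k)"
    using eventually_ge_at_top[of k]
    by eventually_elim (subst nn_integral_eq_integral[OF i], auto intro!: ennreal_leI b)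
  qed
  finally show ?thesis .
 qed
 with uAE show thesis by (rule that)
qed

text \<open>Diagonal choice: simple functions within \<open>(1/4)^k\<close> of \<open>u k\<close> in
  the squared L2 norm differ from \<open>u k\<close> by a null sequence almost everywhere, by
  \<open>AE_geometric\<close>; so they converge to \<open>w\<close> as well.\<close>

lemma (in seminormed) sm_limit:
 assumes u: "!!k. sq_int T (u k)" and w: "AE t in time T. w t \<in> X"
  and lim: "AE t in time T. (%k. nrm (u k t - w t)) \<longlonglongrightarrow> 0"
 shows "strong_meas T X nrm w"
proof -
 have "EX s. simple_function (time T) s \<and> (ALL t:{0<..<T}. s t \<in> X) \<and> (LINT t|time T. (nrm (u k t - s t))^2) < (1/4) ^ k" for k
 proof -
  have "(0::real) < (1/4) ^ k" by simp
  then obtain s where "simple_function (time T) s" "!!t. t \<in> {0<..<T} ==> s t \<in> X"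
   "(LINT t|time T. (nrm (u k t - s t))^2) < (1/4) ^ k"
   by (rule simple_approx[OF u[of k]]) (rule that, assumption+)
  thus ?thesis by (intro exI[of _ s] conjI ballI)
 qed
 hence "ALL k. EX s. simple_function (time T) s \<and> (ALL t:{0<..<T}. s t \<in> X) \<and> (LINT t|time T. (nrm (u k t - s t))^2) < (1/4) ^ k" ..
 from choice[OF this] obtain s where "ALL k. simple_function (time T) (s k) \<and> (ALL t:{0<..<T}. s k t \<in> X) \<and>
  (LINT t|time T. (nrm (u k t - s k t))^2) < (1/4) ^ k" ..
 hence s: "!!k. simple_function (time T) (s k)" "!!k t. t \<in> {0<..<T} ==> s k t \<in> X"
  "!!k. (LINT t|time T. (nrm (u k t - s k t))^2) < (1/4) ^ k" by simp_all
 have sm: "strong_meas T X nrm (%t. u k t - s k t)" for k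
 proof (rule sm_diff)
  show "strong_meas T X nrm (s k)"
   unfolding strong_meas_def using s(1,2)
   by (intro conjI exI[of _ "%_. s k"]) (auto intro!: AE_I2)
 qed (use u in \<open>auto simp: sq_int_def\<close>)
 have si: "sq_int T (%t. u k t - s k t)" for k
 proof -
  have sb: "EX B. ALL t:{0<..<T}. (nrm (s k t))^2 <= B"
  proof -
   have fin: "finite (s k ` {0<..<T})" using simple_functionD(1)[OF s(1)[of k]] by simp
   define B where "B = (\<Sum>v\<in>s k ` {0<..<T}. (nrm v)^2)"
   have "(nrm (s k t))^2 <= B" if "t \<in> {0<..<T}" for t
    unfolding B_def by (rule member_le_sum[OF _ _ fin]) (use that in auto)
   thus ?thesis by blast
  qed
  then obtain B where B: "!!t. t \<in> {0<..<T} ==> (nrm (s k t))^2 <= B" by blast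
  have "strong_meas T X nrm (s k)"
   unfolding strong_meas_def using s(1,2)
   by (intro conjI exI[of _ "%_. s k"]) (auto intro!: AE_I2)
  moreover have "AE t in time T. (nrm (s k t))^2 <= B" by (rule AE_I2) (use B in simp)
  ultimately have "sq_int T (s k)" by (rule sq_int_bound[OF _ integrable_time_const])
  thus ?thesis using sq_int_diff[OF u] by blast
 qed
 have "AE t in time T. EX S. ALL k. \<bar>nrm (u k t - s k t)\<bar> <= S * sqrt (1/2) ^ k"
 proof (rule AE_geometric[where C = 1])
  show "(%t. nrm (u k t - s k t)) \<in> borel_measurable (time T)" for k by (rule sm_nrm[OF sm])
  show "integrable (time T) (%t. (nrm (u k t - s k t))^2)" for k using si unfolding sq_int_def by blast
  show "(LINT t|time T. (nrm (u k t - s k t))^2) <= 1 * (1/4) ^ k" for k using s(3)[of k] by simp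
 qed
 moreover have "AE t in time T. ALL k. u k t \<in> X"
  using sq_int_mem[OF u] by (simp add: AE_all_countable)
 ultimately have "AE t in time T. (%k. nrm (s k t - w t)) \<longlonglongrightarrow> 0"
  using w lim AE_time_in
 proof eventually_elim
  case (elim t)
  then obtain S where S: "!!k. \<bar>nrm (u k t - s k t)\<bar> <= S * sqrt (1/2) ^ k" by blast
  show ?case
  proof (rule Lim_null_comparison)
   have "nrm (s k t - w t) <= S * sqrt (1/2) ^ k + nrm (u k t - w t)" for k
    using triangle_via[of "s k t" "u k t" "w t"] nrm_commute[of "s k t" "u k t"] S[of k] elim s(2) by fastforce
   moreover have "0 <= nrm (s k t - w t)" for k using elim s(2) by (intro nonneg) auto
   ultimately show "\<forall>\<^sub>F k in sequentially. norm (nrm (s k t - w t)) <= S * sqrt (1/2) ^ k + nrm (u k t - w t)" by simp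
   have "(%k. S * sqrt (1/2) ^ k + nrm (u k t - w t)) \<longlonglongrightarrow> S * 0 + 0"
    by (intro tendsto_add tendsto_mult tendsto_const LIMSEQ_power_zero elim) (simp add: real_sqrt_divide)
   thus "(%k. S * sqrt (1/2) ^ k + nrm (u k t - w t)) \<longlonglongrightarrow> 0" by simp
  qed
 qed
 thus ?thesis unfolding strong_meas_def using w s(1,2) by blast
qed

section \<open>Density of the residuals and construction of the solution\<close>

context garding
begin

definition residual :: "(real => 'v) => (real => 'v) => real => 'v => real" where
 "residual U D t = hp (D t) + a (U t)"

lemma residual_dual:
 assumes "V.piecewise T F U D" shows "residual U D t \<in> V.dual"
proof -
 have "U t \<in> V" "D t \<in> V" using assms unfolding V.piecewise_def by auto
 thus ?thesis unfolding residual_def by auto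
qed

lemma residual_sq_integrable:
 assumes p: "V.piecewise T F U D"
 shows "D.sq_int T (residual U D)"
 unfolding residual_def
proof (rule D.sq_int_add)
 have le: "H.nrm v <= 1 * V.nrm v" if "v \<in> V" for v using nrm_le[OF that] by simp
 show "D.sq_int T (%t. hp (D t))"
 proof (rule V.sq_int_linear[OF _ V.dual_seminormed, of _ _ _ 1])
  show "V.sq_int T D" using p unfolding V.piecewise_def by blast
  show "V.dnorm (hp x - hp y) <= 1 * V.nrm (x - y)" if "x \<in> V" "y \<in> V" for x y
   using dnorm_hp_diff[of x y] le[of "x - y"] that by force
  show "V.dnorm (hp x) <= 1 * V.nrm x" if x: "x \<in> V" for x
  proof (rule V.dnorm_least)
   fix v assume v: "v \<in> V"
   have "\<bar>hp x v\<bar> <= H.nrm x * V.nrm v" using x v by (intro hp_bound) auto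
   also have "... <= 1 * V.nrm x * V.nrm v" using le[OF x] V.nonneg[OF v] by (intro mult_right_mono) auto
   finally show "\<bar>hp x v\<bar> <= 1 * V.nrm x * V.nrm v" .
  qed (use V.nonneg x in auto)
 qed auto
 show "D.sq_int T (%t. a (U t))"
  by (rule V.sq_int_linear[OF V.piecewise_sq_integrable[OF p] V.dual_seminormed, of _ Ca])
    (auto simp: a_dnorm_diff a_dnorm)
qed

text \<open>The target is first replaced by the pivot image of a Lipschitz function, for which the
  Rothe interpolant has a residual of order \<open>h\<close>.\<close>

lemma residual_dense:
 assumes T: "T > 0" and b: "D.sq_int T b" and e: "e > 0"
 obtains F U D where "V.piecewise T F U D" "(LINT t|time T. (V.dnorm (residual U D t - b t))^2) < e"
proof -
 have e4: "e / 4 > 0" using e by simp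
 obtain g L where g: "!!t. t \<in> {0..T} ==> g t \<in> V"
   "!!t s. t \<in> {0..T} ==> s \<in> {0..T} ==> V.nrm (g t - g s) <= L * \<bar>t - s\<bar>"
   "(LINT t|time T. (V.dnorm (b t - hp (g t)))^2) < e / 4"
  using sq_int_approx[OF b, unfolded approx_def, rule_format, OF e4] by blast
 obtain C1 N0 where N0: "N0 > 0" and rothe: "!!N. N >= N0 ==> EX d. (ALL i. d i \<in> V) \<and> (T / real N) * (\<Sum>i<N. (V.nrm (d i))^2) <= C1 \<and>
    (ALL t:{0<..T}. ALL v:V. \<bar>hp (slope (T / real N) N d t) v + a (polygon (T / real N) N d t) v - hp (g t) v\<bar>
      <= (T / real N) * (L + Ca * V.nrm (slope (T / real N) N d t)) * V.nrm v)"
  by (rule rothe[OF T g(1,2)]) (assumption, assumption, assumption, rule that, assumption, blast)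
 define W where "W = measure (time T) (space (time T))"
 \<comment> \<open>The bound \<open>h^2 * (L + Ca * V.nrm (D t))^2\<close> for the squared residual
   integrates to at most \<open>h^2 * Q\<close>; \<open>N\<close> is chosen so that this is below
   \<open>e / 4\<close>.\<close>
 define Q where "Q = 2 * L^2 * W + 2 * Ca^2 * C1"
 have "(%N. (T * (1 / real N))^2 * Q) \<longlonglongrightarrow> (T * 0)^2 * Q"
  by (intro tendsto_intros lim_1_over_n)
 hence "\<forall>\<^sub>F N in sequentially. (T * (1 / real N))^2 * Q < e / 4"
  using e4 by (intro order_tendstoD(2)) auto
 then obtain N1 where N1: "!!N. N >= N1 ==> (T * (1 / real N))^2 * Q < e / 4" by (auto simp: eventually_sequentially)
 define N where "N = max N0 N1"
 define h where "h = T / real N"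
 have "N >= N0" "N > 0" using N0 by (auto simp: N_def)
 hence h: "h > 0" "real N * h = T" using T by (auto simp: h_def)
 have hQ: "h^2 * Q < e / 4" using N1[of N] by (simp add: N_def h_def)
 obtain d where d: "!!i. d i \<in> V" "h * (\<Sum>i<N. (V.nrm (d i))^2) <= C1"
   "!!t v. t \<in> {0<..T} ==> v \<in> V ==> \<bar>hp (slope h N d t) v + a (polygon h N d t) v - hp (g t) v\<bar>
      <= h * (L + Ca * V.nrm (slope h N d t)) * V.nrm v"
  using rothe[OF \<open>N >= N0\<close>] unfolding h_def[symmetric] by blast
 define U D where "U = polygon h N d" and "D = slope h N d"
 have p: "V.piecewise T ((%i. real i * h) ` {..N}) U D"
  unfolding U_def D_def by (rule V.piecewise_polygon[OF h(1) d(1)])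
 have DV: "D t \<in> V" for t using p unfolding V.piecewise_def by blast
 have L0: "L >= 0"
 proof -
  have "0 <= V.nrm (g T - g 0)" using g(1)[of T] g(1)[of 0] T by (intro V.nonneg) auto
  also have "... <= L * T" using g(2)[of T 0] T by simp
  finally show ?thesis using T by (simp add: zero_le_mult_iff)
 qed
 have Di: "integrable (time T) (%t. (V.nrm (D t))^2)"
  using p unfolding V.piecewise_def V.sq_int_def by blast
 have DC: "(LINT t|time T. (V.nrm (D t))^2) <= C1"
 proof -
  have "(LINT t|time T. (V.nrm (D t))^2) = (LINT t|time T. (\<Sum>i<N. window h i t * (V.nrm (d i))^2))"
  proof (rule Bochner_Integration.integral_cong[OF refl])
   fix t assume t: "t \<in> space (time T)"
   then obtain i where i: "i < N" "real i * h < t" "t <= real (Suc i) * h"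
    using locate[OF h(1), of t N] h by auto
   have "(\<Sum>j<N. window h j t * (V.nrm (d j))^2) = (\<Sum>j<N. if j = i then (V.nrm (d i))^2 else 0)"
    by (rule sum.cong) (use window_at[OF h(1) i(2,3)] in auto)
   thus "(V.nrm (D t))^2 = (\<Sum>i<N. window h i t * (V.nrm (d i))^2)"
    unfolding D_def slope_at[OF h(1) i] using i by simp
  qed
  also have "... = (\<Sum>i<N. (LINT t|time T. window h i t) * (V.nrm (d i))^2)"
   using integrable_window by simp
  also have "... <= (\<Sum>i<N. h * (V.nrm (d i))^2)"
   using integral_window_le[OF h(1)] by (intro sum_mono mult_right_mono) auto
  also have "... <= C1" using d(2) by (simp add: sum_distrib_left)
  finally show ?thesis .
 qed
 have "(LINT t|time T. (V.dnorm (residual U D t - hp (g t)))^2) <= (LINT t|time T. h^2 * (2 * L^2 + 2 * Ca^2 * (V.nrm (D t))^2))"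
 proof (rule integral_mono')
  show "integrable (time T) (%t. h^2 * (2 * L^2 + 2 * Ca^2 * (V.nrm (D t))^2))" using Di by simp
  fix t assume t: "t \<in> space (time T)"
  have dn: "V.dnorm (residual U D t - hp (g t)) <= h * (L + Ca * V.nrm (D t))"
  proof (rule V.dnorm_least)
   show "0 <= h * (L + Ca * V.nrm (D t))" using h L0 Ca V.nonneg[OF DV] by simp
   show "\<bar>(residual U D t - hp (g t)) v\<bar> <= h * (L + Ca * V.nrm (D t)) * V.nrm v" if "v \<in> V" for v
    using d(3)[of t v] t that by (simp add: residual_def U_def D_def)
  qed
  have "residual U D t - hp (g t) \<in> V.dual" using residual_dual[OF p] g(1)[of t] t by auto
  hence "(V.dnorm (residual U D t - hp (g t)))^2 <= (h * (L + Ca * V.nrm (D t)))^2"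
   by (intro power_mono dn V.dnorm_nonneg)
  also have "... = h^2 * (L + Ca * V.nrm (D t))^2" by (simp add: power_mult_distrib)
  also have "... <= h^2 * (2 * L^2 + 2 * Ca^2 * (V.nrm (D t))^2)"
   using sum_squares_bound[of L "Ca * V.nrm (D t)"] by (intro mult_left_mono) (auto simp: power2_sum power_mult_distrib)
  finally show "(V.dnorm (residual U D t - hp (g t)))^2 <= h^2 * (2 * L^2 + 2 * Ca^2 * (V.nrm (D t))^2)" .
 qed auto
 also have "... = h^2 * (2 * L^2 * W + 2 * Ca^2 * (LINT t|time T. (V.nrm (D t))^2))"
  using Di by (simp add: W_def)
 also have "... <= h^2 * Q" unfolding Q_def using DC by (intro mult_left_mono add_left_mono) auto
 finally have 1: "(LINT t|time T. (V.dnorm (residual U D t - hp (g t)))^2) < e / 4" using hQ by simp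
 have "(LINT t|time T. (V.dnorm (residual U D t - b t))^2) <= 2 * (LINT t|time T. (V.dnorm (residual U D t - hp (g t)))^2)
   + 2 * (LINT t|time T. (V.dnorm (hp (g t) - b t))^2)"
  by (rule sq_integral_add_le[OF D.sq_int_diff[OF residual_sq_integrable[OF p] sq_int_hp[OF g(1,2)]]
     D.sq_int_diff[OF sq_int_hp[OF g(1,2)] b]]) auto
 also have "(LINT t|time T. (V.dnorm (hp (g t) - b t))^2) = (LINT t|time T. (V.dnorm (b t - hp (g t)))^2)"
 proof (rule integral_cong_AE)
  show "(%t. (V.dnorm (hp (g t) - b t))^2) \<in> borel_measurable (time T)"
   using D.sq_int_diff[OF sq_int_hp[OF g(1,2)] b] unfolding D.sq_int_def by auto
  show "(%t. (V.dnorm (b t - hp (g t)))^2) \<in> borel_measurable (time T)"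
   using D.sq_int_diff[OF b sq_int_hp[OF g(1,2)]] unfolding D.sq_int_def by auto
  show "AE t in time T. (V.dnorm (hp (g t) - b t))^2 = (V.dnorm (b t - hp (g t)))^2"
   using D.sq_int_mem[OF b] AE_time_in
   by eventually_elim (use g(1) D.nrm_commute in auto)
 qed
 finally have "(LINT t|time T. (V.dnorm (residual U D t - b t))^2) < e" using 1 g(3) by linarith
 thus ?thesis using that[OF p] by blast
qed

lemma piecewise_integrated:
 assumes p: "V.piecewise T F U D" and t: "t \<in> {0..T}" and v: "v \<in> V"
 shows "hp (U t) v = (LINT s|time t. residual U D s v - a (U s) v)"
proof -
 have mem: "U s \<in> V" "D s \<in> V" for s using p unfolding V.piecewise_def by auto
 have hv: "seminormed.sq_int V.dual V.dnorm T (%t. hp v)"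
  using D.sm_const[of "hp v" T] v by (simp add: D.sq_int_def)
 have "integrable (time T) (%s. hp v (D s))"
  by (rule V.integrable_pairing[OF hv]) (use p in \<open>simp add: V.piecewise_def\<close>)
 hence int: "integrable (time T) (%s. hp (D s) v)" using mem v H.sym by simp
 have "(LINT s|time t. hp (D s) v) = hp (U t) v - hp (U 0) v"
  by (rule time_FTC[of F])
    (use t p v piecewise_continuous_ip[OF p v] piecewise_derivative(1)[OF p _ v] time_integrable_subset[OF int, of t]
    in \<open>auto simp: V.piecewise_def\<close>)
 moreover have "hp (U 0) v = 0" using p v unfolding V.piecewise_def by simp
 ultimately show ?thesis by (simp add: residual_def)
qed

text \<open>Piecewise affine functions whose residuals approach \<open>b\<close> at a geometric rate
  are Cauchy by the energy estimate for their differences, uniformly in \<open>H\<close> and in L2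
  with values in \<open>V\<close>. The first limit is the continuous representative
  \<open>c\<close>, the second is \<open>u\<close>.\<close>

theorem parabolic_existence:
 assumes T: "T > 0" and b: "D.sq_int T b"
 obtains u c where "V.sq_int T u" "!!t. t \<in> {0..T} ==> c t \<in> H"
  "!!t. t \<in> {0..T} ==> ((%s. H.nrm (c s - c t)) \<longlongrightarrow> 0) (at t within {0..T})"
  "AE t in time T. H.nrm (c t - u t) = 0" "H.nrm (c 0) = 0"
  "!!t v. t \<in> {0..T} ==> v \<in> V ==> hp (c t) v = (LINT s|time t. b s v - a (u s) v)"
proof -
 have ex: "EX W. V.piecewise T (fst W) (fst (snd W)) (snd (snd W)) \<and>
   (LINT t|time T. (V.dnorm (residual (fst (snd W)) (snd (snd W)) t - b t))^2) < (1/4) ^ k" for k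
 proof -
  have "(0::real) < (1/4) ^ k" by simp
  then obtain F U D where "V.piecewise T F U D" "(LINT t|time T. (V.dnorm (residual U D t - b t))^2) < (1/4) ^ k"
   by (rule residual_dense[OF T b]) (rule that, assumption+)
  thus ?thesis by (intro exI[of _ "(F, U, D)"]) simp
 qed
 from choice[OF allI[OF ex]] obtain W where W: "ALL k. V.piecewise T (fst (W k)) (fst (snd (W k))) (snd (snd (W k))) \<and>
   (LINT t|time T. (V.dnorm (residual (fst (snd (W k))) (snd (snd (W k))) t - b t))^2) < (1/4) ^ k" ..
 define F U D where "F k = fst (W k)" and "U k = fst (snd (W k))" and "D k = snd (snd (W k))" for k
 have p: "V.piecewise T (F k) (U k) (D k)"
  and B: "(LINT t|time T. (V.dnorm (residual (U k) (D k) t - b t))^2) < (1/4) ^ k" for k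
  using W unfolding F_def U_def D_def by simp_all
 have mem: "U k s \<in> V" "D k s \<in> V" for k s using p[of k] unfolding V.piecewise_def by auto
 define r where "r k t = residual (U k) (D k) t - b t" for k t
 have rsi: "D.sq_int T (r k)" for k
  unfolding r_def by (rule D.sq_int_diff[OF residual_sq_integrable[OF p] b])
 have ri: "integrable (time T) (%t. (V.dnorm (r k t))^2)" for k
  using rsi unfolding D.sq_int_def by blast
 have rB: "(LINT t|time T. (V.dnorm (r k t))^2) <= 1 * (1/4) ^ k" for k
  using B[of k] by (simp add: r_def)
 define E where "E = exp (2 * K * T)"
 have E: "E > 0" by (simp add: E_def)
 \<comment> \<open>\<open>E\<close> undoes the exponential factor of \<open>energy\<close>,
   \<open>1 / c0\<close> is its constant, and 4 arises from
   \<open>2 * (1/4)^k + 2 * (1/4)^l <= 4 * (1/4)^k\<close> for \<open>k <= l\<close>.\<close>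
 define C where "C = 4 * E / c0"
 have C0: "C >= 0" using E c0 by (simp add: C_def)
 have diff: "(H.nrm (U k tau - U l tau))^2 + c0 * (LINT t|time tau. (V.nrm (U k t - U l t))^2) <= C * (1/4) ^ k"
  if kl: "k <= l" and tau: "0 <= tau" "tau <= T" for k l tau
 proof -
  have pd: "V.piecewise T (F k \<union> F l) (%t. U k t - U l t) (%t. D k t - D l t)"
   by (rule V.piecewise_diff[OF p p])
  \<comment> \<open>\<open>energy\<close> asks for a majorant at every time, but \<open>b t\<close>
    lies in the dual only almost everywhere; at the remaining times \<open>f\<close> is the very
    quantity to be bounded.\<close>
  define f where "f t = (if b t \<in> V.dual then 2 * (V.dnorm (r k t))^2 + 2 * (V.dnorm (r l t))^2
   else (V.dnorm (hp (D k t - D l t) + a (U k t - U l t)))^2)" for t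
  have ae: "AE t in time T. 2 * (V.dnorm (r k t))^2 + 2 * (V.dnorm (r l t))^2 = f t"
   using D.sq_int_mem[OF b] by eventually_elim (simp add: f_def)
  have gi: "integrable (time T) (%t. 2 * (V.dnorm (r k t))^2 + 2 * (V.dnorm (r l t))^2)" using ri by simp
  have fm: "f \<in> borel_measurable (time T)"
   by (rule time_measurable_AE[OF borel_measurable_integrable[OF gi] ae])
  have fi: "integrable (time T) f"
   by (rule integrable_cong_AE_imp[OF gi fm ae])
  have fle: "(LINT t|time T. f t) <= 4 * (1/4) ^ k"
  proof -
   have "(LINT t|time T. f t) = (LINT t|time T. 2 * (V.dnorm (r k t))^2 + 2 * (V.dnorm (r l t))^2)"
    using ae by (intro integral_cong_AE fm) (use gi in auto)
   also have "... <= 2 * (1/4) ^ k + 2 * (1/4) ^ l" using rB[of k] rB[of l] ri by simp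
   also have "... <= 4 * (1/4) ^ k" using power_decreasing[OF kl, of "1/4 :: real"] by simp
   finally show ?thesis .
  qed
  have "exp (- 2 * K * T) * ((H.nrm (U k tau - U l tau))^2 + c0 * (LINT t|time tau. (V.nrm (U k t - U l t))^2)) <= (LINT t|time T. f t) / c0"
  proof (rule energy[OF pd tau fi])
   fix t
   show "(V.dnorm (hp (D k t - D l t) + a (U k t - U l t)))^2 <= f t"
   proof (cases "b t \<in> V.dual")
    case True
    have rk: "r k t \<in> V.dual" "r l t \<in> V.dual" using True residual_dual[OF p] by (auto simp: r_def)
    have e1: "V.dnorm (hp (D k t - D l t) + a (U k t - U l t)) = V.dnorm (r k t + - r l t)"
     by (rule dnorm_cong) (use mem in \<open>simp add: r_def residual_def H.ip_simps a_diff_left\<close>)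
    have "(V.dnorm (r k t + - r l t))^2 <= 2 * (V.dnorm (r k t))^2 + 2 * (V.dnorm (- r l t))^2"
     by (rule D.sq_add_le[OF rk(1) D.mem(5)[OF rk(2)]])
    also have "... = f t" unfolding D.nrm_minus[OF rk(2)] using True by (simp add: f_def)
    finally show ?thesis unfolding e1 .
   qed (simp add: f_def)
  qed
  also have "... <= 4 * (1/4) ^ k / c0" using fle c0 by (simp add: divide_right_mono)
  finally have "E * (exp (- 2 * K * T) * ((H.nrm (U k tau - U l tau))^2 + c0 * (LINT t|time tau. (V.nrm (U k t - U l t))^2))) <= E * (4 * (1/4) ^ k / c0)"
   using E by (intro mult_left_mono) auto
  moreover have "E * exp (- 2 * K * T) = 1" by (simp add: E_def exp_minus_inverse)
  ultimately show ?thesis by (simp add: C_def mult.assoc[symmetric] mult.commute[of E])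
 qed
 have int0: "0 <= (LINT t|time tau. (V.nrm (U k t - U l t))^2)" for k l tau by (rule integral_nonneg_AE) simp
 have Hdiff: "H.nrm (U k t - U l t) <= sqrt C * (1/2) ^ k" if "k <= l" "t \<in> {0..T}" for k l t
 proof -
  have "0 <= c0 * (LINT s|time t. (V.nrm (U k s - U l s))^2)" using c0 int0 by simp
  hence "(H.nrm (U k t - U l t))^2 <= C * (1/4) ^ k" using diff[of k l t] that by simp
  hence "H.nrm (U k t - U l t) <= sqrt (C * (1/4) ^ k)" by (rule real_le_rsqrt)
  also have "... = sqrt C * (1/2) ^ k"
   by (simp add: real_sqrt_mult real_sqrt_power real_sqrt_divide)
  finally show ?thesis .
 qed
 have Vdiff: "(LINT t|time T. (V.nrm (U k t - U l t))^2) <= (C / c0) * (1/4) ^ k" if "k <= l" for k l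
 proof -
  have "c0 * (LINT t|time T. (V.nrm (U k t - U l t))^2) <= C * (1/4) ^ k"
   using diff[of k l T] that T zero_le_power2[of "H.nrm (U k T - U l T)"] by linarith
  thus ?thesis using c0 by (simp add: field_simps)
 qed
 define c where "c t = (SOME x. x \<in> H \<and> (%k. H.nrm (U k t - x)) \<longlonglongrightarrow> 0)" for t
 have c: "c t \<in> H \<and> (%k. H.nrm (U k t - c t)) \<longlonglongrightarrow> 0" if t: "t \<in> {0..T}" for t
 proof -
  obtain x where "x \<in> H" "(%k. H.nrm (U k t - x)) \<longlonglongrightarrow> 0"
  proof (rule H.complete_geometric[of "%k. U k t" "1/2" "sqrt C"])
   show "H.nrm (U (Suc k) t - U k t) <= sqrt C * (1 / 2) ^ k" for k
    using Hdiff[of k "Suc k" t] t H.nrm_commute[of "U k t" "U (Suc k) t"] mem by simp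
  qed (use mem in auto)
  hence "EX x. x \<in> H \<and> (%k. H.nrm (U k t - x)) \<longlonglongrightarrow> 0" by blast
  thus ?thesis unfolding c_def by (rule someI_ex)
 qed
 have cH: "c t \<in> H" if "t \<in> {0..T}" for t using c[OF that] by blast
 have crate: "H.nrm (U k t - c t) <= sqrt C * (1/2) ^ k" if t: "t \<in> {0..T}" for k t
 proof -
  have "(%l. sqrt C * (1/2) ^ k + H.nrm (U l t - c t)) \<longlonglongrightarrow> sqrt C * (1/2) ^ k + 0"
   using c[OF t] by (intro tendsto_intros) auto
  moreover have "ALL l>=k. H.nrm (U k t - c t) <= sqrt C * (1/2) ^ k + H.nrm (U l t - c t)"
  proof (intro allI impI)
   fix l assume "k <= l"
   thus "H.nrm (U k t - c t) <= sqrt C * (1/2) ^ k + H.nrm (U l t - c t)"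
    using H.triangle_via[of "U k t" "U l t" "c t"] Hdiff[of k l t] t mem cH[OF t] by force
  qed
  ultimately show ?thesis by (intro LIMSEQ_le_const[where X = "%l. sqrt C * (1/2) ^ k + H.nrm (U l t - c t)"]) auto
 qed
 have ccont: "((%s. H.nrm (c s - c t)) \<longlongrightarrow> 0) (at t within {0..T})" if t: "t \<in> {0..T}" for t
 proof (rule tendstoI)
  fix e :: real assume e: "e > 0"
  have "(%k. sqrt C * (1/2) ^ k) \<longlonglongrightarrow> sqrt C * 0" by (intro tendsto_intros LIMSEQ_power_zero) auto
  hence "\<forall>\<^sub>F k in sequentially. sqrt C * (1/2) ^ k < e / 4" using e by (intro order_tendstoD(2)) auto
  then obtain k where k: "sqrt C * (1/2) ^ k < e / 4" by (auto simp: eventually_sequentially)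
  obtain L where L: "!!t s. V.nrm (U k t - U k s) <= L * \<bar>t - s\<bar>" using p[of k] unfolding V.piecewise_def by blast
  have "((%s. L * \<bar>s - t\<bar>) \<longlongrightarrow> L * \<bar>t - t\<bar>) (at t within {0..T})" by (intro tendsto_intros)
  hence "\<forall>\<^sub>F s in at t within {0..T}. L * \<bar>s - t\<bar> < e / 4" using e by (intro order_tendstoD(2)) auto
  moreover have "\<forall>\<^sub>F s in at t within {0..T}. s \<in> {0..T}" by (simp add: eventually_at_filter)
  ultimately show "\<forall>\<^sub>F s in at t within {0..T}. dist (H.nrm (c s - c t)) 0 < e"
  proof eventually_elim
   case (elim s)
   have "H.nrm (c s - c t) <= H.nrm (c s - U k s) + H.nrm (U k s - c t)"
    using cH elim t mem by (intro H.triangle_via) auto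
   moreover have "H.nrm (U k s - c t) <= H.nrm (U k s - U k t) + H.nrm (U k t - c t)"
    using cH elim t mem by (intro H.triangle_via) auto
   moreover have "H.nrm (U k s - U k t) <= L * \<bar>s - t\<bar>"
    using L[of s t] nrm_le[of "U k s - U k t"] mem by force
   moreover have "H.nrm (c s - U k s) = H.nrm (U k s - c s)" using cH elim mem by (intro H.nrm_commute) auto
   ultimately have "H.nrm (c s - c t) < e" using crate[OF elim(2), of k] crate[OF t, of k] k elim(1) e by linarith
   moreover have "0 <= H.nrm (c s - c t)" using cH elim t by (intro H.nonneg) auto
   ultimately show ?case by simp
  qed
 qed
 have c00: "H.nrm (c 0) = 0"
 proof -
  have "U k 0 = 0" for k using p[of k] unfolding V.piecewise_def by blast
  hence "(%k. H.nrm (- c 0)) \<longlonglongrightarrow> 0" using c[of 0] T by simp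
  hence "H.nrm (- c 0) = 0" by (simp add: LIMSEQ_const_iff)
  thus ?thesis using H.nrm_minus[OF cH[of 0]] T by simp
 qed

 have Usi: "V.sq_int T (U k)" for k by (rule V.piecewise_sq_integrable[OF p])
 have Udi: "V.sq_int T (%t. U k t - U l t)" for k l by (rule V.sq_int_diff[OF Usi Usi])
 obtain u where uAE: "AE t in time T. u t \<in> V \<and> (%k. V.nrm (U k t - u t)) \<longlonglongrightarrow> 0"
  and nnfin: "!!k. (\<integral>\<^sup>+t. ennreal ((V.nrm (U k t - u t))^2) \<partial>time T) <= ennreal ((C / c0) * (1/4) ^ k)"
  by (rule V.L2_geometric_limit[OF mem(1) _ _ Vdiff]; (use Udi in \<open>auto simp: V.sq_int_def intro: V.sm_nrm\<close>)?)
 hence uV: "AE t in time T. u t \<in> V" and ulim: "AE t in time T. (%k. V.nrm (U k t - u t)) \<longlonglongrightarrow> 0"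
  by (auto elim: eventually_mono)
 have usm: "strong_meas T V V.nrm u" by (rule V.sm_limit[OF Usi uV ulim])
 have udsm: "strong_meas T V V.nrm (%t. U k t - u t)" for k
  using Usi usm by (intro V.sm_diff) (auto simp: V.sq_int_def)
 have udi: "V.sq_int T (%t. U k t - u t)" for k
  unfolding V.sq_int_def
 proof
  show "integrable (time T) (%t. (V.nrm (U k t - u t))^2)"
  proof (rule integrableI_bounded)
   show "(%t. (V.nrm (U k t - u t))^2) \<in> borel_measurable (time T)" using V.sm_nrm[OF udsm] by measurable
   show "(\<integral>\<^sup>+t. ennreal (norm ((V.nrm (U k t - u t))^2)) \<partial>time T) < \<infinity>"
    using nnfin[of k] by (simp add: order_le_less_trans[OF _ ennreal_less_top])
  qed
 qed (rule udsm)
 have uint: "(LINT t|time T. (V.nrm (U k t - u t))^2) <= (C / c0) * (1/4) ^ k" for k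
 proof -
  have "ennreal (LINT t|time T. (V.nrm (U k t - u t))^2) = (\<integral>\<^sup>+t. ennreal ((V.nrm (U k t - u t))^2) \<partial>time T)"
   by (rule nn_integral_eq_integral[symmetric]) (use udi in \<open>auto simp: V.sq_int_def\<close>)
  also have "... <= ennreal ((C / c0) * (1/4) ^ k)" by (rule nnfin)
  finally show ?thesis using C0 c0 by (simp add: ennreal_le_iff)
 qed
 have usi: "V.sq_int T u"
  using V.sq_int_diff[OF Usi[of 0] udi[of 0]] by simp
 have cu: "AE t in time T. H.nrm (c t - u t) = 0"
  using uAE AE_time_in
 proof eventually_elim
  case (elim t)
  hence t: "t \<in> {0..T}" and ut: "u t \<in> V" by auto
  have "(%k. H.nrm (U k t - c t) + V.nrm (U k t - u t)) \<longlonglongrightarrow> 0 + 0"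
   using c[OF t] elim by (intro tendsto_add) auto
  moreover have "H.nrm (c t - u t) <= H.nrm (U k t - c t) + V.nrm (U k t - u t)" for k
  proof -
   have "H.nrm (c t - u t) <= H.nrm (c t - U k t) + H.nrm (U k t - u t)"
    using cH[OF t] mem ut by (intro H.triangle_via) auto
   moreover have "H.nrm (U k t - u t) <= V.nrm (U k t - u t)" using mem ut by (intro nrm_le) auto
   moreover have "H.nrm (c t - U k t) = H.nrm (U k t - c t)" using cH[OF t] mem by (intro H.nrm_commute) auto
   ultimately show ?thesis by linarith
  qed
  ultimately have "H.nrm (c t - u t) <= 0" by (intro LIMSEQ_le_const) auto
  moreover have "0 <= H.nrm (c t - u t)" using cH[OF t] ut by (intro H.nonneg) auto
  ultimately show ?case by simp
 qed
 have weak: "hp (c t) v = (LINT s|time t. b s v - a (u s) v)" if t: "t \<in> {0..T}" and v: "v \<in> V" for t v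
 proof -
  have cv: "V.sq_int T (%_. v)" using V.sm_const[OF v, of T] by (simp add: V.sq_int_def)
  have asi: "D.sq_int T (%s. a (w s))" if "V.sq_int T w" for w
   by (rule V.sq_int_linear[OF that V.dual_seminormed, of _ Ca]) (auto simp: a_dnorm_diff a_dnorm)
  have ib: "integrable (time T) (%s. b s v)" by (rule V.integrable_pairing[OF b cv])
  have ia: "integrable (time T) (%s. a (w s) v)" if "V.sq_int T w" for w
   by (rule V.integrable_pairing[OF asi[OF that] cv])
  have ir: "integrable (time T) (%s. residual (U k) (D k) s v)" for k
   by (rule V.integrable_pairing[OF residual_sq_integrable[OF p] cv])
  have tT: "t <= T" using t by simp
  have n1: "integrable (time T) (%s. \<bar>V.dnorm (r k s)\<bar>)" "(%k. \<integral>s. \<bar>V.dnorm (r k s)\<bar> \<partial>time T) \<longlonglongrightarrow> 0" for k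
   by (rule time_integral_small[where C = 1]; use rsi rB in \<open>auto simp: D.sq_int_def intro: D.sm_nrm\<close>)+
  have n2: "integrable (time T) (%s. \<bar>V.nrm (U k s - u s)\<bar>)" "(%k. \<integral>s. \<bar>V.nrm (U k s - u s)\<bar> \<partial>time T) \<longlonglongrightarrow> 0" for k
   by (rule time_integral_small[where C = "C / c0"]; use udi uint in \<open>auto simp: V.sq_int_def intro: V.sm_nrm\<close>)+
  \<comment> \<open>In integrated form the passage to the limit needs only L1 convergence of the
    residuals and of \<open>U k\<close>; no time derivative of the limit is taken.\<close>
  have "(%k. hp (U k t) v - (LINT s|time t. b s v - a (u s) v)) \<longlonglongrightarrow> 0"
  proof (rule Lim_null_comparison)
   have "\<bar>hp (U k t) v - (LINT s|time t. b s v - a (u s) v)\<bar>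
     <= (LINT s|time T. \<bar>V.dnorm (r k s)\<bar>) * V.nrm v + Ca * (LINT s|time T. \<bar>V.nrm (U k s - u s)\<bar>) * V.nrm v" for k
   proof -
    define q where "q s = (residual (U k) (D k) s v - a (U k s) v) - (b s v - a (u s) v)" for s
    have qi: "integrable (time T) q" unfolding q_def using ir ia[OF Usi] ib ia[OF usi] by auto
    have "hp (U k t) v - (LINT s|time t. b s v - a (u s) v) = (LINT s|time t. q s)"
     unfolding piecewise_integrated[OF p t v] q_def
     by (rule Bochner_Integration.integral_diff[symmetric]; rule time_integrable_subset[OF _ tT])
       (use ir ia[OF Usi] ib ia[OF usi] in auto)
    also have "\<bar>...\<bar> <= (LINT s|time t. \<bar>q s\<bar>)" by (rule integral_abs_bound)
    also have "... <= (LINT s|time T. \<bar>q s\<bar>)"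
     by (rule time_integral_mono_set[OF _ tT]) (use qi in auto)
    also have "... <= (LINT s|time T. \<bar>V.dnorm (r k s)\<bar> * V.nrm v + Ca * \<bar>V.nrm (U k s - u s)\<bar> * V.nrm v)"
    proof (rule integral_mono_AE)
     show "AE s in time T. \<bar>q s\<bar> <= \<bar>V.dnorm (r k s)\<bar> * V.nrm v + Ca * \<bar>V.nrm (U k s - u s)\<bar> * V.nrm v"
      using uV D.sq_int_mem[OF rsi[of k]]
     proof eventually_elim
      case (elim s)
      have "q s = r k s v - a (U k s - u s) v"
       using mem elim v by (simp add: q_def r_def a_diff_left)
      moreover have "\<bar>r k s v\<bar> <= \<bar>V.dnorm (r k s)\<bar> * V.nrm v"
       using V.dnorm_bound[OF elim(2) v] V.dnorm_nonneg[OF elim(2)] by simp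
      moreover have "\<bar>a (U k s - u s) v\<bar> <= Ca * \<bar>V.nrm (U k s - u s)\<bar> * V.nrm v"
       using a_bound[of "U k s - u s" v] mem elim v V.nonneg[of "U k s - u s"] by simp
      ultimately show ?case by linarith
     qed
    qed (use qi n1(1) n2(1) in auto)
    also have "... = (LINT s|time T. \<bar>V.dnorm (r k s)\<bar>) * V.nrm v + Ca * (LINT s|time T. \<bar>V.nrm (U k s - u s)\<bar>) * V.nrm v"
     using n1(1) n2(1) by simp
    finally show ?thesis .
   qed
   thus "\<forall>\<^sub>F k in sequentially. norm (hp (U k t) v - (LINT s|time t. b s v - a (u s) v))
     <= (LINT s|time T. \<bar>V.dnorm (r k s)\<bar>) * V.nrm v + Ca * (LINT s|time T. \<bar>V.nrm (U k s - u s)\<bar>) * V.nrm v" by simp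
   have "(%k. (LINT s|time T. \<bar>V.dnorm (r k s)\<bar>) * V.nrm v + Ca * (LINT s|time T. \<bar>V.nrm (U k s - u s)\<bar>) * V.nrm v)
    \<longlonglongrightarrow> 0 * V.nrm v + Ca * 0 * V.nrm v"
    by (intro tendsto_intros n1(2) n2(2))
   thus "(%k. (LINT s|time T. \<bar>V.dnorm (r k s)\<bar>) * V.nrm v + Ca * (LINT s|time T. \<bar>V.nrm (U k s - u s)\<bar>) * V.nrm v) \<longlonglongrightarrow> 0"
    by simp
  qed
  hence "(%k. hp (U k t) v) \<longlonglongrightarrow> (LINT s|time t. b s v - a (u s) v)" by (simp add: LIM_zero_iff)
  moreover have "(%k. hp (U k t) v) \<longlonglongrightarrow> hp (c t) v"
   by (rule H.tendsto_ip) (use c[OF t] mem v in auto)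
  ultimately show ?thesis by (rule LIMSEQ_unique[symmetric])
 qed
 show thesis by (rule that[of u c, OF usi cH ccont cu c00 weak])
qed

end

subsection \<open>Uniqueness for the abstract parabolic problem\<close>

lemma id_time_measurable: "(%t. t) \<in> borel_measurable (time T)"
 by (intro measurable_restrict_space1 measurable_completion) simp

text \<open>Fubini on the triangle \<open>s < t\<close>: the inner integral of \<open>psi\<close>
  from \<open>s\<close> to \<open>T\<close> is \<open>- zeta s\<close>, since
  \<open>zeta T = 0\<close>.\<close>

lemma time_parts:
 fixes zeta psi y :: "real => real"
 assumes F: "finite F" and T: "0 <= T" and cont: "continuous_on {0..T} zeta"
  and deriv: "!!t. t \<in> {0<..<T} - F ==> (zeta has_real_derivative psi t) (at t)"
  and m [measurable]: "psi \<in> borel_measurable (time T)" and bd: "!!t. t \<in> {0<..<T} ==> \<bar>psi t\<bar> <= R"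
  and 0: "zeta T = 0" and y: "integrable (time T) y"
 shows "integrable (time T) (%t. psi t * (LINT s|time t. y s))"
  "(LINT t|time T. psi t * (LINT s|time t. y s)) = - (LINT s|time T. zeta s * y s)"
proof -
 interpret N: finite_measure "time T" by (rule finite_measure_time)
 interpret P: pair_sigma_finite "time T" "time T" ..
 note [measurable] = id_time_measurable
 have [measurable]: "y \<in> borel_measurable (time T)" using y by simp
 define k where "k z = y (fst z) * (psi (snd z) * of_bool (fst z < snd z))" for z
 have [measurable]: "(%z. fst z) \<in> borel_measurable (time T \<Otimes>\<^sub>M time T)" "(%z. snd z) \<in> borel_measurable (time T \<Otimes>\<^sub>M time T)"
  using measurable_compose[OF measurable_fst id_time_measurable] measurable_compose[OF measurable_snd id_time_measurable]
  by blast+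
 have [measurable]: "(%z. y (fst z)) \<in> borel_measurable (time T \<Otimes>\<^sub>M time T)" "(%z. psi (snd z)) \<in> borel_measurable (time T \<Otimes>\<^sub>M time T)"
  using measurable_compose[OF measurable_fst \<open>y \<in> _\<close>] measurable_compose[OF measurable_snd m] by blast+
 have km [measurable]: "k \<in> borel_measurable (time T \<Otimes>\<^sub>M time T)" unfolding k_def by measurable
 have M0: "0 <= R" if "t \<in> {0<..<T}" for t using bd[OF that] by (rule order_trans[OF abs_ge_zero])
 have kint: "integrable (time T) (%t. psi t * of_bool (s < t))" for s
  by (rule N.integrable_const_bound[of _ "\<bar>R\<bar>"]) (use bd in \<open>force intro!: AE_I2\<close>, measurable)
 have ki: "integrable (time T \<Otimes>\<^sub>M time T) k"
 proof (rule P.Fubini_integrable[OF km])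
  show "AE x in time T. integrable (time T) (%t. k (x, t))" unfolding k_def using kint by simp
  show "integrable (time T) (%x. \<integral>t. norm (k (x, t)) \<partial>time T)"
  proof (rule Bochner_Integration.integrable_bound)
   show "integrable (time T) (%s. y s * (\<bar>R\<bar> * measure (time T) (space (time T))))" using y by simp
   show "(%x. \<integral>t. norm (k (x, t)) \<partial>time T) \<in> borel_measurable (time T)"
    by (rule N.borel_measurable_lebesgue_integral) measurable
   show "AE x in time T. norm (LINT t|time T. norm (k (x, t))) <= norm (y x * (\<bar>R\<bar> * measure (time T) (space (time T))))"
   proof (rule AE_I2)
    fix x
    have "(LINT t|time T. norm (k (x, t))) <= (LINT t|time T. \<bar>y x\<bar> * \<bar>R\<bar>)"
    proof (rule integral_mono')
     fix t assume "t \<in> space (time T)"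
     hence "\<bar>psi t\<bar> <= \<bar>R\<bar>" using bd[of t] by simp
     thus "norm (k (x, t)) <= \<bar>y x\<bar> * \<bar>R\<bar>" by (simp add: k_def abs_mult mult_left_mono)
    qed auto
    thus "norm (LINT t|time T. norm (k (x, t))) <= norm (y x * (\<bar>R\<bar> * measure (time T) (space (time T))))"
     by (simp add: abs_mult algebra_simps)
   qed
  qed
 qed
 have inner1: "(LINT s|time T. k (s, t)) = psi t * (LINT s|time t. y s)" if t: "t \<in> {0<..<T}" for t
 proof -
  have "(LINT s|time T. k (s, t)) = (LINT s|time T. psi t * (indicator {0<..<t} s * y s))"
   by (rule Bochner_Integration.integral_cong) (auto simp: k_def indicator_def)
  thus ?thesis using time_restrict(2)[of t T y] t by simp
 qed
 have inner2: "(LINT t|time T. k (s, t)) = - (zeta s * y s)" if s: "s \<in> {0<..<T}" for s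
 proof -
  \<comment> \<open>\<open>zeta (max s t)\<close> is constant up to \<open>s\<close> and follows
    \<open>zeta\<close> afterwards, so it is the right primitive; its kink at \<open>s\<close> joins
    the exceptional set.\<close>
  have "(LINT t|time T. psi t * of_bool (s < t)) = zeta (max s T) - zeta (max s 0)"
  proof (rule time_FTC[of "F \<union> {s}"])
   have "continuous_on {0..T} (%t. max s t)" by (intro continuous_intros)
   moreover have "(%t. max s t) ` {0..T} \<subseteq> {0..T}" using s by auto
   ultimately show "continuous_on {0..T} (%t. zeta (max s t))" by (rule continuous_on_compose2[OF cont])
   fix t assume t: "t \<in> {0<..<T} - (F \<union> {s})"
   show "((%t. zeta (max s t)) has_real_derivative psi t * of_bool (s < t)) (at t)"
   proof (cases "s < t")
    case True
    have "\<forall>\<^sub>F x in nhds t. x \<in> {s<..}" using True by (intro eventually_nhds_in_open) auto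
    hence "\<forall>\<^sub>F x in nhds t. zeta (max s x) = zeta x" by eventually_elim simp
    hence "((%t. zeta (max s t)) has_real_derivative psi t) (at t)"
     using deriv[of t] t by (subst DERIV_cong_ev[OF refl _ refl]) auto
    thus ?thesis using True by simp
   next
    case False
    hence "t < s" using t by auto
    have "\<forall>\<^sub>F x in nhds t. x \<in> {..<s}" using \<open>t < s\<close> by (intro eventually_nhds_in_open) auto
    hence "\<forall>\<^sub>F x in nhds t. zeta (max s x) = zeta s" by eventually_elim simp
    hence "((%t. zeta (max s t)) has_real_derivative 0) (at t)"
     by (subst DERIV_cong_ev[OF refl _ refl]) auto
    thus ?thesis using False by simp
   qed
  qed (use F T kint in auto)
  hence "(LINT t|time T. psi t * of_bool (s < t)) = - zeta s" using s 0 by simp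
  thus ?thesis by (simp add: k_def mult.commute)
 qed
 have "integrable (time T) (%t. \<integral>s. k (s, t) \<partial>time T)"
  using P.integrable_snd[of "%x y. k (x, y)"] ki by simp
 moreover have "integrable (time T) (%t. \<integral>s. k (s, t) \<partial>time T) = integrable (time T) (%t. psi t * (LINT s|time t. y s))"
  by (rule Bochner_Integration.integrable_cong) (auto simp: inner1)
 ultimately show "integrable (time T) (%t. psi t * (LINT s|time t. y s))" by simp
 have "(LINT t|time T. psi t * (LINT s|time t. y s)) = (LINT t|time T. (LINT s|time T. k (s, t)))"
  by (rule Bochner_Integration.integral_cong) (auto simp: inner1)
 also have "... = (LINT s|time T. (LINT t|time T. k (s, t)))"
  using P.Fubini_integral[of "%x y. k (x, y)"] ki by simp
 also have "... = (LINT s|time T. - (zeta s * y s))"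
  by (rule Bochner_Integration.integral_cong) (auto simp: inner2)
 finally show "(LINT t|time T. psi t * (LINT s|time t. y s)) = - (LINT s|time T. zeta s * y s)" by simp
qed

lemma AE_time_mono:
 assumes "AE t in time T. P t" "tau <= T" shows "AE t in time tau. P t"
proof -
 have "AE t in lebesgue. t \<in> {0<..<T} --> P t" using assms(1) by (simp add: AE_restrict_space_iff)
 hence "AE t in lebesgue. t \<in> {0<..<tau} --> P t" by eventually_elim (use assms(2) in auto)
 thus ?thesis by (simp add: AE_restrict_space_iff)
qed

lemma continuous_primitive:
 fixes f :: "real => real"
 assumes f: "integrable (time T) f"
 shows "continuous_on {0..T} (%t. \<integral>s. f s \<partial>time t)"
proof -
 have e: "(LINT s|time t. f s) = integral {0..t} f" if "t <= T" for t
  using time_has_integral[OF time_integrable_subset[OF f that]] by (simp add: integral_unique)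
 have "f integrable_on {0..T}" using time_has_integral[OF f] by blast
 hence "continuous_on {0..T} (%t. integral {0..t} f)" by (rule indefinite_integral_continuous_1)
 thus ?thesis by (subst continuous_on_cong[OF refl]) (auto simp: e)
qed

context gelfand
begin

lemma V_sq_integrable_const: "v \<in> V ==> V.sq_int T (%t. v)"
 unfolding V.sq_int_def by (simp add: V.sm_const)

lemma pairing_integrable: "D.sq_int T w ==> v \<in> V ==> integrable (time T) (%t. w t v)"
 by (rule V.integrable_pairing[OF _ V_sq_integrable_const])

lemma dual_integrable:
 assumes "V.sq_int T u" "k \<in> V.dual" shows "integrable (time T) (%t. k (u t))"
 by (rule V.integrable_pairing[OF _ assms(1)]) (simp add: D.sq_int_def D.sm_const assms(2))

lemma hp_cong_left: "h \<in> H ==> k \<in> H ==> H.nrm (h - k) = 0 ==> v \<in> H ==> hp h v = hp k v"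
 using H.Cauchy_Schwarz[of "h - k" v] H.diff_left[of h k v] by simp

text \<open>The primitive of \<open>u\<close> exists in V by the Riesz representation theorem; no vector-valued integral
 is needed.\<close>

lemma primitive:
 assumes u: "V.sq_int T u"
 obtains z \<Phi> where "!!t. z t \<in> V" "continuous_on {0..T} \<Phi>" "0 <= T ==> V.nrm (z 0) = 0"
  "!!t k. t \<in> {0..T} ==> k \<in> V.dual ==> k (z t) = (LINT s|time t. k (u s))"
  "!!s t. s \<in> {0..T} ==> t \<in> {0..T} ==> V.nrm (z t - z s) <= \<bar>\<Phi> t - \<Phi> s\<bar>"
proof -
 \<comment> \<open>Resetting \<open>u\<close> on a null set makes the Cauchy-Schwarz bounds hold at
   every time.\<close>
 define y where "y t = (if u t \<in> V then u t else 0)" for t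
 have y: "V.sq_int T y" unfolding y_def
  by (rule V.sq_int_linear[where G = "%x. if x \<in> V then x else 0" and C = 1, OF u V.seminormed_axioms]) auto
 have yV: "y t \<in> V" for t by (simp add: y_def)
 have uy: "AE t in time T. k (u t) = k (y t)" for k :: "'v => real"
  using V.sq_int_mem[OF u] by eventually_elim (simp add: y_def)
 have ky: "integrable (time T) (%s. k (y s))" if "k \<in> V.dual" for k by (rule dual_integrable[OF y that])
 have kc: "(LINT s|time t. k (u s)) = (LINT s|time t. k (y s))" if k: "k \<in> V.dual" and t: "t <= T" for k t
 proof (rule integral_cong_AE)
  show "AE s in time t. k (u s) = k (y s)" by (rule AE_time_mono[OF uy t])
  show "(%s. k (u s)) \<in> borel_measurable (time t)" "(%s. k (y s)) \<in> borel_measurable (time t)"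
   by (rule borel_measurable_integrable[OF time_integrable_subset[OF dual_integrable[OF _ k] t]], fact)+
 qed
 \<comment> \<open>The primitive of the norms serves as a modulus of continuity: \<open>z\<close>
   moves no further than \<Phi> does, and \<Phi> is continuous.\<close>
 define \<Phi> where "\<Phi> t = (LINT s|time t. V.nrm (y s))" for t
 have ny: "integrable (time T) (%s. V.nrm (y s))"
 proof (rule Bochner_Integration.integrable_bound)
  show "integrable (time T) (%s. 1 + (V.nrm (y s))^2)" using y unfolding V.sq_int_def by simp
  show "(%s. V.nrm (y s)) \<in> borel_measurable (time T)" using y V.sm_nrm unfolding V.sq_int_def by blast
  have "\<bar>r\<bar> <= 1 + r^2" for r :: real using sum_squares_bound[of 1 "\<bar>r\<bar>"] by simp
  thus "AE s in time T. norm (V.nrm (y s)) <= norm (1 + (V.nrm (y s))^2)" by simp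
 qed
 have mono: "(LINT s|time r. f s) <= (LINT s|time t. f s)"
  if "integrable (time T) f" "r <= t" "t <= T" "!!s. 0 <= f s" for f :: "real => real" and r t
  by (rule time_integral_mono_set[OF time_integrable_subset[OF that(1,3)] that(2,4)])
 have le: "\<bar>(LINT s|time t. ip (y s) v) - (LINT s|time r. ip (y s) v)\<bar> <= (\<Phi> t - \<Phi> r) * V.nrm v"
  if v: "v \<in> V" and rt: "r <= t" "t <= T" for v r t
 proof -
  have iy: "integrable (time T) (%s. ip (y s) v)"
   using ky[OF V.ip_dual[OF v]] V.sym[OF yV v] by simp
  have f: "integrable (time tau) (%s. ip (y s) v)" "integrable (time tau) (%s. V.nrm (y s) * V.nrm v)" if "tau <= T" for tau
   using time_integrable_subset[OF iy that] time_integrable_subset[OF ny that] by simp_all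
  have CS: "\<bar>ip (y s) v\<bar> <= V.nrm (y s) * V.nrm v" for s by (rule V.Cauchy_Schwarz[OF yV v])
  \<comment> \<open>Adding or subtracting \<open>ip (y s) v\<close> keeps the integrand nonnegative,
    so both integrals grow with the interval; together they bound the absolute value.\<close>
  have nn: "0 <= V.nrm (y s) * V.nrm v + ip (y s) v" "0 <= V.nrm (y s) * V.nrm v - ip (y s) v" for s using CS[of s] by linarith+
  note fT = f(2)[OF order_refl] f(1)[OF order_refl]
  have "(LINT s|time r. V.nrm (y s) * V.nrm v + ip (y s) v) <= (LINT s|time t. V.nrm (y s) * V.nrm v + ip (y s) v)"
   by (rule mono[OF Bochner_Integration.integrable_add[OF fT] rt nn(1)])
  moreover have "(LINT s|time r. V.nrm (y s) * V.nrm v - ip (y s) v) <= (LINT s|time t. V.nrm (y s) * V.nrm v - ip (y s) v)"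
   by (rule mono[OF Bochner_Integration.integrable_diff[OF fT] rt nn(2)])
  ultimately show ?thesis using f[of r] f[of t] rt by (simp add: \<Phi>_def left_diff_distrib abs_le_iff)
 qed
 have "EX w. w \<in> V \<and> (ALL v:V. t \<in> {0..T} --> (LINT s|time t. ip (y s) v) = ip w v)" for t
 proof (cases "t \<in> {0..T}")
  case True
  have "(%v. \<integral>s. ip (y s) v \<partial>time t) \<in> V.dual"
  proof (rule V.dualI)
   have i: "integrable (time t) (%s. ip (y s) v)" if "v \<in> V" for v
    using time_integrable_subset[OF ky[OF V.ip_dual[OF that]], of t] V.sym[OF yV that] True by simp
   show "(LINT s|time t. ip (y s) (v + w)) = (LINT s|time t. ip (y s) v) + (LINT s|time t. ip (y s) w)" if "v \<in> V" "w \<in> V" for v w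
    using i that yV by (simp add: V.add_right)
   show "(LINT s|time t. ip (y s) (r *\<^sub>R v)) = r * (LINT s|time t. ip (y s) v)" if "v \<in> V" for r v
    using that yV by (simp add: V.scale_right)
   have z: "(LINT s|time 0. f s) = 0" for f :: "real => real" by (rule integral_eq_zero_AE) (auto intro: AE_I2)
   show "\<bar>\<integral>s. ip (y s) v \<partial>time t\<bar> <= \<Phi> t * V.nrm v" if "v \<in> V" for v
    using le[OF that, of 0 t] True z by (simp add: \<Phi>_def)
  qed
  from V.riesz[OF this] show ?thesis by metis
 qed auto
 from choice[OF allI[OF this]] obtain z where z: "ALL t. z t \<in> V \<and> (ALL v:V. t \<in> {0..T} --> (LINT s|time t. ip (y s) v) = ip (z t) v)" ..
 have zV: "z t \<in> V" for t using z by blast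
 have zi: "ip (z t) v = (LINT s|time t. ip (y s) v)" if "t \<in> {0..T}" "v \<in> V" for t v using z that by simp
 have lip: "V.nrm (z t - z r) <= \<Phi> t - \<Phi> r" if rt: "r \<in> {0..T}" "t \<in> {0..T}" "r <= t" for r t
 proof (rule V.nrm_le_of_sq_le)
  show w: "z t - z r \<in> V" using zV by auto
  have "(V.nrm (z t - z r))^2 = ip (z t) (z t - z r) - ip (z r) (z t - z r)"
   using w zV by (simp add: V.nrm_sq V.diff_left)
  also have "... <= (\<Phi> t - \<Phi> r) * V.nrm (z t - z r)"
   using le[OF w rt(3)] rt by (simp add: zi[OF _ w] abs_le_iff)
  finally show "(V.nrm (z t - z r))^2 <= (\<Phi> t - \<Phi> r) * V.nrm (z t - z r)" .
  show "0 <= \<Phi> t - \<Phi> r" unfolding \<Phi>_def using mono[OF ny rt(3)] rt V.nonneg[OF yV] by simp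
 qed
 show thesis
 proof (rule that[OF zV])
  show "continuous_on {0..T} \<Phi>" unfolding \<Phi>_def by (rule continuous_primitive[OF ny])
  show "k (z t) = (LINT s|time t. k (u s))" if t: "t \<in> {0..T}" and k: "k \<in> V.dual" for t k
  proof -
   obtain r where r: "r \<in> V" "!!v. v \<in> V ==> k v = ip r v" using V.riesz[OF k] by blast
   have "k (z t) = ip (z t) r" using r zV V.sym by simp
   also have "... = (LINT s|time t. k (y s))" using r yV V.sym by (simp add: zi[OF t])
   finally show ?thesis using kc[OF k, of t] t by simp
  qed
  show "V.nrm (z t - z s) <= \<bar>\<Phi> t - \<Phi> s\<bar>" if "s \<in> {0..T}" "t \<in> {0..T}" for s t
   using lip[of s t] lip[of t s] that V.nrm_commute[OF zV zV, of s t] by (cases "s <= t") auto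
  have "(LINT s|time 0. ip (y s) (z 0)) = 0" by (rule integral_eq_zero_AE) (auto intro: AE_I2)
  thus "V.nrm (z 0) = 0" if "0 <= T" using zi[OF _ zV, of 0 0] that by (simp add: V.nrm_def)
 qed
qed

end

context garding
begin

text \<open>Integrated in time, the homogeneous equation reads \<open>(z', v) + a (z, v) = 0\<close> for the primitive \<open>z\<close>
 of \<open>u\<close>, and \<open>z\<close> is smooth enough for the energy argument.\<close>

theorem parabolic_uniqueness:
 assumes T: "T > 0" and u: "V.sq_int T u" and cH: "!!t. t \<in> {0..T} ==> c t \<in> H"
  and cu: "AE t in time T. H.nrm (c t - u t) = 0"
  and eq: "!!t v. t \<in> {0..T} ==> v \<in> V ==> hp (c t) v = (LINT s|time t. - a (u s) v)"
 shows "AE t in time T. H.nrm (u t) = 0"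
proof -
 obtain z \<Phi> where zV: "!!t. z t \<in> V" and \<Phi>: "continuous_on {0..T} \<Phi>" and z0: "0 <= T ==> V.nrm (z 0) = 0"
  and zk: "!!t k. t \<in> {0..T} ==> k \<in> V.dual ==> k (z t) = (LINT s|time t. k (u s))"
  and z\<Phi>: "!!s t. s \<in> {0..T} ==> t \<in> {0..T} ==> V.nrm (z t - z s) <= \<bar>\<Phi> t - \<Phi> s\<bar>"
  by (rule primitive[OF u]) (rule that, assumption+)
 note uV = V.sq_int_mem[OF u]
 have aV: "(%x. a x v) \<in> V.dual" if "v \<in> V" for v
  by (rule V.dualI[of _ "Ca * V.nrm v"]) (use that a_bound[OF _ that] in \<open>auto simp: a_add_left a_scale_left mult_ac\<close>)
 \<comment> \<open>Evaluation of \<open>a\<close> at a fixed second argument is a bounded functional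
   of the first, so it commutes with the primitive.\<close>
 have cz: "hp (c t) v = - a (z t) v" if "t \<in> {0..T}" "v \<in> V" for t v
  using eq[OF that] zk[OF that(1) aV[OF that(2)]] by simp
 have lim: "((%s. V.nrm (z s - z t)) \<longlongrightarrow> 0) (at t within {0..T})" if t: "t \<in> {0..T}" for t
 proof (rule Lim_null_comparison)
  show "\<forall>\<^sub>F s in at t within {0..T}. norm (V.nrm (z s - z t)) <= \<bar>\<Phi> s - \<Phi> t\<bar>"
   unfolding eventually_at_filter using z\<Phi>[OF t] V.nonneg[OF V.mem(4)[OF zV zV]] by (intro always_eventually) simp
  have "((%s. \<Phi> s - \<Phi> t) \<longlongrightarrow> 0) (at t within {0..T})" using \<Phi> t unfolding continuous_on_def by (simp add: LIM_zero)
  thus "((%s. \<bar>\<Phi> s - \<Phi> t\<bar>) \<longlongrightarrow> 0) (at t within {0..T})" by (rule tendsto_rabs_zero)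
 qed
 have ac: "continuous_on {0..T} (%t. a (z t) v)" if v: "v \<in> V" for v
  unfolding continuous_on_def
 proof
  fix t assume t: "t \<in> {0..T}"
  have "((%s. a (z s) v - a (z t) v) \<longlongrightarrow> 0) (at t within {0..T})"
  proof (rule Lim_null_comparison)
   show "\<forall>\<^sub>F s in at t within {0..T}. norm (a (z s) v - a (z t) v) <= V.nrm (z s - z t) * (Ca * V.nrm v)"
    using a_bound[OF V.mem(4)[OF zV zV] v] a_diff_left[OF zV zV v] by (simp add: mult_ac)
  qed (rule tendsto_mult_left_zero[OF lim[OF t]])
  thus "((%s. a (z s) v) \<longlongrightarrow> a (z t) v) (at t within {0..T})" by (simp add: LIM_zero_iff)
 qed
 \<comment> \<open>The equation is read as a derivative for fixed \<open>v\<close> only; continuity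
   of \<open>z\<close> makes the right-hand side continuous, so the derivative exists at every time,
   one-sided at the endpoints.\<close>
 have hz: "((%t. hp (z t) v) has_real_derivative - a (z t) v) (at t within {0..T})" if t: "t \<in> {0..T}" and v: "v \<in> V" for t v
 proof -
  have e: "hp (z t) v = integral {0..t} (%s. - a (z s) v)" if t: "t \<in> {0..T}" for t
  proof -
   have "(%s. - a (z s) v) integrable_on {0..t}"
    by (rule integrable_continuous_real, rule continuous_on_minus, rule continuous_on_subset[OF ac[OF v]]) (use t in auto)
   have tT: "t <= T" using t by simp
   have hv: "hp v \<in> V.dual" using v by auto
   have ae: "AE s in time t. hp v (u s) = - a (z s) v"
    using AE_time_mono[OF uV tT] AE_time_mono[OF cu tT] AE_time_in
   proof eventually_elim
    case (elim s)
    hence s: "s \<in> {0..T}" using tT by auto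
    have "hp v (u s) = hp (c s) v" using hp_cong_left[OF cH[OF s] _ elim(2)] elim(1) v H.sym[of v "u s"] by simp
    thus ?case using cz[OF s v] by simp
   qed
   have i: "integrable (time t) (%s. hp v (u s))" by (rule time_integrable_subset[OF dual_integrable[OF u hv] tT])
   have m: "(%s. - a (z s) v) \<in> borel_measurable (time t)" by (rule time_measurable_AE[OF borel_measurable_integrable[OF i] ae])
   have "hp (z t) v = (LINT s|time t. hp v (u s))" using zk[OF t hv] H.sym[of v "z t"] v zV by simp
   also have "... = (LINT s|time t. - a (z s) v)" by (rule integral_cong_AE[OF borel_measurable_integrable[OF i] m ae])
   finally show ?thesis using integral_unique[OF time_has_integral[OF integrable_cong_AE_imp[OF i m ae]]] by (simp only:)
  qed
  have "((%t. integral {0..t} (%s. - a (z s) v)) has_real_derivative - a (z t) v) (at t within {0..T})"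
   unfolding has_real_derivative_iff_has_vector_derivative
   by (rule integral_has_vector_derivative[OF continuous_on_minus[OF ac[OF v]] t])
  thus ?thesis by (rule has_field_derivative_transform_within[OF _ zero_less_one t]) (simp add: e)
 qed
 have "compact (\<Phi> ` {0..T})" by (rule compact_continuous_image[OF \<Phi> compact_Icc])
 then obtain B where B: "!!y. y \<in> \<Phi> ` {0..T} ==> norm y <= B" using compact_imp_bounded bounded_iff by metis
 have zB: "V.nrm (z t) <= 2 * B" if t: "t \<in> {0..T}" for t
 proof -
  have "\<bar>\<Phi> t\<bar> <= B" "\<bar>\<Phi> 0\<bar> <= B" using B[of "\<Phi> t"] B[of "\<Phi> 0"] t T by auto
  moreover have "V.nrm (z t) <= V.nrm (z t - z 0) + V.nrm (z 0)" using V.triangle[OF V.mem(4)[OF zV zV] zV, of t 0 0] by simp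
  ultimately show ?thesis using z\<Phi>[of 0 t] z0 t T by simp
 qed
 \<comment> \<open>The chain rule for \<open>hp (z t) (z t)\<close> hinges on this: the mean value
   inequality, applied with the test vector \<open>z s - z t\<close> held fixed, makes the quadratic
   increment of smaller order than \<open>\<bar>s - t\<bar>\<close>.\<close>
 have sq: "hp (z s - z t) (z s - z t) <= Ca * (2 * B) * V.nrm (z s - z t) * \<bar>s - t\<bar>" if "s \<in> {0..T}" "t \<in> {0..T}" for s t
 proof -
  have w: "z s - z t \<in> V" using zV by auto
  have "norm (hp (z s) (z s - z t) - hp (z t) (z s - z t)) <= (Ca * (2 * B) * V.nrm (z s - z t)) * norm (s - t)"
  proof (rule field_differentiable_bound[OF _ hz[OF _ w] _ that])
   fix r assume r: "r \<in> {0..T}"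
   have "Ca * V.nrm (z r) * V.nrm (z s - z t) <= Ca * (2 * B) * V.nrm (z s - z t)"
    using zB[OF r] Ca V.nonneg[OF w] by (intro mult_right_mono mult_left_mono) auto
   thus "norm (- a (z r) (z s - z t)) <= Ca * (2 * B) * V.nrm (z s - z t)" using a_bound[OF zV w, of r] by simp
  qed simp
  thus ?thesis using w zV by (simp add: H.diff_left)
 qed
 define phi where "phi t = hp (z t) (z t)" for t
 have dphi: "(phi has_real_derivative - 2 * a (z t) (z t)) (at t within {0..T})" if t: "t \<in> {0..T}" for t
 proof -
  have "((%s. hp (z s - z t) (z s - z t)) has_real_derivative 0) (at t within {0..T})"
   unfolding has_field_derivative_iff
  proof (rule Lim_null_comparison)
   show "\<forall>\<^sub>F s in at t within {0..T}. norm ((hp (z s - z t) (z s - z t) - hp (z t - z t) (z t - z t)) / (s - t))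
     <= V.nrm (z s - z t) * (Ca * (2 * B))"
    unfolding eventually_at_filter
   proof (intro always_eventually allI impI)
    fix s assume s: "s \<noteq> t" "s \<in> {0..T}"
    have "0 <= hp (z s - z t) (z s - z t)" using zV by (intro H.pos) auto
    thus "norm ((hp (z s - z t) (z s - z t) - hp (z t - z t) (z t - z t)) / (s - t)) <= V.nrm (z s - z t) * (Ca * (2 * B))"
     using sq[OF s(2) t] s(1) by (simp add: divide_le_eq mult_ac)
   qed
  qed (rule tendsto_mult_left_zero[OF lim[OF t]])
  \<comment> \<open>\<open>hp (z s) (z s)\<close> equals \<open>2 * hp (z s) (z t) + hp (z s - z t)
    (z s - z t) - hp (z t) (z t)\<close>: a part linear in \<open>z s\<close>, a part with
    derivative 0 and a constant.\<close>
  from DERIV_add[OF DERIV_add[OF hz[OF t zV[of t]] hz[OF t zV[of t]]] DERIV_add[OF this DERIV_const[of "- hp (z t) (z t)"]]]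
  have "((%s. hp (z s) (z t) + hp (z s) (z t) + (hp (z s - z t) (z s - z t) + - hp (z t) (z t))) has_real_derivative - 2 * a (z t) (z t)) (at t within {0..T})"
   by simp
  moreover have "(%s. hp (z s) (z t) + hp (z s) (z t) + (hp (z s - z t) (z s - z t) + - hp (z t) (z t))) = phi"
  proof
   fix s
   show "hp (z s) (z t) + hp (z s) (z t) + (hp (z s - z t) (z s - z t) + - hp (z t) (z t)) = phi s"
    using zV H.sym[of "z t" "z s"] by (simp add: phi_def H.ip_simps)
  qed
  ultimately show ?thesis by (simp only:)
 qed
 have phi0: "phi t <= 0" if t: "t \<in> {0..T}" for t
 proof -
  have dE: "((%t. exp (- 2 * K * t) * phi t) has_real_derivative exp (- 2 * K * s) * (- 2 * a (z s) (z s) - 2 * K * phi s)) (at s within {0..T})"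
   if "s \<in> {0..T}" for s
   by (rule derivative_eq_intros dphi[OF that] refl)+ (simp add: algebra_simps)
  have "exp (- 2 * K * t) * phi t - exp (- 2 * K * 0) * phi 0 <= (LINT s|time t. 0)"
  proof (rule time_FTC_le[where F = "{}"])
   show "continuous_on {0..t} (%t. exp (- 2 * K * t) * phi t)"
    by (rule continuous_on_subset[OF DERIV_continuous_on[OF dE]]) (use t in auto)
   fix s assume s: "s \<in> {0<..<t} - {}"
   hence sT: "s \<in> {0..T}" "0 < s" "s < T" using t by auto
   show "((%t. exp (- 2 * K * t) * phi t) has_real_derivative exp (- 2 * K * s) * (- 2 * a (z s) (z s) - 2 * K * phi s)) (at s)"
    using dE[OF sT(1)] at_within_Icc_at[OF sT(2,3)] by simp
   have "0 <= c0 * (V.nrm (z s))^2" using c0 by simp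
   hence "- 2 * a (z s) (z s) - 2 * K * phi s <= 0"
    using garding[OF zV, of s] zV by (simp add: phi_def H.nrm_sq)
   thus "exp (- 2 * K * s) * (- 2 * a (z s) (z s) - 2 * K * phi s) <= 0" by (rule mult_nonneg_nonpos[rotated]) simp
  qed (use t in auto)
  moreover have "phi 0 = 0"
  proof -
   have "H.nrm (z 0) <= 0" using nrm_le[OF zV, of 0] z0 T by simp
   thus ?thesis using H.nrm_sq[OF VH'[OF zV], of 0] H.nonneg[OF VH'[OF zV], of 0] by (simp add: phi_def)
  qed
  ultimately show ?thesis by (simp add: mult_le_0_iff)
 qed
 show ?thesis
  using uV cu AE_time_in
 proof eventually_elim
  case (elim t)
  hence t: "t \<in> {0..T}" by auto
  \<comment> \<open>The primitive vanishes, so by \<open>cz\<close> the value \<open>c t\<close> is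
    orthogonal to all of \<open>V\<close>; testing with \<open>u t\<close> itself shows that
    \<open>u t\<close> has pivot norm zero.\<close>
  have "(H.nrm (z t))^2 <= 0" using phi0[OF t] H.nrm_sq[OF VH'[OF zV]] by (simp add: phi_def)
  hence "V.nrm (z t) = 0" using inj[OF zV] by simp
  hence "a (z t) (u t) = 0" using a_bound[OF zV elim(1), of t] by simp
  hence "hp (u t) (u t) = 0"
   using cz[OF t elim(1)] hp_cong_left[OF cH[OF t] _ elim(2)] elim(1) by simp
  thus ?case by (simp add: H.nrm_def)
 qed
qed

end

subsection \<open>Smooth functions\<close>

lemma frechet_eq: "(f has_derivative f') (at x) ==> frechet_derivative f (at x) = f'"
 using frechet_derivative_at by metis

lemma Ck_on_UNIV_Suc:
 "Ck_on (Suc k) UNIV f \<longleftrightarrow>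
   (ALL x. f differentiable (at x)) \<and> (ALL h. Ck_on k UNIV (%x. frechet_derivative f (at x) h))"
 by (simp add: differentiable_on_def)

lemma Ck_on_SucD: "Ck_on (Suc k) S f ==> Ck_on k S f"
proof (induction k arbitrary: f)
 case 0
 thus ?case by (simp add: differentiable_imp_continuous_on)
next
 case (Suc k)
 have d: "f differentiable_on S" and c: "!!h. Ck_on (Suc k) S (%x. frechet_derivative f (at x within S) h)"
  using Suc.prems by (simp_all only: Ck_on.simps(2)[of "Suc k"])
 thus ?case using Suc.IH by (simp add: Ck_on.simps(2)[of k])
qed

lemma Ck_const: "Ck_on k UNIV (%x. c)"
 by (induction k arbitrary: c) (simp_all add: differentiable_on_def)

lemma Ck_add: "Ck_on k UNIV f ==> Ck_on k UNIV g ==> Ck_on k UNIV (%x. f x + g x)"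
proof (induction k arbitrary: f g)
 case 0
 thus ?case by (simp add: continuous_on_add)
next
 case (Suc k)
 hence d: "f differentiable (at x)" "g differentiable (at x)" for x by (simp_all only: Ck_on_UNIV_Suc)
 have "frechet_derivative (%x. f x + g x) (at x) = (%h. frechet_derivative f (at x) h + frechet_derivative g (at x) h)" for x
  by (rule frechet_eq, rule has_derivative_add) (use d frechet_derivative_works in blast)+
 thus ?case using Suc d by (simp add: Ck_on_UNIV_Suc del: Ck_on.simps)
qed

lemma Ck_mult: "Ck_on k UNIV f ==> Ck_on k UNIV g ==> Ck_on k UNIV (%x. f x * g x)"
proof (induction k arbitrary: f g)
 case 0
 thus ?case by (simp add: continuous_on_mult)
next
 case (Suc k)
 hence d: "f differentiable (at x)" "g differentiable (at x)" for x by (simp_all only: Ck_on_UNIV_Suc)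
 have "frechet_derivative (%x. f x * g x) (at x) = (%h. f x * frechet_derivative g (at x) h + frechet_derivative f (at x) h * g x)" for x
  by (rule frechet_eq, rule has_derivative_mult) (use d frechet_derivative_works in blast)+
 moreover have "Ck_on k UNIV f" "Ck_on k UNIV g" using Suc.prems Ck_on_SucD by blast+
 ultimately show ?case using Suc d
  by (simp add: Ck_on_UNIV_Suc Ck_add del: Ck_on.simps)
qed

lemma Ck_cmult: "Ck_on k UNIV f ==> Ck_on k UNIV (%x. c * f x)"
 by (intro Ck_mult Ck_const)

lemma Ck_prod: "finite I ==> (!!i. i \<in> I ==> Ck_on k UNIV (f i)) ==> Ck_on k UNIV (%x. \<Prod>i\<in>I. f i x)"
 by (induction I rule: finite_induct) (simp_all add: Ck_const Ck_mult)

lemma Ck_affine: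
 fixes b :: "'a::euclidean_space" and F :: "real => real"
 assumes "Ck_on k UNIV F"
 shows "Ck_on k UNIV (%z. F (z \<bullet> b + c))"
 using assms
proof (induction k arbitrary: F)
 case 0
 hence "continuous_on UNIV F" by simp
 hence "continuous_on UNIV (%z. F (z \<bullet> b + c))"
  by (rule continuous_on_compose2) (auto intro!: continuous_intros)
 thus ?case by simp
next
 case (Suc k)
 hence d: "F differentiable (at s)" for s by (simp only: Ck_on_UNIV_Suc)
 have der: "((%z. F (z \<bullet> b + c)) has_derivative (%h. frechet_derivative F (at (z \<bullet> b + c)) (h \<bullet> b))) (at z)" for z
 proof -
  have "((%z. z \<bullet> b + c) has_derivative (%h. h \<bullet> b)) (at z)" by (auto intro!: derivative_eq_intros)
  moreover have "(F has_derivative frechet_derivative F (at (z \<bullet> b + c))) (at (z \<bullet> b + c))"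
   using d frechet_derivative_works by blast
  ultimately show ?thesis by (rule has_derivative_compose)
 qed
 have fr: "frechet_derivative (%z. F (z \<bullet> b + c)) (at z) = (%h. frechet_derivative F (at (z \<bullet> b + c)) (h \<bullet> b))" for z
  by (rule frechet_eq[OF der])
 have "Ck_on k UNIV (%z. frechet_derivative F (at (z \<bullet> b + c)) (h \<bullet> b))" for h
  by (rule Suc.IH) (use Suc.prems in \<open>simp only: Ck_on_UNIV_Suc\<close>)
 thus ?case using der unfolding Ck_on_UNIV_Suc fr differentiable_def by blast
qed

lemma Ck_real_derivative:
 fixes f :: "real => real"
 assumes d: "!!x. (f has_real_derivative f' x) (at x)" and c: "Ck_on k UNIV f'"
 shows "Ck_on (Suc k) UNIV f"
proof -
 have d': "(f has_derivative (%h. f' x * h)) (at x)" for x using d[of x] by (simp add: has_field_derivative_def)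
 have "frechet_derivative f (at x) = (%h. f' x * h)" for x by (rule frechet_eq[OF d'])
 thus ?thesis using d' Ck_mult[OF c Ck_const] unfolding Ck_on_UNIV_Suc differentiable_def by auto
qed

text \<open>Allowing all powers \<open>m\<close> makes the family closed under differentiation up to
  linear combinations, so smoothness follows by one induction on the order for all \<open>m\<close>
  at once. The parameter \<open>c\<close> is kept because \<open>exp (- c / t)\<close> tends to 1 as
  \<open>c\<close> tends to 0.\<close>

definition flat :: "real => nat => real => real" where
 "flat c m t = (if t > 0 then (1 / t) ^ m * exp (- c / t) else 0)"

lemma flat_right_limit:
 assumes c: "c > 0" shows "(flat c m \<longlongrightarrow> 0) (at_right 0)"
proof -
 have "((%x::real. x ^ m / exp x) \<longlongrightarrow> 0) at_top" by (rule tendsto_power_div_exp_0)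
 moreover have "filterlim (%t. c / t) at_top (at_right 0)"
  unfolding divide_inverse
  by (rule filterlim_tendsto_pos_mult_at_top[OF tendsto_const c filterlim_inverse_at_top_right])
 ultimately have "((%t. (c / t) ^ m / exp (c / t)) \<longlongrightarrow> 0) (at_right 0)" by (rule filterlim_compose)
 hence "((%t. (1 / c ^ m) * ((c / t) ^ m / exp (c / t))) \<longlongrightarrow> (1 / c ^ m) * 0) (at_right 0)"
  by (intro tendsto_intros)
 moreover have "\<forall>\<^sub>F t in at_right 0. (1 / c ^ m) * ((c / t) ^ m / exp (c / t)) = flat c m t"
  using eventually_at_right_less[of 0]
  by eventually_elim (use c in \<open>simp add: flat_def power_divide exp_minus field_simps\<close>)
 ultimately show ?thesis by (simp add: tendsto_cong)
qed

lemma flat_derivative: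
 assumes c: "c > 0"
 shows "(flat c m has_real_derivative (- real m * flat c (Suc m) t + c * flat c (Suc (Suc m)) t)) (at t)"
proof (cases t "0 :: real" rule: linorder_cases)
 case less
 have "\<forall>\<^sub>F s in nhds t. s \<in> {..<0}" using less by (intro eventually_nhds_in_open) auto
 hence "\<forall>\<^sub>F s in nhds t. flat c m s = 0" by eventually_elim (simp add: flat_def)
 thus ?thesis using less by (subst DERIV_cong_ev[OF refl _ refl]) (auto simp: flat_def)
next
 case greater
 have "\<forall>\<^sub>F s in nhds t. s \<in> {0<..}" using greater by (intro eventually_nhds_in_open) auto
 hence ev: "\<forall>\<^sub>F s in nhds t. flat c m s = (1 / s) ^ m * exp (- c / s)" by eventually_elim (simp add: flat_def)
 have "((%s. (1 / s) ^ m * exp (- c / s)) has_real_derivative (- real m * flat c (Suc m) t + c * flat c (Suc (Suc m)) t)) (at t)"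
 proof -
  define q where "q = 1 / t"
  define D where "D = - (q * q)"
  have d1: "((%s. 1 / s) has_real_derivative D) (at t)"
   using greater by (auto intro!: derivative_eq_intros simp: D_def q_def)
  have d2: "((%s. exp (- c / s)) has_real_derivative exp (- c / t) * (- c * D)) (at t)"
   using greater by (auto intro!: derivative_eq_intros simp: D_def q_def)
  have "((%s. (1 / s) ^ m * exp (- c / s)) has_real_derivative
    (real m * (D * (1 / t) ^ (m - Suc 0))) * exp (- c / t) + (exp (- c / t) * (- c * D)) * (1 / t) ^ m) (at t)"
   by (rule DERIV_mult[OF DERIV_power[OF d1] d2])
  moreover have "(real m * (D * (1 / t) ^ (m - Suc 0))) * exp (- c / t) + (exp (- c / t) * (- c * D)) * (1 / t) ^ m
    = - real m * flat c (Suc m) t + c * flat c (Suc (Suc m)) t"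
   using greater unfolding flat_def q_def[symmetric] D_def by (cases m) (simp_all add: algebra_simps)
  ultimately show ?thesis by simp
 qed
 thus ?thesis using ev by (subst DERIV_cong_ev[OF refl _ refl])
next
 case equal
 have "(flat c m has_real_derivative 0) (at 0)"
  unfolding has_field_derivative_iff
 proof (subst filterlim_at_split, intro conjI)
  have "\<forall>\<^sub>F t in at_left (0::real). (flat c m t - flat c m 0) / (t - 0) = 0"
   unfolding eventually_at_filter by (intro always_eventually) (simp add: flat_def)
  thus "((%t. (flat c m t - flat c m 0) / (t - 0)) \<longlongrightarrow> 0) (at_left 0)" by (rule tendsto_eventually)
  have "\<forall>\<^sub>F t in at_right (0::real). flat c (Suc m) t = (flat c m t - flat c m 0) / (t - 0)"
   using eventually_at_right_less[of 0] by eventually_elim (simp add: flat_def)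
  thus "((%t. (flat c m t - flat c m 0) / (t - 0)) \<longlongrightarrow> 0) (at_right 0)"
   using flat_right_limit[OF c, of "Suc m"] by (simp add: tendsto_cong)
 qed
 thus ?thesis using equal by (simp add: flat_def)
qed

lemma Ck_flat:
 assumes c: "c > 0" shows "Ck_on k UNIV (flat c m)"
proof (induction k arbitrary: m)
 case 0
 have "isCont (flat c m) x" for x using flat_derivative[OF c] DERIV_isCont by blast
 thus ?case by (simp add: continuous_on_eq_continuous_at)
next
 case (Suc k)
 show ?case
  by (rule Ck_real_derivative[OF flat_derivative[OF c]]) (intro Ck_add Ck_cmult Suc.IH)
qed

text \<open>The product over the coordinates vanishes outside the open box from \<open>a\<close> to
  \<open>b\<close> and increases to its indicator as \<open>c\<close> decreases to 0, so test
  functions detect integrals over boxes.\<close>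

definition bump :: "real => 'a::euclidean_space => 'a => 'a => real" where
 "bump c a b z = (\<Prod>i\<in>Basis. flat c 0 (z \<bullet> i - a \<bullet> i) * flat c 0 (b \<bullet> i - z \<bullet> i))"

lemma flat_bounds: "c > 0 ==> 0 <= flat c 0 t \<and> flat c 0 t <= 1"
 by (auto simp: flat_def)

lemma Ck_bump:
 assumes c: "c > 0" shows "Ck_on k UNIV (bump c a b)"
 unfolding bump_def
proof (intro Ck_prod Ck_mult)
 fix i :: 'a
 show "Ck_on k UNIV (%z. flat c 0 (z \<bullet> i - a \<bullet> i))"
  using Ck_affine[OF Ck_flat[OF c], of k 0 i "- (a \<bullet> i)"] by simp
 show "Ck_on k UNIV (%z. flat c 0 (b \<bullet> i - z \<bullet> i))"
  using Ck_affine[OF Ck_flat[OF c], of k 0 "- i" "b \<bullet> i"] by simp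
qed simp

lemma bump_outside: "z \<notin> box a b ==> bump c a b z = 0"
 by (auto simp: bump_def mem_box flat_def)

lemma bump_bounds: "c > 0 ==> 0 <= bump c a b z" "c > 0 ==> bump c a b z <= 1"
 unfolding bump_def using flat_bounds[of c] by (auto intro!: prod_nonneg prod_le_1 mult_le_one)

lemma bump_test_function: "c > 0 ==> cbox a b \<subseteq> U ==> bump c a b \<in> test_functions U"
 unfolding test_functions_def
proof (intro CollectI conjI allI exI[of _ "cbox a b"] impI)
 fix z assume "z \<notin> cbox a b"
 thus "bump c a b z = 0" using bump_outside[of z a b c] box_subset_cbox[of a b] by blast
qed (auto simp: Ck_bump)

lemma bump_limit: "(%k. bump (1 / real (Suc k)) a b z) \<longlonglongrightarrow> indicator (box a b) z"
proof (cases "z \<in> box a b")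
 case True
 have fl: "(%k. flat (1 / real (Suc k)) 0 t) \<longlonglongrightarrow> 1" if t: "t > 0" for t
 proof -
  have "(%k. exp (- (1 / real (Suc k)) / t)) \<longlonglongrightarrow> exp (- 0 / t)"
   using t by (intro tendsto_intros LIMSEQ_Suc lim_1_over_n) auto
  thus ?thesis using t by (simp add: flat_def)
 qed
 have "(%k. bump (1 / real (Suc k)) a b z) \<longlonglongrightarrow> (\<Prod>i\<in>(Basis::'a set). 1 * 1)"
  unfolding bump_def by (intro tendsto_prod tendsto_mult fl) (use True in \<open>auto simp: mem_box\<close>)
 thus ?thesis using True by simp
next
 case False
 thus ?thesis by (simp add: bump_outside)
qed

lemma test_function_continuous: "psi \<in> test_functions U ==> continuous_on UNIV psi"
proof -
 assume "psi \<in> test_functions U"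
 hence "Ck_on 0 UNIV psi" unfolding test_functions_def by blast
 thus ?thesis by simp
qed

lemma test_function_derivative:
 "psi \<in> test_functions U ==> (psi has_derivative frechet_derivative psi (at z)) (at z)"
 "psi \<in> test_functions U ==> continuous_on UNIV (%z. frechet_derivative psi (at z) b)"
proof -
 assume psi: "psi \<in> test_functions U"
 hence "Ck_on (Suc 0) UNIV psi" unfolding test_functions_def by blast
 hence *: "psi differentiable (at z)" "!!h. Ck_on 0 UNIV (%x. frechet_derivative psi (at x) h)"
  unfolding Ck_on_UNIV_Suc by blast+
 thus "(psi has_derivative frechet_derivative psi (at z)) (at z)"
  "continuous_on UNIV (%z. frechet_derivative psi (at z) b)"
  using frechet_derivative_works by auto
qed

subsection \<open>The fundamental lemma of the calculus of variations\<close>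

lemma enn2real_inject: "enn2real x = enn2real y ==> x \<noteq> top ==> y \<noteq> top ==> x = y"
 by (cases x; cases y) auto

text \<open>The positive and the negative part of \<open>g\<close> are densities of two measures
  that agree on boxes, an intersection-stable generator of the Borel sets. So the densities agree
  almost everywhere, which is possible only where \<open>g\<close> vanishes.\<close>

lemma integrable_box_zero:
 fixes g :: "'a::euclidean_space => real"
 assumes g: "integrable lborel g" and 0: "!!a b. (LINT z|lborel. indicator (box a b) z * g z) = 0"
 shows "AE z in lborel. g z = 0"
proof -
 have [measurable]: "g \<in> borel_measurable borel" using g by simp
 let ?p = "%z. ennreal (g z)" and ?m = "%z. ennreal (- g z)"
 let ?E = "range (%(a, b). box a b::'a set)"
 have finite: "(\<integral>\<^sup>+z. ennreal (s * g z) * indicator A z \<partial>lborel) \<noteq> \<infinity>" if "\<bar>s\<bar> = 1" "A \<in> sets borel" for A s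
 proof -
  have "(\<integral>\<^sup>+z. ennreal (s * g z) * indicator A z \<partial>lborel) <= (\<integral>\<^sup>+z. ennreal (norm (g z)) \<partial>lborel)"
  proof (rule nn_integral_mono)
   fix z
   have "s * g z <= \<bar>g z\<bar>" using that(1) by (metis abs_ge_self abs_mult mult_1)
   thus "ennreal (s * g z) * indicator A z <= ennreal (norm (g z))"
    by (auto simp: indicator_def intro!: ennreal_leI)
  qed
  also have "... < \<infinity>" using g by (simp add: integrable_iff_bounded)
  finally show ?thesis by simp
 qed
 have eqbox: "(\<integral>\<^sup>+z. ?p z * indicator (box a b) z \<partial>lborel) = (\<integral>\<^sup>+z. ?m z * indicator (box a b) z \<partial>lborel)" for a b :: 'a
 proof -
  have i: "integrable lborel (%z. indicator (box a b) z * g z)"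
   using integrable_mult_indicator[OF _ g, of "box a b"] by simp
  have e: "ennreal (indicator (box a b) z * g z) = ?p z * indicator (box a b) z"
   "ennreal (- (indicator (box a b) z * g z)) = ?m z * indicator (box a b) z" for z
   by (auto simp: indicator_def)
  have "enn2real (\<integral>\<^sup>+z. ?p z * indicator (box a b) z \<partial>lborel) = enn2real (\<integral>\<^sup>+z. ?m z * indicator (box a b) z \<partial>lborel)"
   using real_lebesgue_integral_def[OF i] 0[of a b] by (simp add: e)
  moreover have "(\<integral>\<^sup>+z. ?p z * indicator (box a b) z \<partial>lborel) \<noteq> top" "(\<integral>\<^sup>+z. ?m z * indicator (box a b) z \<partial>lborel) \<noteq> top"
   using finite[of 1 "box a b"] finite[of "-1" "box a b"] by simp_all
  ultimately show ?thesis by (rule enn2real_inject)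
 qed
 have "density lborel ?p = density lborel ?m"
 proof (rule measure_eqI_generator_eq)
  show "Int_stable ?E" by (auto simp: Int_stable_def box_Int_box)
  show "?E \<subseteq> Pow UNIV" "sets (density lborel ?p) = sigma_sets UNIV ?E" "sets (density lborel ?m) = sigma_sets UNIV ?E"
   by (simp_all add: borel_eq_box)
  let ?A = "%n::nat. box (- (real n *\<^sub>R One)) (real n *\<^sub>R One) :: 'a set"
  show "range ?A \<subseteq> ?E" "(\<Union>i. ?A i) = UNIV"
   unfolding UN_box_eq_UNIV by auto
  show "emeasure (density lborel ?p) (?A i) \<noteq> \<infinity>" for i using finite[of 1 "?A i"] by (simp add: emeasure_density)
  show "emeasure (density lborel ?p) X = emeasure (density lborel ?m) X" if XE: "X \<in> ?E" for X
  proof -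
   obtain a b where X: "X = box a b" using XE by auto
   show ?thesis unfolding X by (subst (1 2) emeasure_density) (use eqbox[of a b] in auto)
  qed
 qed
 hence "AE z in lborel. ?p z = ?m z"
  by (intro sigma_finite_measure.density_unique[OF sigma_finite_lborel]) auto
 thus ?thesis
 proof eventually_elim
  case (elim z)
  show ?case
  proof (cases "g z >= 0")
   case True
   thus ?thesis using elim by (simp add: ennreal_neg)
  next
   case False
   thus ?thesis using elim by (simp add: ennreal_neg)
  qed
 qed
qed

lemma lborel_cbox_AE: "AE z in lborel. z \<in> cbox a b --> z \<in> box a (b :: 'a::euclidean_space)"
proof -
 have "cbox a b - box a b \<in> null_sets lborel"
  using negligible_frontier_interval[of a b] null_sets_completion_iff[of "cbox a b - box a b" lborel]
  by (simp add: negligible_iff_null_sets)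
 from AE_not_in[OF this] show ?thesis by eventually_elim auto
qed

text \<open>Bump functions tend to indicators of boxes, so \<open>G\<close> has integral zero over
  every box whose closed version lies in \<open>U\<close>; \<open>integrable_box_zero\<close>
  handles one box at a time, and countably many boxes cover \<open>U\<close>.\<close>

theorem fundamental_lemma:
 fixes G :: "'a::euclidean_space => real"
 assumes U: "open U" and G: "!!K. compact K ==> K \<subseteq> U ==> set_integrable lborel K G"
  and 0: "!!psi. psi \<in> test_functions U ==> (LINT z:U|lborel. G z * psi z) = 0"
 shows "AE z in lborel. z \<in> U --> G z = 0"
proof -
 have zero: "(LINT z|lborel. indicator (box a b) z * G z) = 0" if ab: "cbox a b \<subseteq> U" for a b
 proof -
  have Gi: "integrable lborel (%z. indicator (cbox a b) z * G z)"
   using G[OF compact_cbox ab] by (simp add: set_integrable_def)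
  define B where "B k = bump (1 / real (Suc k)) a b" for k
  have Bm: "B k \<in> borel_measurable borel" for k unfolding B_def
   by (intro borel_measurable_continuous_onI test_function_continuous[of _ U] bump_test_function) (use ab in auto)
  have "(%k. \<integral>z. indicator (cbox a b) z * G z * B k z \<partial>lborel) \<longlonglongrightarrow> (LINT z|lborel. indicator (cbox a b) z * G z * indicator (box a b) z)"
  proof (rule integral_dominated_convergence)
   show "integrable lborel (%z. \<bar>indicator (cbox a b) z * G z\<bar>)" using Gi by (rule integrable_abs)
   show "(%z. indicator (cbox a b) z * G z * indicator (box a b) z) \<in> borel_measurable lborel"
    by (intro borel_measurable_times borel_measurable_integrable[OF Gi] borel_measurable_indicator) simp
   show "(%z. indicator (cbox a b) z * G z * B k z) \<in> borel_measurable lborel" for k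
    by (intro borel_measurable_times borel_measurable_integrable[OF Gi]) (use Bm in simp)
   show "AE z in lborel. (%k. indicator (cbox a b) z * G z * B k z) \<longlonglongrightarrow> indicator (cbox a b) z * G z * indicator (box a b) z"
    unfolding B_def by (intro AE_I2 tendsto_mult tendsto_const bump_limit)
   show "AE z in lborel. norm (indicator (cbox a b) z * G z * B k z) <= \<bar>indicator (cbox a b) z * G z\<bar>" for k
   proof (rule AE_I2)
    fix z
    have "\<bar>B k z\<bar> <= 1" using bump_bounds[of "1 / real (Suc k)" a b z] by (simp add: B_def)
    hence "\<bar>indicator (cbox a b) z * G z\<bar> * \<bar>B k z\<bar> <= \<bar>indicator (cbox a b) z * G z\<bar> * 1"
     by (intro mult_left_mono) auto
    thus "norm (indicator (cbox a b) z * G z * B k z) <= \<bar>indicator (cbox a b) z * G z\<bar>" by (simp add: abs_mult)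
   qed
  qed
  moreover have "(LINT z|lborel. indicator (cbox a b) z * G z * B k z) = 0" for k
  proof -
   have "(LINT z|lborel. indicator (cbox a b) z * G z * B k z) = (LINT z:U|lborel. G z * B k z)"
    unfolding set_lebesgue_integral_def
    by (rule Bochner_Integration.integral_cong)
      (use ab bump_outside[of _ a b] box_subset_cbox[of a b] in \<open>auto simp: indicator_def B_def\<close>)
   also have "... = 0" unfolding B_def by (intro 0 bump_test_function ab) simp
   finally show ?thesis .
  qed
  ultimately have "(LINT z|lborel. indicator (cbox a b) z * G z * indicator (box a b) z) = 0"
   using LIMSEQ_unique[OF _ tendsto_const] by auto
  moreover have "indicator (cbox a b) z * G z * indicator (box a b) z = indicator (box a b) z * G z" for z
   using box_subset_cbox[of a b] by (auto simp: indicator_def)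
  ultimately show ?thesis by simp
 qed
 have local: "AE z in lborel. z \<in> cbox a b --> G z = 0" if ab: "cbox a b \<subseteq> U" for a b
 proof -
  have Gi: "integrable lborel (%z. indicator (cbox a b) z * G z)"
   using G[OF compact_cbox ab] by (simp add: set_integrable_def)
  have "AE z in lborel. indicator (box a b) z * G z = 0"
  proof (rule integrable_box_zero)
   have "integrable lborel (%z. indicator (box a b) z *\<^sub>R (indicator (cbox a b) z * G z))"
    by (rule integrable_mult_indicator[OF _ Gi]) simp
   moreover have "(%z. indicator (box a b) z *\<^sub>R (indicator (cbox a b) z * G z)) = (%z. indicator (box a b) z * G z)"
    using box_subset_cbox[of a b] by (auto simp: indicator_def fun_eq_iff)
   ultimately show "integrable lborel (%z. indicator (box a b) z * G z)" by (simp only:)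
   fix p q
   \<comment> \<open>The intersection of two open boxes is a box, again with its closed version
     inside \<open>U\<close>, so \<open>zero\<close> applies to it.\<close>
   define p' q' where "p' = (\<Sum>i\<in>Basis. max (p\<bullet>i) (a\<bullet>i) *\<^sub>R i)" and "q' = (\<Sum>i\<in>Basis. min (q\<bullet>i) (b\<bullet>i) *\<^sub>R i)"
   have "box p q \<inter> box a b = box p' q'" unfolding p'_def q'_def by (rule box_Int_box)
   hence "(%z. indicator (box p q) z * (indicator (box a b) z * G z)) = (%z. indicator (box p' q') z * G z)"
    by (metis (no_types) indicator_inter_arith mult.assoc)
   moreover have "cbox p' q' \<subseteq> U"
    by (rule order_trans[OF _ ab]) (auto simp: p'_def q'_def mem_box)
   ultimately show "(LINT z|lborel. indicator (box p q) z * (indicator (box a b) z * G z)) = 0"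
    using zero by (simp only:)
  qed
  thus ?thesis using lborel_cbox_AE[of a b] by eventually_elim auto
 qed
 obtain \<D> where D: "countable \<D>" "\<D> \<subseteq> Pow U" "!!X. X \<in> \<D> ==> EX a b. X = cbox a b" "\<Union>\<D> = U"
  by (rule open_countable_Union_open_cbox[OF U]) (rule that, assumption+)
 have "AE z in lborel. ALL X:\<D>. z \<in> X --> G z = 0"
 proof (subst AE_ball_countable[OF D(1)], rule ballI)
  fix X assume X: "X \<in> \<D>"
  then obtain a b where Xab: "X = cbox a b" using D(3) by blast
  have "cbox a b \<subseteq> U" using X D(2) Xab by blast
  thus "AE z in lborel. z \<in> X --> G z = 0" unfolding Xab by (rule local)
 qed
 thus ?thesis
 proof eventually_elim
  case (elim z)
  thus ?case using D(4) by blast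
 qed
qed

lemma test_function_deriv:
 fixes eta :: "real => real"
 assumes eta: "eta \<in> test_functions U"
 shows "(eta has_real_derivative deriv eta t) (at t)" "continuous_on S (deriv eta)"
proof -
 have d: "(eta has_real_derivative frechet_derivative eta (at t) 1) (at t)" for t
 proof -
  have D: "(eta has_derivative frechet_derivative eta (at t)) (at t)" by (rule test_function_derivative(1)[OF eta])
  have "frechet_derivative eta (at t) h = frechet_derivative eta (at t) 1 * h" for h
   using linear_cmul[OF has_derivative_linear[OF D], of h 1] by (simp add: mult.commute)
  hence "frechet_derivative eta (at t) = (*) (frechet_derivative eta (at t) 1)" by (rule ext)
  with D show ?thesis unfolding has_field_derivative_def by (rule subst[rotated])
 qed
 have e: "deriv eta = (%t. frechet_derivative eta (at t) 1)" using DERIV_imp_deriv[OF d] by (simp add: fun_eq_iff)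
 show "(eta has_real_derivative deriv eta t) (at t)" unfolding e by (rule d)
 show "continuous_on S (deriv eta)" unfolding e
  by (rule continuous_on_subset[OF test_function_derivative(2)[OF eta]]) simp
qed

text \<open>The convolution of \<open>f\<close> with a bump is constant, and approximates \<open>f\<close>.\<close>

theorem du_Bois_Reymond:
 fixes f :: "real => real"
 assumes T: "T > 0" and f: "continuous_on {0..T} f"
  and 0: "!!eta. eta \<in> test_functions {0<..<T} ==> integral {0..T} (%t. deriv eta t * f t) = 0"
  and t: "t \<in> {0..T}"
 shows "f t = f (T / 2)"
proof -
 have inner: "f s = f r" if s: "s \<in> {0<..<T}" and r: "r \<in> {0<..<T}" for s r
 proof (rule ccontr)
  assume ne: "f s \<noteq> f r"
  \<comment> \<open>Two errors of size \<open>e\<close> stay below the gap \<open>3 * e\<close>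
    between the two values.\<close>
  define e where "e = \<bar>f s - f r\<bar> / 3"
  have e: "e > 0" using ne by (simp add: e_def)
  have near: "EX d>0. ALL x:{0..T}. \<bar>x - y\<bar> < d --> \<bar>f x - f y\<bar> < e" if "y \<in> {0<..<T}" for y
   using f e that unfolding continuous_on_iff dist_real_def by force
  obtain d1 where d1: "d1 > 0" "!!x. x \<in> {0..T} ==> \<bar>x - s\<bar> < d1 ==> \<bar>f x - f s\<bar> < e" using near[OF s] by blast
  obtain d2 where d2: "d2 > 0" "!!x. x \<in> {0..T} ==> \<bar>x - r\<bar> < d2 ==> \<bar>f x - f r\<bar> < e" using near[OF r] by blast
  \<comment> \<open>Half of \<open>m\<close> suits both continuity estimates and keeps the supports
    of the bumps centred at \<open>s\<close>, at \<open>r\<close> and at all points between inside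
    the open interval.\<close>
  define m where "m = min (min d1 d2) (min (min s r) (min (T - s) (T - r)))"
  have m: "0 < m" "m <= d1" "m <= d2" "m <= s" "m <= r" "m <= T - s" "m <= T - r" using d1(1) d2(1) s r by (auto simp: m_def)
  define h where "h = m / 2"
  have h: "0 < h" "h < d1" "h < d2" "h < s" "h < r" "h < T - s" "h < T - r"
   using m unfolding h_def by linarith+
  define B where "B = bump 1 (- h) h"
  define J where "J = {min s r..max s r}"
  have B: "B \<in> test_functions UNIV" unfolding B_def by (rule bump_test_function) auto
  have Bc: "continuous_on S B" for S using test_function_continuous[OF B] continuous_on_subset by blast
  have shift: "(%t. B (t - x)) = bump 1 (x - h) (x + h)" for x by (auto simp: B_def bump_def fun_eq_iff algebra_simps)
  have test: "(%t. B (t - x)) \<in> test_functions {0<..<T}" if "x \<in> J" for x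
   unfolding shift using h that by (intro bump_test_function) (auto simp: J_def)
  have dB: "deriv (%t. B (t - x)) t = deriv B (t - x)" for x t
  proof (rule DERIV_imp_deriv)
   have "((%t. t - x) has_real_derivative 1) (at t)" by (auto intro!: derivative_eq_intros)
   from DERIV_chain2[where f = B, OF test_function_deriv(1)[OF B] this] show "((%t. B (t - x)) has_real_derivative deriv B (t - x)) (at t)" by simp
  qed
  \<comment> \<open>Moving the centre \<open>x\<close> differentiates the bump, and
    \<open>deriv B (t - x)\<close> is the derivative of a test function, so the weighted mean of
    \<open>g\<close> does not depend on \<open>x\<close>. This is used for \<open>f\<close> and for
    the constant 1, whose mean is the mass \<open>I\<close>.\<close>
  have const: "integral {0..T} (%t. B (t - s) * g t) = integral {0..T} (%t. B (t - r) * g t)"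
   if g: "continuous_on {0..T} g" and g0: "!!eta. eta \<in> test_functions {0<..<T} ==> integral {0..T} (%t. deriv eta t * g t) = 0" for g
  proof -
   have "((%x. integral (cbox 0 T) (%t. B (t - x) * g t)) has_field_derivative 0) (at x within J)" if x: "x \<in> J" for x
   proof -
    have "((%x. integral (cbox 0 T) (%t. B (t - x) * g t)) has_field_derivative integral (cbox 0 T) (%t. - deriv B (t - x) * g t)) (at x within J)"
    proof (rule leibniz_rule_field_derivative)
     show "((%x. B (t - x) * g t) has_field_derivative - deriv B (t - x) * g t) (at x within J)" for x t
     proof (rule DERIV_cmult_right)
      have "((%x. t - x) has_real_derivative - 1) (at x within J)" by (auto intro!: derivative_eq_intros)
      from DERIV_chain2[where f = B, OF test_function_deriv(1)[OF B] this] show "((%x. B (t - x)) has_real_derivative - deriv B (t - x)) (at x within J)" by simp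
     qed
     show "(%t. B (t - x) * g t) integrable_on cbox 0 T" for x
      by (intro integrable_continuous continuous_on_mult continuous_on_compose2[OF Bc[of UNIV]] continuous_intros) (use g in auto)
     show "continuous_on (J \<times> cbox 0 T) (%(x, t). - deriv B (t - x) * g t)"
      unfolding case_prod_beta' using g
      by (intro continuous_on_mult continuous_on_minus continuous_on_compose2[OF test_function_deriv(2)[OF B, of UNIV]]
       continuous_on_compose2[OF g] continuous_intros) auto
    qed (use x in \<open>auto simp: J_def\<close>)
    moreover have "integral (cbox 0 T) (%t. - deriv B (t - x) * g t) = 0" using g0[OF test[OF x]] by (simp add: dB)
    ultimately show ?thesis by simp
   qed
   from has_field_derivative_zero_constant[OF _ this]
   obtain k where "!!x. x \<in> J ==> integral (cbox 0 T) (%t. B (t - x) * g t) = k" by (auto simp: J_def)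
   from this[of s] this[of r] show ?thesis by (simp add: J_def)
  qed
  define I where "I = integral {0..T} (%t. B (t - s) * 1)"
  have I: "integral {0..T} (%t. B (t - r) * 1) = I" unfolding I_def
  proof (rule const[symmetric])
   fix eta assume eta: "eta \<in> test_functions {0<..<T}"
   have "eta 0 = 0" "eta T = 0" using eta unfolding test_functions_def by force+
   moreover have "(deriv eta has_integral eta T - eta 0) {0..T}"
    using T test_function_deriv(1)[OF eta]
    by (intro fundamental_theorem_of_calculus) (auto simp: has_real_derivative_iff_has_vector_derivative[symmetric] intro: has_field_derivative_at_within)
   ultimately show "integral {0..T} (%t. deriv eta t * 1) = 0" by (simp add: integral_unique)
  qed simp
  have Bi: "(%t. B (t - x) * g t) integrable_on {0..T}" if "continuous_on {0..T} g" for x g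
   by (intro integrable_continuous_real continuous_on_mult continuous_on_compose2[OF Bc[of UNIV]] continuous_intros) (use that in auto)
  have B0: "0 <= B y" for y unfolding B_def by (rule bump_bounds) simp
  have "I \<noteq> 0"
  proof
   assume "I = 0"
   moreover have "continuous_on {0..T} (%t. B (t - s))"
    by (intro continuous_on_compose2[OF Bc[of UNIV]] continuous_intros) auto
   ultimately have "ALL x:{0..T}. B (x - s) = 0" unfolding I_def using integral_eq_0_iff[of 0 T "%t. B (t - s)"] T B0 by simp
   hence "B (s - s) = 0" using s by (intro bspec[where x = s]) auto
   thus False using h by (auto simp: B_def bump_def flat_def)
  qed
  moreover have "0 <= I" unfolding I_def using B0 by (intro integral_nonneg Bi) auto
  ultimately have Ip: "I > 0" by simp
  have est: "\<bar>integral {0..T} (%t. B (t - y) * f t) - f y * I\<bar> <= e * I"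
   if y: "integral {0..T} (%t. B (t - y) * 1) = I" "!!x. x \<in> {0..T} ==> \<bar>x - y\<bar> < h ==> \<bar>f x - f y\<bar> <= e" for y
  proof -
   have "integral {0..T} (%t. B (t - y) * f t) - f y * I = integral {0..T} (%t. B (t - y) * f t - f y * (B (t - y) * 1))"
    unfolding y(1)[symmetric] by (subst Henstock_Kurzweil_Integration.integral_diff[OF Bi[OF f] integrable_on_mult_right[OF Bi[OF continuous_on_const]]]) simp
   moreover have "norm (integral {0..T} (%t. B (t - y) * f t - f y * (B (t - y) * 1))) <= integral {0..T} (%t. e * (B (t - y) * 1))"
   proof (rule integral_norm_bound_integral)
    show "(%t. B (t - y) * f t - f y * (B (t - y) * 1)) integrable_on {0..T}" "(%t. e * (B (t - y) * 1)) integrable_on {0..T}"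
     by (intro integrable_diff integrable_on_mult_right Bi f continuous_on_const)+
    fix t assume t: "t \<in> {0..T}"
    have "t - y \<notin> box (- h) h" if "\<not> \<bar>t - y\<bar> < h" using that unfolding box_real greaterThanLessThan_iff by linarith
    hence "B (t - y) = 0 \<or> \<bar>t - y\<bar> < h" using bump_outside[of "t - y" "- h" h 1] unfolding B_def by blast
    hence "B (t - y) * \<bar>f t - f y\<bar> <= B (t - y) * e" using y(2)[OF t] B0 by (auto intro: mult_left_mono)
    thus "norm (B (t - y) * f t - f y * (B (t - y) * 1)) <= e * (B (t - y) * 1)"
     using B0[of "t - y"] abs_mult[of "B (t - y)" "f t - f y"] by (simp add: right_diff_distrib mult.commute)
   qed
   ultimately show ?thesis using y(1) by simp
  qed
  have "\<bar>f s * I - f r * I\<bar> <= 2 * (e * I)"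
  proof -
   have e1: "\<bar>f x - f s\<bar> <= e" if "x \<in> {0..T}" "\<bar>x - s\<bar> < h" for x using d1(2)[OF that(1)] that(2) h(2) by linarith
   have e2: "\<bar>f x - f r\<bar> <= e" if "x \<in> {0..T}" "\<bar>x - r\<bar> < h" for x using d2(2)[OF that(1)] that(2) h(3) by linarith
   have "\<bar>integral {0..T} (%t. B (t - s) * f t) - f s * I\<bar> <= e * I" by (rule est[OF I_def[symmetric] e1])
   moreover have "\<bar>integral {0..T} (%t. B (t - r) * f t) - f r * I\<bar> <= e * I" by (rule est[OF I e2])
   moreover have "integral {0..T} (%t. B (t - s) * f t) = integral {0..T} (%t. B (t - r) * f t)" by (rule const[OF f 0])
   ultimately show ?thesis by linarith
  qed
  hence "\<bar>f s - f r\<bar> * I <= (2 * e) * I" using Ip by (simp add: abs_mult flip: left_diff_distrib)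
  hence "\<bar>f s - f r\<bar> <= 2 * e" using Ip by simp
  thus False using e by (simp add: e_def)
 qed
 have "closure {0<..<T} = {0..T}" by (rule closure_greaterThanLessThan[OF T])
 hence c: "continuous_on (closure {0<..<T}) f" "t \<in> closure {0<..<T}" using f t by auto
 have "f x = f (T / 2)" if "x \<in> {0<..<T}" for x by (rule inner[OF that]) (use T in simp)
 from continuous_constant_on_closure[OF c(1) this c(2)] show ?thesis .
qed

subsection \<open>Spherical coordinates\<close>

text \<open>The components of \<open>v\<close> are radius, azimuth and polar angle, in this order;
  the last two are the arguments of \<open>direction\<close>.\<close>

definition spherical :: "real^3 => real^3" where
 "spherical v = (v$1 * cos (v$2) * sin (v$3)) *\<^sub>R axis 1 1 + (v$1 * sin (v$2) * sin (v$3)) *\<^sub>R axis 2 1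
   + (v$1 * cos (v$3)) *\<^sub>R axis 3 1"

definition spherical' :: "real^3 => real^3 => real^3" where
 "spherical' v h = (h$1 * cos (v$2) * sin (v$3) - v$1 * sin (v$2) * h$2 * sin (v$3) + v$1 * cos (v$2) * cos (v$3) * h$3) *\<^sub>R axis 1 1
   + (h$1 * sin (v$2) * sin (v$3) + v$1 * cos (v$2) * h$2 * sin (v$3) + v$1 * sin (v$2) * cos (v$3) * h$3) *\<^sub>R axis 2 1
   + (h$1 * cos (v$3) - v$1 * sin (v$3) * h$3) *\<^sub>R axis 3 1"

lemma has_derivative_vec_nth: "((%v. v $ i) has_derivative (%h. h $ i)) (at x within S)"
 by (rule bounded_linear.has_derivative[OF bounded_linear_vec_nth has_derivative_ident])

lemma spherical_derivative: "(spherical has_derivative spherical' v) (at v within S)"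
proof -
 have [derivative_intros]: "((%v. v $ i) has_derivative (%h. h $ i)) (at v within S)" for i :: 3
  by (rule has_derivative_vec_nth)
 show ?thesis unfolding spherical_def[abs_def] spherical'_def[abs_def]
  by (rule derivative_eq_intros refl | simp add: algebra_simps)+
qed

lemma spherical_nth [simp]:
 "spherical v $ 1 = v$1 * cos (v$2) * sin (v$3)" "spherical v $ 2 = v$1 * sin (v$2) * sin (v$3)"
 "spherical v $ 3 = v$1 * cos (v$3)"
 by (simp_all add: spherical_def axis_def)

lemma direction_nth [simp]:
 "direction phi theta $ 1 = cos phi * sin theta" "direction phi theta $ 2 = sin phi * sin theta" "direction phi theta $ 3 = cos theta"
 by (simp_all add: direction_def)

lemma vec3_eqI: "x $ 1 = y $ 1 ==> x $ 2 = y $ 2 ==> x $ 3 = y $ 3 ==> x = (y :: 'a^3)"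
 by (simp add: vec_eq_iff forall_3)

lemma spherical_direction: "spherical v = v$1 *\<^sub>R direction (v$2) (v$3)"
 by (rule vec3_eqI) simp_all

lemma norm3_sq: "(norm (x :: real^3))^2 = (x$1)^2 + (x$2)^2 + (x$3)^2"
 by (simp add: norm_vec_def L2_set_def sum_3)

lemma norm_direction [simp]: "norm (direction phi theta) = 1"
proof -
 have "(norm (direction phi theta))^2 = (sin theta)^2 * ((cos phi)^2 + (sin phi)^2) + (cos theta)^2"
  unfolding norm3_sq direction_nth by algebra
 also have "... = 1" by (simp only: sin_cos_squared_add2 mult_1_right sin_cos_squared_add)
 finally have "norm (direction phi theta) = 1 \<or> norm (direction phi theta) = - 1" by (simp only: power2_eq_1_iff)
 thus ?thesis using norm_ge_zero[of "direction phi theta"] by linarith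
qed

lemma continuous_direction: "continuous_on S (%(phi, theta). direction phi theta)"
proof -
 have "(%(phi, theta). direction phi theta) = (%p. (cos (fst p) * sin (snd p)) *\<^sub>R axis 1 1 + (sin (fst p) * sin (snd p)) *\<^sub>R axis 2 1
   + (cos (snd p)) *\<^sub>R (axis 3 1 :: real^3))"
  by (auto simp: fun_eq_iff axis_def intro!: vec3_eqI)
 thus ?thesis by (simp only:) (intro continuous_intros)
qed

lemma direction_measurable: "(%(phi, theta). direction phi theta) \<in> borel \<rightarrow>\<^sub>M borel"
 by (rule borel_measurable_continuous_onI[OF continuous_direction])

lemma det_spherical: "\<bar>det (matrix (spherical' v))\<bar> = (v$1)^2 * \<bar>sin (v$3)\<bar>"
proof -
 have m: "matrix (spherical' v) $ i $ j = spherical' v (axis j 1) $ i" for i j by (simp add: matrix_def)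
 have n: "axis (1::3) (1::real) $ 1 = 1" "axis (1::3) (1::real) $ 2 = 0" "axis (1::3) (1::real) $ 3 = 0"
  "axis (2::3) (1::real) $ 1 = 0" "axis (2::3) (1::real) $ 2 = 1" "axis (2::3) (1::real) $ 3 = 0"
  "axis (3::3) (1::real) $ 1 = 0" "axis (3::3) (1::real) $ 2 = 0" "axis (3::3) (1::real) $ 3 = 1"
  by (simp_all add: axis_def)
 define c s C S where "c = cos (v$2)" and "s = sin (v$2)" and "C = cos (v$3)" and "S = sin (v$3)"
 have one: "c^2 + s^2 = 1" "C^2 + S^2 = 1" by (simp_all add: c_def s_def C_def S_def)
 have "det (matrix (spherical' v)) = - ((v$1)^2) * S * ((c^2 + s^2) * (C^2 + S^2))"
  unfolding det_3 m spherical'_def c_def[symmetric] s_def[symmetric] C_def[symmetric] S_def[symmetric]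
  by (simp add: n) (simp add: power2_eq_square algebra_simps)
 thus ?thesis unfolding one by (simp add: S_def abs_mult)
qed

definition shell :: "real => real => (real^3) set" where
 "shell a b = {y. a < norm y \<and> norm y < b}"

lemma shell_borel [measurable]: "shell a b \<in> sets borel"
 unfolding shell_def by measurable

definition angles :: "(real \<times> real) set" where
 "angles = {0..2*pi} \<times> {0..pi}"

lemma angles_AE: "AE p in lborel. p \<in> angles \<longleftrightarrow> p \<in> {0<..<2*pi} \<times> {0<..<pi}"
proof -
 have e: "angles = cbox (0, 0) (2*pi, pi)" "{0<..<2*pi} \<times> {0<..<pi} = box (0, 0) (2*pi, pi)"
  by (auto simp: angles_def mem_box Basis_prod_def)
 show ?thesis unfolding e using lborel_cbox_AE[of "(0::real, 0::real)" "(2*pi, pi)"]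
  by eventually_elim (use box_subset_cbox[of "(0::real, 0::real)" "(2*pi, pi)"] in auto)
qed

lemma direction_sphere_measurable:
 "(%(phi, theta). direction phi theta) \<in> density (restrict_space lborel angles) (%(phi, theta). ennreal (sin theta)) \<rightarrow>\<^sub>M restrict_space borel (sphere 0 1)"
 by (rule measurable_restrict_space2)
   (auto intro!: measurable_restrict_space1 direction_measurable simp: measurable_density_eq1 measurable_lborel1)

lemma emeasure_sphere:
 assumes B: "B \<in> sets borel" "B \<subseteq> sphere 0 1"
 shows "emeasure sphere_measure B = (\<integral>\<^sup>+p. indicator angles p * (ennreal (sin (snd p)) * indicator B (direction (fst p) (snd p))) \<partial>lborel)"
proof -
 have Bs: "B \<in> sets (restrict_space borel (sphere 0 1))" using B by (auto simp: sets_restrict_space_iff)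
 have A [measurable]: "angles \<in> sets (borel :: (real \<times> real) measure)"
  by (auto simp: angles_def intro!: borel_closed closed_Times)
 have dm: "(%p. direction (fst p) (snd p)) \<in> borel \<rightarrow>\<^sub>M borel" using direction_measurable by (simp add: case_prod_beta')
 have dB: "{p. direction (fst p) (snd p) \<in> B} \<in> sets borel"
  using measurable_sets[OF dm B(1)] by (simp add: vimage_def)
 have "emeasure sphere_measure B = emeasure (density (restrict_space lborel angles) (%(phi, theta). ennreal (sin theta)))
   ((%(phi, theta). direction phi theta) -` B \<inter> angles)"
  unfolding sphere_measure_def angles_def[symmetric]
  by (subst emeasure_distr[OF direction_sphere_measurable Bs]) (simp add: space_restrict_space)
 also have "... = (\<integral>\<^sup>+p. ennreal (sin (snd p)) * indicator ((%(phi, theta). direction phi theta) -` B \<inter> angles) p \<partial>restrict_space lborel angles)"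
 proof (subst emeasure_density)
  show "(%(phi, theta). ennreal (sin theta)) \<in> borel_measurable (restrict_space lborel angles)"
  proof (rule measurable_restrict_space1)
   have "(%p :: real \<times> real. sin (snd p)) \<in> borel_measurable borel"
    by (intro borel_measurable_continuous_onI continuous_intros)
   from measurable_compose[OF this measurable_ennreal]
   show "(%(phi :: real, theta). ennreal (sin theta)) \<in> borel_measurable lborel" by (simp add: case_prod_beta')
  qed
  show "(%(phi, theta). direction phi theta) -` B \<inter> angles \<in> sets (restrict_space lborel angles)"
   using A dB by (auto simp: sets_restrict_space_iff case_prod_beta' vimage_def)
 qed (simp add: case_prod_beta')
 also have "... = (\<integral>\<^sup>+p. (ennreal (sin (snd p)) * indicator ((%(phi, theta). direction phi theta) -` B \<inter> angles) p) * indicator angles p \<partial>lborel)"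
  by (rule nn_integral_restrict_space) simp
 also have "... = (\<integral>\<^sup>+p. indicator angles p * (ennreal (sin (snd p)) * indicator B (direction (fst p) (snd p))) \<partial>lborel)"
  by (rule nn_integral_cong) (auto simp: indicator_def case_prod_beta')
 finally show ?thesis .
qed

definition triple :: "real \<times> real \<times> real => real^3" where
 "triple p = fst p *\<^sub>R axis 1 1 + fst (snd p) *\<^sub>R axis 2 1 + snd (snd p) *\<^sub>R axis 3 1"

lemma triple_nth [simp]: "triple p $ 1 = fst p" "triple p $ 2 = fst (snd p)" "triple p $ 3 = snd (snd p)"
 by (simp_all add: triple_def axis_def)

lemma triple_measurable [measurable]: "triple \<in> borel_measurable borel"
 unfolding triple_def[abs_def] by (intro borel_measurable_continuous_onI continuous_intros)

lemma emeasure_lborel_Times: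
 fixes A :: "'a::euclidean_space set" and B :: "'b::euclidean_space set"
 assumes "A \<in> sets borel" "B \<in> sets borel"
 shows "emeasure lborel (A \<times> B) = emeasure lborel A * emeasure lborel B"
 unfolding lborel_prod[symmetric] by (rule lborel.emeasure_pair_measure_Times) (use assms in auto)

text \<open>The nested pairs split off the radius and leave the two angles as a pair, the shape in
  which \<open>sphere_measure\<close> is defined.\<close>

lemma lborel_triple: "(lborel :: (real^3) measure) = distr lborel borel triple"
proof (rule lborel_eqI)
 fix l u :: "real^3" assume le: "!!b. b \<in> Basis ==> l \<bullet> b <= u \<bullet> b"
 have le': "l $ i <= u $ i" for i using le[of "axis i 1"] by (simp add: cart_eq_inner_axis axis_in_Basis_iff)
 have "triple -` box l u = {l$1<..<u$1} \<times> ({l$2<..<u$2} \<times> {l$3<..<u$3})"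
  by (auto simp: mem_box_cart forall_3)
 hence "emeasure (distr lborel borel triple) (box l u) = emeasure lborel ({l$1<..<u$1} \<times> ({l$2<..<u$2} \<times> {l$3<..<u$3}))"
  by (subst emeasure_distr) auto
 also have "... = emeasure lborel {l$1<..<u$1} * (emeasure lborel {l$2<..<u$2} * emeasure lborel {l$3<..<u$3})"
  by (subst emeasure_lborel_Times, simp, simp add: borel_open open_Times, subst emeasure_lborel_Times) simp_all
 also have "... = ennreal ((u$1 - l$1) * ((u$2 - l$2) * (u$3 - l$3)))"
  using le' by (simp add: ennreal_mult)
 also have "(u$1 - l$1) * ((u$2 - l$2) * (u$3 - l$3)) = (\<Prod>b\<in>Basis. (u - l) \<bullet> b)"
 proof -
  have B: "(Basis :: (real^3) set) = (%i. axis i 1) ` UNIV" by (auto simp: Basis_vec_def)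
  have "(\<Prod>b\<in>Basis. (u - l) \<bullet> b) = (\<Prod>i\<in>(UNIV::3 set). (u - l) \<bullet> axis i 1)"
   unfolding B by (rule prod.reindex_cong[of "%i. axis i 1"]) (auto simp: inj_on_def axis_eq_axis)
  moreover have "(\<Prod>i\<in>(UNIV::3 set). g i) = g 1 * (g 2 * g 3)" for g :: "3 => real"
   unfolding UNIV_3 by simp
  ultimately show ?thesis by (simp add: inner_axis)
 qed
 finally show "emeasure (distr lborel borel triple) (box l u) = ennreal (\<Prod>b\<in>Basis. (u - l) \<bullet> b)" .
qed simp

lemma nn_integral_triple:
 assumes [measurable]: "f \<in> borel_measurable (borel :: (real^3) measure)"
 shows "(\<integral>\<^sup>+v. f v \<partial>lborel) = (\<integral>\<^sup>+r. (\<integral>\<^sup>+p. f (triple (r, p)) \<partial>lborel) \<partial>lborel)"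
proof -
 have "(\<integral>\<^sup>+v. f v \<partial>lborel) = (\<integral>\<^sup>+q. f (triple q) \<partial>lborel)"
  by (subst lborel_triple, subst nn_integral_distr) auto
 also have "... = (\<integral>\<^sup>+q. f (triple q) \<partial>(lborel \<Otimes>\<^sub>M lborel))"
  by (simp only: lborel_prod)
 also have "... = (\<integral>\<^sup>+r. (\<integral>\<^sup>+p. f (triple (r, p)) \<partial>lborel) \<partial>lborel)"
  by (subst lborel.nn_integral_fst[symmetric]) (auto simp: lborel_prod)
 finally show ?thesis .
qed

lemma null_plane: "{y :: real^3. y $ 2 = 0} \<in> null_sets lebesgue"
proof -
 have "negligible {y :: real^3. axis 2 1 \<bullet> y = 0}" by (rule negligible_hyperplane) (simp add: axis_eq_0_iff)
 moreover have "{y :: real^3. axis 2 1 \<bullet> y = 0} = {y. y $ 2 = 0}" by (auto simp: inner_axis')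
 ultimately show ?thesis by (simp add: negligible_iff_null_sets)
qed

text \<open>Change of variables with Jacobian \<open>r^2 * sin theta\<close>; integrating out the
  radius gives \<open>(b^3 - a^3) / 3\<close>. Spherical coordinates are injective on the open
  parameter set \<open>S\<close>, and what they miss is a null set.\<close>

lemma emeasure_cone:
 assumes B: "B \<in> sets borel" "B \<subseteq> sphere 0 1" and ab: "0 < a" "a < b"
 shows "emeasure lborel {y \<in> shell a b. y /\<^sub>R norm y \<in> B} = ennreal ((b^3 - a^3) / 3) * emeasure sphere_measure B"
proof -
 define S where "S = {v :: real^3. v$1 \<in> {a<..<b} \<and> (v$2, v$3) \<in> {0<..<2*pi} \<times> {0<..<pi} \<and> direction (v$2) (v$3) \<in> B}"
 define Cn where "Cn = {y \<in> shell a b. y /\<^sub>R norm y \<in> B}"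
 have dm: "(%p. direction (fst p) (snd p)) \<in> borel \<rightarrow>\<^sub>M borel" using direction_measurable by (simp add: case_prod_beta')
 have nm [measurable]: "(%v :: real^3. v $ i) \<in> borel_measurable borel" for i
  by (intro borel_measurable_continuous_onI continuous_intros)
 have dmv [measurable]: "(%v :: real^3. direction (v$2) (v$3)) \<in> borel \<rightarrow>\<^sub>M borel"
  using measurable_compose[OF _ dm, of "%v :: real^3. (v$2, v$3)" borel]
  by (simp add: borel_measurable_continuous_onI continuous_intros)
 have S [measurable]: "S \<in> sets borel"
 proof -
  have "{v :: real^3. direction (v$2) (v$3) \<in> B} \<in> sets borel"
   using measurable_sets[OF dmv B(1)] by (simp add: vimage_def)
  moreover have "{v :: real^3. v$1 \<in> {a<..<b} \<and> (v$2, v$3) \<in> {0<..<2*pi} \<times> {0<..<pi}} \<in> sets borel"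
   by simp measurable
  moreover have "S = {v. v$1 \<in> {a<..<b} \<and> (v$2, v$3) \<in> {0<..<2*pi} \<times> {0<..<pi}} \<inter> {v. direction (v$2) (v$3) \<in> B}"
   by (auto simp: S_def)
  ultimately show ?thesis by auto
 qed
 have Cnm: "Cn \<in> sets borel"
 proof -
  have "(%y :: real^3. y /\<^sub>R norm y) \<in> borel_measurable borel" by measurable
  from measurable_sets[OF this B(1)] have "{y :: real^3. y /\<^sub>R norm y \<in> B} \<in> sets borel" by (simp add: vimage_def)
  moreover have "Cn = shell a b \<inter> {y. y /\<^sub>R norm y \<in> B}" by (auto simp: Cn_def)
  ultimately show ?thesis by auto
 qed
 have inj: "inj_on spherical S"
 proof (rule inj_onI)
  fix v w assume vS: "v \<in> S" and wS: "w \<in> S" and eq: "spherical v = spherical w"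
  have "norm (spherical v) = v$1" "norm (spherical w) = w$1"
   using vS wS ab unfolding spherical_direction by (auto simp: S_def)
  hence 1: "v$1 = w$1" using eq by simp
  have pos: "v$1 > 0" using vS ab by (auto simp: S_def)
  have d: "direction (v$2) (v$3) = direction (w$2) (w$3)" using eq 1 pos unfolding spherical_direction by simp
  hence "cos (v$3) = cos (w$3)" using direction_nth(3) by metis
  hence 3: "v$3 = w$3" using vS wS cos_inj_pi[of "v$3" "w$3"] by (auto simp: S_def)
  have sp: "sin (v$3) > 0" using vS sin_gt_zero[of "v$3"] by (auto simp: S_def)
  have "cos (v$2) * sin (v$3) = cos (w$2) * sin (v$3)" "sin (v$2) * sin (v$3) = sin (w$2) * sin (v$3)"
   using d direction_nth(1,2) 3 by metis+
  hence "sin (v$2) = sin (w$2) \<and> cos (v$2) = cos (w$2)" using sp by simp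
  then obtain k :: int where k: "v$2 = w$2 + 2 * pi * k" using sin_cos_eq_iff by blast
  have "\<bar>v$2 - w$2\<bar> < 2 * pi" using vS wS by (auto simp: S_def)
  hence "2 * pi * \<bar>real_of_int k\<bar> < 2 * pi * 1" using k by (simp add: abs_mult)
  hence "\<bar>real_of_int k\<bar> < 1" using mult_less_cancel_left_pos[of "2 * pi" "\<bar>real_of_int k\<bar>" 1] by simp
  hence "k = 0" by linarith
  thus "v = w" using 1 3 k by (intro vec3_eqI) auto
 qed
 have img: "spherical ` S \<subseteq> Cn"
  using ab by (auto simp: S_def Cn_def shell_def spherical_direction)
 \<comment> \<open>If \<open>y $ 2\<close> is nonzero then \<open>y\<close> lies neither on the
   polar axis nor on the half-plane of azimuth 0, so radius and both angles can be chosen in the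
   open ranges.\<close>
 have miss: "Cn - spherical ` S \<subseteq> {y. y $ 2 = 0}"
 proof
  fix y assume y: "y \<in> Cn - spherical ` S"
  show "y \<in> {y. y $ 2 = 0}"
  proof (rule ccontr)
   assume "y \<notin> {y. y $ 2 = 0}"
   hence y2: "y $ 2 \<noteq> 0" by simp
   define r where "r = norm y"
   have r: "a < r" "r < b" "r > 0" and yB: "y /\<^sub>R r \<in> B" using y ab by (auto simp: Cn_def shell_def r_def)
   have rr: "r^2 = (y$1)^2 + (y$2)^2 + (y$3)^2" unfolding r_def by (rule norm3_sq)
   define q where "q = sqrt ((y$1)^2 + (y$2)^2)"
   have qp: "q > 0" using y2 by (simp add: q_def add_nonneg_pos)
   have qq: "q^2 = (y$1)^2 + (y$2)^2" by (simp add: q_def)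
   have "(y$3)^2 + q^2 = r^2" using rr qq by simp
   hence c1: "(y$3 / r)^2 + (q / r)^2 = 1" using r by (simp add: power_divide flip: add_divide_distrib)
   have "0 < q / r" using qp r by simp
   hence "(y$3 / r)^2 < 1" using c1 zero_less_power[of "q / r" 2] by linarith
   hence yr: "\<bar>y$3 / r\<bar> < 1" by (simp only: abs_square_less_1)
   define theta where "theta = arccos (y$3 / r)"
   have yr2: "- 1 < y$3 / r" "y$3 / r < 1" using yr by linarith+
   have th: "0 < theta" "theta < pi" using arccos_lt_bounded[OF yr2] by (simp_all add: theta_def)
   have ct: "cos theta = y$3 / r" unfolding theta_def by (rule cos_arccos) (use yr2 in linarith)+
   have st: "sin theta = q / r"
   proof -
    have "(sin theta)^2 = (q / r)^2" using sin_squared_eq[of theta] ct c1 by simp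
    moreover have "sin theta > 0" using th sin_gt_zero by blast
    ultimately show ?thesis using \<open>0 < q / r\<close> by (simp add: power2_eq_iff_nonneg)
   qed
   have "(y$1 / q)^2 + (y$2 / q)^2 = q^2 / q^2" by (simp only: power_divide add_divide_distrib qq)
   hence "(y$1 / q)^2 + (y$2 / q)^2 = 1" using qp by simp
   then obtain phi where ph: "0 <= phi" "phi < 2*pi" "y$1 / q = cos phi" "y$2 / q = sin phi" using sincos_total_2pi by metis
   have "phi \<noteq> 0" using ph(4) y2 qp by auto
   define v where "v = triple (r, phi, theta)"
   have y12: "y$1 = q * cos phi" "y$2 = q * sin phi" using ph qp by (auto simp: field_simps)
   have sv: "spherical v = y"
    using r by (intro vec3_eqI) (simp_all add: v_def ct st y12)
   have "direction phi theta = y /\<^sub>R r" using sv r unfolding spherical_direction by (auto simp: v_def)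
   hence "v \<in> S" using r th ph \<open>phi \<noteq> 0\<close> yB by (auto simp: S_def v_def)
   thus False using sv y by blast
  qed
 qed
 have Sle: "S \<in> sets lebesgue" using S by (simp add: sets_completionI_sets)
 define f where "f v = (v$1)^2 * \<bar>sin (v$3)\<bar>" for v :: "real^3"
 have fm [measurable]: "f \<in> borel_measurable borel" unfolding f_def by measurable
 have nnS: "(\<integral>\<^sup>+v. indicator S v * ennreal (f v) \<partial>lborel) = ennreal ((b^3 - a^3) / 3) * emeasure sphere_measure B"
 proof -
  define k where "k p = indicator ({0<..<2*pi} \<times> {0<..<pi}) p * (ennreal (sin (snd p)) * indicator B (direction (fst p) (snd p)))" for p
  have Op [measurable]: "{0<..<2*pi} \<times> {0<..<pi} \<in> sets (borel :: (real \<times> real) measure)"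
   by (intro borel_open open_Times) auto
  have iB: "(%p. indicator B (direction (fst p) (snd p)) :: ennreal) \<in> borel_measurable borel"
   using measurable_compose[OF dm borel_measurable_indicator[OF B(1)]] by simp
  have "(%p :: real \<times> real. sin (snd p)) \<in> borel_measurable borel"
   by (intro borel_measurable_continuous_onI continuous_intros)
  hence sm: "(%p :: real \<times> real. ennreal (sin (snd p))) \<in> borel_measurable borel"
   by (rule measurable_compose[OF _ measurable_ennreal])
  have km [measurable]: "k \<in> borel_measurable borel" unfolding k_def
   by (intro borel_measurable_times_ennreal borel_measurable_indicator Op iB sm)
  have e: "indicator S (triple (r, p)) * ennreal (f (triple (r, p))) = (indicator {a<..<b} r * ennreal (r^2)) * k p" for r p
  proof (cases "triple (r, p) \<in> S")
   case True
   hence "0 < sin (snd p)" using sin_gt_zero[of "snd p"] by (auto simp: S_def)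
   thus ?thesis using True by (auto simp: S_def k_def f_def indicator_def ennreal_mult' mult.commute mem_Times_iff)
  next
   case False
   thus ?thesis by (auto simp: S_def k_def indicator_def mem_Times_iff)
  qed
  have "(\<integral>\<^sup>+v. indicator S v * ennreal (f v) \<partial>lborel) = (\<integral>\<^sup>+r. (\<integral>\<^sup>+p. (indicator {a<..<b} r * ennreal (r^2)) * k p \<partial>lborel) \<partial>lborel)"
   by (subst nn_integral_triple) (simp_all add: e)
  also have "... = (\<integral>\<^sup>+r. indicator {a<..<b} r * ennreal (r^2) \<partial>lborel) * (\<integral>\<^sup>+p. k p \<partial>lborel)"
   by (simp add: nn_integral_cmult nn_integral_multc)
  also have "(\<integral>\<^sup>+p. k p \<partial>lborel) = emeasure sphere_measure B"
   unfolding emeasure_sphere[OF B] k_def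
   by (rule nn_integral_cong_AE) (use angles_AE in \<open>eventually_elim, auto simp: indicator_def\<close>)
  also have "(\<integral>\<^sup>+r. indicator {a<..<b} r * ennreal (r^2) \<partial>lborel) = ennreal ((b^3 - a^3) / 3)"
  proof -
   have "(\<integral>\<^sup>+r. indicator {a<..<b} r * ennreal (r^2) \<partial>lborel) = (\<integral>\<^sup>+r. ennreal (r^2) * indicator {a..b} r \<partial>lborel)"
   proof (rule nn_integral_cong_AE)
    have "AE r in lborel. r \<noteq> a" "AE r in lborel. r \<noteq> b" by (rule AE_lborel_singleton)+
    thus "AE r in lborel. indicator {a<..<b} r * ennreal (r^2) = ennreal (r^2) * indicator {a..b} r"
     by eventually_elim (auto simp: indicator_def)
   qed
   also have "... = ennreal (b^3 / 3 - a^3 / 3)"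
    by (rule nn_integral_FTC_Icc) (use ab in \<open>auto intro!: derivative_eq_intros\<close>)
   finally show ?thesis by (simp add: diff_divide_distrib)
  qed
  finally show ?thesis .
 qed
 have Sb: "\<bar>f v\<bar> <= b^2" if "v \<in> S" for v
 proof -
  have "(v$1)^2 <= b^2" using that ab by (intro power_mono) (auto simp: S_def)
  hence "(v$1)^2 * \<bar>sin (v$3)\<bar> <= b^2 * 1" by (intro mult_mono) auto
  thus ?thesis by (simp add: f_def abs_mult)
 qed
 have Sfin: "emeasure lborel S < \<infinity>"
 proof -
  have "S \<subseteq> cbox (triple (a, 0, 0)) (triple (b, 2*pi, pi))"
   by (auto simp: S_def mem_box_cart forall_3)
  hence "emeasure lborel S <= emeasure lborel (cbox (triple (a, 0, 0)) (triple (b, 2*pi, pi)))"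
   by (rule emeasure_mono) simp
  also have "... < \<infinity>" by (rule emeasure_lborel_cbox_finite)
  finally show ?thesis .
 qed
 have fi: "integrable lborel (%v. indicator S v * f v)"
 proof (rule Bochner_Integration.integrable_bound)
  have "integrable lborel (indicator S :: real^3 => real)" using Sfin by (intro integrable_real_indicator) auto
  thus "integrable lborel (%v. b^2 * indicator S v)" by simp
  show "AE v in lborel. norm (indicator S v * f v) <= norm (b^2 * indicator S v)"
   by (rule AE_I2) (use Sb in \<open>auto simp: indicator_def\<close>)
 qed measurable
 define m where "m = (LINT v|lborel. indicator S v * f v)"
 have m: "ennreal m = (\<integral>\<^sup>+v. indicator S v * ennreal (f v) \<partial>lborel)"
 proof -
  have "(\<integral>\<^sup>+v. ennreal (indicator S v * f v) \<partial>lborel) = ennreal m"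
   unfolding m_def by (rule nn_integral_eq_integral[OF fi]) (auto simp: f_def)
  moreover have "ennreal (indicator S v * f v) = indicator S v * ennreal (f v)" for v by (auto simp: indicator_def)
  ultimately show ?thesis by simp
 qed
 have "((%v. indicator S v * f v) has_integral m) UNIV"
  unfolding m_def by (rule has_integral_integral_lborel[OF fi])
 moreover have "(%v. indicator S v * f v) = (%v. if v \<in> S then f v else 0)" by (auto simp: indicator_def)
 ultimately have "(f has_integral m) S" by (simp add: has_integral_restrict_UNIV)
 hence hi: "((%v. \<bar>det (matrix (spherical' v))\<bar>) has_integral m) S" by (simp add: det_spherical f_def[abs_def])
 have sm: "spherical ` S \<in> lmeasurable" "measure lebesgue (spherical ` S) = m"
  using has_measure_differentiable_image[OF Sle spherical_derivative inj, of m] hi by auto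
 have "emeasure lebesgue (spherical ` S) = ennreal m"
  using emeasure_eq_measure2[OF sm(1)] sm(2) by simp
 moreover have "emeasure lebesgue Cn = emeasure lebesgue (spherical ` S)"
 proof -
  have "Cn - spherical ` S \<in> null_sets lebesgue"
   using miss null_plane by (meson negligible_iff_null_sets negligible_subset)
  moreover have "Cn = spherical ` S \<union> (Cn - spherical ` S)" using img by blast
  ultimately show ?thesis using emeasure_Un_null_set[of "spherical ` S" lebesgue "Cn - spherical ` S"] sm(1) by (simp add: fmeasurableD)
 qed
 moreover have "emeasure lebesgue Cn = emeasure lborel Cn" using Cnm by simp
 ultimately show ?thesis unfolding Cn_def[symmetric] using m nnS by simp
qed

subsection \<open>The Hilbert space of square-integrable functions\<close>

lemma L2_integrable_mult:
 assumes "u \<in> L2 N" "v \<in> L2 N"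
 shows "integrable N (%z. u z * v z)"
proof (rule Bochner_Integration.integrable_bound)
 show "integrable N (%z. (u z)^2 + (v z)^2)" using assms unfolding L2_def by auto
 show "(%z. u z * v z) \<in> borel_measurable N" using assms unfolding L2_def by auto
 have "\<bar>a * b\<bar> <= a^2 + b^2" for a b :: real
  using sum_squares_bound[of "\<bar>a\<bar>" "\<bar>b\<bar>", unfolded power2_abs] zero_le_power2[of a] zero_le_power2[of b]
  unfolding abs_mult by linarith
 thus "AE z in N. norm (u z * v z) <= norm ((u z)^2 + (v z)^2)" by (intro AE_I2) simp
qed

lemma L2_bound:
 assumes "f \<in> borel_measurable N" "u \<in> L2 N" "AE z in N. \<bar>f z\<bar> <= C * \<bar>u z\<bar>"
 shows "f \<in> L2 N"
 unfolding L2_def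
proof (intro CollectI conjI)
 show "integrable N (%z. (f z)^2)"
 proof (rule Bochner_Integration.integrable_bound)
  show "integrable N (%z. C^2 * (u z)^2)" using assms(2) unfolding L2_def by auto
  show "AE z in N. norm ((f z)^2) <= norm (C^2 * (u z)^2)"
   using assms(3)
  proof eventually_elim
   case (elim z)
   hence "\<bar>f z\<bar>^2 <= (C * \<bar>u z\<bar>)^2" by (intro power_mono) auto
   thus ?case by (simp add: power_mult_distrib)
  qed
 qed (use assms(1) in measurable)
qed (rule assms(1))

lemma L2_mult_bounded:
 assumes "g \<in> borel_measurable N" "AE z in N. \<bar>g z\<bar> <= C" "u \<in> L2 N"
 shows "(%z. g z * u z) \<in> L2 N"
proof (rule L2_bound[OF _ assms(3)])
 show "(%z. g z * u z) \<in> borel_measurable N" using assms(1,3) unfolding L2_def by auto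
 show "AE z in N. \<bar>g z * u z\<bar> <= C * \<bar>u z\<bar>"
  using assms(2) by eventually_elim (simp add: abs_mult mult_right_mono)
qed

lemma L2_norm_mult_bounded:
 assumes g: "g \<in> borel_measurable N" "AE z in N. \<bar>g z\<bar> <= C" "0 <= C" and u: "u \<in> L2 N"
 shows "L2_norm N (%z. g z * u z) <= C * L2_norm N u"
proof -
 have "(LINT z|N. (g z * u z)^2) <= (LINT z|N. C^2 * (u z)^2)"
 proof (rule integral_mono_AE)
  show "integrable N (%z. (g z * u z)^2)" using L2_mult_bounded[OF g(1,2) u] by (simp add: L2_def)
  show "AE z in N. (g z * u z)^2 <= C^2 * (u z)^2"
   using g(2)
  proof eventually_elim
   case (elim z)
   hence "\<bar>g z\<bar>^2 <= C^2" by (intro power_mono) auto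
   thus ?case by (simp add: power_mult_distrib mult_right_mono)
  qed
 qed (use u in \<open>simp add: L2_def\<close>)
 hence "sqrt (LINT z|N. (g z * u z)^2) <= sqrt (C^2 * (LINT z|N. (u z)^2))" by (intro real_sqrt_le_mono) simp
 thus ?thesis using g(3) by (simp add: L2_norm_def real_sqrt_mult)
qed

lemma L2_bounded:
 assumes "finite_measure N" "f \<in> borel_measurable N" "AE z in N. \<bar>f z\<bar> <= C"
 shows "f \<in> L2 N"
 unfolding L2_def
proof (intro CollectI conjI)
 interpret finite_measure N by (rule assms)
 show "integrable N (%z. (f z)^2)"
 proof (rule integrable_const_bound[of _ "C^2"])
  show "AE z in N. norm ((f z)^2) <= C^2"
   using assms(3)
  proof eventually_elim
   case (elim z)
   hence "\<bar>f z\<bar>^2 <= C^2" by (intro power_mono) auto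
   thus ?case by simp
  qed
 qed (use assms(2) in measurable)
qed (rule assms)

lemma L2_semi_inner: "semi_inner (L2 N) (%u v. \<integral>z. u z * v z \<partial>N)"
proof
 show "subspace (L2 N)"
 proof (rule subspaceI)
  show "0 \<in> L2 N" by (simp add: L2_def zero_fun_def)
  show "u + v \<in> L2 N" if u: "u \<in> L2 N" and v: "v \<in> L2 N" for u v
  proof -
   have "integrable N (%z. (u z)^2 + (v z)^2 + 2 * (u z * v z))"
    using u v L2_integrable_mult[OF u v] unfolding L2_def by auto
   moreover have "((u + v) z)^2 = (u z)^2 + (v z)^2 + 2 * (u z * v z)" for z by (simp add: power2_sum)
   moreover have "u + v \<in> borel_measurable N" using u v unfolding L2_def plus_fun_def by auto
   ultimately show ?thesis unfolding L2_def by simp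
  qed
  show "c *\<^sub>R u \<in> L2 N" if u: "u \<in> L2 N" for c u
   using u unfolding L2_def scaleR_fun_def by (auto simp: power_mult_distrib)
 qed
 fix u v w :: "'a => real"
 assume u: "u \<in> L2 N" and w: "w \<in> L2 N"
 show "(LINT z|N. (c *\<^sub>R u) z * w z) = c * (LINT z|N. u z * w z)" for c
  by (simp add: mult.assoc)
 show "(LINT z|N. u z * w z) = (LINT z|N. w z * u z)" by (simp add: mult.commute)
 show "0 <= (LINT z|N. u z * u z)" by (rule integral_nonneg_AE) simp
 assume v: "v \<in> L2 N"
 show "(LINT z|N. (u + v) z * w z) = (LINT z|N. u z * w z) + (LINT z|N. v z * w z)"
  using L2_integrable_mult[OF u w] L2_integrable_mult[OF v w] by (simp add: distrib_right)
qed

text \<open>Viewing the reals as a semi-Hilbert space lets \<open>L2_geometric_limit\<close> serve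
  for scalar functions, so completeness of L2 follows from the same argument as the limits in
  time.\<close>

lemma real_semi_hilbert: "semi_hilbert (UNIV :: real set) (*)"
proof -
 interpret R: semi_inner "UNIV :: real set" "(*)" by unfold_locales (auto simp: algebra_simps)
 show ?thesis
 proof
  fix s :: "nat => real" assume "!!e. e > 0 ==> EX K. ALL m>=K. ALL k>=K. R.nrm (s m - s k) < e"
  hence "Cauchy s" by (intro metric_CauchyI) (simp add: R.nrm_def dist_real_def)
  then obtain x where "s \<longlonglongrightarrow> x" using Cauchy_convergent convergent_def by blast
  thus "EX x:UNIV. (%k. R.nrm (s k - x)) \<longlonglongrightarrow> 0"
   by (intro bexI[of _ x]) (simp_all add: R.nrm_def tendsto_rabs_zero_iff LIM_zero)
 qed
qed

lemma L2_semi_hilbert: "semi_hilbert (L2 N) (%u v. \<integral>z. u z * v z \<partial>N)"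
proof -
 interpret L: semi_inner "L2 N" "%u v. \<integral>z. u z * v z \<partial>N" by (rule L2_semi_inner)
 have nsq: "(L.nrm u)^2 = (LINT z|N. (u z)^2)" if "u \<in> L2 N" for u
  using L.nrm_sq[OF that] by (simp add: power2_eq_square)
 show ?thesis
 proof
  fix s :: "nat => 'a => real" assume s: "!!k. s k \<in> L2 N"
   and cau: "!!e. e > 0 ==> EX K. ALL m>=K. ALL k>=K. L.nrm (s m - s k) < e"
  have "EX K. ALL m>=K. ALL k>=K. L.nrm (s m - s k) < (1/2) ^ j" for j by (rule cau) simp
  then obtain \<nu> where \<nu>: "!!j m k. m >= \<nu> j ==> k >= \<nu> j ==> L.nrm (s m - s k) < (1/2) ^ j" by metis
  \<comment> \<open>Partial sums of the thresholds dominate all earlier thresholds, so the selected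
    functions satisfy the geometric bound for every later index, not only for the next one.\<close>
  define \<sigma> where "\<sigma> j = (\<Sum>i\<le>j. \<nu> i)" for j
  have \<sigma>: "\<nu> j <= \<sigma> l" if "j <= l" for j l
   unfolding \<sigma>_def by (rule member_le_sum) (use that in auto)
  define t where "t j = s (\<sigma> j)" for j
  have tL: "t j \<in> L2 N" for j using s by (simp add: t_def)
  have tm [measurable]: "t j \<in> borel_measurable N" for j using tL[of j] unfolding L2_def by blast
  have td: "L.nrm (t j - t l) < (1/2) ^ j" if "j <= l" for j l
   unfolding t_def using \<nu> \<sigma> that by simp
  have tdi: "integrable N (%z. (t j z - t l z)^2)" for j l
   using L.mem(4)[OF tL tL, of j l] unfolding L2_def by simp
  have tsq: "(LINT z|N. (t j z - t l z)^2) <= (1/4) ^ j" if "j <= l" for j l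
  proof -
   have "(L.nrm (t j - t l))^2 <= ((1/2) ^ j)^2"
    using td[OF that] L.nonneg[OF L.mem(4)[OF tL tL]] by (intro power_mono) auto
   moreover have "(((1::real)/2) ^ j)^2 = (1/4) ^ j" by (simp add: power2_eq_square flip: power_mult_distrib)
   ultimately show ?thesis using nsq[OF L.mem(4)[OF tL tL], of j l] by simp
  qed
  interpret R: semi_hilbert "UNIV :: real set" "(*)" by (rule real_semi_hilbert)
  obtain g where g: "AE z in N. g z \<in> UNIV \<and> (%j. R.nrm (t j z - g z)) \<longlonglongrightarrow> 0"
   and gn: "!!j. (\<integral>\<^sup>+z. ennreal ((R.nrm (t j z - g z))^2) \<partial>N) <= ennreal (1 * (1/4) ^ j)"
   by (rule R.L2_geometric_limit[of t N 1]) (use tdi tsq in \<open>auto simp: R.nrm_def\<close>)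
  \<comment> \<open>\<open>g\<close> comes without measurability; the pointwise \<open>lim\<close>
    is measurable and agrees with \<open>g\<close> almost everywhere.\<close>
  define f where "f z = lim (%j. t j z)" for z
  have fm [measurable]: "f \<in> borel_measurable N" unfolding f_def by measurable
  have fg: "AE z in N. f z = g z" using g
  proof eventually_elim
   case (elim z)
   hence "(%j. t j z) \<longlonglongrightarrow> g z" by (simp add: R.nrm_def tendsto_rabs_zero_iff LIM_zero_iff)
   thus ?case unfolding f_def by (rule limI)
  qed
  have nn: "(\<integral>\<^sup>+z. ennreal ((t j z - f z)^2) \<partial>N) <= ennreal ((1/4) ^ j)" for j
  proof -
   have "(\<integral>\<^sup>+z. ennreal ((t j z - f z)^2) \<partial>N) = (\<integral>\<^sup>+z. ennreal ((R.nrm (t j z - g z))^2) \<partial>N)"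
    by (rule nn_integral_cong_AE) (use fg in \<open>eventually_elim, simp add: R.nrm_def\<close>)
   thus ?thesis using gn[of j] by simp
  qed
  have tfi: "integrable N (%z. (t j z - f z)^2)" for j
  proof (rule integrableI_bounded)
   show "(\<integral>\<^sup>+z. ennreal (norm ((t j z - f z)^2)) \<partial>N) < \<infinity>"
    using nn[of j] by (simp add: order_le_less_trans[OF _ ennreal_less_top])
  qed measurable
  have tfL: "t j - f \<in> L2 N" for j
   unfolding L2_def fun_diff_def using tfi by simp
  have fL: "f \<in> L2 N" using L.mem(4)[OF tL tfL, of 0 0] by simp
  have tfn: "L.nrm (t j - f) <= (1/2) ^ j" for j
  proof -
   have "ennreal (LINT z|N. (t j z - f z)^2) = (\<integral>\<^sup>+z. ennreal ((t j z - f z)^2) \<partial>N)"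
    by (rule nn_integral_eq_integral[OF tfi, symmetric]) simp
   also have "... <= ennreal ((1/4) ^ j)" by (rule nn)
   finally have "(LINT z|N. (t j z - f z)^2) <= (1/4) ^ j" by (simp add: ennreal_le_iff)
   moreover have "(((1::real)/2) ^ j)^2 = (1/4) ^ j" by (simp add: power2_eq_square flip: power_mult_distrib)
   ultimately have "(L.nrm (t j - f))^2 <= ((1/2) ^ j)^2" using nsq[OF tfL] by simp
   thus ?thesis by (rule power2_le_imp_le) simp
  qed
  have "(%k. L.nrm (s k - f)) \<longlonglongrightarrow> 0"
  proof (rule LIMSEQ_I)
   fix e :: real assume e: "e > 0"
   have "(%j. (1/2 :: real) ^ j) \<longlonglongrightarrow> 0" by (rule LIMSEQ_power_zero) simp
   hence "\<forall>\<^sub>F j in sequentially. (1/2 :: real) ^ j < e / 2" using e by (intro order_tendstoD(2)) auto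
   then obtain j where j: "(1/2 :: real) ^ j < e / 2" by (auto simp: eventually_sequentially)
   have "norm (L.nrm (s k - f) - 0) < e" if k: "k >= \<nu> j" for k
   proof -
    have "L.nrm (s k - f) <= L.nrm (s k - t j) + L.nrm (t j - f)" by (rule L.triangle_via[OF s tL fL])
    also have "L.nrm (s k - t j) < (1/2) ^ j" unfolding t_def by (rule \<nu>[OF k \<sigma>]) simp
    finally have "L.nrm (s k - f) < e" using tfn[of j] j by linarith
    thus ?thesis using L.nonneg[OF L.mem(4)[OF s fL], of k] by simp
   qed
   thus "EX no. ALL k>=no. norm (L.nrm (s k - f) - 0) < e" by blast
  qed
  thus "EX x:L2 N. (%k. L.nrm (s k - x)) \<longlonglongrightarrow> 0" using fL by blast
 qed
qed

lemma L2_norm_eq: "semi_inner.nrm (%u v. \<integral>z. u z * v z \<partial>N) = L2_norm N"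
 by (simp add: fun_eq_iff semi_inner.nrm_def[OF L2_semi_inner] L2_norm_def power2_eq_square)

subsection \<open>The measure on the sphere bundle\<close>

definition unit_dir :: "real^3 => real^3" where
 "unit_dir y = y /\<^sub>R norm y"

lemma sets_sphere_measure [simp]: "sets sphere_measure = sets (restrict_space borel (sphere 0 1))"
 by (simp add: sphere_measure_def)

lemma space_sphere_measure [simp]: "space sphere_measure = sphere 0 1"
 by (simp add: sphere_measure_def space_restrict_space)

lemma nn_integral_shell:
 assumes p: "p \<in> borel_measurable (restrict_space borel (sphere 0 1))" and ab: "0 < a" "a < b"
 shows "(\<integral>\<^sup>+y. indicator (shell a b) y * p (unit_dir y) \<partial>lborel) = ennreal ((b^3 - a^3) / 3) * (\<integral>\<^sup>+omega. p omega \<partial>sphere_measure)"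
proof -
 have um: "unit_dir \<in> restrict_space lborel (shell a b) \<rightarrow>\<^sub>M restrict_space borel (sphere 0 1)"
 proof (rule measurable_restrict_space2)
  show "unit_dir \<in> space (restrict_space lborel (shell a b)) \<rightarrow> sphere 0 1"
  proof (rule Pi_I)
   fix y assume "y \<in> space (restrict_space lborel (shell a b))"
   hence "y \<noteq> 0" using ab by (auto simp: space_restrict_space shell_def)
   thus "unit_dir y \<in> sphere 0 1" by (simp add: unit_dir_def)
  qed
  have "unit_dir \<in> borel_measurable borel" unfolding unit_dir_def[abs_def] by measurable
  thus "unit_dir \<in> borel_measurable (restrict_space lborel (shell a b))" by (intro measurable_restrict_space1) simp
 qed
 have "distr (restrict_space lborel (shell a b)) (restrict_space borel (sphere 0 1)) unit_dir
   = scale_measure (ennreal ((b^3 - a^3) / 3)) sphere_measure"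
 proof (rule measure_eqI)
  fix B assume "B \<in> sets (distr (restrict_space lborel (shell a b)) (restrict_space borel (sphere 0 1)) unit_dir)"
  hence Bs: "B \<in> sets (restrict_space borel (sphere 0 1))" by simp
  hence B: "B \<in> sets borel" "B \<subseteq> sphere 0 1" by (subst (asm) sets_restrict_space_iff; force)+
  have "emeasure (distr (restrict_space lborel (shell a b)) (restrict_space borel (sphere 0 1)) unit_dir) B
    = emeasure (restrict_space lborel (shell a b)) (unit_dir -` B \<inter> shell a b)"
   by (subst emeasure_distr[OF um Bs]) (simp add: space_restrict_space)
  also have "... = emeasure lborel (unit_dir -` B \<inter> shell a b)"
   by (rule emeasure_restrict_space) auto
  also have "unit_dir -` B \<inter> shell a b = {y \<in> shell a b. y /\<^sub>R norm y \<in> B}" by (auto simp: unit_dir_def)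
  finally show "emeasure (distr (restrict_space lborel (shell a b)) (restrict_space borel (sphere 0 1)) unit_dir) B
   = emeasure (scale_measure (ennreal ((b^3 - a^3) / 3)) sphere_measure) B"
   using emeasure_cone[OF B ab] by simp
 qed simp
 hence "(\<integral>\<^sup>+omega. p omega \<partial>scale_measure (ennreal ((b^3 - a^3) / 3)) sphere_measure)
   = (\<integral>\<^sup>+omega. p omega \<partial>distr (restrict_space lborel (shell a b)) (restrict_space borel (sphere 0 1)) unit_dir)" by simp
 also have "... = (\<integral>\<^sup>+y. p (unit_dir y) \<partial>restrict_space lborel (shell a b))" by (rule nn_integral_distr[OF um]) (simp add: p)
 also have "... = (\<integral>\<^sup>+y. p (unit_dir y) * indicator (shell a b) y \<partial>lborel)" by (rule nn_integral_restrict_space) simp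
 moreover have "p \<in> borel_measurable sphere_measure" using p by (subst measurable_cong_sets[OF sets_sphere_measure refl])
 ultimately show ?thesis by (simp add: nn_integral_scale_measure mult.commute)
qed

text \<open>The cone over the whole sphere between the radii 1 and 2 has finite volume, and this
  volume is \<open>7 / 3 = (2^3 - 1^3) / 3\<close> times the total mass.\<close>

lemma finite_sphere_measure: "finite_measure sphere_measure"
proof
 have "sphere 0 1 \<in> sets (borel :: (real^3) measure)" by (simp add: borel_closed)
 hence "emeasure lborel {y \<in> shell 1 2. y /\<^sub>R norm y \<in> sphere 0 1} = ennreal (7 / 3) * emeasure sphere_measure (sphere 0 1)"
  using emeasure_cone[of "sphere 0 1" 1 2] by simp
 moreover have "emeasure lborel {y \<in> shell 1 2. y /\<^sub>R norm y \<in> sphere (0 :: real^3) 1} <= emeasure lborel (cball (0 :: real^3) 2)"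
  by (rule emeasure_mono) (auto simp: shell_def)
 moreover have "emeasure lborel (cball (0 :: real^3) 2) < \<infinity>" by (rule emeasure_lborel_cball_finite)
 ultimately have "ennreal (7 / 3) * emeasure sphere_measure (sphere 0 1) < \<infinity>" by (metis le_less_trans)
 thus "emeasure sphere_measure (space sphere_measure) \<noteq> \<infinity>"
  by (auto simp: ennreal_mult_less_top)
qed

section \<open>Integration over the unit sphere bundle of the medium\<close>

locale medium =
 fixes n :: "real^3 => real" and c :: real
 assumes c: "c > 0" and n_ge: "!!x. x \<in> M ==> c <= n x" and n_C1: "Ck_on 1 M n"
begin

abbreviation SM :: "phase measure" where "SM \<equiv> Sigma_measure n"

lemma n_pos: "x \<in> M ==> 0 < n x"
 using n_ge[of x] c by linarith

lemma n_continuous: "continuous_on M n"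
 using Ck_on_SucD[of 0 M n] n_C1 by simp

definition nmax :: real where "nmax = (SOME B. ALL x:M. n x <= B)"

lemma n_le: "x \<in> M ==> n x <= nmax"
proof -
 have "compact (n ` M)" by (intro compact_continuous_image n_continuous compact_cball)
 then obtain B where "!!y. y \<in> n ` M ==> norm y <= B" using compact_imp_bounded bounded_iff by metis
 hence "EX B. ALL x:M. n x <= B" by (intro exI[of _ B]) force
 hence "ALL x:M. n x <= nmax" unfolding nmax_def by (rule someI_ex)
 thus "x \<in> M ==> n x <= nmax" by blast
qed

lemma nmax: "nmax >= c" "nmax > 0"
 using n_le[of 0] n_ge[of 0] c by auto

lemma n_measurable: "n \<in> borel_measurable (restrict_space borel M)"
 by (rule borel_measurable_continuous_on_restrict[OF n_continuous])

lemma mem_OmegaM: "z \<in> OmegaM n \<longleftrightarrow> fst z \<in> M \<and> n (fst z) * norm (snd z) = 1"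
proof (cases "fst z \<in> M")
 case True
 hence "metric_norm n (fst z) (snd z) = n (fst z) * norm (snd z)"
  using n_pos[OF True] by (simp add: metric_norm_def metric_def real_sqrt_mult dot_square_norm)
 thus ?thesis using True by (simp add: OmegaM_def case_prod_beta')
qed (simp add: OmegaM_def case_prod_beta')

text \<open>The radial retraction of nonzero tangent vectors onto the unit sphere bundle; the
  extension \<open>hext n u\<close>, homogeneous of degree 0, is composition with it.\<close>

definition fold_dir :: "phase => phase" where
 "fold_dir z = (fst z, snd z /\<^sub>R (n (fst z) * norm (snd z)))"

lemma hext_fold: "hext n u z = u (fold_dir z)"
 by (simp add: hext_def fold_dir_def case_prod_beta')

lemma fold_dir_OmegaM: "fst z \<in> M ==> snd z \<noteq> 0 ==> fold_dir z \<in> OmegaM n"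
 using n_pos[of "fst z"] by (simp add: mem_OmegaM fold_dir_def field_simps)

lemma scaled_OmegaM: "x \<in> M ==> norm omega = 1 ==> (x, omega /\<^sub>R n x) \<in> OmegaM n"
 using n_pos[of x] by (simp add: mem_OmegaM)

lemma fold_dir_id: "z \<in> OmegaM n ==> fold_dir z = z"
 by (simp add: mem_OmegaM fold_dir_def prod_eq_iff)

lemma space_SM [simp]: "space SM = OmegaM n"
 by (simp add: Sigma_measure_def space_restrict_space)

lemma sets_SM [simp]: "sets SM = sets (restrict_space borel (OmegaM n))"
 by (simp add: Sigma_measure_def)

lemma param_measurable: "(%(x, omega). (x, omega /\<^sub>R n x)) \<in> restrict_space lborel M \<Otimes>\<^sub>M sphere_measure \<rightarrow>\<^sub>M restrict_space borel (OmegaM n)"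
proof (rule measurable_restrict_space2)
 show "(%(x, omega). (x, omega /\<^sub>R n x)) \<in> space (restrict_space lborel M \<Otimes>\<^sub>M sphere_measure) \<rightarrow> OmegaM n"
  using scaled_OmegaM by (auto simp: space_pair_measure space_restrict_space)
 have f: "fst \<in> restrict_space lborel M \<Otimes>\<^sub>M sphere_measure \<rightarrow>\<^sub>M restrict_space borel M"
  using measurable_fst[of "restrict_space lborel M" sphere_measure]
  by (subst measurable_cong_sets[OF refl, of _ "restrict_space lborel M"]) (auto simp: sets_restrict_space)
 have nm: "(%p. n (fst p)) \<in> borel_measurable (restrict_space lborel M \<Otimes>\<^sub>M sphere_measure)"
  by (rule measurable_compose[OF f n_measurable])
 have fb: "fst \<in> borel_measurable (restrict_space lborel M \<Otimes>\<^sub>M sphere_measure)"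
  using measurable_compose[OF f measurable_restrict_space1[OF measurable_ident_sets[OF refl]]] by simp
 have s: "snd \<in> restrict_space lborel M \<Otimes>\<^sub>M sphere_measure \<rightarrow>\<^sub>M restrict_space borel (sphere 0 1)"
  using measurable_snd[of "restrict_space lborel M" sphere_measure]
  by (subst measurable_cong_sets[OF refl sets_sphere_measure[symmetric]])
 have sb: "snd \<in> borel_measurable (restrict_space lborel M \<Otimes>\<^sub>M sphere_measure)"
  using measurable_compose[OF s measurable_restrict_space1[OF measurable_ident_sets[OF refl]]] by simp
 have "(%p. (fst p, snd p /\<^sub>R n (fst p))) \<in> borel_measurable (restrict_space lborel M \<Otimes>\<^sub>M sphere_measure)"
  using fb sb nm by measurable
 thus "(%(x, omega). (x, omega /\<^sub>R n x)) \<in> borel_measurable (restrict_space lborel M \<Otimes>\<^sub>M sphere_measure)"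
  by (simp add: case_prod_beta')
qed

lemma n_pair_measurable: "(%(x, omega). ennreal (n x ^ 3)) \<in> borel_measurable (restrict_space lborel M \<Otimes>\<^sub>M sphere_measure)"
proof -
 have f: "fst \<in> restrict_space lborel M \<Otimes>\<^sub>M sphere_measure \<rightarrow>\<^sub>M restrict_space borel M"
  using measurable_fst[of "restrict_space lborel M" sphere_measure]
  by (subst measurable_cong_sets[OF refl, of _ "restrict_space lborel M"]) (auto simp: sets_restrict_space)
 have "(%p. n (fst p)) \<in> borel_measurable (restrict_space lborel M \<Otimes>\<^sub>M sphere_measure)"
  by (rule measurable_compose[OF f n_measurable])
 thus ?thesis by (simp add: case_prod_beta')
qed

lemma SM_measurable_iff: "P \<in> borel_measurable SM \<longleftrightarrow> P \<in> borel_measurable (restrict_space borel (OmegaM n))"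
 by (rule iffI; subst measurable_cong_sets[OF sets_SM refl] measurable_cong_sets[OF sets_SM[symmetric] refl]; assumption)

lemma continuous_SM_measurable: "continuous_on (OmegaM n) f ==> f \<in> borel_measurable SM"
 by (simp add: SM_measurable_iff borel_measurable_continuous_on_restrict)

lemma n_fst_measurable [measurable]: "(%z. n (fst z)) \<in> borel_measurable SM"
 by (rule continuous_SM_measurable, rule continuous_on_compose2[OF n_continuous])
  (auto intro!: continuous_intros simp: mem_OmegaM)

lemma nn_integral_SM:
 assumes P: "P \<in> borel_measurable SM"
 shows "(\<integral>\<^sup>+z. P z \<partial>SM) = (\<integral>\<^sup>+x. indicator M x * (ennreal (n x ^ 3) * (\<integral>\<^sup>+omega. P (x, omega /\<^sub>R n x) \<partial>sphere_measure)) \<partial>lborel)"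
proof -
 interpret S: finite_measure sphere_measure by (rule finite_sphere_measure)
 have P': "P \<in> borel_measurable (restrict_space borel (OmegaM n))" using P by (simp add: SM_measurable_iff)
 have pm: "(%(x, omega). (x, omega /\<^sub>R n x)) \<in> density (restrict_space lborel M \<Otimes>\<^sub>M sphere_measure) (%(x, omega). ennreal (n x ^ 3)) \<rightarrow>\<^sub>M restrict_space borel (OmegaM n)"
  using param_measurable by (simp add: measurable_density_eq1)
 have Pp: "(%q. P (case q of (x, omega) => (x, omega /\<^sub>R n x))) \<in> borel_measurable (restrict_space lborel M \<Otimes>\<^sub>M sphere_measure)"
  by (rule measurable_compose[OF param_measurable P'])
 have "(\<integral>\<^sup>+z. P z \<partial>SM) = (\<integral>\<^sup>+q. P (case q of (x, omega) => (x, omega /\<^sub>R n x)) \<partial>density (restrict_space lborel M \<Otimes>\<^sub>M sphere_measure) (%(x, omega). ennreal (n x ^ 3)))"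
  unfolding Sigma_measure_def by (rule nn_integral_distr[OF pm]) (simp add: P')
 also have "... = (\<integral>\<^sup>+q. (case q of (x, omega) => ennreal (n x ^ 3)) * P (case q of (x, omega) => (x, omega /\<^sub>R n x)) \<partial>(restrict_space lborel M \<Otimes>\<^sub>M sphere_measure))"
  by (rule nn_integral_density[OF n_pair_measurable Pp])
 also have "... = (\<integral>\<^sup>+x. (\<integral>\<^sup>+omega. ennreal (n x ^ 3) * P (x, omega /\<^sub>R n x) \<partial>sphere_measure) \<partial>restrict_space lborel M)"
  by (subst S.nn_integral_fst[symmetric]) (use n_pair_measurable Pp in auto)
 also have "... = (\<integral>\<^sup>+x. ennreal (n x ^ 3) * (\<integral>\<^sup>+omega. P (x, omega /\<^sub>R n x) \<partial>sphere_measure) \<partial>restrict_space lborel M)"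
 proof (rule nn_integral_cong)
  fix x assume "x \<in> space (restrict_space lborel M)"
  hence "(%omega. P (x, omega /\<^sub>R n x)) \<in> borel_measurable sphere_measure"
   using measurable_compose[OF measurable_Pair1' Pp, of x] by simp
  thus "(\<integral>\<^sup>+omega. ennreal (n x ^ 3) * P (x, omega /\<^sub>R n x) \<partial>sphere_measure) = ennreal (n x ^ 3) * (\<integral>\<^sup>+omega. P (x, omega /\<^sub>R n x) \<partial>sphere_measure)"
   by (rule nn_integral_cmult)
 qed
 also have "... = (\<integral>\<^sup>+x. (ennreal (n x ^ 3) * (\<integral>\<^sup>+omega. P (x, omega /\<^sub>R n x) \<partial>sphere_measure)) * indicator M x \<partial>lborel)"
  by (rule nn_integral_restrict_space) simp
 finally show ?thesis by (simp add: mult.commute)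
qed

lemma finite_SM: "finite_measure SM"
proof
 interpret S: finite_measure sphere_measure by (rule finite_sphere_measure)
 have "emeasure SM (space SM) = (\<integral>\<^sup>+z. 1 \<partial>SM)" by simp
 also have "... = (\<integral>\<^sup>+x. indicator M x * (ennreal (n x ^ 3) * (\<integral>\<^sup>+omega. 1 \<partial>sphere_measure)) \<partial>lborel)"
  by (rule nn_integral_SM) simp
 also have "... <= (\<integral>\<^sup>+x. (ennreal (nmax ^ 3) * emeasure sphere_measure (sphere 0 1)) * indicator M x \<partial>lborel)"
 proof (rule nn_integral_mono)
  fix x
  show "indicator M x * (ennreal (n x ^ 3) * (\<integral>\<^sup>+omega. 1 \<partial>sphere_measure)) <= (ennreal (nmax ^ 3) * emeasure sphere_measure (sphere 0 1)) * indicator M x"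
  proof (cases "x \<in> M")
   case True
   have "n x ^ 3 <= nmax ^ 3" using n_le[OF True] n_pos[OF True] by (intro power_mono) auto
   thus ?thesis using True by (simp add: mult_right_mono ennreal_leI)
  qed simp
 qed
 also have "... = (ennreal (nmax ^ 3) * emeasure sphere_measure (sphere 0 1)) * emeasure lborel M"
  by (rule nn_integral_cmult_indicator) simp
 also have "... < \<infinity>"
 proof -
  have "emeasure sphere_measure (sphere 0 1) < top"
   using S.emeasure_finite[of "sphere 0 1"] by (simp only: less_top infinity_ennreal_def)
  moreover have "emeasure lborel M < top"
   using emeasure_lborel_cball_finite[of "0 :: real^3" 1] by (simp only: infinity_ennreal_def)
  ultimately show ?thesis by (simp add: ennreal_mult_less_top)
 qed
 finally show "emeasure SM (space SM) \<noteq> \<infinity>" by simp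
qed

text \<open>Extensions that are constant along rays are in general not integrable over a whole
  fibre. Slabs keep the length of the vector between positive bounds, and every compact subset of
  \<open>punctured_TM\<close> lies in one.\<close>

definition slab :: "real => real => phase set" where
 "slab a b = interior M \<times> shell a b"

lemma slab_borel [measurable]: "slab a b \<in> sets borel"
 unfolding slab_def by (rule borel_Times[OF borel_open[OF open_interior] shell_borel])

lemma slab_sub: "0 < a ==> z \<in> slab a b ==> fst z \<in> M \<and> snd z \<noteq> 0"
 using interior_subset[of M] by (auto simp: slab_def shell_def)

lemma continuous_fold_dir: "continuous_on (M \<times> (- {0})) fold_dir"
proof -
 have "continuous_on (M \<times> (- {0})) (%z. n (fst z))"
  by (rule continuous_on_compose2[OF n_continuous]) (auto intro!: continuous_intros)
 thus ?thesis unfolding fold_dir_def[abs_def]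
  by (intro continuous_intros) (use n_pos in force)+
qed

lemma hext_measurable:
 assumes P: "P \<in> borel_measurable SM"
 shows "(%z. P (fold_dir z)) \<in> borel_measurable (restrict_space borel (M \<times> (- {0})))"
proof (rule measurable_compose[where f = fold_dir and g = P])
 show "fold_dir \<in> restrict_space borel (M \<times> (- {0})) \<rightarrow>\<^sub>M restrict_space borel (OmegaM n)"
 proof (rule measurable_restrict_space2)
  show "fold_dir \<in> space (restrict_space borel (M \<times> (- {0}))) \<rightarrow> OmegaM n"
  proof (rule Pi_I)
   fix z assume "z \<in> space (restrict_space borel (M \<times> (- {0 :: real^3})))"
   thus "fold_dir z \<in> OmegaM n" by (intro fold_dir_OmegaM) (auto simp: space_restrict_space)
  qed
  show "fold_dir \<in> borel_measurable (restrict_space borel (M \<times> (- {0})))"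
   by (rule borel_measurable_continuous_on_restrict[OF continuous_fold_dir])
 qed
 show "P \<in> borel_measurable (restrict_space borel (OmegaM n))" using P by (simp add: SM_measurable_iff)
qed

lemma punctured_borel: "M \<times> (- {0}) \<in> sets (borel :: phase measure)"
 by (rule borel_Times[OF borel_closed borel_open]) (auto simp: open_Compl)

lemma hext_indicator_measurable:
 fixes P :: "phase => real"
 assumes P: "P \<in> borel_measurable SM" and K: "K \<in> sets borel" "K \<subseteq> M \<times> (- {0})"
 shows "(%z. indicator K z * P (fold_dir z)) \<in> borel_measurable borel"
proof -
 have "(%z. indicator (M \<times> (- {0})) z *\<^sub>R P (fold_dir z)) \<in> borel_measurable borel"
  using hext_measurable[OF P] punctured_borel by (subst (asm) borel_measurable_restrict_space_iff) auto
 hence "(%z. indicator K z * (indicator (M \<times> (- {0})) z *\<^sub>R P (fold_dir z))) \<in> borel_measurable borel"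
  using K(1) by measurable
 moreover have "(%z. indicator K z * (indicator (M \<times> (- {0})) z *\<^sub>R P (fold_dir z))) = (%z. indicator K z * P (fold_dir z))"
  using K(2) by (auto simp: indicator_def fun_eq_iff)
 ultimately show ?thesis by (simp only:)
qed

lemma AE_interior: "AE x in lborel. x \<in> M \<longleftrightarrow> x \<in> interior M"
proof -
 have "negligible (sphere 0 1 :: (real^3) set)" by (rule negligible_sphere)
 moreover have "sphere 0 1 \<in> sets (borel :: (real^3) measure)" by (simp add: borel_closed)
 ultimately have "sphere (0 :: real^3) 1 \<in> null_sets lborel"
  using null_sets_completion_iff[of "sphere (0 :: real^3) 1" lborel] by (simp add: negligible_iff_null_sets)
 from AE_not_in[OF this] show ?thesis
  by eventually_elim (auto simp: interior_cball)
qed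

text \<open>Polar coordinates in each fibre produce the radial factor and the sphere measure; the
  density \<open>n^3\<close> carried by \<open>SM\<close> is divided out again. The identity carries
  integrability from \<open>SM\<close> to Lebesgue measure and null sets back.\<close>

lemma nn_integral_slab:
 fixes P :: "phase => real"
 assumes P: "P \<in> borel_measurable SM" and P0: "!!z. 0 <= P z" and ab: "0 < a" "a < b"
 shows "(\<integral>\<^sup>+z. ennreal (indicator (slab a b) z * P (fold_dir z)) \<partial>lborel)
   = ennreal ((b^3 - a^3) / 3) * (\<integral>\<^sup>+z. ennreal (P z / n (fst z) ^ 3) \<partial>SM)"
proof -
 have sl: "slab a b \<subseteq> M \<times> (- {0})" using slab_sub[OF ab(1)] by fastforce
 have gm: "(%z. indicator (slab a b) z * P (fold_dir z)) \<in> borel_measurable borel"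
  by (rule hext_indicator_measurable[OF P slab_borel sl])
 have nf: "(%z. n (fst z)) \<in> borel_measurable (restrict_space borel (OmegaM n))"
  using n_fst_measurable by (simp only: SM_measurable_iff)
 have Pn: "(%z. ennreal (P z / n (fst z) ^ 3)) \<in> borel_measurable SM"
  using P nf unfolding SM_measurable_iff by measurable
 have pmr: "(%omega. P (x, omega /\<^sub>R n x)) \<in> borel_measurable (restrict_space borel (sphere 0 1))" if x: "x \<in> M" for x
 proof -
  have "(%omega. (x, omega /\<^sub>R n x)) \<in> restrict_space borel (sphere 0 1) \<rightarrow>\<^sub>M restrict_space borel (OmegaM n)"
  proof (rule measurable_restrict_space2)
   show "(%omega. (x, omega /\<^sub>R n x)) \<in> space (restrict_space borel (sphere 0 1)) \<rightarrow> OmegaM n"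
    using scaled_OmegaM[OF x] by (auto simp: space_restrict_space)
   have "(%omega :: real^3. (x, omega /\<^sub>R n x)) \<in> borel_measurable borel"
    by (intro borel_measurable_continuous_onI continuous_intros)
   thus "(%omega :: real^3. (x, omega /\<^sub>R n x)) \<in> borel_measurable (restrict_space borel (sphere 0 1))"
    by (rule measurable_restrict_space1)
  qed
  thus ?thesis using P unfolding SM_measurable_iff by measurable
 qed
 have pm: "(%omega. ennreal (P (x, omega /\<^sub>R n x))) \<in> borel_measurable (restrict_space borel (sphere 0 1))" if x: "x \<in> M" for x
  using pmr[OF x] by measurable
 have "(\<integral>\<^sup>+z. ennreal (indicator (slab a b) z * P (fold_dir z)) \<partial>lborel)
   = (\<integral>\<^sup>+z. ennreal (indicator (slab a b) z * P (fold_dir z)) \<partial>(lborel \<Otimes>\<^sub>M lborel))" by (simp only: lborel_prod)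
 also have "... = (\<integral>\<^sup>+x. (\<integral>\<^sup>+y. ennreal (indicator (slab a b) (x, y) * P (fold_dir (x, y))) \<partial>lborel) \<partial>lborel)"
  by (subst lborel.nn_integral_fst[symmetric]) (use gm in \<open>auto simp: lborel_prod\<close>)
 also have "... = (\<integral>\<^sup>+x. ennreal ((b^3 - a^3) / 3) * (indicator M x * (ennreal (n x ^ 3) * (\<integral>\<^sup>+omega. ennreal (P (x, omega /\<^sub>R n x) / n x ^ 3) \<partial>sphere_measure))) \<partial>lborel)"
 proof (rule nn_integral_cong_AE)
  show "AE x in lborel. (\<integral>\<^sup>+y. ennreal (indicator (slab a b) (x, y) * P (fold_dir (x, y))) \<partial>lborel)
   = ennreal ((b^3 - a^3) / 3) * (indicator M x * (ennreal (n x ^ 3) * (\<integral>\<^sup>+omega. ennreal (P (x, omega /\<^sub>R n x) / n x ^ 3) \<partial>sphere_measure)))"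
   using AE_interior
  proof eventually_elim
   case (elim x)
   show ?case
   proof (cases "x \<in> interior M")
    case False
    hence "indicator (slab a b) (x, y) = (0 :: real)" for y by (simp add: slab_def)
    thus ?thesis using False elim by simp
   next
    case True
    hence x: "x \<in> M" using elim by blast
    have "(\<integral>\<^sup>+y. ennreal (indicator (slab a b) (x, y) * P (fold_dir (x, y))) \<partial>lborel)
     = (\<integral>\<^sup>+y. indicator (shell a b) y * ennreal (P (x, unit_dir y /\<^sub>R n x)) \<partial>lborel)"
     by (rule nn_integral_cong) (use True in \<open>auto simp: slab_def indicator_def fold_dir_def unit_dir_def mult.commute\<close>)
    also have "... = ennreal ((b^3 - a^3) / 3) * (\<integral>\<^sup>+omega. ennreal (P (x, omega /\<^sub>R n x)) \<partial>sphere_measure)"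
     by (rule nn_integral_shell[OF pm[OF x] ab])
    also have "(\<integral>\<^sup>+omega. ennreal (P (x, omega /\<^sub>R n x)) \<partial>sphere_measure)
     = (\<integral>\<^sup>+omega. ennreal (n x ^ 3) * ennreal (P (x, omega /\<^sub>R n x) / n x ^ 3) \<partial>sphere_measure)"
     using n_pos[OF x] P0 by (simp add: ennreal_mult[symmetric])
    also have "... = ennreal (n x ^ 3) * (\<integral>\<^sup>+omega. ennreal (P (x, omega /\<^sub>R n x) / n x ^ 3) \<partial>sphere_measure)"
    proof (rule nn_integral_cmult)
     have "(%omega. ennreal (P (x, omega /\<^sub>R n x) / n x ^ 3)) \<in> borel_measurable (restrict_space borel (sphere 0 1))"
      using pmr[OF x] by measurable
     thus "(%omega. ennreal (P (x, omega /\<^sub>R n x) / n x ^ 3)) \<in> borel_measurable sphere_measure"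
      by (subst measurable_cong_sets[OF sets_sphere_measure refl])
    qed
    finally show ?thesis using x by simp
   qed
  qed
 qed
 also have "... = ennreal ((b^3 - a^3) / 3) * (\<integral>\<^sup>+x. indicator M x * (ennreal (n x ^ 3) * (\<integral>\<^sup>+omega. ennreal (P (x, omega /\<^sub>R n x) / n x ^ 3) \<partial>sphere_measure)) \<partial>lborel)"
 proof (rule nn_integral_cmult)
  interpret S: finite_measure sphere_measure by (rule finite_sphere_measure)
  have "(%q. ennreal (P (fst q, snd q /\<^sub>R n (fst q)) / n (fst q) ^ 3)) \<in> borel_measurable (restrict_space lborel M \<Otimes>\<^sub>M sphere_measure)"
   using measurable_compose[OF param_measurable, of "%z. ennreal (P z / n (fst z) ^ 3)" borel] Pn
   by (simp add: SM_measurable_iff case_prod_beta')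
  from S.borel_measurable_nn_integral_fst[OF this]
  have "(%x. \<integral>\<^sup>+omega. ennreal (P (x, omega /\<^sub>R n x) / n x ^ 3) \<partial>sphere_measure) \<in> borel_measurable (restrict_space lborel M)" by simp
  moreover have "n \<in> borel_measurable (restrict_space lborel M)" using n_measurable
   by (subst measurable_cong_sets[OF _ refl, of _ "restrict_space borel M"]) (auto simp: sets_restrict_space)
  ultimately have "(%x. ennreal (n x ^ 3) * (\<integral>\<^sup>+omega. ennreal (P (x, omega /\<^sub>R n x) / n x ^ 3) \<partial>sphere_measure)) \<in> borel_measurable (restrict_space lborel M)"
   by measurable
  hence "(%x. (ennreal (n x ^ 3) * (\<integral>\<^sup>+omega. ennreal (P (x, omega /\<^sub>R n x) / n x ^ 3) \<partial>sphere_measure)) * indicator M x) \<in> borel_measurable lborel"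
   by (subst (asm) borel_measurable_restrict_space_iff_ennreal) auto
  thus "(%x. indicator M x * (ennreal (n x ^ 3) * (\<integral>\<^sup>+omega. ennreal (P (x, omega /\<^sub>R n x) / n x ^ 3) \<partial>sphere_measure))) \<in> borel_measurable lborel"
   by (simp add: mult.commute)
 qed
 also have "(\<integral>\<^sup>+x. indicator M x * (ennreal (n x ^ 3) * (\<integral>\<^sup>+omega. ennreal (P (x, omega /\<^sub>R n x) / n x ^ 3) \<partial>sphere_measure)) \<partial>lborel)
   = (\<integral>\<^sup>+z. ennreal (P z / n (fst z) ^ 3) \<partial>SM)"
  using nn_integral_SM[OF Pn] by simp
 finally show ?thesis .
qed

end

subsection \<open>Weak derivatives on the sphere bundle\<close>

lemma test_function_support:
 assumes "psi \<in> test_functions U"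
 obtains K where "compact K" "K \<subseteq> U" "!!z. z \<notin> K ==> psi z = 0" "!!z b. z \<notin> K ==> frechet_derivative psi (at z) b = 0"
proof -
 obtain K where K: "compact K" "K \<subseteq> U" "!!z. z \<notin> K ==> psi z = 0"
  using assms unfolding test_functions_def by blast
 have "frechet_derivative psi (at z) b = 0" if "z \<notin> K" for z b
 proof -
  have "(psi has_derivative (%h. 0)) (at z)"
   by (rule has_derivative_transform_within_open[of "%_. 0" _ _ _ "- K"])
    (use K that in \<open>auto simp: compact_imp_closed open_Compl\<close>)
  thus ?thesis by (simp add: frechet_eq)
 qed
 with K show ?thesis by (rule that)
qed

context medium
begin

abbreviation hip :: "(phase => real) => (phase => real) => real" where
 "hip \<equiv> %u v. \<integral>z. u z * v z \<partial>SM"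

sublocale H: semi_hilbert "L2 SM" hip
 by (rule L2_semi_hilbert)

lemma H_nrm: "H.nrm = L2_norm SM"
 by (rule L2_norm_eq)

lemma L2_AE_iff:
 assumes "u \<in> L2 SM" shows "H.nrm u = 0 \<longleftrightarrow> (AE z in SM. u z = 0)"
proof -
 have "integrable SM (%z. (u z)^2)" using assms by (simp add: L2_def)
 hence "(LINT z|SM. (u z)^2) = 0 \<longleftrightarrow> (AE z in SM. (u z)^2 = 0)" by (intro integral_nonneg_eq_0_iff_AE) auto
 thus ?thesis by (simp add: H_nrm L2_norm_def)
qed

lemma L2_SM_const: "(%z. C) \<in> L2 SM"
 by (rule L2_bounded[OF finite_SM, of _ "\<bar>C\<bar>"]) auto

lemma L2_SM_integrable: "u \<in> L2 SM ==> integrable SM u"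
 using L2_integrable_mult[OF _ L2_SM_const[of 1], of u] by simp

lemma L1_le_L2:
 assumes u: "u \<in> L2 SM" shows "(LINT z|SM. \<bar>u z\<bar>) <= H.nrm (%z. 1) * H.nrm u"
proof -
 have a: "(%z. \<bar>u z\<bar>) \<in> L2 SM" by (rule L2_bound[OF _ u, of _ 1]) (use u in \<open>auto simp: L2_def\<close>)
 have "H.nrm (%z. \<bar>u z\<bar>) = H.nrm u" by (simp add: H.nrm_def)
 thus ?thesis using H.Cauchy_Schwarz[OF a L2_SM_const[of 1]] by (simp add: mult.commute)
qed

text \<open>The index pairs a flag with a coordinate: \<open>True\<close> for base derivatives,
  \<open>False\<close> for fibre derivatives. \<open>wt\<close> is the factor that restores
  homogeneity of degree -1 in the fibre case, so that both kinds satisfy one and the same weak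
  equation.\<close>

definition wt :: "bool \<times> 3 => phase => real" where
 "wt q z = (if fst q then 1 else 1 / (n (fst z) * norm (snd z)))"

definition dir :: "bool \<times> 3 => phase" where
 "dir q = (if fst q then (axis (snd q) 1, 0) else (0, axis (snd q) 1))"

definition wder :: "bool \<times> 3 => (phase => real) => (phase => real) => bool" where
 "wder q u p \<longleftrightarrow> (if fst q then weak_dx n (snd q) u p else weak_dxi n (snd q) u p)"

definition dd :: "bool \<times> 3 => (phase => real) => phase => real" where
 "dd q u = (if fst q then dx n (snd q) u else dxi n (snd q) u)"

lemma wder_iff: "wder q u p \<longleftrightarrow> p \<in> L2 SM \<and>
  weak_derivative punctured_TM (dir q) (hext n u) (%z. hext n p z * wt q z)"
 by (auto simp: wder_def weak_dx_def weak_dxi_def wt_def dir_def case_prod_beta' split: if_splits)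

lemma compact_slab:
 assumes K: "compact K" "K \<subseteq> punctured_TM"
 obtains a b where "0 < a" "a < b" "K \<subseteq> slab a b"
proof (cases "K = {}")
 case True
 thus ?thesis using that[of 1 2] by simp
next
 case False
 have cont: "continuous_on K (%z. norm (snd z))" by (intro continuous_intros)
 obtain z0 where z0: "z0 \<in> K" "ALL z:K. norm (snd z0) <= norm (snd z)" using continuous_attains_inf[OF K(1) False cont] by blast
 obtain z1 where z1: "z1 \<in> K" "ALL z:K. norm (snd z) <= norm (snd z1)" using continuous_attains_sup[OF K(1) False cont] by blast
 have pos: "norm (snd z0) > 0" using z0(1) K(2) by (auto simp: punctured_TM_def)
 show ?thesis
 proof (rule that[of "norm (snd z0) / 2" "norm (snd z1) + 1"])
  show "norm (snd z0) / 2 < norm (snd z1) + 1" using bspec[OF z0(2) z1(1)] pos by linarith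
  show "K \<subseteq> slab (norm (snd z0) / 2) (norm (snd z1) + 1)"
  proof
   fix z assume z: "z \<in> K"
   hence "norm (snd z0) <= norm (snd z)" "norm (snd z) <= norm (snd z1)" "fst z \<in> interior M"
    using z0 z1 K(2) by (auto simp: punctured_TM_def)
   thus "z \<in> slab (norm (snd z0) / 2) (norm (snd z1) + 1)"
    using pos unfolding slab_def shell_def mem_Times_iff mem_Collect_eq by (intro conjI) (assumption | linarith)+
  qed
 qed (use pos in auto)
qed

text \<open>Integration of such a function against the extension of \<open>g\<close> is a bounded
  functional of \<open>g\<close>. Every weak derivative equation thus becomes an identity between
  continuous functionals on \<open>L2 SM\<close>.\<close>

definition kernel :: "(phase => real) => bool" where
 "kernel k \<longleftrightarrow> k \<in> borel_measurable borel \<and>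
   (EX a b B. 0 < a \<and> a < b \<and> (ALL z. \<bar>k z\<bar> <= B * indicator (slab a b) z))"

definition pair :: "(phase => real) => (phase => real) => real" where
 "pair k g = (LINT z|lborel. k z * g (fold_dir z))"

text \<open>This is \<open>nn_integral_slab\<close> with \<open>n >= c\<close> in the denominator;
  \<open>C\<close> depends on the kernel only, hence the order of the quantifiers.\<close>

lemma kernel_integrable_bound:
 assumes k: "kernel k"
 shows "EX C>=0. ALL g. integrable SM g --> integrable lborel (%z. k z * g (fold_dir z)) \<and> \<bar>pair k g\<bar> <= C * (LINT z|SM. \<bar>g z\<bar>)"
proof -
 obtain a b B where km: "k \<in> borel_measurable borel" and ab: "0 < a" "a < b" and B: "!!z. \<bar>k z\<bar> <= B * indicator (slab a b) z"
  using k unfolding kernel_def by blast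
 have k0: "k z = 0" if "z \<notin> slab a b" for z using B[of z] that by simp
 have kB: "\<bar>k z\<bar> <= \<bar>B\<bar> * indicator (slab a b) z" for z using B[of z] by (auto simp: indicator_def split: if_splits)
 have sl: "slab a b \<subseteq> M \<times> (- {0})" using slab_sub[OF ab(1)] by fastforce
 define V where "V = (b^3 - a^3) / 3"
 have V: "V >= 0" unfolding V_def using power_mono[of a b 3] ab by simp
 define C where "C = \<bar>B\<bar> * V / c^3"
 have main: "integrable lborel (%z. k z * g (fold_dir z)) \<and> \<bar>pair k g\<bar> <= C * (LINT z|SM. \<bar>g z\<bar>)" if g: "integrable SM g" for g
 proof -
  have gm [measurable]: "g \<in> borel_measurable SM" using g by simp
  have am: "(%z. \<bar>g z\<bar>) \<in> borel_measurable SM" by measurable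
  have "(%z. k z * (indicator (slab a b) z * g (fold_dir z))) \<in> borel_measurable borel"
   using km hext_indicator_measurable[OF gm slab_borel sl] by measurable
  moreover have "(%z. k z * (indicator (slab a b) z * g (fold_dir z))) = (%z. k z * g (fold_dir z))"
   using k0 by (auto simp: fun_eq_iff indicator_def)
  ultimately have m: "(%z. k z * g (fold_dir z)) \<in> borel_measurable lborel" by simp
  have "(\<integral>\<^sup>+z. ennreal (norm (k z * g (fold_dir z))) \<partial>lborel)
    <= (\<integral>\<^sup>+z. ennreal \<bar>B\<bar> * ennreal (indicator (slab a b) z * \<bar>g (fold_dir z)\<bar>) \<partial>lborel)"
  proof (rule nn_integral_mono)
   fix z
   have "\<bar>k z\<bar> * \<bar>g (fold_dir z)\<bar> <= (\<bar>B\<bar> * indicator (slab a b) z) * \<bar>g (fold_dir z)\<bar>"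
    by (rule mult_right_mono[OF kB]) simp
   thus "ennreal (norm (k z * g (fold_dir z))) <= ennreal \<bar>B\<bar> * ennreal (indicator (slab a b) z * \<bar>g (fold_dir z)\<bar>)"
    by (simp add: abs_mult ennreal_mult[symmetric] ennreal_leI mult.assoc)
  qed
  also have "... = ennreal \<bar>B\<bar> * (\<integral>\<^sup>+z. ennreal (indicator (slab a b) z * \<bar>g (fold_dir z)\<bar>) \<partial>lborel)"
   by (rule nn_integral_cmult) (use hext_indicator_measurable[OF am slab_borel sl] in measurable)
  also have "... = ennreal \<bar>B\<bar> * (ennreal V * (\<integral>\<^sup>+z. ennreal (\<bar>g z\<bar> / n (fst z) ^ 3) \<partial>SM))"
   unfolding V_def by (subst nn_integral_slab[OF am _ ab]) simp_all
  also have "... <= ennreal \<bar>B\<bar> * (ennreal V * (\<integral>\<^sup>+z. ennreal (\<bar>g z\<bar> / c ^ 3) \<partial>SM))"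
  proof (intro mult_left_mono nn_integral_mono ennreal_leI)
   fix z assume "z \<in> space SM"
   hence "c <= n (fst z)" by (simp add: mem_OmegaM n_ge)
   thus "\<bar>g z\<bar> / n (fst z) ^ 3 <= \<bar>g z\<bar> / c ^ 3"
    using c by (intro divide_left_mono power_mono) auto
  qed auto
  also have "(\<integral>\<^sup>+z. ennreal (\<bar>g z\<bar> / c ^ 3) \<partial>SM) = ennreal ((LINT z|SM. \<bar>g z\<bar>) / c ^ 3)"
   by (subst nn_integral_eq_integral) (use g c in auto)
  also have "ennreal \<bar>B\<bar> * (ennreal V * ennreal ((LINT z|SM. \<bar>g z\<bar>) / c ^ 3)) = ennreal (C * (LINT z|SM. \<bar>g z\<bar>))"
   using V c by (simp add: C_def ennreal_mult[symmetric] integral_nonneg_AE)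
  finally have nn: "(\<integral>\<^sup>+z. ennreal (norm (k z * g (fold_dir z))) \<partial>lborel) <= ennreal (C * (LINT z|SM. \<bar>g z\<bar>))" .
  have i: "integrable lborel (%z. k z * g (fold_dir z))"
   using m nn order_le_less_trans[OF nn ennreal_less_top] by (intro integrableI_bounded) auto
  have "ennreal (norm (pair k g)) <= ennreal (C * (LINT z|SM. \<bar>g z\<bar>))"
   unfolding pair_def by (rule order_trans[OF integral_norm_bound_ennreal[OF i] nn])
  hence "\<bar>pair k g\<bar> <= C * (LINT z|SM. \<bar>g z\<bar>)"
   using V c by (subst (asm) ennreal_le_iff) (auto simp: C_def integral_nonneg_AE)
  with i show ?thesis by blast
 qed
 show ?thesis by (rule exI[of _ C]) (use V c main in \<open>auto simp: C_def\<close>)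
qed

lemma kernel_integrable: "kernel k ==> integrable SM g ==> integrable lborel (%z. k z * g (fold_dir z))"
 using kernel_integrable_bound by blast

lemma pair_L2_bound:
 assumes "kernel k" shows "EX C. ALL g:L2 SM. \<bar>pair k g\<bar> <= C * H.nrm g"
proof -
 obtain C where C: "C >= 0" "!!g. integrable SM g ==> \<bar>pair k g\<bar> <= C * (LINT z|SM. \<bar>g z\<bar>)"
  using kernel_integrable_bound[OF assms] by blast
 have "\<bar>pair k g\<bar> <= (C * H.nrm (%z. 1)) * H.nrm g" if g: "g \<in> L2 SM" for g
  using C(2)[OF L2_SM_integrable[OF g]] mult_left_mono[OF L1_le_L2[OF g] C(1)] by (simp add: mult.assoc)
 thus ?thesis by blast
qed

lemma pair_linear:
 assumes "kernel k" "u \<in> L2 SM" "v \<in> L2 SM"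
 shows "pair k (u + v) = pair k u + pair k v" "pair k (u - v) = pair k u - pair k v" "pair k (r *\<^sub>R u) = r * pair k u"
 using kernel_integrable[OF assms(1) L2_SM_integrable[OF assms(2)]] kernel_integrable[OF assms(1) L2_SM_integrable[OF assms(3)]]
 by (simp_all add: pair_def distrib_left right_diff_distrib mult.left_commute)

lemma pair_tendsto:
 assumes k: "kernel k" and s: "!!j. s j \<in> L2 SM" "g \<in> L2 SM" and l: "(%j. H.nrm (s j - g)) \<longlonglongrightarrow> 0"
 shows "(%j. pair k (s j)) \<longlonglongrightarrow> pair k g"
proof -
 obtain C where C: "!!g. g \<in> L2 SM ==> \<bar>pair k g\<bar> <= C * H.nrm g" using pair_L2_bound[OF k] by blast
 have "(%j. pair k (s j) - pair k g) \<longlonglongrightarrow> 0"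
 proof (rule Lim_null_comparison)
  show "(%j. C * H.nrm (s j - g)) \<longlonglongrightarrow> 0" using tendsto_mult_right_zero[OF l] .
  show "\<forall>\<^sub>F j in sequentially. norm (pair k (s j) - pair k g) <= C * H.nrm (s j - g)"
   using C[OF H.mem(4)[OF s(1) s(2)]] pair_linear(2)[OF k s(1) s(2)] by (intro always_eventually allI) simp
 qed
 thus ?thesis by (simp add: LIM_zero_iff)
qed

lemma pair_AE:
 assumes k: "kernel k" and s: "u \<in> L2 SM" "v \<in> L2 SM" and l: "AE z in SM. u z = v z"
 shows "pair k u = pair k v"
proof -
 obtain C where C: "!!g. g \<in> L2 SM ==> \<bar>pair k g\<bar> <= C * H.nrm g" using pair_L2_bound[OF k] by blast
 have "H.nrm (u - v) = 0" using L2_AE_iff[OF H.mem(4)[OF s]] l by simp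
 thus ?thesis using C[OF H.mem(4)[OF s]] pair_linear(2)[OF k s] by simp
qed

lemma kernel_compact:
 assumes K: "compact K" "K \<subseteq> punctured_TM" and h: "continuous_on K h"
 shows "kernel (%z. indicator K z * h z)"
proof -
 obtain a b where ab: "0 < a" "a < b" "K \<subseteq> slab a b" using compact_slab[OF K] .
 have "compact (h ` K)" by (rule compact_continuous_image[OF h K(1)])
 then obtain B where B: "!!z. z \<in> K ==> norm (h z) <= B" using compact_imp_bounded bounded_iff by (metis imageI)
 have "\<bar>indicator K z * h z\<bar> <= \<bar>B\<bar> * indicator (slab a b) z" for z
  using B[of z] ab(3) by (auto simp: indicator_def)
 moreover have "(%z. indicator K z * h z) \<in> borel_measurable borel"
  using borel_measurable_continuous_on_indicator[OF _ h] borel_compact[OF K(1)] by simp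
 ultimately show ?thesis unfolding kernel_def using ab(1,2) by blast
qed

lemma continuous_wt: "continuous_on (M \<times> (- {0})) (wt q)"
proof (cases "fst q")
 case False
 have "continuous_on (M \<times> (- {0 :: real^3})) (%z. n (fst z))"
  by (rule continuous_on_compose2[OF n_continuous]) (auto intro!: continuous_intros)
 thus ?thesis using False unfolding wt_def[abs_def]
  by (simp) (intro continuous_intros; use n_pos in force)
qed (simp add: wt_def[abs_def])

lemma wt_pos: "fst z \<in> M ==> snd z \<noteq> 0 ==> 0 < wt q z"
 using n_pos[of "fst z"] by (simp add: wt_def)

lemma punctured_TM_sub: "punctured_TM \<subseteq> M \<times> (- {0})" "open punctured_TM"
 using interior_subset[of M] by (auto simp: punctured_TM_def intro!: open_Times open_Compl)

definition kerD :: "bool \<times> 3 => (phase => real) => phase => real" where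
 "kerD q psi z = indicator punctured_TM z * frechet_derivative psi (at z) (dir q)"

definition kerW :: "bool \<times> 3 => (phase => real) => phase => real" where
 "kerW q psi z = indicator punctured_TM z * (wt q z * psi z)"

lemma kernel_test:
 assumes psi: "psi \<in> test_functions punctured_TM"
 shows "kernel (kerD q psi)" "kernel (kerW q psi)"
proof -
 obtain K where K: "compact K" "K \<subseteq> punctured_TM" "!!z. z \<notin> K ==> psi z = 0" "!!z b. z \<notin> K ==> frechet_derivative psi (at z) b = 0"
  by (rule test_function_support[OF psi]) (rule that, assumption+)
 have e: "kerD q psi = (%z. indicator K z * frechet_derivative psi (at z) (dir q))" "kerW q psi = (%z. indicator K z * (wt q z * psi z))"
  using K(2,3,4) by (auto simp: kerD_def kerW_def fun_eq_iff indicator_def)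
 have w: "continuous_on K (wt q)" using K(2) punctured_TM_sub(1) by (intro continuous_on_subset[OF continuous_wt]) blast
 show "kernel (kerD q psi)" unfolding e
  by (rule kernel_compact[OF K(1,2)]) (rule continuous_on_subset[OF test_function_derivative(2)[OF psi]], simp)
 show "kernel (kerW q psi)" unfolding e
  by (rule kernel_compact[OF K(1,2)], rule continuous_on_mult[OF w]) (rule continuous_on_subset[OF test_function_continuous[OF psi]], simp)
qed

text \<open>Local integrability of the extensions comes from \<open>kernel_compact\<close>, so weak
  differentiability turns into equations in \<open>pair\<close>. Linearity, invariance under a.e.
  equality and closedness under limits are then inherited from \<open>pair\<close>.\<close>

lemma wder_char:
 assumes u: "u \<in> L2 SM"
 shows "wder q u p \<longleftrightarrow> p \<in> L2 SM \<and> (ALL psi:test_functions punctured_TM. pair (kerD q psi) u = - pair (kerW q psi) p)"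
proof -
 have loc: "set_integrable lborel K (%z. hext n g z * h z)"
  if K: "compact K" "K \<subseteq> punctured_TM" and h: "continuous_on (M \<times> (- {0})) h" and g: "g \<in> L2 SM" for K h g
 proof -
  have "continuous_on K h" using K(2) punctured_TM_sub(1) by (intro continuous_on_subset[OF h]) blast
  from kernel_integrable[OF kernel_compact[OF K this] L2_SM_integrable[OF g]]
  show ?thesis by (simp add: set_integrable_def hext_fold mult_ac)
 qed
 have L: "(LINT z:punctured_TM|lborel. hext n u z * frechet_derivative psi (at z) (dir q)) = pair (kerD q psi) u" for psi
  by (simp add: set_lebesgue_integral_def pair_def kerD_def hext_fold mult_ac)
 have R: "(LINT z:punctured_TM|lborel. hext n p z * wt q z * psi z) = pair (kerW q psi) p" for psi
  by (simp add: set_lebesgue_integral_def pair_def kerW_def hext_fold mult_ac)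
 have "set_integrable lborel K (hext n u)" if K: "compact K" "K \<subseteq> punctured_TM" for K
  using loc[OF K continuous_on_const u, of 1] by simp
 thus ?thesis unfolding wder_iff weak_derivative_def L R using loc[OF _ _ continuous_wt] by blast
qed

lemma wder_L2: "wder q u p ==> p \<in> L2 SM"
 by (simp add: wder_iff)

lemma wder_add:
 assumes "u \<in> L2 SM" "v \<in> L2 SM" "wder q u p" "wder q v r"
 shows "wder q (u + v) (p + r)"
 using assms wder_L2[OF assms(3)] wder_L2[OF assms(4)]
 by (simp add: wder_char pair_linear kernel_test)

lemma wder_scale:
 assumes "u \<in> L2 SM" "wder q u p" shows "wder q (a *\<^sub>R u) (a *\<^sub>R p)"
 using assms wder_L2[OF assms(2)] pair_linear(3)[OF _ assms(1) assms(1)] pair_linear(3)[OF _ wder_L2[OF assms(2)] assms(1)]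
 by (simp add: wder_char kernel_test)

lemma wder_limit:
 assumes s: "!!j. s j \<in> L2 SM" "!!j. wder q (s j) (r j)" and u: "u \<in> L2 SM" and p: "p \<in> L2 SM"
  and l: "(%j. H.nrm (s j - u)) \<longlonglongrightarrow> 0" "(%j. H.nrm (r j - p)) \<longlonglongrightarrow> 0"
 shows "wder q u p"
 unfolding wder_char[OF u]
proof (intro conjI ballI p)
 fix psi assume psi: "psi \<in> test_functions punctured_TM"
 have "(%j. pair (kerD q psi) (s j)) \<longlonglongrightarrow> pair (kerD q psi) u"
  by (rule pair_tendsto[OF kernel_test(1)[OF psi] s(1) u l(1)])
 moreover have "(%j. - pair (kerW q psi) (r j)) \<longlonglongrightarrow> - pair (kerW q psi) p"
  by (rule tendsto_minus, rule pair_tendsto[OF kernel_test(2)[OF psi] wder_L2[OF s(2)] p l(2)])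
 moreover have "pair (kerD q psi) (s j) = - pair (kerW q psi) (r j)" for j
  using s(2)[of j] psi unfolding wder_char[OF s(1)] by blast
 ultimately show "pair (kerD q psi) u = - pair (kerW q psi) p" by (simp add: LIMSEQ_unique)
qed

lemma wder_AE:
 assumes "wder q u p" "u \<in> L2 SM" "v \<in> L2 SM" "r \<in> L2 SM" "AE z in SM. u z = v z" "AE z in SM. p z = r z"
 shows "wder q v r"
 using assms pair_AE[OF kernel_test(1) assms(2,3,5)] pair_AE[OF kernel_test(2) wder_L2[OF assms(1)] assms(4,6)]
 by (simp add: wder_char)

text \<open>The fundamental lemma gives equality of the extensions almost everywhere in a slab, and
  \<open>nn_integral_slab\<close> carries this down to \<open>SM\<close>. The radii 1 and 2 of the
  slab are arbitrary.\<close>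

lemma wder_unique:
 assumes p: "wder q u p" and r: "wder q u r"
 shows "AE z in SM. p z = r z"
proof -
 define G where "G z = hext n p z * wt q z - hext n r z * wt q z" for z
 have wp: "weak_derivative punctured_TM (dir q) (hext n u) (%z. hext n p z * wt q z)"
  and wr: "weak_derivative punctured_TM (dir q) (hext n u) (%z. hext n r z * wt q z)"
  using p r by (simp_all add: wder_iff)
 have pL: "p \<in> L2 SM" and rL: "r \<in> L2 SM" using p r by (simp_all add: wder_iff)
 have "AE z in lborel. z \<in> punctured_TM --> G z = 0"
 proof (rule fundamental_lemma[OF punctured_TM_sub(2)])
  fix K assume "compact K" "K \<subseteq> punctured_TM"
  thus "set_integrable lborel K G" unfolding G_def[abs_def]
   using wp wr unfolding weak_derivative_def by (intro set_integral_diff(1)) blast+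
 next
  fix psi assume psi: "psi \<in> test_functions punctured_TM"
  have "(LINT z:punctured_TM|lborel. hext n p z * wt q z * psi z) = (LINT z:punctured_TM|lborel. hext n r z * wt q z * psi z)"
  proof -
   have e: "(LINT z:punctured_TM|lborel. hext n u z * frechet_derivative psi (at z) (dir q)) = - (LINT z:punctured_TM|lborel. g z * psi z)"
    if "weak_derivative punctured_TM (dir q) (hext n u) g" for g
    using that psi unfolding weak_derivative_def by blast
   show ?thesis using e[OF wp] e[OF wr] by linarith
  qed
  moreover have "set_integrable lborel punctured_TM (%z. hext n g z * wt q z * psi z)" if g: "g \<in> L2 SM" for g
   using kernel_integrable[OF kernel_test(2)[OF psi] L2_SM_integrable[OF g], of q]
   by (simp add: set_integrable_def hext_fold kerW_def mult_ac)
  ultimately show "(LINT z:punctured_TM|lborel. G z * psi z) = 0"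
   using pL rL by (simp add: G_def left_diff_distrib set_integral_diff(2))
 qed
 hence z: "AE z in lborel. ennreal (indicator (slab 1 2) z * \<bar>p (fold_dir z) - r (fold_dir z)\<bar>) = 0"
 proof eventually_elim
  case (elim z)
  show ?case
  proof (cases "z \<in> slab 1 2")
   case True
   hence "z \<in> punctured_TM" "fst z \<in> M" "snd z \<noteq> 0"
    using slab_sub[of 1 z 2] by (auto simp: slab_def punctured_TM_def shell_def)
   thus ?thesis using elim wt_pos[of z q] by (auto simp: G_def hext_fold)
  qed simp
 qed
 have m: "(%z. \<bar>p z - r z\<bar>) \<in> borel_measurable SM" using pL rL by (auto simp: L2_def)
 have "(\<integral>\<^sup>+z. ennreal (indicator (slab 1 2) z * \<bar>p (fold_dir z) - r (fold_dir z)\<bar>) \<partial>lborel) = 0"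
  using nn_integral_cong_AE[OF z] by simp
 hence "(\<integral>\<^sup>+z. ennreal (\<bar>p z - r z\<bar> / n (fst z) ^ 3) \<partial>SM) = 0"
  using nn_integral_slab[OF m, of 1 2] by simp
 hence "AE z in SM. ennreal (\<bar>p z - r z\<bar> / n (fst z) ^ 3) = 0"
  by (subst (asm) nn_integral_0_iff_AE) (use m in measurable)
 thus ?thesis using AE_space
 proof eventually_elim
  case (elim z)
  hence "n (fst z) > 0" by (simp add: mem_OmegaM n_pos)
  hence "\<bar>p z - r z\<bar> / n (fst z) ^ 3 > 0" if "p z \<noteq> r z" using that by simp
  thus ?case using elim(1) by (metis ennreal_eq_0_iff not_le)
 qed
qed

subsection \<open>The Sobolev space as a semi-Hilbert space\<close>

lemma H1_iff: "u \<in> H1 n \<longleftrightarrow> u \<in> L2 SM \<and> (ALL q. EX p. wder q u p)"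
 by (auto simp: H1_def wder_def)

lemma H1_L2: "u \<in> H1 n ==> u \<in> L2 SM"
 by (simp add: H1_iff)

lemma wder_dd: "u \<in> H1 n ==> wder q u (dd q u)"
proof -
 assume "u \<in> H1 n"
 then obtain p where "wder q u p" unfolding H1_iff by blast
 thus ?thesis unfolding wder_def dd_def dx_def dxi_def
  using someI[of "weak_dx n (snd q) u" p] someI[of "weak_dxi n (snd q) u" p] by (simp split: if_splits)
qed

lemma dd_L2: "u \<in> H1 n ==> dd q u \<in> L2 SM"
 using wder_dd wder_L2 by blast

lemma H1_wder: "u \<in> L2 SM ==> (!!q. wder q u (p q)) ==> u \<in> H1 n"
 unfolding H1_iff by blast

lemma dd_eq: "u \<in> H1 n ==> wder q u p ==> AE z in SM. dd q u z = p z"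
 by (rule wder_unique[OF wder_dd])

lemma subspace_H1: "subspace (H1 n)"
proof (rule subspaceI)
 have "wder q (0 *\<^sub>R 0) (0 *\<^sub>R (0 :: phase => real))" for q
  unfolding wder_char[OF H.mem(3)[OF H.mem(1)]] by (auto simp: pair_def)
 thus "0 \<in> H1 n" by (intro H1_wder[of 0 "%q. 0"]) simp_all
 show "u + v \<in> H1 n" if "u \<in> H1 n" "v \<in> H1 n" for u v
  by (rule H1_wder[OF _ wder_add[OF _ _ wder_dd wder_dd]]) (use that H1_L2 in auto)
 show "a *\<^sub>R u \<in> H1 n" if "u \<in> H1 n" for u a
  by (rule H1_wder[OF _ wder_scale[OF _ wder_dd]]) (use that H1_L2 in auto)
qed

text \<open>\<open>dd\<close> is chosen by \<open>SOME\<close> separately for each function, so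
  additivity is available only up to the a.e. uniqueness of weak derivatives.\<close>

lemma dd_add: "u \<in> H1 n ==> v \<in> H1 n ==> AE z in SM. dd q (u + v) z = dd q u z + dd q v z"
 using dd_eq[OF subspace_add[OF subspace_H1] wder_add[OF H1_L2 H1_L2 wder_dd wder_dd], of u v q] by simp

lemma dd_scale:
 assumes "u \<in> H1 n" shows "AE z in SM. dd q (a *\<^sub>R u) z = a * dd q u z"
 using dd_eq[OF subspace_scale[OF subspace_H1 assms] wder_scale[OF H1_L2 wder_dd, OF assms assms]] by simp

text \<open>The gradient has components \<open>dd q u / n^2\<close> and the metric contributes a
  factor \<open>n^2\<close>; with this normalisation the metric products of gradients are plain sums
  of products.\<close>

definition gd :: "bool \<times> 3 => (phase => real) => phase => real" where
 "gd q u z = dd q u z / n (fst z)"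

lemma n_bounds: "AE z in SM. \<bar>1 / n (fst z)\<bar> <= 1 / c" "AE z in SM. \<bar>n (fst z)\<bar> <= nmax"
proof -
 have "\<bar>1 / n (fst z)\<bar> <= 1 / c \<and> \<bar>n (fst z)\<bar> <= nmax" if "z \<in> space SM" for z
 proof -
  have "fst z \<in> M" using that by (simp add: mem_OmegaM)
  thus ?thesis using n_ge[of "fst z"] n_le[of "fst z"] n_pos[of "fst z"] c
   by (simp only: abs_divide abs_one abs_of_pos) (simp add: frac_le)
 qed
 thus "AE z in SM. \<bar>1 / n (fst z)\<bar> <= 1 / c" "AE z in SM. \<bar>n (fst z)\<bar> <= nmax" by auto
qed

lemma gd_L2: "u \<in> H1 n ==> gd q u \<in> L2 SM"
 using L2_mult_bounded[OF _ n_bounds(1) dd_L2, of u q] by (simp add: gd_def[abs_def])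

lemma gd_add: "u \<in> H1 n ==> v \<in> H1 n ==> AE z in SM. gd q (u + v) z = (gd q u + gd q v) z"
 by (drule (1) dd_add[of u v q], erule eventually_mono) (simp add: gd_def add_divide_distrib)

lemma gd_scale: "u \<in> H1 n ==> AE z in SM. gd q (a *\<^sub>R u) z = (a *\<^sub>R gd q u) z"
 by (drule dd_scale[of u q a], erule eventually_mono) (simp add: gd_def)

lemma gd_diff: assumes "u \<in> H1 n" "v \<in> H1 n" shows "AE z in SM. gd q (u - v) z = (gd q u - gd q v) z"
proof -
 have "(-1) *\<^sub>R v \<in> H1 n" by (rule subspace_scale[OF subspace_H1 assms(2)])
 from gd_add[OF assms(1) this, of q] gd_scale[OF assms(2), of q "-1"] show ?thesis
  by eventually_elim simp
qed

lemma hip_cong: "AE z in SM. u z = u' z ==> AE z in SM. v z = v' z ==> u \<in> L2 SM ==> u' \<in> L2 SM ==> v \<in> L2 SM ==> v' \<in> L2 SM ==> hip u v = hip u' v'"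
 by (rule integral_cong_AE) (auto simp: L2_def)

definition h1 :: "(phase => real) => (phase => real) => real" where
 "h1 u v = hip u v + (\<Sum>q\<in>UNIV. hip (gd q u) (gd q v))"

lemma H1_semi_inner: "semi_inner (H1 n) h1"
proof
 show "subspace (H1 n)" by (rule subspace_H1)
 fix u w assume u: "u \<in> H1 n" and w: "w \<in> H1 n"
 note L = H1_L2[OF u] H1_L2[OF w] gd_L2[OF u] gd_L2[OF w]
 show "h1 u w = h1 w u" unfolding h1_def by (simp add: mult.commute)
 show "0 <= h1 u u" unfolding h1_def using H.pos[OF L(1)] H.pos[OF L(3)] by (simp add: sum_nonneg)
 show "h1 (a *\<^sub>R u) w = a * h1 u w" for a
 proof -
  have "hip (gd q (a *\<^sub>R u)) (gd q w) = hip (a *\<^sub>R gd q u) (gd q w)" for q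
   by (rule hip_cong[OF gd_scale[OF u] AE_I2[OF refl] gd_L2[OF subspace_scale[OF subspace_H1 u]] H.mem(3)[OF L(3)] L(4) L(4)])
  hence "hip (gd q (a *\<^sub>R u)) (gd q w) = a * hip (gd q u) (gd q w)" for q
   using H.scale_left[OF L(3) L(4)] by simp
  thus ?thesis unfolding h1_def using H.scale_left[OF L(1,2), of a] by (simp add: distrib_left sum_distrib_left)
 qed
 fix v assume v: "v \<in> H1 n"
 have "hip (gd q (u + v)) (gd q w) = hip (gd q u + gd q v) (gd q w)" for q
  by (rule hip_cong[OF gd_add[OF u v] AE_I2[OF refl] gd_L2[OF subspace_add[OF subspace_H1 u v]] H.mem(2)[OF L(3) gd_L2[OF v]] L(4) L(4)])
 hence "hip (gd q (u + v)) (gd q w) = hip (gd q u) (gd q w) + hip (gd q v) (gd q w)" for q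
  using H.add_left[OF L(3) gd_L2[OF v] L(4)] by simp
 thus "h1 (u + v) w = h1 u w + h1 v w"
  unfolding h1_def using H.add_left[OF L(1) H1_L2[OF v] L(2)] by (simp add: sum.distrib)
qed

sublocale W: semi_inner "H1 n" h1
 by (rule H1_semi_inner)

lemma W_nrm_sq: "u \<in> H1 n ==> (W.nrm u)^2 = (H.nrm u)^2 + (\<Sum>q\<in>UNIV. (H.nrm (gd q u))^2)"
 using W.nrm_sq[of u] H.nrm_sq[OF H1_L2, of u] H.nrm_sq[OF gd_L2, of u] by (simp add: h1_def)

lemma W_nrm_ge: assumes "u \<in> H1 n" shows "H.nrm u <= W.nrm u" "H.nrm (gd q u) <= W.nrm u"
proof -
 have s: "(H.nrm (gd q u))^2 <= (\<Sum>q\<in>UNIV. (H.nrm (gd q u))^2)" by (rule member_le_sum) auto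
 have "(H.nrm u)^2 <= (W.nrm u)^2" using s W_nrm_sq[OF assms] by (smt (verit) zero_le_power2)
 thus "H.nrm u <= W.nrm u" by (rule power2_le_imp_le[OF _ W.nonneg[OF assms]])
 have "(H.nrm (gd q u))^2 <= (W.nrm u)^2" using s W_nrm_sq[OF assms] by (smt (verit) zero_le_power2)
 thus "H.nrm (gd q u) <= W.nrm u" by (rule power2_le_imp_le[OF _ W.nonneg[OF assms]])
qed

lemma sum_bool_3: "(\<Sum>q\<in>UNIV. f q) = (\<Sum>i\<in>UNIV. f (True, i)) + (\<Sum>i\<in>UNIV. f (False, i :: 3))" for f :: "bool \<times> 3 => real"
proof -
 have "(\<Sum>q\<in>UNIV. f q) = (\<Sum>s\<in>UNIV. \<Sum>i\<in>UNIV. f (s, i))"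
  by (simp add: sum.cartesian_product)
 thus ?thesis by (simp add: UNIV_bool)
qed

lemma H1_norm_eq: assumes u: "u \<in> H1 n" shows "H1_norm n u = W.nrm u"
proof -
 have "(LINT z|SM. ((u z)^2 + (metric_norm n (fst z) (nabla_x n u z))^2
   + (metric_norm n (fst z) (nabla_xi n u z))^2)) = (LINT z|SM. u z * u z + (\<Sum>q\<in>UNIV. gd q u z * gd q u z))"
 proof (rule Bochner_Integration.integral_cong[OF refl])
  fix z assume "z \<in> space SM"
  hence n: "n (fst z) > 0" by (simp add: mem_OmegaM n_pos)
  have "(metric_norm n (fst z) (nabla_x n u z))^2 = (\<Sum>i\<in>UNIV. gd (True, i) u z * gd (True, i) u z)"
   using n by (simp add: metric_norm_def metric_def inner_vec_def nabla_x_def gd_def dd_def sum_distrib_left sum_nonneg power2_eq_square)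
  moreover have "(metric_norm n (fst z) (nabla_xi n u z))^2 = (\<Sum>i\<in>UNIV. gd (False, i) u z * gd (False, i) u z)"
   using n by (simp add: metric_norm_def metric_def inner_vec_def nabla_xi_def gd_def dd_def sum_distrib_left sum_nonneg power2_eq_square)
  ultimately show "(u z)^2 + (metric_norm n (fst z) (nabla_x n u z))^2 + (metric_norm n (fst z) (nabla_xi n u z))^2
    = u z * u z + (\<Sum>q\<in>UNIV. gd q u z * gd q u z)"
   by (simp add: sum_bool_3 power2_eq_square)
 qed
 also have "... = h1 u u"
  unfolding h1_def using L2_integrable_mult[OF H1_L2[OF u] H1_L2[OF u]] L2_integrable_mult[OF gd_L2[OF u] gd_L2[OF u]]
  by (subst Bochner_Integration.integral_add) (auto intro!: Bochner_Integration.integral_sum)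
 finally show ?thesis by (simp add: H1_norm_def W.nrm_def)
qed

text \<open>Functions and normalised derivatives converge separately in L2; multiplication by
  \<open>n\<close> restores the weak derivatives, and closedness (\<open>wder_limit\<close>)
  identifies their limits.\<close>

lemma H1_complete: "semi_hilbert (H1 n) h1"
proof
 fix s :: "nat => phase => real" assume s: "!!k. s k \<in> H1 n" and cau: "!!e. e > 0 ==> EX K. ALL m>=K. ALL k>=K. W.nrm (s m - s k) < e"
 have sd: "s m - s k \<in> H1 n" for m k using s by auto
 have gdd: "H.nrm (gd q (u - v)) = H.nrm (gd q u - gd q v)" if "u \<in> H1 n" "v \<in> H1 n" for u v q
  using hip_cong[OF gd_diff[OF that] gd_diff[OF that] gd_L2 H.mem(4) gd_L2 H.mem(4), of q q] that gd_L2
  by (simp add: H.nrm_def)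
 have "EX x:L2 SM. (%k::nat. H.nrm (s k - x)) \<longlonglongrightarrow> 0"
 proof (rule H.complete)
  show "s k \<in> L2 SM" for k using s H1_L2 by blast
  fix e :: real assume "e > 0"
  then obtain K where "ALL m>=K. ALL k>=K. W.nrm (s m - s k) < e" using cau by blast
  thus "EX K. ALL m>=K. ALL k>=K. H.nrm (s m - s k) < e" using W_nrm_ge(1)[OF sd] le_less_trans by blast
 qed
 then obtain u where u: "u \<in> L2 SM" "(%k. H.nrm (s k - u)) \<longlonglongrightarrow> 0" by blast
 have "EX x:L2 SM. (%k. H.nrm (gd q (s k) - x)) \<longlonglongrightarrow> 0" for q
 proof (rule H.complete)
  show "gd q (s k) \<in> L2 SM" for k using s gd_L2 by blast
  fix e :: real assume "e > 0"
  then obtain K where "ALL m>=K. ALL k>=K. W.nrm (s m - s k) < e" using cau by blast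
  thus "EX K. ALL m>=K. ALL k>=K. H.nrm (gd q (s m) - gd q (s k)) < e"
   unfolding gdd[OF s s, symmetric] using le_less_trans[OF W_nrm_ge(2)[OF sd]] by fast
 qed
 hence "EX x. x \<in> L2 SM \<and> (%k. H.nrm (gd q (s k) - x)) \<longlonglongrightarrow> 0" for q by blast
 from choice[OF allI[OF this]] obtain g where g: "ALL q. g q \<in> L2 SM \<and> (%k. H.nrm (gd q (s k) - g q)) \<longlonglongrightarrow> 0" ..
 note gL = g[THEN spec, THEN conjunct1] and gl = g[THEN spec, THEN conjunct2]
 define p where "p q = (%z. n (fst z) * g q z)" for q
 have pL: "p q \<in> L2 SM" for q unfolding p_def by (rule L2_mult_bounded[OF n_fst_measurable n_bounds(2) gL])
 have nn: "H.nrm (%z. n (fst z) * v z) <= nmax * H.nrm v" if v: "v \<in> L2 SM" for v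
  unfolding H_nrm by (rule L2_norm_mult_bounded[OF n_fst_measurable n_bounds(2) _ v]) (use nmax in simp)
 have wd: "wder q u (p q)" for q
 proof (rule wder_limit[OF H1_L2[OF s] wder_dd[OF s] u(1) pL u(2)])
  show "(%k. H.nrm (dd q (s k) - p q)) \<longlonglongrightarrow> 0"
  proof (rule tendsto_sandwich[OF _ _ tendsto_const tendsto_mult_right_zero[OF gl]])
   show "\<forall>\<^sub>F k in sequentially. 0 <= H.nrm (dd q (s k) - p q)"
    using H.nonneg[OF H.mem(4)[OF dd_L2[OF s] pL]] by simp
   have "H.nrm (dd q (s k) - p q) = H.nrm (%z. n (fst z) * (gd q (s k) - g q) z)" for k
    unfolding H_nrm L2_norm_def
    by (intro arg_cong[of _ _ sqrt] Bochner_Integration.integral_cong) (use n_pos in \<open>auto simp: gd_def p_def mem_OmegaM right_diff_distrib\<close>)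
   thus "\<forall>\<^sub>F k in sequentially. H.nrm (dd q (s k) - p q) <= nmax * H.nrm (gd q (s k) - g q)"
    using nn[OF H.mem(4)[OF gd_L2[OF s] gL]] by simp
  qed
 qed
 have uH: "u \<in> H1 n" by (rule H1_wder[OF u(1) wd])
 have gu: "AE z in SM. gd q u z = g q z" for q
  using dd_eq[OF uH wd, of q] AE_space
 proof eventually_elim
  case (elim z)
  thus ?case using n_pos[of "fst z"] by (simp add: gd_def p_def mem_OmegaM)
 qed
 have ge: "H.nrm (gd q (s k - u)) = H.nrm (gd q (s k) - g q)" for q k
 proof -
  have "AE z in SM. (gd q (s k) - gd q u) z = (gd q (s k) - g q) z" using gu[of q] by eventually_elim simp
  note hip_cong[OF this this H.mem(4)[OF gd_L2[OF s] gd_L2[OF uH]] H.mem(4)[OF gd_L2[OF s] gL] H.mem(4)[OF gd_L2[OF s] gd_L2[OF uH]] H.mem(4)[OF gd_L2[OF s] gL]]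
  hence "H.nrm (gd q (s k) - gd q u) = H.nrm (gd q (s k) - g q)" unfolding H.nrm_def by (rule arg_cong)
  thus ?thesis using gdd[OF s uH] by (rule trans[rotated])
 qed
 have "(%k. sqrt ((H.nrm (s k - u))^2 + (\<Sum>q\<in>UNIV. (H.nrm (gd q (s k) - g q))^2))) \<longlonglongrightarrow> sqrt (0^2 + (\<Sum>q\<in>(UNIV :: (bool \<times> 3) set). 0^2))"
  by (intro tendsto_intros u(2) gl)
 moreover have "sqrt ((H.nrm (s k - u))^2 + (\<Sum>q\<in>UNIV. (H.nrm (gd q (s k) - g q))^2)) = W.nrm (s k - u)" for k
  using W_nrm_sq[OF W.mem(4)[OF s uH], of k] W.nonneg[OF W.mem(4)[OF s uH], of k] by (metis (no_types, lifting) ge real_sqrt_unique sum.cong)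
 ultimately show "EX x:H1 n. (%k. W.nrm (s k - x)) \<longlonglongrightarrow> 0" using uH by (intro bexI[of _ u]) simp_all
qed

end

subsection \<open>Functions that are continuously differentiable up to the boundary\<close>

lemma lborel_integral_translation:
 fixes G :: "'a::euclidean_space => real"
 assumes "integrable lborel G"
 shows "integrable lborel (%z. G (z + h))" "(LINT z|lborel. G (z + h)) = (LINT z|lborel. G z)"
proof -
 have G: "G \<in> borel_measurable borel" using assms by simp
 have d: "distr lborel borel ((+) h) = (lborel :: 'a measure)" by (rule lborel_distr_plus)
 have "integrable (distr lborel borel ((+) h)) G" using assms by (simp only: d)
 thus "integrable lborel (%z. G (z + h))"
  by (subst (asm) integrable_distr_eq) (use G in \<open>auto simp: add.commute\<close>)
 have "(\<integral>z. G z \<partial>distr lborel borel ((+) h)) = (LINT z|lborel. G (h + z))"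
  by (rule integral_distr) (use G in auto)
 thus "(LINT z|lborel. G (z + h)) = (LINT z|lborel. G z)" by (simp add: d add.commute)
qed

text \<open>Difference quotients have integral zero by translation invariance. They are bounded by a
  bound for the derivative and supported in one common ball, as the steps are at most 1, so
  dominated convergence applies.\<close>

lemma integral_directional_derivative:
 fixes G :: "'a::euclidean_space => real"
 assumes K: "compact K" and G0: "!!z. z \<notin> K ==> G z = 0"
  and der: "!!z. (G has_derivative G' z) (at z)" and cont: "continuous_on UNIV (%z. G' z d)"
 shows "integrable lborel (%z. G' z d)" "(LINT z|lborel. G' z d) = 0"
proof -
 have G'0: "G' z d = 0" if "z \<notin> K" for z
 proof -
  have "((%_. 0) has_derivative G' z) (at z)"
   by (rule has_derivative_transform_within_open[OF der, of "- K"]) (use K that G0 in \<open>auto simp: compact_imp_closed open_Compl\<close>)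
  from has_derivative_unique[OF this has_derivative_const] show ?thesis by simp
 qed
 have "compact ((%z. G' z d) ` K)" by (rule compact_continuous_image[OF continuous_on_subset[OF cont] K]) simp
 then obtain B where "!!y. y \<in> (%z. G' z d) ` K ==> norm y <= B" using compact_imp_bounded bounded_iff by metis
 hence B: "\<bar>G' z d\<bar> <= \<bar>B\<bar>" for z using G'0[of z] by (cases "z \<in> K") force+
 obtain R where R: "!!z. z \<in> K ==> norm z <= R" using compact_imp_bounded[OF K] bounded_iff by metis
 have Gc: "continuous_on UNIV G" by (intro continuous_at_imp_continuous_on ballI has_derivative_continuous[OF der])
 have Gi: "integrable lborel G"
 proof -
  have "integrable lborel (%z. indicator K z *\<^sub>R G z)" by (rule borel_integrable_compact[OF K continuous_on_subset[OF Gc]]) simp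
  moreover have "(%z. indicator K z *\<^sub>R G z) = G" using G0 by (auto simp: fun_eq_iff indicator_def)
  ultimately show ?thesis by simp
 qed
 have mv: "\<bar>G (z + t *\<^sub>R d) - G z\<bar> <= \<bar>B\<bar> * t" if "t > 0" for z t
 proof -
  have "((%s. G (z + s *\<^sub>R d)) has_real_derivative G' (z + s *\<^sub>R d) d) (at s)" for s
  proof -
   have "((%s. z + s *\<^sub>R d) has_derivative (%h. h *\<^sub>R d)) (at s)" by (auto intro!: derivative_eq_intros)
   from has_derivative_compose[OF this der] have "((%s. G (z + s *\<^sub>R d)) has_derivative (%h. G' (z + s *\<^sub>R d) (h *\<^sub>R d))) (at s)" .
   moreover have "G' w (h *\<^sub>R d) = G' w d * h" for w h using linear_cmul[OF has_derivative_linear[OF der]] by (simp add: mult.commute)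
   ultimately show ?thesis by (simp add: has_field_derivative_def)
  qed
  from MVT2[OF that this] obtain s where "G (z + t *\<^sub>R d) - G (z + 0 *\<^sub>R d) = (t - 0) * G' (z + s *\<^sub>R d) d" by blast
  thus ?thesis using B[of "z + s *\<^sub>R d"] that by (simp add: abs_mult mult.commute mult_right_mono)
 qed
 define s where "s k z = (G (z + (1 / real (Suc k)) *\<^sub>R d) - G z) * real (Suc k)" for k :: nat and z
 have sb: "\<bar>s k z\<bar> <= \<bar>B\<bar>" for k z
 proof -
  have "\<bar>s k z\<bar> = \<bar>G (z + (1 / real (Suc k)) *\<^sub>R d) - G z\<bar> * real (Suc k)" by (simp add: s_def abs_mult)
  also have "... <= (\<bar>B\<bar> * (1 / real (Suc k))) * real (Suc k)" by (intro mult_right_mono mv) auto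
  finally show ?thesis by simp
 qed
 have s0: "s k z = 0" if "z \<notin> cball 0 (R + norm d)" for k z
 proof -
  have nz: "norm z > R + norm d" using that by simp
  have "norm ((1 / real (Suc k)) *\<^sub>R d) <= norm d" by (simp add: divide_le_eq distrib_left)
  moreover have "norm z <= norm (z + (1 / real (Suc k)) *\<^sub>R d) + norm ((1 / real (Suc k)) *\<^sub>R d)"
   using norm_triangle_ineq4[of "z + (1 / real (Suc k)) *\<^sub>R d" "(1 / real (Suc k)) *\<^sub>R d"] by simp
  ultimately have "norm (z + (1 / real (Suc k)) *\<^sub>R d) > R" "norm z > R" using nz norm_ge_zero[of d] by linarith+
  hence "z + (1 / real (Suc k)) *\<^sub>R d \<notin> K" "z \<notin> K" using R by force+
  thus ?thesis by (simp add: s_def G0)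
 qed
 have lim: "(%k. s k z) \<longlonglongrightarrow> G' z d" for z
 proof -
  have "((%s. z + s *\<^sub>R d) has_derivative (%h. h *\<^sub>R d)) (at 0)" by (auto intro!: derivative_eq_intros)
  from has_derivative_compose[OF this, of G "G' z"] der[of z]
  have "((%s. G (z + s *\<^sub>R d)) has_derivative (%h. G' z (h *\<^sub>R d))) (at 0)" by simp
  moreover have "G' w (h *\<^sub>R d) = G' w d * h" for w h using linear_cmul[OF has_derivative_linear[OF der]] by (simp add: mult.commute)
  ultimately have "((%s. G (z + s *\<^sub>R d)) has_real_derivative G' z d) (at 0)" by (simp add: has_field_derivative_def)
  hence "((%h. (G (z + h *\<^sub>R d) - G z) / h) \<longlongrightarrow> G' z d) (at 0)" by (simp add: DERIV_def)
  moreover have "filterlim (%k. 1 / real (Suc k)) (at 0) sequentially"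
   unfolding filterlim_at using LIMSEQ_Suc[OF lim_1_over_n] by simp
  ultimately have "(%k. (G (z + (1 / real (Suc k)) *\<^sub>R d) - G z) / (1 / real (Suc k))) \<longlonglongrightarrow> G' z d" by (rule filterlim_compose)
  thus ?thesis by (simp add: s_def)
 qed
 have sm: "s k \<in> borel_measurable lborel" for k
  unfolding s_def by (intro borel_measurable_integrable) (auto intro!: lborel_integral_translation(1) Gi)
 have dm: "(%z. G' z d) \<in> borel_measurable lborel" using borel_measurable_continuous_onI[OF cont] by simp
 have bi: "integrable lborel (%z. indicator (cball 0 (R + norm d)) z *\<^sub>R \<bar>B\<bar> :: real)"
  by (rule borel_integrable_compact) auto
 have bd: "AE z in lborel. norm (s k z) <= indicator (cball 0 (R + norm d)) z *\<^sub>R \<bar>B\<bar>" for k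
  by (rule AE_I2) (use s0[of _ k] sb[of k] in \<open>auto simp: indicator_def\<close>)
 show "integrable lborel (%z. G' z d)"
  by (rule integrable_dominated_convergence[OF dm sm bi AE_I2[OF lim] bd])
 have "(%k. \<integral>z. s k z \<partial>lborel) \<longlonglongrightarrow> (LINT z|lborel. G' z d)"
  by (rule integral_dominated_convergence[OF dm sm bi AE_I2[OF lim] bd])
 moreover have "(LINT z|lborel. s k z) = 0" for k
  unfolding s_def using lborel_integral_translation[OF Gi, of "(1 / real (Suc k)) *\<^sub>R d"] Gi by (simp add: Bochner_Integration.integral_diff)
 ultimately show "(LINT z|lborel. G' z d) = 0" by (simp add: LIMSEQ_const_iff)
qed

abbreviation TM0 :: "phase set" where "TM0 \<equiv> M \<times> (- {0})"

text \<open>At boundary points of the base only inward segments stay in the set. The directions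
  \<open>(p - fst z, w)\<close> with \<open>p\<close> in the ball are admissible by convexity, and
  they span, so two linear derivatives must agree.\<close>

lemma TM0_derivative_unique:
 fixes F :: "phase => real"
 assumes z: "z \<in> TM0" and A: "(F has_derivative A) (at z within TM0)" and B: "(F has_derivative B) (at z within TM0)"
 shows "A = B"
proof -
 have lA: "linear A" and lB: "linear B" using A B by (auto intro: has_derivative_linear)
 have x: "norm (fst z) <= 1" and y: "snd z \<noteq> 0" using z by auto
 have dir: "A (p - fst z, w) = B (p - fst z, w)" if p: "norm p <= 1" for p w
 proof -
  let ?v = "(p - fst z, w)"
  \<comment> \<open>At most 1 for convexity in the base; at most half of
    \<open>norm (snd z) / (norm w + 1)\<close> so that the fibre component cannot reach 0.\<close>
  define delta where "delta = min 1 (norm (snd z) / (2 * (norm w + 1)))"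
  have pos: "2 * (norm w + 1) > 0" by (simp add: add_nonneg_pos)
  have delta: "0 < delta" "delta <= 1" using y pos by (auto simp: delta_def)
  have "delta <= norm (snd z) / (2 * (norm w + 1))" by (simp add: delta_def)
  hence deltaw: "delta * (2 * (norm w + 1)) <= norm (snd z)" using pos by (simp add: pos_le_divide_eq)
  have sub: "(%t. z + t *\<^sub>R ?v) ` {0..delta} \<subseteq> TM0"
  proof
   fix u assume "u \<in> (%t. z + t *\<^sub>R ?v) ` {0..delta}"
   then obtain t where t: "0 <= t" "t <= delta" and u: "u = z + t *\<^sub>R ?v" by auto
   have "fst u = (1 - t) *\<^sub>R fst z + t *\<^sub>R p" by (simp add: u algebra_simps)
   also have "norm ... <= (1 - t) * 1 + t * 1"
    using t delta x p by (intro order_trans[OF norm_triangle_ineq] add_mono) (auto intro!: mult_left_mono mult_left_le)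
   finally have "fst u \<in> M" by simp
   moreover have "snd u \<noteq> 0"
   proof
    assume "snd u = 0"
    hence "snd z = - (t *\<^sub>R w)" by (simp add: u eq_neg_iff_add_eq_0)
    hence "norm (snd z) = t * norm w" using t by simp
    also have "... <= delta * norm w" using t by (intro mult_right_mono) auto
    finally have "delta * norm w + 2 * delta <= 0" using deltaw by (simp add: algebra_simps)
    moreover have "0 <= delta * norm w" using delta by simp
    ultimately show False using delta by linarith
   qed
   ultimately show "u \<in> TM0" by (cases u) auto
  qed
  have vd: "((%t. F (z + t *\<^sub>R ?v)) has_vector_derivative C ?v) (at 0 within cbox 0 delta)"
   if C: "(F has_derivative C) (at z within TM0)" for C
  proof -
   have "((%t. z + t *\<^sub>R ?v) has_derivative (%h. h *\<^sub>R ?v)) (at 0 within {0..delta})" by (auto intro!: derivative_eq_intros)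
   moreover have "(F has_derivative C) (at (z + 0 *\<^sub>R ?v) within (%t. z + t *\<^sub>R ?v) ` {0..delta})"
    using has_derivative_subset[OF C sub] by (simp only: scaleR_zero_left add_0_right)
   ultimately have "((%t. F (z + t *\<^sub>R ?v)) has_derivative (%h. C (h *\<^sub>R ?v))) (at 0 within {0..delta})" by (rule has_derivative_in_compose)
   moreover have "C (h *\<^sub>R ?v) = h *\<^sub>R C ?v" for h using linear_cmul[OF has_derivative_linear[OF C]] by blast
   ultimately show ?thesis by (simp add: has_vector_derivative_def)
  qed
  show ?thesis
   by (rule vector_derivative_unique_within_closed_interval[OF _ _ vd[OF A] vd[OF B]]) (use delta in auto)
 qed
 have fib: "A (0, w) = B (0, w)" for w using dir[of "fst z" w] x by simp
 have base: "A (p, 0) = B (p, 0)" if "norm p <= 1" for p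
 proof -
  have "A ((p - fst z, 0) - (0 - fst z, 0)) = B ((p - fst z, 0) - (0 - fst z, 0))"
   unfolding linear_diff[OF lA] linear_diff[OF lB] dir[OF that] using dir[of 0 0] by simp
  thus ?thesis by simp
 qed
 have "A h = B h" for h
 proof -
  define N where "N = norm (fst h) + 1"
  have N: "N > 0" using norm_ge_zero[of "fst h"] by (simp add: N_def add_nonneg_pos)
  have "norm (fst h /\<^sub>R N) <= 1" using N by (simp add: N_def field_simps)
  from base[OF this] have "N *\<^sub>R A (fst h /\<^sub>R N, 0) = N *\<^sub>R B (fst h /\<^sub>R N, 0)" by simp
  hence "A (N *\<^sub>R (fst h /\<^sub>R N, 0)) = B (N *\<^sub>R (fst h /\<^sub>R N, 0))" by (simp only: linear_cmul[OF lA] linear_cmul[OF lB])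
  hence "A (fst h, 0) = B (fst h, 0)" using N by simp
  hence "A ((fst h, 0) + (0, snd h)) = B ((fst h, 0) + (0, snd h))"
   unfolding linear_add[OF lA] linear_add[OF lB] using fib by simp
  thus ?thesis by simp
 qed
 thus ?thesis by blast
qed

text \<open>Uniqueness lets any exhibited derivative replace \<open>frechet_derivative\<close>, also
  at boundary points; the usual differentiation rules then apply directly.\<close>

lemma Ck_TM0_iff: "Ck_on 1 TM0 F \<longleftrightarrow>
  (EX F'. (ALL z:TM0. (F has_derivative F' z) (at z within TM0)) \<and> (ALL h. continuous_on TM0 (%z. F' z h)))"
proof
 assume "Ck_on 1 TM0 F"
 hence d: "F differentiable_on TM0" and c: "ALL h. continuous_on TM0 (%z. frechet_derivative F (at z within TM0) h)" by simp_all
 show "EX F'. (ALL z:TM0. (F has_derivative F' z) (at z within TM0)) \<and> (ALL h. continuous_on TM0 (%z. F' z h))"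
  by (rule exI[of _ "%z. frechet_derivative F (at z within TM0)"])
   (use d c in \<open>simp add: differentiable_on_def frechet_derivative_works\<close>)
next
 assume "EX F'. (ALL z:TM0. (F has_derivative F' z) (at z within TM0)) \<and> (ALL h. continuous_on TM0 (%z. F' z h))"
 then obtain F' where F': "!!z. z \<in> TM0 ==> (F has_derivative F' z) (at z within TM0)" "!!h. continuous_on TM0 (%z. F' z h)" by blast
 have d: "F differentiable_on TM0" using F'(1) unfolding differentiable_on_def differentiable_def by blast
 have e: "frechet_derivative F (at z within TM0) = F' z" if "z \<in> TM0" for z
  using d that unfolding differentiable_on_def frechet_derivative_works
  by (intro TM0_derivative_unique[OF that _ F'(1)[OF that]]) blast
 have "continuous_on TM0 (%z. frechet_derivative F (at z within TM0) h)" for h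
  using F'(2)[of h] by (subst continuous_on_cong[OF refl]) (use e in auto)
 with d show "Ck_on 1 TM0 F" by simp
qed

context medium
begin

definition C1 :: "(phase => real) set" where
 "C1 = {w. Ck_on 1 TM0 (hext n w)}"

lemma subspace_C1: "subspace C1"
proof (rule subspaceI)
 have e: "hext n 0 = (%z. 0)" by (simp add: hext_fold fun_eq_iff)
 show "0 \<in> C1" unfolding C1_def mem_Collect_eq Ck_TM0_iff e by (rule exI[of _ "%z h. 0"]) simp
 fix u v assume u: "u \<in> C1"
 obtain U where U: "ALL z:TM0. (hext n u has_derivative U z) (at z within TM0)" "ALL h. continuous_on TM0 (%z. U z h)"
  using u unfolding C1_def mem_Collect_eq Ck_TM0_iff by blast
 show "a *\<^sub>R u \<in> C1" for a
 proof -
  have e: "hext n (a *\<^sub>R u) = (%z. a * hext n u z)" by (simp add: hext_fold fun_eq_iff)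
  show ?thesis unfolding C1_def mem_Collect_eq Ck_TM0_iff e
   by (rule exI[of _ "%z h. a * U z h"]) (use U in \<open>auto intro!: has_derivative_mult_right continuous_intros\<close>)
 qed
 assume v: "v \<in> C1"
 obtain V where V: "ALL z:TM0. (hext n v has_derivative V z) (at z within TM0)" "ALL h. continuous_on TM0 (%z. V z h)"
  using v unfolding C1_def mem_Collect_eq Ck_TM0_iff by blast
 have e: "hext n (u + v) = (%z. hext n u z + hext n v z)" by (simp add: hext_fold fun_eq_iff)
 show "u + v \<in> C1" unfolding C1_def mem_Collect_eq Ck_TM0_iff e
  by (rule exI[of _ "%z h. U z h + V z h"]) (use U V in \<open>auto intro!: has_derivative_add continuous_intros\<close>)
qed

lemma OmegaM_sub: "OmegaM n \<subseteq> TM0"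
 by (auto simp: mem_OmegaM)

lemma compact_OmegaM: "compact (OmegaM n)"
proof -
 have "OmegaM n = (%q. (fst q, snd q /\<^sub>R n (fst q))) ` (M \<times> sphere 0 1)"
 proof (rule set_eqI iffI)+
  fix z assume z: "z \<in> OmegaM n"
  hence "n (fst z) > 0" by (simp add: mem_OmegaM n_pos)
  thus "z \<in> (%q. (fst q, snd q /\<^sub>R n (fst q))) ` (M \<times> sphere 0 1)"
   by (intro image_eqI[of _ _ "(fst z, n (fst z) *\<^sub>R snd z)"]) (use z in \<open>auto simp: mem_OmegaM\<close>)
 next
  fix z :: phase assume "z \<in> (%q. (fst q, snd q /\<^sub>R n (fst q))) ` (M \<times> sphere 0 1)"
  thus "z \<in> OmegaM n" using scaled_OmegaM by auto
 qed
 moreover have "continuous_on (M \<times> sphere 0 1) (%q :: phase. (fst q, snd q /\<^sub>R n (fst q)))"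
 proof -
  have "continuous_on (M \<times> sphere 0 1) (%z :: phase. n (fst z))"
   by (rule continuous_on_compose2[OF n_continuous]) (auto intro!: continuous_intros)
  thus ?thesis by (intro continuous_intros) (use n_pos in force)+
 qed
 ultimately show ?thesis by (simp add: compact_continuous_image compact_Times)
qed

lemma continuous_OmegaM_bounded: "continuous_on (OmegaM n) f ==> EX B. ALL z:OmegaM n. \<bar>f z\<bar> <= B" for f :: "phase => real"
 using compact_imp_bounded[OF compact_continuous_image[OF _ compact_OmegaM, of f]] by (auto simp: bounded_iff)

lemma continuous_L2:
 assumes "continuous_on (OmegaM n) f" shows "f \<in> L2 SM"
proof -
 obtain B where "ALL z:OmegaM n. \<bar>f z\<bar> <= B" using continuous_OmegaM_bounded[OF assms] by blast
 thus ?thesis by (intro L2_bounded[OF finite_SM continuous_SM_measurable[OF assms], of B] AE_I2) simp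
qed

lemma C1_continuous: "w \<in> C1 ==> continuous_on (OmegaM n) w"
proof -
 assume "w \<in> C1"
 hence "continuous_on TM0 (hext n w)" unfolding C1_def mem_Collect_eq by (simp add: differentiable_imp_continuous_on)
 hence "continuous_on (OmegaM n) (hext n w)" using OmegaM_sub continuous_on_subset by blast
 thus ?thesis by (subst continuous_on_cong[OF refl, of _ _ "hext n w"]) (simp_all add: hext_fold fold_dir_id)
qed

text \<open>The radial derivative drops out: the extension is homogeneous of degree 0 in the fibre, hence
 its base derivatives are homogeneous of degree 0 and its fibre derivatives of degree -1.\<close>

lemma C1_wder:
 assumes w: "w \<in> C1"
 obtains p where "!!q. continuous_on (OmegaM n) (p q)" "!!q. wder q w (p q)"
proof -
 let ?F = "hext n w"
 obtain F' where F': "!!z. z \<in> TM0 ==> (?F has_derivative F' z) (at z within TM0)" "!!h. continuous_on TM0 (%z. F' z h)"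
  using w unfolding C1_def mem_Collect_eq Ck_TM0_iff by blast
 define p where "p q z = F' z (dir q)" for q z
 have pc: "continuous_on (OmegaM n) (p q)" for q unfolding p_def using F'(2) OmegaM_sub continuous_on_subset by blast
 have hom: "F' z (dir q) = wt q z * p q (fold_dir z)" if z: "z \<in> TM0" for q z
 proof -
  \<comment> \<open>\<open>S\<close> is the linear map that stretches the fibre by this number,
    frozen at \<open>z\<close>, so that \<open>S z = fold_dir z\<close>. The extension is invariant
    under \<open>S\<close>; differentiating the invariance compares its derivatives at
    \<open>z\<close> and at \<open>fold_dir z\<close> without differentiating
    \<open>n\<close>.\<close>
  define r where "r = 1 / (n (fst z) * norm (snd z))"
  have "0 < n (fst z) * norm (snd z)" using z n_pos[of "fst z"] by (intro mult_pos_pos) auto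
  hence r: "r > 0" by (simp add: r_def)
  define S where "S h = (fst h, r *\<^sub>R snd h)" for h :: phase
  have Sz: "S z = fold_dir z" by (simp add: S_def fold_dir_def r_def divide_inverse)
  have Sd: "(S has_derivative S) (at z within TM0)"
   unfolding S_def[abs_def] by (auto intro!: derivative_eq_intros has_derivative_Pair)
  have SD: "S ` TM0 \<subseteq> TM0" using r by (auto simp: S_def)
  have "S z \<in> TM0" using SD z by blast
  from has_derivative_in_compose[OF Sd has_derivative_subset[OF F'(1)[OF this] SD]]
  have "((%z. ?F (S z)) has_derivative (%h. F' (S z) (S h))) (at z within TM0)" .
  moreover have "?F (S u) = ?F u" if "u \<in> TM0" for u
   using r by (simp add: hext_fold fold_dir_def S_def field_simps)
  ultimately have "(?F has_derivative (%h. F' (S z) (S h))) (at z within TM0)"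
   using has_derivative_transform[OF z, of ?F "%z. ?F (S z)"] by simp
  hence e: "F' z = (%h. F' (S z) (S h))" using TM0_derivative_unique[OF z F'(1)[OF z]] by blast
  have "S (dir q) = wt q z *\<^sub>R dir q" by (simp add: S_def dir_def wt_def r_def)
  thus ?thesis unfolding e p_def Sz
   using linear_cmul[OF has_derivative_linear[OF F'(1)[OF \<open>S z \<in> TM0\<close>]]] by (simp add: Sz)
 qed
 have wL: "w \<in> L2 SM" by (rule continuous_L2[OF C1_continuous[OF w]])
 have Fc: "continuous_on TM0 ?F" using F'(1) has_derivative_continuous_on by blast
 let ?U = punctured_TM
 have Us: "?U \<subseteq> TM0" and Uo: "open ?U" by (rule punctured_TM_sub)+
 have "wder q w (p q)" for q
  unfolding wder_char[OF wL]
 proof (intro conjI ballI)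
  show "p q \<in> L2 SM" by (rule continuous_L2[OF pc])
  fix psi assume psi: "psi \<in> test_functions ?U"
  obtain K where K: "compact K" "K \<subseteq> ?U" "!!z. z \<notin> K ==> psi z = 0" "!!z b. z \<notin> K ==> frechet_derivative psi (at z) b = 0"
   by (rule test_function_support[OF psi]) (rule that, assumption+)
  have cK: "open (- K)" using K(1) by (simp add: compact_imp_closed open_Compl)
  \<comment> \<open>Extended by zero outside \<open>punctured_TM\<close>, the product is
    differentiable on the whole space because \<open>psi\<close> has compact support inside. Its
    derivative integrates to zero, which is the weak equation.\<close>
  define G where "G z = (if z \<in> ?U then ?F z * psi z else 0)" for z
  define G' where "G' z h = (if z \<in> ?U then ?F z * frechet_derivative psi (at z) h + F' z h * psi z else 0)" for z h
  have der: "(G has_derivative G' z) (at z)" for z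
  proof (cases "z \<in> ?U")
   case True
   have "(?F has_derivative F' z) (at z)"
    using has_derivative_subset[OF F'(1) Us, of z] True Us at_within_open[OF True Uo] by auto
   from has_derivative_mult[OF this test_function_derivative(1)[OF psi]]
   have "(G has_derivative (%h. ?F z * frechet_derivative psi (at z) h + F' z h * psi z)) (at z)"
    by (rule has_derivative_transform_within_open[OF _ Uo True]) (simp add: G_def)
   moreover have "G' z = (%h. ?F z * frechet_derivative psi (at z) h + F' z h * psi z)" using True by (simp add: G'_def fun_eq_iff)
   ultimately show ?thesis by simp
  next
   case False
   hence "z \<in> - K" using K(2) by blast
   hence "(G has_derivative (%h. 0)) (at z)"
    using K(3) by (intro has_derivative_transform_within_open[OF has_derivative_const cK]) (auto simp: G_def)
   moreover have "G' z = (%h. 0)" using False by (simp add: G'_def fun_eq_iff)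
   ultimately show ?thesis by simp
  qed
  have "continuous_on (?U \<union> - K) (%z. G' z (dir q))"
  proof (rule continuous_on_open_Un[OF Uo cK])
   have "continuous_on ?U (%z. ?F z * frechet_derivative psi (at z) (dir q) + F' z (dir q) * psi z)"
    by (intro continuous_intros continuous_on_subset[OF Fc Us] continuous_on_subset[OF F'(2) Us]
      continuous_on_subset[OF test_function_continuous[OF psi]] continuous_on_subset[OF test_function_derivative(2)[OF psi]]) auto
   thus "continuous_on ?U (%z. G' z (dir q))"
    by (subst continuous_on_cong[OF refl]) (auto simp: G'_def)
   show "continuous_on (- K) (%z. G' z (dir q))"
    by (subst continuous_on_cong[OF refl, of _ _ "%z. 0"]) (auto simp: G'_def K)
  qed
  moreover have "?U \<union> - K = UNIV" using K(2) by blast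
  ultimately have cont: "continuous_on UNIV (%z. G' z (dir q))" by simp
  have "(LINT z|lborel. G' z (dir q)) = 0"
   by (rule integral_directional_derivative(2)[OF K(1) _ der cont]) (simp add: G_def K)
  moreover have "G' z (dir q) = kerD q psi z * w (fold_dir z) + kerW q psi z * p q (fold_dir z)" for z
  proof (cases "z \<in> ?U")
   case True
   thus ?thesis using hom[of z q] Us by (auto simp: G'_def kerD_def kerW_def hext_fold)
  qed (simp add: G'_def kerD_def kerW_def)
  ultimately have "pair (kerD q psi) w + pair (kerW q psi) (p q) = 0"
   using kernel_integrable[OF kernel_test(1)[OF psi] L2_SM_integrable[OF wL], of q]
    kernel_integrable[OF kernel_test(2)[OF psi] L2_SM_integrable[OF continuous_L2[OF pc]], of q q]
   by (simp add: pair_def)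
  thus "pair (kerD q psi) w = - pair (kerW q psi) (p q)" by simp
 qed
 with pc show ?thesis by (rule that)
qed

lemma C1_H1: "w \<in> C1 ==> w \<in> H1 n"
proof -
 assume w: "w \<in> C1"
 obtain p where "!!q. wder q w (p q)" by (rule C1_wder[OF w]) (rule that, assumption)
 thus ?thesis by (rule H1_wder[OF continuous_L2[OF C1_continuous[OF w]]])
qed

section \<open>Boundary values and the subspace of zero trace\<close>

abbreviation \<Gamma> :: "phase measure" where "\<Gamma> \<equiv> bdry_measure n"

lemma finite_bdry: "finite_measure \<Gamma>"
proof -
 interpret S: finite_measure sphere_measure by (rule finite_sphere_measure)
 let ?P = "sphere_measure \<Otimes>\<^sub>M sphere_measure"
 interpret P: finite_measure ?P by (intro finite_measure_pair_measure finite_sphere_measure)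
 have sM: "sphere (0 :: real^3) 1 \<subseteq> M" by auto
 have f: "fst \<in> ?P \<rightarrow>\<^sub>M restrict_space borel (sphere 0 1)" "snd \<in> ?P \<rightarrow>\<^sub>M restrict_space borel (sphere 0 1)"
  using measurable_fst[of sphere_measure sphere_measure] measurable_snd[of sphere_measure sphere_measure]
  by (simp_all add: measurable_cong_sets[OF refl sets_sphere_measure])
 have fb: "fst \<in> borel_measurable ?P" "snd \<in> borel_measurable ?P"
  using measurable_compose[OF f(1) measurable_restrict_space1[OF measurable_ident_sets[OF refl]]]
   measurable_compose[OF f(2) measurable_restrict_space1[OF measurable_ident_sets[OF refl]]] by simp_all
 have nm: "(%p. n (fst p)) \<in> borel_measurable ?P"
  by (rule measurable_compose[OF f(1)], rule borel_measurable_continuous_on_restrict, rule continuous_on_subset[OF n_continuous sM])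
 let ?D = "density ?P (%(x, omega). ennreal ((n x)^2))"
 have dm: "(%(x, omega). ennreal ((n x)^2)) \<in> borel_measurable ?P" using nm by (simp add: case_prod_beta')
 have "emeasure ?D (space ?D) = (\<integral>\<^sup>+p. (case p of (x, omega) => ennreal ((n x)^2)) \<partial>?P)"
  using emeasure_density[OF dm sets.top] by (simp add: nn_integral_set_ennreal cong: nn_integral_cong)
 also have "... <= (\<integral>\<^sup>+p. ennreal (nmax^2) \<partial>?P)"
 proof (rule nn_integral_mono)
  fix p assume "p \<in> space ?P"
  hence "fst p \<in> M" by (auto simp: space_pair_measure)
  hence "(n (fst p))^2 <= nmax^2" using n_le n_pos by (intro power_mono) (auto simp: less_imp_le)
  thus "(case p of (x, omega) => ennreal ((n x)^2)) <= ennreal (nmax^2)" by (simp add: case_prod_beta' ennreal_leI)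
 qed
 also have "... < \<infinity>"
 proof -
  have "emeasure ?P (space ?P) < top" using P.emeasure_finite[of "space ?P"] by (simp only: less_top infinity_ennreal_def)
  thus ?thesis by (simp add: ennreal_mult_less_top)
 qed
 finally interpret D: finite_measure ?D by (intro finite_measureI) simp
 have "(%(x, omega). (x, omega /\<^sub>R n x)) \<in> ?D \<rightarrow>\<^sub>M restrict_space borel (bdry_OmegaM n)"
 proof (rule measurable_restrict_space2)
  show "(%(x, omega). (x, omega /\<^sub>R n x)) \<in> space ?D \<rightarrow> bdry_OmegaM n"
   using scaled_OmegaM sM by (auto simp: space_pair_measure bdry_OmegaM_def)
  have "(%p. (fst p, snd p /\<^sub>R n (fst p))) \<in> borel_measurable ?P" using fb nm by measurable
  thus "(%(x, omega). (x, omega /\<^sub>R n x)) \<in> borel_measurable ?D" by (simp add: case_prod_beta')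
 qed
 thus ?thesis unfolding bdry_measure_def by (rule D.finite_measure_distr)
qed

lemma C1_bdry: assumes w: "w \<in> C1" shows "w \<in> L2 \<Gamma>"
proof -
 have s: "bdry_OmegaM n \<subseteq> OmegaM n" by (auto simp: bdry_OmegaM_def)
 have sp: "space \<Gamma> = bdry_OmegaM n" and st: "sets \<Gamma> = sets (restrict_space borel (bdry_OmegaM n))"
  by (simp_all add: bdry_measure_def space_restrict_space)
 have m: "w \<in> borel_measurable \<Gamma>" unfolding measurable_cong_sets[OF st refl]
  by (rule borel_measurable_continuous_on_restrict[OF continuous_on_subset[OF C1_continuous[OF w] s]])
 obtain B where "ALL z:OmegaM n. \<bar>w z\<bar> <= B" using continuous_OmegaM_bounded[OF C1_continuous[OF w]] by blast
 thus ?thesis using s by (intro L2_bounded[OF finite_bdry m, of B] AE_I2) (auto simp: sp)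
qed

text \<open>With the trace condition in epsilon form, the subspace property and closedness are
  one-step approximations instead of manipulations of sequences.\<close>

lemma H10_iff: "u \<in> H10 n \<longleftrightarrow> u \<in> H1 n \<and> (ALL e>0. EX w:C1. W.nrm (w - u) < e \<and> L2_norm \<Gamma> w < e)"
proof
 assume "u \<in> H10 n"
 then obtain w where u: "u \<in> H1 n" and w: "!!k. w k \<in> C1" and l: "(%k. H1_norm n (%z. w k z - u z)) \<longlonglongrightarrow> 0" "(%k. L2_norm \<Gamma> (w k)) \<longlonglongrightarrow> 0"
  unfolding H10_def has_trace_def C1_def by auto
 have "EX w:C1. W.nrm (w - u) < e \<and> L2_norm \<Gamma> w < e" if "e > 0" for e
 proof -
  have "H1_norm n (%z. w k z - u z) = W.nrm (w k - u)" for k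
   using H1_norm_eq[OF W.mem(4)[OF C1_H1[OF w] u], of k] by (simp add: fun_diff_def)
  hence "\<forall>\<^sub>F k in sequentially. W.nrm (w k - u) < e" using order_tendstoD(2)[OF l(1) that] by simp
  moreover have "\<forall>\<^sub>F k in sequentially. L2_norm \<Gamma> (w k) < e" using order_tendstoD(2)[OF l(2) that] by simp
  ultimately have "\<forall>\<^sub>F k in sequentially. W.nrm (w k - u) < e \<and> L2_norm \<Gamma> (w k) < e" by eventually_elim simp
  then obtain k where "W.nrm (w k - u) < e \<and> L2_norm \<Gamma> (w k) < e" by (auto simp: eventually_sequentially)
  thus ?thesis using w by blast
 qed
 thus "u \<in> H1 n \<and> (ALL e>0. EX w:C1. W.nrm (w - u) < e \<and> L2_norm \<Gamma> w < e)" using u by blast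
next
 assume a: "u \<in> H1 n \<and> (ALL e>0. EX w:C1. W.nrm (w - u) < e \<and> L2_norm \<Gamma> w < e)"
 hence u: "u \<in> H1 n" by blast
 have "EX w. w \<in> C1 \<and> W.nrm (w - u) < 1 / real (Suc k) \<and> L2_norm \<Gamma> w < 1 / real (Suc k)" for k
 proof -
  have "1 / real (Suc k) > 0" by simp
  with a show ?thesis by blast
 qed
 from choice[OF allI[OF this]] obtain w where w: "ALL k. w k \<in> C1 \<and> W.nrm (w k - u) < 1 / real (Suc k) \<and> L2_norm \<Gamma> (w k) < 1 / real (Suc k)" ..
 have wC: "w k \<in> C1" for k using w by blast
 have l: "(%k. 1 / real (Suc k)) \<longlonglongrightarrow> 0" by (rule LIMSEQ_Suc[OF lim_1_over_n])
 have e: "H1_norm n (%z. w k z - u z) = W.nrm (w k - u)" for k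
  using H1_norm_eq[OF W.mem(4)[OF C1_H1[OF wC] u], of k] by (simp add: fun_diff_def)
 have "(%k. H1_norm n (%z. w k z - u z)) \<longlonglongrightarrow> 0"
 proof (rule tendsto_sandwich[OF _ _ tendsto_const l])
  show "\<forall>\<^sub>F k in sequentially. 0 <= H1_norm n (%z. w k z - u z)"
   unfolding e using W.nonneg[OF W.mem(4)[OF C1_H1[OF wC] u]] by simp
  show "\<forall>\<^sub>F k in sequentially. H1_norm n (%z. w k z - u z) <= 1 / real (Suc k)"
   unfolding e using w by (intro always_eventually allI) (simp add: less_imp_le)
 qed
 moreover have "(%k. L2_norm \<Gamma> (%z. w k z - 0)) \<longlonglongrightarrow> 0"
 proof (rule tendsto_sandwich[OF _ _ tendsto_const l])
  show "\<forall>\<^sub>F k in sequentially. 0 <= L2_norm \<Gamma> (%z. w k z - 0)" by (simp add: L2_norm_def)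
  show "\<forall>\<^sub>F k in sequentially. L2_norm \<Gamma> (%z. w k z - 0) <= 1 / real (Suc k)"
   using w by (intro always_eventually allI) (simp add: less_imp_le)
 qed
 moreover have "(%z. 0) \<in> L2 \<Gamma>" by (simp add: L2_def)
 ultimately show "u \<in> H10 n" using u wC unfolding H10_def has_trace_def C1_def by auto
qed

lemma H10_H1: "u \<in> H10 n ==> u \<in> H1 n"
 by (simp add: H10_iff)

lemma subspace_H10: "subspace (H10 n)"
proof (rule subspaceI)
 interpret B: semi_inner "L2 \<Gamma>" "%u v. \<integral>z. u z * v z \<partial>\<Gamma>" by (rule L2_semi_inner)
 note BL = L2_norm_eq[of \<Gamma>]
 have C0: "0 \<in> C1" by (rule subspace_0[OF subspace_C1])
 have "L2_norm \<Gamma> 0 = 0" by (simp add: L2_norm_def)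
 thus "0 \<in> H10 n" unfolding H10_iff using C0 by (auto intro!: bexI[of _ 0])
 fix u assume u: "u \<in> H10 n"
 note uH = H10_H1[OF u]
 show "a *\<^sub>R u \<in> H10 n" for a
  unfolding H10_iff
 proof (intro conjI allI impI W.mem uH)
  fix e :: real assume e: "e > 0"
  define d where "d = e / (\<bar>a\<bar> + 1)"
  have d: "d > 0" "\<bar>a\<bar> * d < e" using e by (auto simp: d_def field_simps)
  obtain w where w: "w \<in> C1" "W.nrm (w - u) < d" "L2_norm \<Gamma> w < d" using u d(1) unfolding H10_iff by blast
  have "W.nrm (a *\<^sub>R w - a *\<^sub>R u) = \<bar>a\<bar> * W.nrm (w - u)"
   using W.scale[OF W.mem(4)[OF C1_H1[OF w(1)] uH], of a] by (simp only: scaleR_diff_right)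
  also have "... <= \<bar>a\<bar> * d" using w by (intro mult_left_mono) auto
  finally have 1: "W.nrm (a *\<^sub>R w - a *\<^sub>R u) < e" using d by linarith
  have "L2_norm \<Gamma> (a *\<^sub>R w) = \<bar>a\<bar> * L2_norm \<Gamma> w" using B.scale[OF C1_bdry[OF w(1)], of a] by (simp only: BL)
  also have "... <= \<bar>a\<bar> * d" using w by (intro mult_left_mono) auto
  finally have "L2_norm \<Gamma> (a *\<^sub>R w) < e" using d by linarith
  thus "EX w:C1. W.nrm (w - a *\<^sub>R u) < e \<and> L2_norm \<Gamma> w < e"
   using 1 subspace_scale[OF subspace_C1 w(1)] by blast
 qed
 fix v assume v: "v \<in> H10 n"
 note vH = H10_H1[OF v]
 show "u + v \<in> H10 n"
  unfolding H10_iff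
 proof (intro conjI allI impI W.mem uH vH)
  fix e :: real assume e: "e > 0"
  hence e2: "e / 2 > 0" by simp
  obtain w where w: "w \<in> C1" "W.nrm (w - u) < e / 2" "L2_norm \<Gamma> w < e / 2" using u e2 unfolding H10_iff by blast
  obtain x where x: "x \<in> C1" "W.nrm (x - v) < e / 2" "L2_norm \<Gamma> x < e / 2" using v e2 unfolding H10_iff by blast
  have "W.nrm ((w - u) + (x - v)) <= W.nrm (w - u) + W.nrm (x - v)"
   by (rule W.triangle[OF W.mem(4)[OF C1_H1[OF w(1)] uH] W.mem(4)[OF C1_H1[OF x(1)] vH]])
  moreover have "(w - u) + (x - v) = (w + x) - (u + v)" by (simp only: add_diff_add)
  ultimately have "W.nrm ((w + x) - (u + v)) <= W.nrm (w - u) + W.nrm (x - v)" by (simp only:)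
  hence 1: "W.nrm ((w + x) - (u + v)) < e" using w(2) x(2) by linarith
  have "L2_norm \<Gamma> (w + x) <= L2_norm \<Gamma> w + L2_norm \<Gamma> x"
   using B.triangle[OF C1_bdry[OF w(1)] C1_bdry[OF x(1)]] by (simp only: BL)
  hence "L2_norm \<Gamma> (w + x) < e" using w x by linarith
  thus "EX w:C1. W.nrm (w - (u + v)) < e \<and> L2_norm \<Gamma> w < e"
   using 1 subspace_add[OF subspace_C1 w(1) x(1)] by blast
 qed
qed

lemma H10_closed:
 assumes s: "!!k. s k \<in> H10 n" and u: "u \<in> H1 n" and l: "(%k. W.nrm (s k - u)) \<longlonglongrightarrow> 0"
 shows "u \<in> H10 n"
 unfolding H10_iff
proof (intro conjI allI impI u)
 fix e :: real assume e: "e > 0"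
 hence e2: "e / 2 > 0" by simp
 obtain k where k: "W.nrm (s k - u) < e / 2" using order_tendstoD(2)[OF l e2] by (auto simp: eventually_sequentially)
 obtain w where w: "w \<in> C1" "W.nrm (w - s k) < e / 2" "L2_norm \<Gamma> w < e / 2" using s[of k] e2 unfolding H10_iff by blast
 have "W.nrm (w - u) <= W.nrm (w - s k) + W.nrm (s k - u)"
  by (rule W.triangle_via[OF C1_H1[OF w(1)] H10_H1[OF s] u])
 hence "W.nrm (w - u) < e" "L2_norm \<Gamma> w < e" using k w e by linarith+
 thus "EX w:C1. W.nrm (w - u) < e \<and> L2_norm \<Gamma> w < e" using w(1) by blast
qed

lemma H10_semi_hilbert: "semi_hilbert (H10 n) h1"
proof -
 interpret C: semi_hilbert "H1 n" h1 by (rule H1_complete)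
 interpret V: semi_inner "H10 n" h1
  by unfold_locales (use subspace_H10 H10_H1 W.add_left W.scale_left W.sym W.pos in auto)
 show ?thesis
 proof
  fix s :: "nat => phase => real" assume s: "!!k. s k \<in> H10 n"
   and cau: "!!e. e > 0 ==> EX K. ALL m>=K. ALL k>=K. W.nrm (s m - s k) < e"
  obtain x where x: "x \<in> H1 n" "(%k. W.nrm (s k - x)) \<longlonglongrightarrow> 0"
   using C.complete[of s, OF H10_H1[OF s] cau] by blast
  thus "EX x:H10 n. (%k. W.nrm (s k - x)) \<longlonglongrightarrow> 0" using H10_closed[OF s x] by blast
 qed
qed

text \<open>A function that vanishes almost everywhere has 0 as a weak derivative, and weak
  derivatives are unique. This is the injectivity that \<open>gelfand\<close> asks for.\<close>

lemma H1_AE_zero: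
 assumes v: "v \<in> H1 n" and 0: "H.nrm v = 0" shows "W.nrm v = 0"
proof -
 have vz: "AE z in SM. v z = 0" using L2_AE_iff[OF H1_L2[OF v]] 0 by blast
 have "wder q v 0" for q
 proof -
  have "wder q v (dd q v)" by (rule wder_dd[OF v])
  have "wder q 0 0" using wder_scale[OF H1_L2[OF v] wder_dd[OF v], of q 0] by simp
  thus ?thesis by (rule wder_AE[OF _ H.mem(1) H1_L2[OF v] H.mem(1)]) (use vz in \<open>auto elim: eventually_mono\<close>)
 qed
 hence "AE z in SM. gd q v z = 0" for q
  using dd_eq[OF v, of q 0] by (auto simp: gd_def elim: eventually_mono)
 hence "H.nrm (gd q v) = 0" for q using L2_AE_iff[OF gd_L2[OF v]] by blast
 hence "(W.nrm v)^2 = 0" unfolding W_nrm_sq[OF v] 0 by simp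
 thus ?thesis by simp
qed

sublocale G: gelfand "H10 n" "L2 SM" h1 hip
proof -
 interpret V: semi_hilbert "H10 n" h1 by (rule H10_semi_hilbert)
 show "gelfand (H10 n) (L2 SM) h1 hip"
  by unfold_locales (use H10_H1 H1_L2 W_nrm_ge(1) H1_AE_zero in auto)
qed

lemma lincomb_fun: "(a *\<^sub>R u + b *\<^sub>R v) = (%z. a * u z + b * v z)" for u v :: "phase => real"
 by (simp add: fun_eq_iff)

lemma Hm1_eq: "Hm1 n = G.V.dual"
 unfolding Hm1_def G.V.dual_def lincomb_fun using H1_norm_eq[OF H10_H1] by (simp cong: ball_cong)

lemma Hm1_norm_eq: "Hm1_norm n = G.V.dnorm"
proof -
 have "{v \<in> H10 n. H1_norm n v <= 1} = {v \<in> H10 n. W.nrm v <= 1}" using H1_norm_eq[OF H10_H1] by auto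
 thus ?thesis unfolding Hm1_norm_def[abs_def] G.V.dnorm_def[abs_def] by simp
qed

end

subsection \<open>The distributional time derivative\<close>

lemma time_integral_continuous:
 fixes f :: "real => real"
 assumes f: "continuous_on {0..T} f"
 shows "integrable (time T) f" "(LINT t|time T. f t) = integral {0..T} f"
proof -
 have "set_integrable lborel {0..T} f" unfolding set_integrable_def by (rule borel_integrable_compact[OF compact_Icc f])
 hence "set_integrable lborel {0<..<T} f" by (rule set_integrable_subset) auto
 hence i: "integrable lborel (%t. indicator {0<..<T} t *\<^sub>R f t)" by (simp add: set_integrable_def)
 thus "integrable (time T) f"
  using borel_measurable_integrable[OF i] by (simp add: integrable_restrict_space integrable_completion)
 from integral_unique[OF time_has_integral[OF this]] show "(LINT t|time T. f t) = integral {0..T} f" by simp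
qed

lemma test_function_parts:
 fixes eta y :: "real => real"
 assumes T: "T > 0" and eta: "eta \<in> test_functions {0<..<T}" and y: "integrable (time T) y"
 shows "integrable (time T) (%t. deriv eta t * (LINT s|time t. y s))"
  "(LINT t|time T. deriv eta t * (LINT s|time t. y s)) = - (LINT s|time T. eta s * y s)"
proof -
 have cd: "continuous_on {0..T} (deriv eta)" by (rule test_function_deriv(2)[OF eta])
 have "compact (deriv eta ` {0..T})" by (rule compact_continuous_image[OF cd compact_Icc])
 then obtain R where "!!y. y \<in> deriv eta ` {0..T} ==> norm y <= R" using compact_imp_bounded bounded_iff by metis
 hence R: "\<bar>deriv eta t\<bar> <= R" if "t \<in> {0<..<T}" for t using that by force
 have etaT: "eta T = 0" using eta unfolding test_functions_def by force
 have m: "deriv eta \<in> borel_measurable (time T)"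
  by (rule borel_measurable_integrable[OF time_integral_continuous(1)[OF cd]])
 have c: "continuous_on {0..T} eta" by (rule continuous_on_subset[OF test_function_continuous[OF eta]]) simp
 note tp = time_parts[where F = "{}" and R = R, OF finite.emptyI less_imp_le[OF T] c test_function_deriv(1)[OF eta] m R etaT y]
 show "integrable (time T) (%t. deriv eta t * (LINT s|time t. y s))"
  "(LINT t|time T. deriv eta t * (LINT s|time t. y s)) = - (LINT s|time T. eta s * y s)"
  by (rule tp; assumption)+
qed

context gelfand
begin

lemma continuous_hp:
 assumes cH: "!!t. t \<in> {0..T} ==> c t \<in> H"
  and cc: "!!t. t \<in> {0..T} ==> ((%s. H.nrm (c s - c t)) \<longlongrightarrow> 0) (at t within {0..T})" and v: "v \<in> H"
 shows "continuous_on {0..T} (%t. hp (c t) v)"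
 unfolding continuous_on_def
proof
 fix t assume t: "t \<in> {0..T}"
 have "((%s. hp (c s) v - hp (c t) v) \<longlongrightarrow> 0) (at t within {0..T})"
 proof (rule Lim_null_comparison)
  show "((%s. H.nrm (c s - c t) * H.nrm v) \<longlongrightarrow> 0) (at t within {0..T})" by (rule tendsto_mult_left_zero[OF cc[OF t]])
  have "norm (hp (c s) v - hp (c t) v) <= H.nrm (c s - c t) * H.nrm v" if "s \<in> {0..T}" for s
   using H.Cauchy_Schwarz[OF H.mem(4)[OF cH[OF that] cH[OF t]] v] H.diff_left[OF cH[OF that] cH[OF t] v] by simp
  thus "\<forall>\<^sub>F s in at t within {0..T}. norm (hp (c s) v - hp (c t) v) <= H.nrm (c s - c t) * H.nrm v"
   unfolding eventually_at_filter by simp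
 qed
 thus "((%s. hp (c s) v) \<longlongrightarrow> hp (c t) v) (at t within {0..T})" by (simp add: LIM_zero_iff)
qed

lemma test_integral_cong:
 assumes T: "T > 0" and eta: "eta \<in> test_functions {0<..<T}" and v: "v \<in> V"
  and u: "V.sq_int T u" and cH: "!!t. t \<in> {0..T} ==> c t \<in> H"
  and cc: "!!t. t \<in> {0..T} ==> ((%s. H.nrm (c s - c t)) \<longlongrightarrow> 0) (at t within {0..T})"
  and cu: "AE t in time T. H.nrm (c t - u t) = 0"
 shows "(LINT t|time T. deriv eta t * hp (u t) v) = (LINT t|time T. deriv eta t * hp (c t) v)"
proof -
 have e: "AE t in time T. deriv eta t * hp (c t) v = deriv eta t * hp (u t) v"
  using cu V.sq_int_mem[OF u] AE_time_in
 proof eventually_elim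
  case (elim t)
  hence "hp (c t) v = hp (u t) v" by (intro hp_cong_left cH VH' v) auto
  thus ?case by simp
 qed
 have m: "(%t. deriv eta t * hp (c t) v) \<in> borel_measurable (time T)"
  by (intro borel_measurable_integrable time_integral_continuous(1) continuous_on_mult test_function_deriv(2)[OF eta] continuous_hp cH cc VH' v)
 have e': "AE t in time T. deriv eta t * hp (u t) v = deriv eta t * hp (c t) v"
  using e by (rule eventually_mono) (rule sym)
 show ?thesis by (rule integral_cong_AE[OF time_measurable_AE[OF m e] m e'])
qed

lemma integrated_time_derivative:
 assumes T: "T > 0" and eta: "eta \<in> test_functions {0<..<T}" and v: "v \<in> V"
  and u: "V.sq_int T u" and w: "D.sq_int T w" and cH: "!!t. t \<in> {0..T} ==> c t \<in> H"
  and cc: "!!t. t \<in> {0..T} ==> ((%s. H.nrm (c s - c t)) \<longlongrightarrow> 0) (at t within {0..T})"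
  and cu: "AE t in time T. H.nrm (c t - u t) = 0"
  and eq: "!!t. t \<in> {0..T} ==> hp (c t) v = (LINT s|time t. w s v)"
 shows "(LINT t|time T. deriv eta t * hp (u t) v) = - (LINT t|time T. eta t * w t v)"
proof -
 have "(LINT t|time T. deriv eta t * hp (c t) v) = (LINT t|time T. deriv eta t * (LINT s|time t. w s v))"
  by (rule Bochner_Integration.integral_cong[OF refl]) (use eq in simp)
 thus ?thesis
  using trans[OF test_integral_cong[OF T eta v u cH cc cu]] test_function_parts(2)[OF T eta pairing_integrable[OF w v]] by simp
qed

text \<open>The difference of \<open>hp (c t) v\<close> and the primitive of \<open>w t v\<close> is
  continuous and annihilates all derivatives of test functions, hence is constant by
  \<open>du_Bois_Reymond\<close>; the initial value makes the constant 0.\<close>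

lemma time_derivative_integrated:
 assumes T: "T > 0" and v: "v \<in> V"
  and u: "V.sq_int T u" and w: "D.sq_int T w" and cH: "!!t. t \<in> {0..T} ==> c t \<in> H"
  and cc: "!!t. t \<in> {0..T} ==> ((%s. H.nrm (c s - c t)) \<longlongrightarrow> 0) (at t within {0..T})"
  and cu: "AE t in time T. H.nrm (c t - u t) = 0" and c0: "H.nrm (c 0) = 0"
  and td: "!!eta. eta \<in> test_functions {0<..<T} ==>
   (LINT t|time T. deriv eta t * hp (u t) v) = - (LINT t|time T. eta t * w t v)"
  and t: "t \<in> {0..T}"
 shows "hp (c t) v = (LINT s|time t. w s v)"
proof -
 define P where "P t = (LINT s|time t. w s v)" for t
 define f where "f t = hp (c t) v - P t" for t
 have y: "integrable (time T) (%s. w s v)" by (rule pairing_integrable[OF w v])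
 have "continuous_on {0..T} P" unfolding P_def by (rule continuous_primitive[OF y])
 hence fc: "continuous_on {0..T} f" unfolding f_def by (intro continuous_on_diff continuous_hp cH cc VH' v)
 have const: "f s = f (T / 2)" if "s \<in> {0..T}" for s
 proof (rule du_Bois_Reymond[OF T fc _ that])
  fix eta assume eta: "eta \<in> test_functions {0<..<T}"
  have dc: "continuous_on {0..T} (%t. deriv eta t * f t)" by (intro continuous_on_mult test_function_deriv(2)[OF eta] fc)
  have hc: "continuous_on {0..T} (%t. deriv eta t * hp (c t) v)"
   by (intro continuous_on_mult test_function_deriv(2)[OF eta] continuous_hp cH cc VH' v)
  have "(LINT t|time T. deriv eta t * f t) = (LINT t|time T. deriv eta t * hp (c t) v - deriv eta t * P t)"
   by (simp add: f_def right_diff_distrib)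
  also have "... = (LINT t|time T. deriv eta t * hp (c t) v) - (LINT t|time T. deriv eta t * P t)"
   by (rule Bochner_Integration.integral_diff[OF time_integral_continuous(1)[OF hc]]) (use test_function_parts(1)[OF T eta y] in \<open>simp add: P_def\<close>)
  also have "... = 0"
  proof -
   have "(LINT t|time T. deriv eta t * hp (u t) v) = (LINT t|time T. deriv eta t * hp (c t) v)"
    by (rule test_integral_cong[OF T eta v u cH cc cu])
   thus ?thesis using td[OF eta] test_function_parts(2)[OF T eta y] unfolding P_def by linarith
  qed
  finally show "integral {0..T} (%t. deriv eta t * f t) = 0" by (simp only: time_integral_continuous(2)[OF dc])
 qed
 have "hp (c 0) v = 0" using H.Cauchy_Schwarz[OF cH VH'[OF v], of 0] c0 T by simp
 moreover have "P 0 = 0" unfolding P_def by (rule integral_eq_zero_AE) (auto intro: AE_I2)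
 ultimately have "f (T / 2) = 0" using const[of 0] T by (simp add: f_def)
 thus ?thesis using const[OF t] by (simp add: f_def P_def)
qed

end

lemma seminormed_cong:
 assumes X: "seminormed X nrm" and e: "!!x. x \<in> X ==> nrm' x = nrm x"
 shows "seminormed X nrm'"
proof -
 interpret seminormed X nrm by (rule X)
 show ?thesis
  by unfold_locales (use sub nonneg triangle scale e in \<open>simp_all add: mem\<close>)
qed

text \<open>The two norms agree on the carrier only, so one cannot simply be rewritten into the
  other inside the Bochner space; instead the identity is treated as a bounded linear map in both
  directions.\<close>

lemma L2_Bochner_cong:
 assumes X: "seminormed X nrm" and e: "!!x. x \<in> X ==> nrm' x = nrm x"
 shows "u \<in> L2_Bochner T X nrm' \<longleftrightarrow> seminormed.sq_int X nrm T u"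
proof -
 have X': "seminormed X nrm'" by (rule seminormed_cong[OF X e])
 interpret A: seminormed X nrm by (rule X)
 interpret B: seminormed X nrm' by (rule X')
 have "A.sq_int T u" if u: "B.sq_int T u"
  by (rule B.sq_int_linear[OF u X, of "%x. x" 1]) (simp_all add: e)
 moreover have "B.sq_int T u" if u: "A.sq_int T u"
  by (rule A.sq_int_linear[OF u X', of "%x. x" 1]) (simp_all add: e)
 ultimately show ?thesis unfolding L2_Bochner_sq_integrable[OF X'] by blast
qed

subsection \<open>Tensor fields as source terms\<close>

context medium
begin

abbreviation vol :: "(real^3) measure" where
 "vol \<equiv> density (restrict_space lborel M) (%x. ennreal (n x ^ 3))"

lemma n_restrict_measurable [measurable]: "n \<in> borel_measurable (restrict_space lborel M)"
 using n_measurable by (subst measurable_cong_sets[OF _ refl, of _ "restrict_space borel M"]) (auto simp: sets_restrict_space)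

lemma space_vol: "space vol = M"
 by (simp add: space_restrict_space)

text \<open>A function of the base point alone is constant on each fibre, so the fibre integral
  contributes the mass of the unit sphere.\<close>

lemma lift_L2:
 assumes g: "g \<in> L2 vol"
 shows "(%z. g (fst z)) \<in> L2 SM" "H.nrm (%z. g (fst z)) = sqrt (measure sphere_measure (sphere 0 1)) * L2_norm vol g"
proof -
 interpret S: finite_measure sphere_measure by (rule finite_sphere_measure)
 let ?s = "measure sphere_measure (sphere 0 1)"
 have gi: "integrable vol (%x. (g x)^2)" using g by (simp add: L2_def)
 have gm: "g \<in> borel_measurable (restrict_space lborel M)" using g by (simp add: L2_def)
 hence gb: "g \<in> borel_measurable (restrict_space borel M)"
  by (subst (asm) measurable_cong_sets[OF _ refl, of _ "restrict_space borel M"]) (auto simp: sets_restrict_space)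
 have "fst \<in> restrict_space borel (OmegaM n) \<rightarrow>\<^sub>M restrict_space borel M"
 proof (rule measurable_restrict_space2)
  show "fst \<in> space (restrict_space borel (OmegaM n)) \<rightarrow> M" by (auto simp: space_restrict_space mem_OmegaM)
  show "fst \<in> borel_measurable (restrict_space (borel :: phase measure) (OmegaM n))"
   by (rule measurable_restrict_space1) (rule borel_measurable_continuous_onI[OF continuous_on_fst[OF continuous_on_id]])
 qed
 from measurable_compose[OF this gb] have m: "(%z. g (fst z)) \<in> borel_measurable SM" by (simp only: SM_measurable_iff)
 have "(\<integral>\<^sup>+z. ennreal ((g (fst z))^2) \<partial>SM) = (\<integral>\<^sup>+x. indicator M x * (ennreal (n x ^ 3) * (\<integral>\<^sup>+omega. ennreal ((g x)^2) \<partial>sphere_measure)) \<partial>lborel)"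
  by (subst nn_integral_SM) (use m in simp_all)
 also have "... = (\<integral>\<^sup>+x. (ennreal ?s * (ennreal (n x ^ 3) * ennreal ((g x)^2))) * indicator M x \<partial>lborel)"
  by (rule nn_integral_cong) (simp add: S.emeasure_eq_measure mult_ac)
 also have "... = (\<integral>\<^sup>+x. ennreal ?s * (ennreal (n x ^ 3) * ennreal ((g x)^2)) \<partial>restrict_space lborel M)"
  by (rule nn_integral_restrict_space[symmetric]) simp
 also have "... = ennreal ?s * (\<integral>\<^sup>+x. ennreal (n x ^ 3) * ennreal ((g x)^2) \<partial>restrict_space lborel M)"
  by (rule nn_integral_cmult) (use gm in measurable)
 also have "(\<integral>\<^sup>+x. ennreal (n x ^ 3) * ennreal ((g x)^2) \<partial>restrict_space lborel M) = (\<integral>\<^sup>+x. ennreal ((g x)^2) \<partial>vol)"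
  by (rule nn_integral_density[symmetric]) (use gm in measurable)
 finally have nn: "(\<integral>\<^sup>+z. ennreal ((g (fst z))^2) \<partial>SM) = ennreal ?s * (\<integral>\<^sup>+x. ennreal ((g x)^2) \<partial>vol)" .
 have e: "(\<integral>\<^sup>+x. ennreal ((g x)^2) \<partial>vol) = ennreal (LINT x|vol. (g x)^2)"
  by (rule nn_integral_eq_integral[OF gi]) simp
 have nn': "(\<integral>\<^sup>+z. ennreal ((g (fst z))^2) \<partial>SM) = ennreal (?s * (LINT x|vol. (g x)^2))"
  unfolding nn e by (simp add: ennreal_mult integral_nonneg_AE)
 have "integrable SM (%z. (g (fst z))^2)" using m nn' by (intro integrableI_bounded) auto
 thus "(%z. g (fst z)) \<in> L2 SM" using m by (simp add: L2_def)
 have "(LINT z|SM. (g (fst z))^2) = ?s * (LINT x|vol. (g x)^2)"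
  by (subst integral_eq_nn_integral) (use m nn' in \<open>auto simp: integral_nonneg_AE\<close>)
 thus "H.nrm (%z. g (fst z)) = sqrt ?s * L2_norm vol g" by (simp add: H_nrm L2_norm_def real_sqrt_mult)
qed

lemma finite_multi_indices: "finite (multi_indices m)"
 using finite_lists_length_eq[of "UNIV :: 3 set" m] by (simp add: multi_indices_def)

definition tensor_ip :: "nat => ((real^3) \<times> 3 list => real) => ((real^3) \<times> 3 list => real) => real" where
 "tensor_ip m F G = (LINT x|vol. (\<Sum>I\<in>multi_indices m. F (x, I) * G (x, I)) / n x ^ (2 * m))"

lemma tensor_component: "F \<in> L2_tensor n m ==> I \<in> multi_indices m ==> (%x. F (x, I)) \<in> L2 vol"
 by (simp add: L2_tensor_def)

lemma tensor_integrable: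
 assumes F: "F \<in> L2_tensor n m" and G: "G \<in> L2_tensor n m"
 shows "integrable vol (%x. (\<Sum>I\<in>multi_indices m. F (x, I) * G (x, I)) / n x ^ (2 * m))"
proof -
 have "integrable vol (%x. (1 / n x ^ (2 * m) * F (x, I)) * G (x, I))" if I: "I \<in> multi_indices m" for I
 proof (rule L2_integrable_mult[OF L2_mult_bounded[OF _ _ tensor_component[OF F I]] tensor_component[OF G I]])
  show "(%x. 1 / n x ^ (2 * m)) \<in> borel_measurable vol" by simp
  show "AE x in vol. \<bar>1 / n x ^ (2 * m)\<bar> <= 1 / c ^ (2 * m)"
  proof (rule AE_I2)
   fix x assume "x \<in> space vol"
   hence x: "x \<in> M" by (simp only: space_vol)
   have "c ^ (2 * m) <= n x ^ (2 * m)" using c n_ge[OF x] by (intro power_mono) auto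
   hence "1 / n x ^ (2 * m) <= 1 / c ^ (2 * m)" using c by (intro divide_left_mono) (auto intro!: mult_pos_pos zero_less_power simp: n_pos[OF x])
   thus "\<bar>1 / n x ^ (2 * m)\<bar> <= 1 / c ^ (2 * m)" using n_pos[OF x] by simp
  qed
 qed
 hence "integrable vol (%x. \<Sum>I\<in>multi_indices m. (1 / n x ^ (2 * m) * F (x, I)) * G (x, I))"
  by (rule Bochner_Integration.integrable_sum)
 thus ?thesis by (simp add: sum_divide_distrib)
qed

lemma tensor_semi_inner: "semi_inner (L2_tensor n m) (tensor_ip m)"
proof
 interpret N: semi_inner "L2 vol" "%u v. \<integral>z. u z * v z \<partial>vol" by (rule L2_semi_inner)
 show "subspace (L2_tensor n m)"
 proof (rule subspaceI)
  show "0 \<in> L2_tensor n m" using N.mem(1) by (simp add: L2_tensor_def zero_fun_def)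
  fix F assume F: "F \<in> L2_tensor n m"
  have symF: "ALL x:M. ALL I:multi_indices m. ALL J. mset J = mset I --> F (x, J) = F (x, I)"
   using F unfolding L2_tensor_def by blast
  show "a *\<^sub>R F \<in> L2_tensor n m" for a
   unfolding L2_tensor_def mem_Collect_eq
  proof (intro conjI ballI allI impI)
   fix I assume "I \<in> multi_indices m"
   from N.mem(3)[OF tensor_component[OF F this], of a]
   show "(%x. (a *\<^sub>R F) (x, I)) \<in> L2 vol" by (simp only: scaleR_fun_def)
  next
   fix x I J assume "x \<in> M" "I \<in> multi_indices m" "mset J = mset I"
   hence "F (x, J) = F (x, I)" by (intro symF[THEN bspec, THEN bspec, THEN spec, THEN mp])
   thus "(a *\<^sub>R F) (x, J) = (a *\<^sub>R F) (x, I)" by (simp only: scaleR_fun_apply)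
  qed
  fix G assume G: "G \<in> L2_tensor n m"
  have symG: "ALL x:M. ALL I:multi_indices m. ALL J. mset J = mset I --> G (x, J) = G (x, I)"
   using G unfolding L2_tensor_def by blast
  show "F + G \<in> L2_tensor n m"
   unfolding L2_tensor_def mem_Collect_eq
  proof (intro conjI ballI allI impI)
   fix I assume I: "I \<in> multi_indices m"
   from N.mem(2)[OF tensor_component[OF F I] tensor_component[OF G I]]
   show "(%x. (F + G) (x, I)) \<in> L2 vol" by (simp only: plus_fun_def)
  next
   fix x I J assume "x \<in> M" "I \<in> multi_indices m" "mset J = mset I"
   with symF symG have "F (x, J) = F (x, I) \<and> G (x, J) = G (x, I)" by (intro conjI) metis+
   thus "(F + G) (x, J) = (F + G) (x, I)" by (simp only: plus_fun_apply)
  qed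
 qed
 fix F G assume F: "F \<in> L2_tensor n m" and G: "G \<in> L2_tensor n m"
 show "tensor_ip m (a *\<^sub>R F) G = a * tensor_ip m F G" for a
 proof -
  have "(\<Sum>I\<in>multi_indices m. (a *\<^sub>R F) (x, I) * G (x, I)) / n x ^ (2 * m) = a * ((\<Sum>I\<in>multi_indices m. F (x, I) * G (x, I)) / n x ^ (2 * m))" for x
   by (simp add: sum_distrib_left mult.assoc)
  thus ?thesis unfolding tensor_ip_def by (simp only: integral_mult_right_zero)
 qed
 show "tensor_ip m F G = tensor_ip m G F" unfolding tensor_ip_def by (simp only: mult.commute)
 show "0 <= tensor_ip m F F" unfolding tensor_ip_def
  by (intro integral_nonneg_AE AE_I2 divide_nonneg_nonneg sum_nonneg) (use n_pos in \<open>auto simp: space_restrict_space less_imp_le\<close>)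
 fix F' assume F': "F' \<in> L2_tensor n m"
 show "tensor_ip m (F + F') G = tensor_ip m F G + tensor_ip m F' G"
  unfolding tensor_ip_def Bochner_Integration.integral_add[OF tensor_integrable[OF F G] tensor_integrable[OF F' G], symmetric]
  by (simp add: distrib_right sum.distrib add_divide_distrib)
qed

lemma tensor_nrm: "semi_inner.nrm (tensor_ip m) = L2_tensor_norm n m"
 by (simp add: fun_eq_iff semi_inner.nrm_def[OF tensor_semi_inner] tensor_ip_def L2_tensor_norm_def power2_eq_square)

lemma tensor_seminormed: "seminormed (L2_tensor n m) (L2_tensor_norm n m)"
proof -
 interpret semi_inner "L2_tensor n m" "tensor_ip m" by (rule tensor_semi_inner)
 show ?thesis using seminormed_axioms by (simp only: tensor_nrm)
qed

lemma tensor_component_norm: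
 assumes F: "F \<in> L2_tensor n m" and I: "I \<in> multi_indices m"
 shows "L2_norm vol (%x. F (x, I)) <= nmax ^ m * L2_tensor_norm n m F"
proof -
 let ?g = "%x. (\<Sum>J\<in>multi_indices m. (F (x, J))^2) / n x ^ (2 * m)"
 have gi: "integrable vol ?g" using tensor_integrable[OF F F] by (simp add: power2_eq_square)
 have "(LINT x|vol. (F (x, I))^2) <= (LINT x|vol. nmax ^ (2 * m) * ?g x)"
 proof (rule integral_mono_AE)
  show "integrable vol (%x. (F (x, I))^2)" using tensor_component[OF F I] by (simp add: L2_def)
  show "integrable vol (%x. nmax ^ (2 * m) * ?g x)" using gi by (rule integrable_mult_right)
  show "AE x in vol. (F (x, I))^2 <= nmax ^ (2 * m) * ?g x"
  proof (rule AE_I2)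
   fix x assume "x \<in> space vol"
   hence x: "x \<in> M" by (simp only: space_vol)
   have p: "0 < n x ^ (2 * m)" using n_pos[OF x] by simp
   have "n x ^ (2 * m) <= nmax ^ (2 * m)" using n_le[OF x] n_pos[OF x] by (intro power_mono) auto
   hence "1 <= nmax ^ (2 * m) / n x ^ (2 * m)" using p by simp
   moreover have "(F (x, I))^2 <= (\<Sum>J\<in>multi_indices m. (F (x, J))^2)"
    by (rule member_le_sum[OF I]) (simp_all add: finite_multi_indices)
   ultimately have "1 * (F (x, I))^2 <= nmax ^ (2 * m) / n x ^ (2 * m) * (\<Sum>J\<in>multi_indices m. (F (x, J))^2)"
    by (intro mult_mono) (auto intro: sum_nonneg)
   thus "(F (x, I))^2 <= nmax ^ (2 * m) * ?g x" by simp
  qed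
 qed
 hence "sqrt (LINT x|vol. (F (x, I))^2) <= sqrt (nmax ^ (2 * m) * (LINT x|vol. ?g x))"
  by (intro real_sqrt_le_mono) (simp only: integral_mult_right_zero)
 moreover have "sqrt (nmax ^ (2 * m)) = nmax ^ m" using nmax(2) by (simp add: power_even_eq)
 ultimately show ?thesis by (simp add: L2_norm_def L2_tensor_norm_def real_sqrt_mult)
qed

definition mono :: "3 list => phase => real" where
 "mono I z = prod_list (map (%i. snd z $ i) I)"

lemma mono_measurable: "mono I \<in> borel_measurable SM"
proof (rule continuous_SM_measurable)
 show "continuous_on (OmegaM n) (mono I)"
  unfolding mono_def[abs_def] by (induction I) (auto intro!: continuous_intros)
qed

lemma mono_bound: "z \<in> OmegaM n ==> \<bar>mono I z\<bar> <= (1 / c) ^ length I"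
proof (induction I)
 case (Cons i I)
 have n: "c <= n (fst z)" "n (fst z) * norm (snd z) = 1" using Cons.prems by (simp_all add: mem_OmegaM n_ge)
 hence "c * norm (snd z) <= 1" using mult_right_mono[OF n(1), of "norm (snd z)"] by simp
 hence "norm (snd z) <= 1 / c" using c by (simp add: field_simps)
 hence "\<bar>snd z $ i\<bar> <= 1 / c" using component_le_norm_cart[of "snd z" i] by linarith
 hence "\<bar>snd z $ i\<bar> * \<bar>mono I z\<bar> <= (1 / c) * (1 / c) ^ length I"
  using Cons c by (intro mult_mono) auto
 thus ?case by (simp add: mono_def abs_mult)
qed (simp add: mono_def)

lemma contract_sum: "contract m F = (\<Sum>I\<in>multi_indices m. (%z. mono I z * F (fst z, I)))"
 by (simp add: contract_def mono_def sum_fun_apply fun_eq_iff mult.commute)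

lemma contract_diff: "contract m (F - G) = contract m F - contract m G"
 by (simp add: contract_def fun_eq_iff left_diff_distrib sum_subtractf)

text \<open>Metric unit vectors have components at most \<open>1 / c\<close>, so each monomial of
  degree \<open>m\<close> is at most \<open>(1 / c)^m\<close>; passing from the tensor norm to a
  component costs another \<open>nmax^m\<close>. One constant serves all tensors, which makes
  contraction a bounded linear map.\<close>

lemma contract_bounded:
 obtains C where "!!F. F \<in> L2_tensor n m ==> contract m F \<in> L2 SM"
  "!!F. F \<in> L2_tensor n m ==> H.nrm (contract m F) <= C * L2_tensor_norm n m F"
proof -
 define s where "s = sqrt (measure sphere_measure (sphere (0 :: real^3) 1))"
 define C where "C = (\<Sum>I\<in>multi_indices m. (1 / c) ^ m * (s * nmax ^ m))"
 have ob: "AE z in SM. \<bar>mono I z\<bar> <= (1 / c) ^ m" if "I \<in> multi_indices m" for I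
  by (rule AE_I2) (use that mono_bound[of _ I] in \<open>simp add: multi_indices_def\<close>)
 have mem: "(%z. mono I z * F (fst z, I)) \<in> L2 SM" if "F \<in> L2_tensor n m" "I \<in> multi_indices m" for F I
  by (rule L2_mult_bounded[OF mono_measurable ob lift_L2(1)[OF tensor_component]]) (use that in auto)
 have bd: "H.nrm (%z. mono I z * F (fst z, I)) <= (1 / c) ^ m * (s * nmax ^ m) * L2_tensor_norm n m F"
  if F: "F \<in> L2_tensor n m" and I: "I \<in> multi_indices m" for F I
 proof -
  have "H.nrm (%z. mono I z * F (fst z, I)) <= (1 / c) ^ m * H.nrm (%z. F (fst z, I))"
   unfolding H_nrm by (rule L2_norm_mult_bounded[OF mono_measurable ob[OF I] _ lift_L2(1)[OF tensor_component[OF F I]]]) (use c in simp)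
  also have "... = (1 / c) ^ m * (s * L2_norm vol (%x. F (x, I)))"
   unfolding s_def lift_L2(2)[OF tensor_component[OF F I]] ..
  also have "... <= (1 / c) ^ m * (s * (nmax ^ m * L2_tensor_norm n m F))"
   by (intro mult_left_mono tensor_component_norm[OF F I]) (use c in \<open>auto simp: s_def\<close>)
  finally show ?thesis by (simp add: mult.assoc)
 qed
 show ?thesis
 proof (rule that[of C])
  show "contract m F \<in> L2 SM" if "F \<in> L2_tensor n m" for F
   unfolding contract_sum by (rule H.mem_sum[OF mem[OF that]])
  show "H.nrm (contract m F) <= C * L2_tensor_norm n m F" if F: "F \<in> L2_tensor n m" for F
  proof -
   have "H.nrm (contract m F) <= (\<Sum>I\<in>multi_indices m. H.nrm (%z. mono I z * F (fst z, I)))"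
    unfolding contract_sum by (rule H.nrm_sum[OF mem[OF F]])
   also have "... <= (\<Sum>I\<in>multi_indices m. (1 / c) ^ m * (s * nmax ^ m) * L2_tensor_norm n m F)"
    by (rule sum_mono[OF bd[OF F]])
   finally show ?thesis by (simp only: C_def sum_distrib_right)
  qed
 qed
qed

lemma source_sq_integrable:
 assumes f: "f \<in> L2_Bochner T (L2_tensor n m) (L2_tensor_norm n m)"
 shows "G.D.sq_int T (%t. hip (contract m (f t)))"
proof -
 interpret N: seminormed "L2_tensor n m" "L2_tensor_norm n m" by (rule tensor_seminormed)
 obtain C where C: "!!F. F \<in> L2_tensor n m ==> contract m F \<in> L2 SM"
  "!!F. F \<in> L2_tensor n m ==> H.nrm (contract m F) <= C * L2_tensor_norm n m F" by (rule contract_bounded) (rule that, assumption+)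
 have fs: "N.sq_int T f" using f L2_Bochner_sq_integrable[OF tensor_seminormed] by blast
 have le: "G.V.dnorm (hip (contract m F) - hip (contract m F')) <= C * L2_tensor_norm n m (F - F')"
  if "F \<in> L2_tensor n m" "F' \<in> L2_tensor n m" for F F'
  using G.dnorm_hp_diff[OF C(1)[OF that(1)] C(1)[OF that(2)]] C(2)[OF N.mem(4)[OF that]] unfolding contract_diff by (rule order_trans)
 show ?thesis
 proof (rule N.sq_int_linear[where G = "%F. hip (contract m F)", OF fs G.D.seminormed_axioms _ le])
  fix F assume F: "F \<in> L2_tensor n m"
  show "hip (contract m F) \<in> G.V.dual" by (rule G.hp_dual[OF C(1)[OF F]])
  have "hip (contract m 0) = 0" by (simp add: contract_def fun_eq_iff case_prod_beta')
  thus "G.V.dnorm (hip (contract m F)) <= C * L2_tensor_norm n m F" using le[OF F N.mem(1)] by (simp only: diff_zero)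
 qed
qed

end

subsection \<open>The bilinear form\<close>

locale viscosity = medium n c for n c +
 fixes alpha :: "phase => real" and eps :: real
 assumes eps: "eps > 0" and alpha_measurable: "alpha \<in> borel_measurable (Sigma_measure n)"
  and alpha_bounded: "EX C. AE z in Sigma_measure n. \<bar>alpha z\<bar> <= C"
begin

text \<open>Coefficients of the transport terms with respect to the normalised derivatives
  \<open>gd\<close>; the factor \<open>n\<close> compensates the division in
  \<open>gd\<close>.\<close>

definition coef :: "bool \<times> 3 => phase => real" where
 "coef q z = (if fst q then n (fst z) * snd z $ snd q
   else - n (fst z) * (\<Sum>i\<in>UNIV. \<Sum>j\<in>UNIV. christoffel n i j (snd q) (fst z) * snd z $ i * snd z $ j))"

definition low :: "(phase => real) => phase => real" where
 "low u = (\<Sum>q\<in>UNIV. (%z. coef q z * gd q u z)) + (%z. alpha z * u z)"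

lemma continuous_coef: "continuous_on (OmegaM n) (coef q)"
proof -
 have f: "continuous_on (OmegaM n) fst" by (intro continuous_intros)
 have s: "fst ` OmegaM n \<subseteq> M" by (auto simp: mem_OmegaM)
 have nc: "continuous_on (OmegaM n) (%z. n (fst z))" by (rule continuous_on_compose2[OF n_continuous f s])
 have "continuous_on M (pdn n i)" for i using n_C1 by (simp add: pdn_def[abs_def])
 hence pc: "continuous_on (OmegaM n) (%z. pdn n i (fst z))" for i by (rule continuous_on_compose2[OF _ f s])
 have "continuous_on (OmegaM n) (%z. christoffel n i j k (fst z))" for i j k
  unfolding christoffel_def by (intro continuous_intros pc nc) (use n_pos in \<open>force simp: mem_OmegaM\<close>)
 thus ?thesis unfolding coef_def[abs_def] by (cases "fst q") (auto intro!: continuous_intros nc)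
qed

text \<open>The coefficients are continuous on the compact sphere bundle, because \<open>n\<close>
  is continuously differentiable up to the boundary, and \<open>alpha\<close> is essentially
  bounded.\<close>

lemma low_bounded:
 obtains L where "L >= 0" "!!u. u \<in> H1 n ==> low u \<in> L2 SM" "!!u. u \<in> H1 n ==> H.nrm (low u) <= L * W.nrm u"
proof -
 have "EX B. ALL z:OmegaM n. \<bar>coef q z\<bar> <= B" for q by (rule continuous_OmegaM_bounded[OF continuous_coef])
 from choice[OF allI[OF this]] obtain B where B: "ALL q. ALL z:OmegaM n. \<bar>coef q z\<bar> <= B q" ..
 have cb: "AE z in SM. \<bar>coef q z\<bar> <= \<bar>B q\<bar>" for q
 proof (rule AE_I2)
  fix z assume "z \<in> space SM"
  hence "\<bar>coef q z\<bar> <= B q" by (intro B[THEN spec, THEN bspec]) simp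
  thus "\<bar>coef q z\<bar> <= \<bar>B q\<bar>" by linarith
 qed
 have cm: "coef q \<in> borel_measurable SM" for q by (rule continuous_SM_measurable[OF continuous_coef])
 obtain A where "AE z in SM. \<bar>alpha z\<bar> <= A" using alpha_bounded by blast
 hence A: "AE z in SM. \<bar>alpha z\<bar> <= \<bar>A\<bar>" by (rule eventually_mono) simp
 have m1: "(%z. coef q z * gd q u z) \<in> L2 SM" if "u \<in> H1 n" for q u by (rule L2_mult_bounded[OF cm cb gd_L2[OF that]])
 have m2: "(%z. alpha z * u z) \<in> L2 SM" if "u \<in> H1 n" for u by (rule L2_mult_bounded[OF alpha_measurable A H1_L2[OF that]])
 have b1: "H.nrm (%z. coef q z * gd q u z) <= \<bar>B q\<bar> * W.nrm u" if u: "u \<in> H1 n" for q u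
 proof -
  have "H.nrm (%z. coef q z * gd q u z) <= \<bar>B q\<bar> * H.nrm (gd q u)"
   unfolding H_nrm by (rule L2_norm_mult_bounded[OF cm cb _ gd_L2[OF u]]) simp
  also have "... <= \<bar>B q\<bar> * W.nrm u" by (intro mult_left_mono W_nrm_ge(2)[OF u]) simp
  finally show ?thesis .
 qed
 have b2: "H.nrm (%z. alpha z * u z) <= \<bar>A\<bar> * W.nrm u" if u: "u \<in> H1 n" for u
 proof -
  have "H.nrm (%z. alpha z * u z) <= \<bar>A\<bar> * H.nrm u"
   unfolding H_nrm by (rule L2_norm_mult_bounded[OF alpha_measurable A _ H1_L2[OF u]]) simp
  also have "... <= \<bar>A\<bar> * W.nrm u" by (intro mult_left_mono W_nrm_ge(1)[OF u]) simp
  finally show ?thesis .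
 qed
 have ms: "(\<Sum>q\<in>UNIV. (%z. coef q z * gd q u z)) \<in> L2 SM" if u: "u \<in> H1 n" for u by (rule H.mem_sum[OF m1[OF u]])
 show ?thesis
 proof (rule that[of "(\<Sum>q\<in>UNIV. \<bar>B q\<bar>) + \<bar>A\<bar>"])
  show "0 <= (\<Sum>q\<in>UNIV. \<bar>B q\<bar>) + \<bar>A\<bar>" by (simp add: sum_nonneg)
  fix u assume u: "u \<in> H1 n"
  show "low u \<in> L2 SM" unfolding low_def by (rule H.mem(2)[OF ms[OF u] m2[OF u]])
  have "H.nrm (low u) <= H.nrm (\<Sum>q\<in>UNIV. (%z. coef q z * gd q u z)) + H.nrm (%z. alpha z * u z)"
   unfolding low_def by (rule H.triangle[OF ms[OF u] m2[OF u]])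
  moreover have "H.nrm (\<Sum>q\<in>UNIV. (%z. coef q z * gd q u z)) <= (\<Sum>q\<in>UNIV. H.nrm (%z. coef q z * gd q u z))"
   by (rule H.nrm_sum[OF m1[OF u]])
  moreover have "... <= (\<Sum>q\<in>UNIV. \<bar>B q\<bar> * W.nrm u)" by (rule sum_mono[OF b1[OF u]])
  moreover have "... = (\<Sum>q\<in>UNIV. \<bar>B q\<bar>) * W.nrm u" by (simp only: sum_distrib_right)
  ultimately show "H.nrm (low u) <= ((\<Sum>q\<in>UNIV. \<bar>B q\<bar>) + \<bar>A\<bar>) * W.nrm u"
   using b2[OF u] unfolding distrib_right by linarith
 qed
qed

lemma low_L2: "u \<in> H1 n ==> low u \<in> L2 SM"
 by (rule low_bounded) auto

lemma low_apply: "low u z = (\<Sum>q\<in>UNIV. coef q z * gd q u z) + alpha z * u z"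
 by (simp add: low_def sum_fun_apply)

lemma low_add:
 assumes "u \<in> H1 n" "v \<in> H1 n" shows "AE z in SM. low (u + v) z = (low u + low v) z"
proof -
 have "AE z in SM. ALL q:UNIV. gd q (u + v) z = (gd q u + gd q v) z"
  by (rule AE_finite_allI[OF finite_class.finite_UNIV gd_add[OF assms]])
 thus ?thesis by (rule eventually_mono) (simp add: low_apply distrib_left sum.distrib del: split_paired_All)
qed

lemma low_scale:
 assumes "u \<in> H1 n" shows "AE z in SM. low (a *\<^sub>R u) z = (a *\<^sub>R low u) z"
proof -
 have "AE z in SM. ALL q:UNIV. gd q (a *\<^sub>R u) z = (a *\<^sub>R gd q u) z"
  by (rule AE_finite_allI[OF finite_class.finite_UNIV gd_scale[OF assms]])
 thus ?thesis by (rule eventually_mono) (simp add: low_apply distrib_left sum_distrib_left mult.left_commute del: split_paired_All)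
qed

lemma swap_sums: "(\<Sum>i\<in>UNIV. \<Sum>j\<in>UNIV. \<Sum>k\<in>UNIV. f i j k * d k) = (\<Sum>k\<in>UNIV. (\<Sum>i\<in>UNIV. \<Sum>j\<in>UNIV. f i j k) * d k)"
 for f :: "3 => 3 => 3 => real"
 by (simp add: sum_3 algebra_simps)

text \<open>\<open>h1 u v - hip u v\<close> is exactly the product of the gradients. Everything
  later about the form uses only the two inner products and the bounded map
  \<open>low\<close>.\<close>

lemma a_form_eq:
 assumes u: "u \<in> H1 n" and v: "v \<in> H1 n"
 shows "a_form n alpha eps u v = eps * (h1 u v - hip u v) + hip (low u) v"
proof -
 have "a_form n alpha eps u v = (LINT z|SM. eps * (\<Sum>q\<in>UNIV. gd q u z * gd q v z) + low u z * v z)"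
  unfolding a_form_def
 proof (rule Bochner_Integration.integral_cong[OF refl])
  fix z assume z: "z \<in> space SM"
  obtain x \<xi> where zx: "z = (x, \<xi>)" by (cases z)
  have n: "n x > 0" using z by (simp add: zx mem_OmegaM n_pos)
  have 1: "metric n x (nabla_x n u z) (nabla_x n v z) = (\<Sum>i\<in>UNIV. gd (True, i) u z * gd (True, i) v z)"
   using n by (simp add: metric_def inner_vec_def nabla_x_def gd_def dd_def zx sum_distrib_left power2_eq_square)
  have 2: "metric n x (nabla_xi n u z) (nabla_xi n v z) = (\<Sum>i\<in>UNIV. gd (False, i) u z * gd (False, i) v z)"
   using n by (simp add: metric_def inner_vec_def nabla_xi_def gd_def dd_def zx sum_distrib_left power2_eq_square)
  have 3: "metric n x (nabla_x n u z) \<xi> = (\<Sum>i\<in>UNIV. coef (True, i) z * gd (True, i) u z)"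
   using n by (simp add: metric_def inner_vec_def nabla_x_def gd_def dd_def zx coef_def sum_distrib_left power2_eq_square mult.commute)
  have 4: "- (\<Sum>i\<in>UNIV. \<Sum>j\<in>UNIV. \<Sum>k\<in>UNIV. christoffel n i j k x * \<xi> $ i * \<xi> $ j * dxi n k u z)
    = (\<Sum>k\<in>UNIV. coef (False, k) z * gd (False, k) u z)"
   unfolding swap_sums using n by (simp add: gd_def dd_def zx coef_def sum_negf)
  have "(case z of (x, \<xi>) => eps * metric n x (nabla_x n u z) (nabla_x n v z) + eps * metric n x (nabla_xi n u z) (nabla_xi n v z)
    + metric n x (nabla_x n u z) \<xi> * v z
    - (\<Sum>i\<in>UNIV. \<Sum>j\<in>UNIV. \<Sum>k\<in>UNIV. christoffel n i j k x * \<xi> $ i * \<xi> $ j * dxi n k u z) * v z + alpha z * u z * v z)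
   = eps * metric n x (nabla_x n u z) (nabla_x n v z) + eps * metric n x (nabla_xi n u z) (nabla_xi n v z)
    + metric n x (nabla_x n u z) \<xi> * v z
    + (- (\<Sum>i\<in>UNIV. \<Sum>j\<in>UNIV. \<Sum>k\<in>UNIV. christoffel n i j k x * \<xi> $ i * \<xi> $ j * dxi n k u z)) * v z + alpha z * u z * v z"
   by (simp add: zx)
  also have "... = eps * (\<Sum>q\<in>UNIV. gd q u z * gd q v z) + low u z * v z"
   unfolding 1 2 3 4 low_apply sum_bool_3 by (simp only: distrib_left distrib_right add.assoc)
  finally show "(case z of (x, \<xi>) => eps * metric n x (nabla_x n u z) (nabla_x n v z) + eps * metric n x (nabla_xi n u z) (nabla_xi n v z)
    + metric n x (nabla_x n u z) \<xi> * v z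
    - (\<Sum>i\<in>UNIV. \<Sum>j\<in>UNIV. \<Sum>k\<in>UNIV. christoffel n i j k x * \<xi> $ i * \<xi> $ j * dxi n k u z) * v z + alpha z * u z * v z)
   = eps * (\<Sum>q\<in>UNIV. gd q u z * gd q v z) + low u z * v z" .
 qed
 also have "... = eps * (\<Sum>q\<in>UNIV. hip (gd q u) (gd q v)) + hip (low u) v"
 proof -
  have i: "integrable SM (%z. gd q u z * gd q v z)" for q by (rule L2_integrable_mult[OF gd_L2[OF u] gd_L2[OF v]])
  have "(LINT z|SM. eps * (\<Sum>q\<in>UNIV. gd q u z * gd q v z) + low u z * v z)
   = (LINT z|SM. eps * (\<Sum>q\<in>UNIV. gd q u z * gd q v z)) + hip (low u) v"
   by (rule Bochner_Integration.integral_add) (intro integrable_mult_right Bochner_Integration.integrable_sum i L2_integrable_mult low_L2 u H1_L2 v)+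
  also have "(LINT z|SM. eps * (\<Sum>q\<in>UNIV. gd q u z * gd q v z)) = eps * (\<Sum>q\<in>UNIV. hip (gd q u) (gd q v))"
   by (simp only: integral_mult_right_zero) (simp add: Bochner_Integration.integral_sum i)
  finally show ?thesis .
 qed
 finally show ?thesis by (simp add: h1_def)
qed

lemma a_form_linear:
 assumes u: "u \<in> H1 n" and w: "w \<in> H1 n" and v: "v \<in> H1 n"
 shows "a_form n alpha eps (u + w) v = a_form n alpha eps u v + a_form n alpha eps w v"
  "a_form n alpha eps (a *\<^sub>R u) v = a * a_form n alpha eps u v"
  "a_form n alpha eps v (u + w) = a_form n alpha eps v u + a_form n alpha eps v w"
  "a_form n alpha eps v (a *\<^sub>R u) = a * a_form n alpha eps v u"
proof -
 note uL = H1_L2[OF u] and wL = H1_L2[OF w] and vL = H1_L2[OF v]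
 have uw: "u + w \<in> H1 n" and au: "a *\<^sub>R u \<in> H1 n" using u w by auto
 have "hip (low (u + w)) v = hip (low u + low w) v"
  by (rule hip_cong[OF low_add[OF u w] AE_I2[OF refl] low_L2[OF uw] H.mem(2)[OF low_L2[OF u] low_L2[OF w]] vL vL])
 also have "... = hip (low u) v + hip (low w) v" by (rule H.add_left[OF low_L2[OF u] low_L2[OF w] vL])
 finally show "a_form n alpha eps (u + w) v = a_form n alpha eps u v + a_form n alpha eps w v"
  unfolding a_form_eq[OF uw v] a_form_eq[OF u v] a_form_eq[OF w v] W.add_left[OF u w v] H.add_left[OF uL wL vL]
  by (simp only:) (simp only: right_diff_distrib distrib_left)
 have "hip (low (a *\<^sub>R u)) v = hip (a *\<^sub>R low u) v"
  by (rule hip_cong[OF low_scale[OF u] AE_I2[OF refl] low_L2[OF au] H.mem(3)[OF low_L2[OF u]] vL vL])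
 also have "... = a * hip (low u) v" by (rule H.scale_left[OF low_L2[OF u] vL])
 finally show "a_form n alpha eps (a *\<^sub>R u) v = a * a_form n alpha eps u v"
  unfolding a_form_eq[OF au v] a_form_eq[OF u v] W.scale_left[OF u v] H.scale_left[OF uL vL]
  by (simp only:) (simp only: right_diff_distrib distrib_left mult.left_commute)
 show "a_form n alpha eps v (u + w) = a_form n alpha eps v u + a_form n alpha eps v w"
  unfolding a_form_eq[OF v uw] a_form_eq[OF v u] a_form_eq[OF v w] W.add_right[OF u w v] H.add_right[OF uL wL vL] H.add_right[OF uL wL low_L2[OF v]]
  by (simp only: right_diff_distrib distrib_left)
 show "a_form n alpha eps v (a *\<^sub>R u) = a * a_form n alpha eps v u"
  unfolding a_form_eq[OF v au] a_form_eq[OF v u] W.scale_right[OF u v] H.scale_right[OF uL vL] H.scale_right[OF uL low_L2[OF v]]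
  by (simp only: right_diff_distrib distrib_left mult.left_commute)
qed

text \<open>Proved on all of \<open>H1 n\<close>, since the extension of the boundary data lies
  there and enters the right-hand side through the form.\<close>

lemma a_form_bounds:
 obtains C K where "C >= 0" "K >= 0"
  "!!u v. u \<in> H1 n ==> v \<in> H1 n ==> \<bar>a_form n alpha eps u v\<bar> <= C * W.nrm u * W.nrm v"
  "!!u. u \<in> H1 n ==> eps / 2 * (W.nrm u)^2 - K * (H.nrm u)^2 <= a_form n alpha eps u u"
proof -
 obtain L where L: "L >= 0" "!!u. u \<in> H1 n ==> H.nrm (low u) <= L * W.nrm u" by (rule low_bounded) (rule that, assumption+)
 have lb: "\<bar>hip (low u) v\<bar> <= L * W.nrm u * H.nrm v" if u: "u \<in> H1 n" and v: "v \<in> H1 n" for u v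
  using H.Cauchy_Schwarz[OF low_L2[OF u] H1_L2[OF v]] mult_right_mono[OF L(2)[OF u] H.nonneg[OF H1_L2[OF v]]] by linarith
 show ?thesis
 proof (rule that[of "2 * eps + L" "eps + L^2 / (2 * eps)"])
  fix u v assume u: "u \<in> H1 n" and v: "v \<in> H1 n"
  note nn = W.nonneg[OF u] W.nonneg[OF v] H.nonneg[OF H1_L2[OF u]] H.nonneg[OF H1_L2[OF v]]
  have "\<bar>hip u v\<bar> <= H.nrm u * H.nrm v" by (rule H.Cauchy_Schwarz[OF H1_L2[OF u] H1_L2[OF v]])
  also have "... <= W.nrm u * W.nrm v" by (intro mult_mono W_nrm_ge(1) u v nn)
  finally have 1: "\<bar>hip u v\<bar> <= W.nrm u * W.nrm v" .
  have 2: "\<bar>h1 u v\<bar> <= W.nrm u * W.nrm v" by (rule W.Cauchy_Schwarz[OF u v])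
  have 3: "\<bar>hip (low u) v\<bar> <= L * W.nrm u * W.nrm v"
   using lb[OF u v] mult_left_mono[OF W_nrm_ge(1)[OF v], of "L * W.nrm u"] L(1) nn(1) by simp
  have "\<bar>eps * (h1 u v - hip u v)\<bar> <= eps * (2 * (W.nrm u * W.nrm v))"
   unfolding abs_mult using 1 2 eps by (intro mult_mono) auto
  with 3 have "\<bar>eps * (h1 u v - hip u v) + hip (low u) v\<bar> <= eps * (2 * (W.nrm u * W.nrm v)) + L * W.nrm u * W.nrm v"
   by (intro order_trans[OF abs_triangle_ineq] add_mono)
  also have "... = (2 * eps + L) * W.nrm u * W.nrm v" by (simp only: algebra_simps)
  finally show "\<bar>a_form n alpha eps u v\<bar> <= (2 * eps + L) * W.nrm u * W.nrm v" unfolding a_form_eq[OF u v] .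
 next
  fix u assume u: "u \<in> H1 n"
  define x y where "x = W.nrm u" and "y = H.nrm u"
  \<comment> \<open>Young's inequality weighted by \<open>eps\<close>: the lower order terms use up
    half of the viscosity and leave \<open>L^2 / (2 * eps)\<close> times the squared L2 norm. The
    further \<open>eps\<close> in the constant makes up for the L2 part contained in
    \<open>W.nrm\<close>.\<close>
  have "0 <= (eps * x - L * y)^2" by simp
  hence "2 * eps * (L * x * y) <= eps^2 * x^2 + L^2 * y^2" by (simp add: power2_eq_square algebra_simps)
  hence "2 * eps * (L * x * y) <= 2 * eps * (eps / 2 * x^2 + L^2 / (2 * eps) * y^2)"
  proof -
   have "2 * eps * (eps / 2 * x^2 + L^2 / (2 * eps) * y^2) = eps^2 * x^2 + L^2 * y^2" using eps by (simp add: power2_eq_square distrib_left)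
   thus ?thesis using \<open>2 * eps * (L * x * y) <= eps^2 * x^2 + L^2 * y^2\<close> by (simp only:)
  qed
  hence "L * x * y <= eps / 2 * x^2 + L^2 / (2 * eps) * y^2" using eps by simp
  moreover have "- (L * x * y) <= hip (low u) u" using lb[OF u u] unfolding x_def y_def by linarith
  moreover have "a_form n alpha eps u u = eps * (x^2 - y^2) + hip (low u) u"
   unfolding a_form_eq[OF u u] x_def y_def W.nrm_sq[OF u] H.nrm_sq[OF H1_L2[OF u]] ..
  moreover have "eps * (x^2 - y^2) = eps / 2 * x^2 + eps / 2 * x^2 - eps * y^2" by (simp add: field_simps)
  ultimately show "eps / 2 * (W.nrm u)^2 - (eps + L^2 / (2 * eps)) * (H.nrm u)^2 <= a_form n alpha eps u u"
   unfolding x_def[symmetric] y_def[symmetric] distrib_right by linarith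
 qed (use eps L(1) in auto)
qed

lemma a_form_garding: "EX C c0 K. garding (H10 n) (L2 SM) h1 hip (a_form n alpha eps) C c0 K"
proof -
 obtain C K where C: "C >= 0" "K >= 0"
  "!!u v. u \<in> H1 n ==> v \<in> H1 n ==> \<bar>a_form n alpha eps u v\<bar> <= C * W.nrm u * W.nrm v"
  "!!u. u \<in> H1 n ==> eps / 2 * (W.nrm u)^2 - K * (H.nrm u)^2 <= a_form n alpha eps u u"
  by (rule a_form_bounds) (rule that, assumption+)
 have "garding (H10 n) (L2 SM) h1 hip (a_form n alpha eps) C (eps / 2) K"
 proof unfold_locales
  show "0 < eps / 2" "0 <= C" "0 <= K" using eps C(1,2) by simp_all
  fix u v w assume "u \<in> H10 n" "v \<in> H10 n"
  hence u: "u \<in> H1 n" and v: "v \<in> H1 n" by (simp_all only: H10_H1)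
  show "a_form n alpha eps (r *\<^sub>R u) v = r * a_form n alpha eps u v" "a_form n alpha eps v (r *\<^sub>R u) = r * a_form n alpha eps v u" for r
   by (rule a_form_linear(2,4)[OF u u v])+
  show "\<bar>a_form n alpha eps u v\<bar> <= C * W.nrm u * W.nrm v" by (rule C(3)[OF u v])
  show "eps / 2 * (W.nrm u)^2 - K * (H.nrm u)^2 <= a_form n alpha eps u u" by (rule C(4)[OF u])
  assume "w \<in> H10 n"
  hence w: "w \<in> H1 n" by (rule H10_H1)
  show "a_form n alpha eps (u + w) v = a_form n alpha eps u v + a_form n alpha eps w v"
   "a_form n alpha eps v (u + w) = a_form n alpha eps v u + a_form n alpha eps v w"
   by (rule a_form_linear(1,3)[OF u w v])+
 qed
 thus ?thesis by blast
qed

text \<open>\<open>phi t\<close> ranges over \<open>H1 n\<close> while the functional is tested on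
  \<open>H10 n\<close>; the bound of the form on \<open>H1 n\<close> covers both arguments.\<close>

lemma a_form_sq_integrable:
 assumes phi: "phi \<in> L2_Bochner T (H1 n) (H1_norm n)"
 shows "G.D.sq_int T (%t. a_form n alpha eps (phi t))"
proof -
 obtain C K where C: "C >= 0" "!!u v. u \<in> H1 n ==> v \<in> H1 n ==> \<bar>a_form n alpha eps u v\<bar> <= C * W.nrm u * W.nrm v"
  by (rule a_form_bounds) (rule that, assumption+)
 have s: "W.sq_int T phi" using phi L2_Bochner_cong[OF W.seminormed_axioms H1_norm_eq] by blast
 have d: "a_form n alpha eps u \<in> G.V.dual" if u: "u \<in> H1 n" for u
  by (rule G.V.dualI[of _ "C * W.nrm u"]) (use u C(2) H10_H1 a_form_linear(3,4)[OF _ _ u] in auto)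
 have b: "G.V.dnorm (a_form n alpha eps u) <= C * W.nrm u" if u: "u \<in> H1 n" for u
  by (rule G.V.dnorm_least) (use u C W.nonneg H10_H1 in auto)
 show ?thesis
 proof (rule W.sq_int_linear[where G = "a_form n alpha eps", OF s G.D.seminormed_axioms d _ b])
  fix u w assume u: "u \<in> H1 n" and w: "w \<in> H1 n"
  have "G.V.dnorm (a_form n alpha eps u - a_form n alpha eps w) = G.V.dnorm (a_form n alpha eps (u - w))"
  proof (rule G.dnorm_cong)
   fix v assume "v \<in> H10 n"
   hence v: "v \<in> H1 n" by (rule H10_H1)
   have "a_form n alpha eps ((u - w) + w) v = a_form n alpha eps (u - w) v + a_form n alpha eps w v"
    by (rule a_form_linear(1)[OF W.mem(4)[OF u w] w v])
   thus "(a_form n alpha eps u - a_form n alpha eps w) v = a_form n alpha eps (u - w) v"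
    unfolding diff_add_cancel by simp
  qed
  thus "G.V.dnorm (a_form n alpha eps u - a_form n alpha eps w) <= C * W.nrm (u - w)"
   using b[OF W.mem(4)[OF u w]] by (simp only:)
 qed
qed

lemma b_form_sq_integrable:
 assumes "f \<in> L2_Bochner T (L2_tensor n m) (L2_tensor_norm n m)" "phi \<in> L2_Bochner T (H1 n) (H1_norm n)"
 shows "G.D.sq_int T (b_form n m alpha eps f phi)"
proof -
 have "b_form n m alpha eps f phi = (%t. hip (contract m (f t)) - a_form n alpha eps (phi t))" by (simp add: b_form_def fun_eq_iff)
 thus ?thesis using G.D.sq_int_diff[OF source_sq_integrable[OF assms(1)] a_form_sq_integrable[OF assms(2)]] by (simp only:)
qed

subsection \<open>Existence and uniqueness\<close>

lemma Bochner_V: "u \<in> L2_Bochner T (H10 n) (H1_norm n) \<longleftrightarrow> G.V.sq_int T u"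
 by (rule L2_Bochner_cong[OF G.V.seminormed_axioms H1_norm_eq[OF H10_H1]])

lemma Bochner_D: "w \<in> L2_Bochner T (Hm1 n) (Hm1_norm n) \<longleftrightarrow> G.D.sq_int T w"
 unfolding Hm1_eq Hm1_norm_eq by (rule L2_Bochner_sq_integrable[OF G.D.seminormed_axioms])

lemma nrm_diff_AE: "u \<in> L2 SM ==> v \<in> L2 SM ==> H.nrm (u - v) = 0 \<longleftrightarrow> (AE z in SM. u z = v z)"
 using L2_AE_iff[OF H.mem(4), of u v] by simp

text \<open>Equality a.e. on the sphere bundle is the vanishing of the L2 norm of the difference,
  the form in which the abstract theorems speak of the continuous representative.\<close>

lemma initial_value_iff:
 assumes u: "G.V.sq_int T u" and T: "T > 0"
 shows "initial_value n T u (%z. 0) \<longleftrightarrow>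
  (EX c. (ALL t:{0..T}. c t \<in> L2 SM \<and> ((%s. H.nrm (c s - c t)) \<longlongrightarrow> 0) (at t within {0..T})) \<and>
    (AE t in time T. H.nrm (c t - u t) = 0) \<and> H.nrm (c 0) = 0)"
proof -
 have d: "L2_norm SM (%z. c s z - c t z) = H.nrm (c s - c t)" for c :: "real => phase => real" and s t
  by (simp add: H_nrm fun_diff_def)
 have e: "(AE t in time T. H.nrm (c t - u t) = 0) \<longleftrightarrow> (AE t in time T. AE z in SM. c t z = u t z)"
  if c: "ALL t:{0..T}. c t \<in> L2 SM" for c
 proof -
  have "AE t in time T. (H.nrm (c t - u t) = 0) = (AE z in SM. c t z = u t z)"
   using G.V.sq_int_mem[OF u] AE_time_in
  proof eventually_elim
   case (elim t)
   hence "c t \<in> L2 SM" using c by simp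
   thus ?case by (rule nrm_diff_AE[OF _ G.VH'[OF elim(1)]])
  qed
  thus ?thesis by (rule eventually_subst)
 qed
 have z: "(H.nrm (c 0) = 0) = (AE z in SM. c 0 z = 0)" if c: "ALL t:{0..T}. c t \<in> L2 SM" for c
  by (rule L2_AE_iff) (use c T in auto)
 show ?thesis unfolding initial_value_def d
  by (rule ex_cong1) (use e z in blast)
qed

lemma time_derivative_iff: "has_time_derivative n T u w \<longleftrightarrow>
  (ALL eta:test_functions {0<..<T}. ALL v:H10 n. (LINT t|time T. deriv eta t * hip (u t) v) = - (LINT t|time T. eta t * w t v))"
 by (simp only: has_time_derivative_def)

lemma solution_exists:
 assumes T: "T > 0" and f: "f \<in> L2_Bochner T (L2_tensor n m) (L2_tensor_norm n m)"
  and phi: "phi \<in> L2_Bochner T (H1 n) (H1_norm n)"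
 shows "EX u. variational_solution n m T alpha eps f phi u"
proof -
 obtain C c0 K where g: "garding (H10 n) (L2 SM) h1 hip (a_form n alpha eps) C c0 K" using a_form_garding by blast
 interpret P: garding "H10 n" "L2 SM" h1 hip "a_form n alpha eps" C c0 K by (rule g)
 let ?b = "b_form n m alpha eps f phi"
 have b: "G.D.sq_int T ?b" by (rule b_form_sq_integrable[OF f phi])
 obtain u k where u: "G.V.sq_int T u" and kH: "!!t. t \<in> {0..T} ==> k t \<in> L2 SM"
  and kc: "!!t. t \<in> {0..T} ==> ((%s. H.nrm (k s - k t)) \<longlongrightarrow> 0) (at t within {0..T})"
  and ku: "AE t in time T. H.nrm (k t - u t) = 0" and k0: "H.nrm (k 0) = 0"
  and eq: "!!t v. t \<in> {0..T} ==> v \<in> H10 n ==> hip (k t) v = (LINT s|time t. ?b s v - a_form n alpha eps (u s) v)"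
  by (rule P.parabolic_existence[OF T b]) (rule that, assumption+)
 \<comment> \<open>The equation itself dictates the time derivative; the integrated equation for
   \<open>k\<close> then shows that it is one.\<close>
 define w where "w t = ?b t - a_form n alpha eps (u t)" for t
 have au: "G.D.sq_int T (%t. a_form n alpha eps (u t))"
  by (rule G.V.sq_int_linear[where G = "a_form n alpha eps", OF u G.D.seminormed_axioms P.a_dual P.a_dnorm_diff P.a_dnorm])
 have w: "G.D.sq_int T w" unfolding w_def by (rule G.D.sq_int_diff[OF b au])
 have eqw: "hip (k t) v = (LINT s|time t. w s v)" if "t \<in> {0..T}" "v \<in> H10 n" for t v
  unfolding w_def fun_diff_def by (rule eq[OF that])
 have td: "has_time_derivative n T u w"
  unfolding time_derivative_iff
  by (intro ballI G.integrated_time_derivative[OF T _ _ u w kH kc ku]) (assumption | rule eqw)+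
 have iv: "initial_value n T u (%z. 0)"
  unfolding initial_value_iff[OF u T] using kH kc ku k0 by (intro exI[of _ k] conjI ballI)
 have "w t v + a_form n alpha eps (u t) v = ?b t v" for t v by (simp add: w_def)
 thus ?thesis
  unfolding variational_solution_def W112_def mem_Collect_eq Bochner_V Bochner_D using u w td iv
  by (intro exI[of _ u] conjI bexI[of _ w] AE_I2 ballI) (simp_all add: Bochner_D)
qed

text \<open>Du Bois-Reymond turns the distributional derivative into an integrated equation for the
  continuous representative, the form that \<open>parabolic_uniqueness\<close> takes as
  hypothesis.\<close>

lemma solution_integrated:
 assumes T: "T > 0" and u: "variational_solution n m T alpha eps f phi u"
 obtains k w where "G.V.sq_int T u" "G.D.sq_int T w" "!!t. t \<in> {0..T} ==> k t \<in> L2 SM"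
  "AE t in time T. H.nrm (k t - u t) = 0"
  "!!t v. t \<in> {0..T} ==> v \<in> H10 n ==> hip (k t) v = (LINT s|time t. w s v)"
  "AE t in time T. ALL v:H10 n. w t v + a_form n alpha eps (u t) v = b_form n m alpha eps f phi t v"
proof -
 have uV: "G.V.sq_int T u" and iv: "initial_value n T u (%z. 0)"
  using u unfolding variational_solution_def W112_def Bochner_V by blast+
 obtain w where w: "G.D.sq_int T w" "has_time_derivative n T u w"
  "AE t in time T. ALL v:H10 n. w t v + a_form n alpha eps (u t) v = b_form n m alpha eps f phi t v"
  using u unfolding variational_solution_def Bochner_D[symmetric] by (elim conjE bexE)
 obtain k where k: "ALL t:{0..T}. k t \<in> L2 SM \<and> ((%s. H.nrm (k s - k t)) \<longlongrightarrow> 0) (at t within {0..T})"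
  and ku: "AE t in time T. H.nrm (k t - u t) = 0" and k0: "H.nrm (k 0) = 0"
  using iv unfolding initial_value_iff[OF uV T] by (elim exE conjE)
 note kH = bspec[OF k, THEN conjunct1] and kc = bspec[OF k, THEN conjunct2]
 have eq: "hip (k t) v = (LINT s|time t. w s v)" if t: "t \<in> {0..T}" and v: "v \<in> H10 n" for t v
  by (rule G.time_derivative_integrated[OF T v uV w(1) kH kc ku k0 _ t])
   (assumption | rule bspec[OF bspec[OF w(2)[unfolded time_derivative_iff]] v])+
 show ?thesis by (rule that[OF uV w(1) kH ku eq w(3)])
qed

lemma solution_unique:
 assumes T: "T > 0" and u: "variational_solution n m T alpha eps f phi u" and u': "variational_solution n m T alpha eps f phi u'"
 shows "AE t in time T. AE z in SM. u' t z = u t z"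
proof -
 obtain C c0 K where g: "garding (H10 n) (L2 SM) h1 hip (a_form n alpha eps) C c0 K" using a_form_garding by blast
 interpret P: garding "H10 n" "L2 SM" h1 hip "a_form n alpha eps" C c0 K by (rule g)
 obtain k w where s: "G.V.sq_int T u" "G.D.sq_int T w" "!!t. t \<in> {0..T} ==> k t \<in> L2 SM"
  "AE t in time T. H.nrm (k t - u t) = 0"
  "!!t v. t \<in> {0..T} ==> v \<in> H10 n ==> hip (k t) v = (LINT s|time t. w s v)"
  "AE t in time T. ALL v:H10 n. w t v + a_form n alpha eps (u t) v = b_form n m alpha eps f phi t v"
  by (rule solution_integrated[OF T u]) (rule that, assumption+)
 obtain k' w' where s': "G.V.sq_int T u'" "G.D.sq_int T w'" "!!t. t \<in> {0..T} ==> k' t \<in> L2 SM"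
  "AE t in time T. H.nrm (k' t - u' t) = 0"
  "!!t v. t \<in> {0..T} ==> v \<in> H10 n ==> hip (k' t) v = (LINT s|time t. w' s v)"
  "AE t in time T. ALL v:H10 n. w' t v + a_form n alpha eps (u' t) v = b_form n m alpha eps f phi t v"
  by (rule solution_integrated[OF T u']) (rule that, assumption+)
 note uV = G.V.sq_int_mem[OF s(1)] and uV' = G.V.sq_int_mem[OF s'(1)]
 have d: "G.V.sq_int T (%t. u' t - u t)" by (rule G.V.sq_int_diff[OF s'(1) s(1)])
 have tri: "H.nrm ((x - y) - (x' - y')) <= H.nrm (x - x') + H.nrm (y - y')"
  if "x \<in> L2 SM" "y \<in> L2 SM" "x' \<in> L2 SM" "y' \<in> L2 SM" for x y x' y'
  using H.triangle_diff[OF H.mem(4)[OF that(1,3)] H.mem(4)[OF that(2,4)]] by (simp only: diff_diff_eq2 diff_diff_add add_diff_eq diff_add_eq add_ac)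
 have "AE t in time T. H.nrm (u' t - u t) = 0"
 \<comment> \<open>The data cancel in the difference of two solutions, whose continuous
   representatives then satisfy the homogeneous integrated equation.\<close>
 proof (rule P.parabolic_uniqueness[OF T d, where c = "%t. k' t - k t"])
  show "k' t - k t \<in> L2 SM" if "t \<in> {0..T}" for t by (rule H.mem(4)[OF s'(3) s(3)]) (rule that)+
  show "AE t in time T. H.nrm (k' t - k t - (u' t - u t)) = 0"
   using s(4) s'(4) uV uV' AE_time_in
  proof eventually_elim
   case (elim t)
   hence t: "t \<in> {0..T}" by simp
   note uH = G.VH'[OF elim(3)] and uH' = G.VH'[OF elim(4)]
   have "H.nrm (k' t - k t - (u' t - u t)) <= H.nrm (k' t - u' t) + H.nrm (k t - u t)"
    by (rule tri[OF s'(3)[OF t] s(3)[OF t] uH' uH])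
   moreover have "0 <= H.nrm (k' t - k t - (u' t - u t))"
    by (intro H.nonneg H.mem(4) s'(3) s(3) uH uH' t)
   ultimately show ?case unfolding elim(1,2) by linarith
  qed
  fix t v assume t: "t \<in> {0..T}" and v: "v \<in> H10 n"
  have tT: "t <= T" using t by simp
  have i: "integrable (time t) (%s. w s v)" "integrable (time t) (%s. w' s v)"
   by (rule time_integrable_subset[OF G.pairing_integrable[OF s(2) v] tT] time_integrable_subset[OF G.pairing_integrable[OF s'(2) v] tT])+
  have ad: "G.D.sq_int T (%t. a_form n alpha eps (u' t - u t))"
   by (rule G.V.sq_int_linear[where G = "a_form n alpha eps", OF d G.D.seminormed_axioms P.a_dual P.a_dnorm_diff P.a_dnorm])
  have ia: "integrable (time t) (%s. - a_form n alpha eps (u' s - u s) v)"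
   by (rule Bochner_Integration.integrable_minus[OF time_integrable_subset[OF G.pairing_integrable[OF ad v] tT]])
  have "hip (k' t - k t) v = hip (k' t) v - hip (k t) v"
   by (rule H.diff_left[OF s'(3)[OF t] s(3)[OF t] G.VH'[OF v]])
  also have "... = (LINT s|time t. w' s v - w s v)"
   unfolding s(5)[OF t v] s'(5)[OF t v] by (rule Bochner_Integration.integral_diff[OF i(2,1), symmetric])
  also have "... = (LINT s|time t. - a_form n alpha eps (u' s - u s) v)"
  proof (rule integral_cong_AE)
   show "(%s. w' s v - w s v) \<in> borel_measurable (time t)"
    by (rule borel_measurable_integrable[OF Bochner_Integration.integrable_diff[OF i(2,1)]])
   show "(%s. - a_form n alpha eps (u' s - u s) v) \<in> borel_measurable (time t)" by (rule borel_measurable_integrable[OF ia])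
   have "AE s in time T. w' s v - w s v = - a_form n alpha eps (u' s - u s) v"
    using s(6) s'(6) uV uV'
   proof eventually_elim
    case (elim r)
    have "w r v + a_form n alpha eps (u r) v = w' r v + a_form n alpha eps (u' r) v"
     using bspec[OF elim(1) v] bspec[OF elim(2) v] by simp
    moreover have "a_form n alpha eps (u' r - u r) v = a_form n alpha eps (u' r) v - a_form n alpha eps (u r) v"
     by (rule P.a_diff_left[OF elim(4,3) v])
    ultimately show ?case by linarith
   qed
   thus "AE s in time t. w' s v - w s v = - a_form n alpha eps (u' s - u s) v" by (rule AE_time_mono[OF _ tT])
  qed
  finally show "hip (k' t - k t) v = (LINT s|time t. - a_form n alpha eps (u' s - u s) v)" .
 qed
 thus ?thesis
  using uV uV'
 proof eventually_elim
  case (elim t)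
  thus ?case using nrm_diff_AE[OF G.VH'[OF elim(3)] G.VH'[OF elim(2)]] by blast
 qed
qed

end

theorem theorem3p4:
  fixes n :: "real^3 \<Rightarrow> real" and c\<^sub>n T \<epsilon> \<alpha>\<^sub>0 :: real
    and \<alpha> :: "phase \<Rightarrow> real" and m :: nat
    and f :: "real \<Rightarrow> (real^3) \<times> 3 list \<Rightarrow> real"
    and \<phi> \<phi>h :: "real \<Rightarrow> phase \<Rightarrow> real"
  assumes n_lower: "c\<^sub>n > 0" "\<forall>x\<in>M. n x \<ge> c\<^sub>n"
    and n_C1: "Ck_on 1 M n"
    and "T > 0" "\<epsilon> > 0"
    and alpha_Linf: "\<alpha> \<in> borel_measurable (Sigma_measure n)"
      "\<exists>C. AE z in Sigma_measure n. \<bar>\<alpha> z\<bar> \<le> C"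
    and alpha_lower: "\<alpha>\<^sub>0 > 0" "\<forall>z\<in>OmegaM n. \<alpha> z \<ge> \<alpha>\<^sub>0"
    and f_L2: "f \<in> L2_Bochner T (L2_tensor n m) (L2_tensor_norm n m)"
    and ext_L2: "\<phi>h \<in> L2_Bochner T (H1 n) (H1_norm n)"
    and ext_trace: "AE t in lebesgue_on {0<..<T}. has_trace_plus n (\<phi>h t) (\<phi> t)"
    and small: "(SUP x\<in>M. metric_norm n x (grad_n n x) / n x) < \<alpha>\<^sub>0"
  shows "\<exists>u. variational_solution n m T \<alpha> \<epsilon> f \<phi>h u \<and>
     (\<forall>u'. variational_solution n m T \<alpha> \<epsilon> f \<phi>h u' \<longrightarrow>
        (AE t in lebesgue_on {0<..<T}. AE z in Sigma_measure n. u' t z = u t z))"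
proof -
 interpret viscosity n "c\<^sub>n" \<alpha> \<epsilon>
  by unfold_locales (use assms in auto)
 obtain u where u: "variational_solution n m T \<alpha> \<epsilon> f \<phi>h u"
  using solution_exists[OF \<open>T > 0\<close> f_L2 ext_L2] by blast
 thus ?thesis using solution_unique[OF \<open>T > 0\<close> u] by blast
qed

end
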